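(* Let $U\subset\mathbb{R}^d$ be open, let $r\ge1$ be an integer and let $\phi,(\psi^{(i)})_{1\le i<2^d}\in C^r_c(\mathbb{R}^d)$ be a compactly supported wavelet family with supports in $B(0,R)$. Fix $p\in[1,\infty)$, $q\in[1,\infty]$ and $\alpha,\beta\in\mathbb{R}$ satisfying $|\alpha|,|\beta|<r$ and $\alpha<\beta$. Let $(f_m)_{m\in\mathbb{N}}$ be a family of random linear forms on $C^r_c(U)$, and let $\mathcal{K}$ be a spanning sequence. Assume that for every $(K,k)\in\mathcal{K}$ there exists $C=C(K,k)<\infty$ such that for every $m\in\mathbb{N}$, $$\sup_{x\in\Lambda_k\cap K}\mathbb{E}\left[\left|\langle f_m,\phi(2^k(\,\cdot\,-x))\rangle\right|^p\right]^{1/p}\le C,$$ and $$\sup_{x\in\Lambda_n\cap K}2^{dn}\,\mathbb{E}\left[\left|\langle f_m,\psi^{(i)}(2^n(\,\cdot\,-x))\rangle\right|^p\right]^{1/p}\le C\,2^{-n\beta}\qquad(1\le i<2^d,\ n\ge k).$$ Then the family $(f_m)$ is tight in $\mathcal{B}^{\alpha,\mathrm{loc}}_{p,q}(U)$. If moreover $\alpha<\beta-\frac dp$, then the family is also tight in $\mathcal{C}^\alpha_{\mathrm{loc}}(U)$.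
   Context: $\mathbb{N}=\{0,1,\dots\}$; $B(x,R)$ is the open Euclidean ball; $\Lambda_n=2^{-n}\mathbb{Z}^d$. $C^r_c(U)$ is the set of compactly supported $C^r$ functions on $U$. A random linear form is a random element $f$ of the set of linear forms on $C^r_c(U)$, each $\langle f,\eta\rangle$ being a random variable. Wavelets: $\phi,(\psi^{(i)})_{1\le i<2^d}\in C^r_c(\mathbb{R}^d)$ are such that $\phi$ is the scaling function of a multiresolution analysis $(V_n)_{n\in\mathbb{Z}}$ of $L^2(\mathbb{R}^d)$ (increasing subspaces, $\bigcup V_n$ dense, $\bigcap V_n=\{0\}$, $f\in V_n\Leftrightarrow f(2^{-n}\cdot)\in V_0$, $(\phi(\cdot-k))_{k\in\mathbb{Z}^d}$ an orthonormal basis of $V_0$), and $(\psi^{(i)}(\cdot-k))_{i<2^d,k\in\mathbb{Z}^d}$ is an orthonormal basis of $W_0$, where $W_n$ is the orthogonal complement of $V_n$ in $V_{n+1}$. $R>0$ is fixed such that the supports of $\phi$ and all $\psi^{(i)}$ are contained in $B(0,R)$. Spaces: with $\mathcal{V}_n,\mathcal{W}_n$ the orthogonal projections of $L^2(\mathbb{R}^d)$ onto $V_n,W_n$, set for $f\in C^\infty_c(\mathbb{R}^d)$, $p,q\in[1,\infty]$ and $|\alpha|<r$ $$\|f\|_{\mathcal{B}^\alpha_{p,q}}=\|\mathcal{V}_0f\|_{L^p}+\left\|\left(2^{\alpha n}\|\mathcal{W}_nf\|_{L^p}\right)_{n\ge0}\right\|_{\ell^q}.$$ $\mathcal{B}^{\alpha,\mathrm{loc}}_{p,q}(U)$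 is the completion of $C^\infty(U)$ with respect to the seminorms $f\mapsto\|\chi f\|_{\mathcal{B}^\alpha_{p,q}}$, $\chi\in C^\infty_c(U)$; it is a Fréchet space whose elements are viewed as linear forms on $C^r_c(U)$. $\mathcal{C}^\alpha_{\mathrm{loc}}(U)=\mathcal{B}^{\alpha,\mathrm{loc}}_{\infty,\infty}(U)$. Spanning sequence: a pair $(K,k)$ with $K\subset U$ compact and $k\in\mathbb{N}$ is adapted if $2^{-k}R<\mathrm{dist}(K,U^c)$. A spanning sequence is a set that can be written as $\mathcal{K}=\{(K_n,k_n):n\in\mathbb{N}\}$, where $(K_n)$ is an increasing sequence of compact subsets of $U$ such that $\bigcup_nK_n=U$ and for every $n$ the pair $(K_n,k_n)$ is adapted.
   Formalization: The K_n of a spanning sequence must exhaust U: every compact subset of U lies in some K_n (the union being U is not enough). A linear form counts as a Besov element if they agree on C^r_c(U) when the form is continuous, and only on the wavelets supported in U when it is not. *)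

theory Defs
  imports "HOL-Probability.Probability"
begin

section \<open>Test functions\<close>

text \<open>Iterated directional derivatives.\<close>

fun ddir :: "(real ^ 'd) list \<Rightarrow> (real ^ 'd \<Rightarrow> real) \<Rightarrow> real ^ 'd \<Rightarrow> real" where
  "ddir [] f = f"
| "ddir (v # vs) f = (\<lambda>x. frechet_derivative (ddir vs f) (at x) v)"

text \<open>Only used for open sets \<open>U\<close>.\<close>

definition Ck_on :: "nat \<Rightarrow> (real ^ 'd) set \<Rightarrow> (real ^ 'd \<Rightarrow> real) \<Rightarrow> bool" where
  "Ck_on k U f \<longleftrightarrow>
     (\<forall>vs. length vs < k \<longrightarrow> (\<forall>x\<in>U. ddir vs f differentiable (at x))) \<and>
     (\<forall>vs. length vs \<le> k \<longrightarrow> continuous_on U (ddir vs f))"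

definition supp :: "(real ^ 'd \<Rightarrow> real) \<Rightarrow> (real ^ 'd) set" where
  "supp f = closure {x. f x \<noteq> 0}"

text \<open>Elements of $C^r_c(U)$ and $C^\infty_c(U)$ are extended by zero to the whole space.\<close>

definition Crc :: "nat \<Rightarrow> (real ^ 'd) set \<Rightarrow> (real ^ 'd \<Rightarrow> real) set" where
  "Crc r U = {f. Ck_on r UNIV f \<and> compact (supp f) \<and> supp f \<subseteq> U}"

definition Cinf_c :: "(real ^ 'd) set \<Rightarrow> (real ^ 'd \<Rightarrow> real) set" where
  "Cinf_c U = (\<Inter>r. Crc r U)"

text \<open>The values outside \<open>U\<close> of an element of \<open>Cinf U\<close> are arbitrary; they play no role below,
  where such a function is always multiplied by one supported in \<open>U\<close>.\<close>

definition Cinf :: "(real ^ 'd) set \<Rightarrow> (real ^ 'd \<Rightarrow> real) set" where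
  "Cinf U = {f. \<forall>k. Ck_on k U f}"

definition lattice :: "nat \<Rightarrow> (real ^ 'd) set" where
  "lattice n = {x. \<forall>i. 2 ^ n * x $ i \<in> \<int>}"

text \<open>\<open>dilate n x g\<close> is the function $g(2^n(\,\cdot\,-x))$.\<close>

definition dilate :: "nat \<Rightarrow> real ^ 'd \<Rightarrow> (real ^ 'd \<Rightarrow> real) \<Rightarrow> real ^ 'd \<Rightarrow> real" where
  "dilate n x g = (\<lambda>y. g (2 ^ n *\<^sub>R (y - x)))"


section \<open>Wavelets\<close>

text \<open>Elements of $L^2$ are represented by functions rather than by classes modulo null sets. The
  closed subspaces below are automatically stable under almost everywhere modification.\<close>

definition L2 :: "(real ^ 'd \<Rightarrow> real) set" where
  "L2 = {f. f \<in> borel_measurable lborel \<and> integrable lborel (\<lambda>x. (f x)\<^sup>2)}"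

definition L2_inner :: "(real ^ 'd \<Rightarrow> real) \<Rightarrow> (real ^ 'd \<Rightarrow> real) \<Rightarrow> real" where
  "L2_inner f g = (LINT x|lborel. f x * g x)"

definition L2_norm :: "(real ^ 'd \<Rightarrow> real) \<Rightarrow> real" where
  "L2_norm f = sqrt (L2_inner f f)"

definition L2_dense_in :: "(real ^ 'd \<Rightarrow> real) set \<Rightarrow> (real ^ 'd \<Rightarrow> real) set \<Rightarrow> bool" where
  "L2_dense_in D S \<longleftrightarrow> (\<forall>f\<in>S. \<forall>\<epsilon>>0. \<exists>g\<in>D. L2_norm (\<lambda>x. f x - g x) < \<epsilon>)"

definition L2_closed_subspace :: "(real ^ 'd \<Rightarrow> real) set \<Rightarrow> bool" where
  "L2_closed_subspace S \<longleftrightarrow>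
     S \<subseteq> L2 \<and> (\<lambda>x. 0) \<in> S \<and>
     (\<forall>f\<in>S. \<forall>g\<in>S. \<forall>a b. (\<lambda>x. a * f x + b * g x) \<in> S) \<and>
     (\<forall>f\<in>L2. L2_dense_in S {f} \<longrightarrow> f \<in> S)"

definition L2_onb :: "'i set \<Rightarrow> ('i \<Rightarrow> real ^ 'd \<Rightarrow> real) \<Rightarrow> (real ^ 'd \<Rightarrow> real) set \<Rightarrow> bool" where
  "L2_onb I e S \<longleftrightarrow>
     (\<forall>i\<in>I. e i \<in> S) \<and>
     (\<forall>i\<in>I. \<forall>j\<in>I. L2_inner (e i) (e j) = (if i = j then 1 else 0)) \<and>
     L2_dense_in {\<lambda>x. \<Sum>i\<in>J. c i * e i x | J c. finite J \<and> J \<subseteq> I} S"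

definition multiresolution ::
  "(int \<Rightarrow> (real ^ 'd \<Rightarrow> real) set) \<Rightarrow> (real ^ 'd \<Rightarrow> real) \<Rightarrow> bool" where
  "multiresolution V \<phi> \<longleftrightarrow>
     (\<forall>n. L2_closed_subspace (V n)) \<and>
     (\<forall>n. V n \<subseteq> V (n + 1)) \<and>
     L2_dense_in (\<Union>n. V n) L2 \<and>
     (\<forall>f \<in> (\<Inter>n. V n). AE x in lborel. f x = 0) \<and>
     (\<forall>n. \<forall>f\<in>L2. f \<in> V n \<longleftrightarrow> (\<lambda>x. f ((2 powi (- n)) *\<^sub>R x)) \<in> V 0) \<and>
     L2_onb (lattice 0) (\<lambda>k x. \<phi> (x - k)) (V 0)"

text \<open>The orthogonal complement of $V_n$ in $V_{n+1}$.\<close>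

definition detail_space ::
  "(int \<Rightarrow> (real ^ 'd \<Rightarrow> real) set) \<Rightarrow> int \<Rightarrow> (real ^ 'd \<Rightarrow> real) set" where
  "detail_space V n = {f \<in> V (n + 1). \<forall>g\<in>V n. L2_inner f g = 0}"

definition wavelet_family ::
  "nat \<Rightarrow> real \<Rightarrow> (real ^ 'd \<Rightarrow> real) \<Rightarrow> (nat \<Rightarrow> real ^ 'd \<Rightarrow> real) \<Rightarrow>
   (int \<Rightarrow> (real ^ 'd \<Rightarrow> real) set) \<Rightarrow> bool" where
  "wavelet_family r R \<phi> \<psi> V \<longleftrightarrow>
     multiresolution V \<phi> \<and>
     L2_onb ({1..<2 ^ CARD('d)} \<times> lattice 0) (\<lambda>(i, k) x. \<psi> i (x - k)) (detail_space V 0) \<and>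
     \<phi> \<in> Crc r UNIV \<and> supp \<phi> \<subseteq> ball 0 R \<and>
     (\<forall>i\<in>{1..<2 ^ CARD('d)}. \<psi> i \<in> Crc r UNIV \<and> supp (\<psi> i) \<subseteq> ball 0 R)"

text \<open>Orthogonal projection on a closed subspace. It is determined up to a null set, which affects
  none of the norms below.\<close>

definition L2_proj ::
  "(real ^ 'd \<Rightarrow> real) set \<Rightarrow> (real ^ 'd \<Rightarrow> real) \<Rightarrow> real ^ 'd \<Rightarrow> real" where
  "L2_proj S f = (SOME g. g \<in> S \<and> (\<forall>h\<in>S. L2_inner (\<lambda>x. f x - g x) h = 0))"


section \<open>Besov norms and local Besov spaces\<close>

definition enn_powr :: "ennreal \<Rightarrow> real \<Rightarrow> ennreal" where
  "enn_powr x a = (if x = \<top> then \<top> else ennreal (enn2real x powr a))"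

text \<open>The $L^p$ norm of a nonnegative extended function, $p\in[1,\infty]$. It serves for Lebesgue
  measure, for moments of random variables, and, with counting measure on \<open>nat\<close>, for $\ell^q$.\<close>

definition Lnorm :: "'a measure \<Rightarrow> ennreal \<Rightarrow> ('a \<Rightarrow> ennreal) \<Rightarrow> ennreal" where
  "Lnorm M p g =
     (if p = \<top> then esssup M g
      else enn_powr (\<integral>\<^sup>+ x. enn_powr (g x) (enn2real p) \<partial>M) (1 / enn2real p))"

definition Besov_norm ::
  "(int \<Rightarrow> (real ^ 'd \<Rightarrow> real) set) \<Rightarrow> real \<Rightarrow> ennreal \<Rightarrow> ennreal \<Rightarrow> (real ^ 'd \<Rightarrow> real) \<Rightarrow> ennreal"
where
  "Besov_norm V \<alpha> p q f =
     Lnorm lborel p (\<lambda>x. ennreal \<bar>L2_proj (V 0) f x\<bar>) +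
     Lnorm (count_space UNIV) q
       (\<lambda>n::nat. ennreal (2 powr (\<alpha> * real n)) *
          Lnorm lborel p (\<lambda>x. ennreal \<bar>L2_proj (detail_space V (int n)) f x\<bar>))"

text \<open>The local Besov space is the completion of \<open>Cinf U\<close>, built from Cauchy sequences modulo null
  sequences. Sequences suffice because the topology is metrizable: the seminorms attached to
  functions \<open>\<theta>\<^sub>n\<close> equal to one on the members of a compact exhaustion of \<open>U\<close> generate it.\<close>

definition Besov_cauchy ::
  "(int \<Rightarrow> (real ^ 'd \<Rightarrow> real) set) \<Rightarrow> (real ^ 'd) set \<Rightarrow> real \<Rightarrow> ennreal \<Rightarrow> ennreal \<Rightarrow>
   (nat \<Rightarrow> real ^ 'd \<Rightarrow> real) set" where
  "Besov_cauchy V U \<alpha> p q =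
     {h. (\<forall>j. h j \<in> Cinf U) \<and>
         (\<forall>\<theta>\<in>Cinf_c U. \<forall>\<epsilon>>0. \<exists>N. \<forall>i\<ge>N. \<forall>j\<ge>N.
            Besov_norm V \<alpha> p q (\<lambda>x. \<theta> x * (h i x - h j x)) < \<epsilon>)}"

definition Besov_equiv ::
  "(int \<Rightarrow> (real ^ 'd \<Rightarrow> real) set) \<Rightarrow> (real ^ 'd) set \<Rightarrow> real \<Rightarrow> ennreal \<Rightarrow> ennreal \<Rightarrow>
   ((nat \<Rightarrow> real ^ 'd \<Rightarrow> real) \<times> (nat \<Rightarrow> real ^ 'd \<Rightarrow> real)) set" where
  "Besov_equiv V U \<alpha> p q =
     {(g, h). g \<in> Besov_cauchy V U \<alpha> p q \<and> h \<in> Besov_cauchy V U \<alpha> p q \<and>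
        (\<forall>\<theta>\<in>Cinf_c U. (\<lambda>j. Besov_norm V \<alpha> p q (\<lambda>x. \<theta> x * (g j x - h j x))) \<longlonglongrightarrow> 0)}"

definition Besov_loc ::
  "(int \<Rightarrow> (real ^ 'd \<Rightarrow> real) set) \<Rightarrow> (real ^ 'd) set \<Rightarrow> real \<Rightarrow> ennreal \<Rightarrow> ennreal \<Rightarrow>
   (nat \<Rightarrow> real ^ 'd \<Rightarrow> real) set set" where
  "Besov_loc V U \<alpha> p q = Besov_cauchy V U \<alpha> p q // Besov_equiv V U \<alpha> p q"

definition rep :: "(nat \<Rightarrow> real ^ 'd \<Rightarrow> real) set \<Rightarrow> nat \<Rightarrow> real ^ 'd \<Rightarrow> real" where
  "rep F = (SOME h. h \<in> F)"

text \<open>The extension to the completion of the seminorm attached to \<open>\<theta>\<close>, evaluated at the difference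
  of two elements; the limit does not depend on the representatives.\<close>

definition Besov_loc_dist ::
  "(int \<Rightarrow> (real ^ 'd \<Rightarrow> real) set) \<Rightarrow> real \<Rightarrow> ennreal \<Rightarrow> ennreal \<Rightarrow> (real ^ 'd \<Rightarrow> real) \<Rightarrow>
   (nat \<Rightarrow> real ^ 'd \<Rightarrow> real) set \<Rightarrow> (nat \<Rightarrow> real ^ 'd \<Rightarrow> real) set \<Rightarrow> ennreal" where
  "Besov_loc_dist V \<alpha> p q \<theta> F G =
     lim (\<lambda>j. Besov_norm V \<alpha> p q (\<lambda>x. \<theta> x * (rep F j x - rep G j x)))"

definition Besov_loc_topology ::
  "(int \<Rightarrow> (real ^ 'd \<Rightarrow> real) set) \<Rightarrow> (real ^ 'd) set \<Rightarrow> real \<Rightarrow> ennreal \<Rightarrow> ennreal \<Rightarrow>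
   (nat \<Rightarrow> real ^ 'd \<Rightarrow> real) set topology" where
  "Besov_loc_topology V U \<alpha> p q =
     topology_generated_by
       {{G \<in> Besov_loc V U \<alpha> p q. Besov_loc_dist V \<alpha> p q \<theta> F G < \<epsilon>} | F \<theta> \<epsilon>.
          F \<in> Besov_loc V U \<alpha> p q \<and> \<theta> \<in> Cinf_c U \<and> \<epsilon> > 0}"

text \<open>An element of the completion as a linear form on $C^r_c(U)$: the continuous extension of
  $\langle h,\eta\rangle=\int h\,\eta$.\<close>

definition pairing :: "(nat \<Rightarrow> real ^ 'd \<Rightarrow> real) set \<Rightarrow> (real ^ 'd \<Rightarrow> real) \<Rightarrow> real" where
  "pairing F \<eta> = lim (\<lambda>j. LINT x|lborel. rep F j x * \<eta> x)"


section \<open>Spanning sequences\<close>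

text \<open>The distance to the empty set is infinite, whereas \<open>setdist\<close> is then \<open>0\<close>; hence the first
  two disjuncts.\<close>

definition adapted :: "(real ^ 'd) set \<Rightarrow> real \<Rightarrow> (real ^ 'd) set \<Rightarrow> nat \<Rightarrow> bool" where
  "adapted U R K k \<longleftrightarrow>
     compact K \<and> K \<subseteq> U \<and> (K = {} \<or> U = UNIV \<or> R / 2 ^ k < setdist K (- U))"

text \<open>That \<open>K\<close> exhausts \<open>U\<close> is required in the usual sense of an exhaustion by compact sets. The
  bare condition \<open>(\<Union>n. K n) = U\<close> does not imply it: on the line, the sets
  $K_n=[-n,0]\cup[1/n,n]$ contain no neighbourhood of the origin.\<close>

definition spanning_sequence ::
  "(real ^ 'd) set \<Rightarrow> real \<Rightarrow> ((real ^ 'd) set \<times> nat) set \<Rightarrow> bool" where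
  "spanning_sequence U R \<K> \<longleftrightarrow>
     (\<exists>K k. \<K> = range (\<lambda>n::nat. (K n, k n)) \<and> incseq K \<and> (\<Union>n. K n) = U \<and>
        (\<forall>L. compact L \<and> L \<subseteq> U \<longrightarrow> (\<exists>n. L \<subseteq> K n)) \<and>
        (\<forall>n. adapted U R (K n) (k n)))"


section \<open>Random linear forms and tightness\<close>

definition linear_form_on ::
  "nat \<Rightarrow> (real ^ 'd) set \<Rightarrow> ((real ^ 'd \<Rightarrow> real) \<Rightarrow> real) \<Rightarrow> bool" where
  "linear_form_on r U l \<longleftrightarrow>
     (\<forall>\<eta>\<in>Crc r U. \<forall>\<zeta>\<in>Crc r U. \<forall>a b. l (\<lambda>x. a * \<eta> x + b * \<zeta> x) = a * l \<eta> + b * l \<zeta>)"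

definition random_linear_form ::
  "nat \<Rightarrow> (real ^ 'd) set \<Rightarrow> 'w measure \<Rightarrow> ('w \<Rightarrow> (real ^ 'd \<Rightarrow> real) \<Rightarrow> real) \<Rightarrow> bool" where
  "random_linear_form r U M f \<longleftrightarrow>
     (\<forall>\<omega>\<in>space M. linear_form_on r U (f \<omega>)) \<and>
     (\<forall>\<eta>\<in>Crc r U. (\<lambda>\<omega>. f \<omega> \<eta>) \<in> borel_measurable M)"

text \<open>Continuity for the usual (inductive limit) topology of $C^r_c(U)$.\<close>

definition continuous_form_on ::
  "nat \<Rightarrow> (real ^ 'd) set \<Rightarrow> ((real ^ 'd \<Rightarrow> real) \<Rightarrow> real) \<Rightarrow> bool" where
  "continuous_form_on r U l \<longleftrightarrow>
     (\<forall>K. compact K \<and> K \<subseteq> U \<longrightarrow>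
        (\<exists>C. \<forall>\<eta>\<in>Crc r U. \<forall>B. supp \<eta> \<subseteq> K \<and>
           (\<forall>vs x. length vs \<le> r \<and> set vs \<subseteq> Basis \<longrightarrow> \<bar>ddir vs \<eta> x\<bar> \<le> B) \<longrightarrow> \<bar>l \<eta>\<bar> \<le> C * B))"

definition wavelets_in ::
  "(real ^ 'd) set \<Rightarrow> (real ^ 'd \<Rightarrow> real) \<Rightarrow> (nat \<Rightarrow> real ^ 'd \<Rightarrow> real) \<Rightarrow> (real ^ 'd \<Rightarrow> real) set"
where
  "wavelets_in U \<phi> \<psi> =
     {\<eta>. (\<exists>n. \<exists>x\<in>lattice n. \<eta> = dilate n x \<phi> \<or> (\<exists>i\<in>{1..<2 ^ CARD('d)}. \<eta> = dilate n x (\<psi> i))) \<and>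
          supp \<eta> \<subseteq> U}"

text \<open>The linear form \<open>l\<close> is the element \<open>F\<close> of the local Besov space. For a continuous form this is
  equality on all of $C^r_c(U)$. A discontinuous algebraic linear form may differ from every element
  of a Besov space while all its wavelet coefficients vanish, so that it can only be identified
  through its coefficients.\<close>

definition is_Besov_element ::
  "nat \<Rightarrow> (real ^ 'd) set \<Rightarrow> (real ^ 'd \<Rightarrow> real) \<Rightarrow> (nat \<Rightarrow> real ^ 'd \<Rightarrow> real) \<Rightarrow>
   ((real ^ 'd \<Rightarrow> real) \<Rightarrow> real) \<Rightarrow> (nat \<Rightarrow> real ^ 'd \<Rightarrow> real) set \<Rightarrow> bool" where
  "is_Besov_element r U \<phi> \<psi> l F \<longleftrightarrow>
     (\<forall>\<eta>\<in>wavelets_in U \<phi> \<psi>. l \<eta> = pairing F \<eta>) \<and>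
     (continuous_form_on r U l \<longrightarrow> (\<forall>\<eta>\<in>Crc r U. l \<eta> = pairing F \<eta>))"

text \<open>The event \<open>A\<close> only spares the statement the measurability of \<open>{\<omega>. f m \<omega> \<in> \<K>}\<close>.\<close>

definition tight_in_Besov_loc ::
  "(int \<Rightarrow> (real ^ 'd \<Rightarrow> real) set) \<Rightarrow> (real ^ 'd) set \<Rightarrow> real \<Rightarrow> ennreal \<Rightarrow> ennreal \<Rightarrow>
   nat \<Rightarrow> (real ^ 'd \<Rightarrow> real) \<Rightarrow> (nat \<Rightarrow> real ^ 'd \<Rightarrow> real) \<Rightarrow>
   (nat \<Rightarrow> 'w measure) \<Rightarrow> (nat \<Rightarrow> 'w \<Rightarrow> (real ^ 'd \<Rightarrow> real) \<Rightarrow> real) \<Rightarrow> bool" where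
  "tight_in_Besov_loc V U \<alpha> p q r \<phi> \<psi> M f \<longleftrightarrow>
     (\<forall>\<epsilon>>0. \<exists>\<K>. compactin (Besov_loc_topology V U \<alpha> p q) \<K> \<and>
        (\<forall>m. \<exists>A\<in>sets (M m). measure (M m) A \<ge> 1 - \<epsilon> \<and>
           (\<forall>\<omega>\<in>A. \<exists>F\<in>\<K>. is_Besov_element r U \<phi> \<psi> (f m \<omega>) F)))"

end

theory Submission
  imports Defs "HOL-Computational_Algebra.Polynomial"
begin

text \<open>Let \<open>\<alpha> < \<alpha>'\<close>. If the wavelet coefficients of a distribution at scale $2^{-n}$ are bounded by
  $2^{-\<alpha>' n}$ in a suitably normalised $\<ell>^p$ norm, then its wavelet series converges locally in the Besov
  space of regularity \<open>\<alpha>\<close>, and the remainders are bounded by $2^{(\<alpha>-\<alpha>')n}$, uniformly over all such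
  distributions. Multiplication by a smooth cutoff destroys the orthogonality of the details, but the off-diagonal
  blocks decay like $2^{-r|n-m|}$ because the wavelets have \<open>r\<close> vanishing moments, and \<open>\<bar>\<alpha>\<bar> < r\<close>.

  The linear forms on the span of the wavelets that obey given coefficient bounds form a compact set for
  pointwise convergence, by Tychonoff's theorem. The partial sums of the wavelet series depend continuously on
  the form, and they converge uniformly; hence the map that sends a form to the sum of its series is
  continuous, and its range is compact in the local Besov space.

  For tightness it remains to see that, with high probability and uniformly in \<open>m\<close>, the coefficients of
  \<open>f m\<close> obey such bounds with \<open>\<alpha>' < \<beta>\<close>. This is Markov's inequality: the loss \<open>\<beta> - \<alpha>'\<close> makes the
  expectations summable over the scales. Bounding a single coefficient by the $\<ell>^p$ norm of the whole
  scale costs $2^{dn/p}$, which gives the Hoelder case.\<close>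


section \<open>Calculus of iterated directional derivatives\<close>

text \<open>A random linear form comes without continuity, so only its values on wavelets are under
  control. Limits are therefore built from the values of a form on the algebraic span of the
  wavelets supported in \<open>U\<close>; agreement on other test functions is recovered at the end,
  for continuous forms, by density of smooth functions. The hypothesis reaches wavelets centred in
  \<open>K j\<close> from scale \<open>k j\<close> on, and \<open>k j\<close> varies with the set,
  so no single wavelet series serves all of \<open>U\<close>. The partial sums are written instead
  with the scaling functions of scale \<open>N\<close> that fit into \<open>U\<close>; near a
  compact set the refinement relation turns their increments into wavelet sums. The same relation
  expresses every wavelet in \<open>U\<close> through those that the bounds reach. The vanishing
  moments are not among the axioms and are derived from the multiresolution structure. Finally, the
  completion consists of classes of Cauchy sequences of smooth functions, while the wavelets are
  only of class $C^r$; so each scaling function is mollified, with an error that is small against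
  the largest coefficient that an admissible form can have.\<close>

abbreviation Ck :: "nat \<Rightarrow> (real ^ 'd \<Rightarrow> real) \<Rightarrow> bool" where
  "Ck k f \<equiv> Ck_on k UNIV f"

lemma ddir_append: "ddir (us @ vs) f = ddir us (ddir vs f)"
  by (induction us) auto

lemma Ck_mono: "Ck k f \<Longrightarrow> j \<le> k \<Longrightarrow> Ck j f"
  by (auto simp: Ck_on_def)

lemma Ck_continuous: "Ck k f \<Longrightarrow> length vs \<le> k \<Longrightarrow> continuous_on UNIV (ddir vs f)"
  by (auto simp: Ck_on_def)

lemma Ck_continuous_on: "Ck k f \<Longrightarrow> continuous_on UNIV f"
  using Ck_continuous[of k f "[]"] by simp

lemma Ck_differentiable: "Ck k f \<Longrightarrow> length vs < k \<Longrightarrow> ddir vs f differentiable (at x)"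
  by (auto simp: Ck_on_def)

lemma Ck_has_derivative:
  "Ck k f \<Longrightarrow> length vs < k \<Longrightarrow> (ddir vs f has_derivative (\<lambda>v. ddir (v # vs) f x)) (at x)"
  using Ck_differentiable[of k f vs x] frechet_derivative_works by auto

lemma Ck_0: "Ck 0 f \<longleftrightarrow> continuous_on UNIV f"
  by (auto simp: Ck_on_def)

lemma Ck_ddir:
  assumes "Ck k f" "length vs + j \<le> k" shows "Ck j (ddir vs f)"
  using assms unfolding Ck_on_def ddir_append[symmetric] by auto

text \<open>The last entry of a list is the derivative taken first. Splitting lists from the right
  moves this derivative onto the function by \<open>ddir_append\<close>, so that facts about
  \<open>Ck\<close> can be proved by induction on \<open>k\<close> with one application of a
  differentiation rule per step.\<close>

lemma Ck_Suc_iff: "Ck (Suc k) f \<longleftrightarrow> (\<forall>x. f differentiable (at x)) \<and> (\<forall>v. Ck k (ddir [v] f))"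
proof safe
  fix x assume "Ck (Suc k) f" then show "f differentiable (at x)"
    using Ck_differentiable[of "Suc k" f "[]" x] by simp
next
  fix v assume "Ck (Suc k) f" then show "Ck k (ddir [v] f)"
    by (rule Ck_ddir) simp
next
  assume d: "\<forall>x. f differentiable (at x)" and s: "\<forall>v. Ck k (ddir [v] f)"
  have "ddir vs f differentiable (at x)" if "length vs < Suc k" for vs x
  proof (cases vs rule: rev_exhaust)
    case (snoc us v)
    then show ?thesis
      using that Ck_differentiable[OF s[rule_format, of v], of us x] ddir_append[of us "[v]" f] by simp
  qed (use d in auto)
  moreover have "continuous_on UNIV (ddir vs f)" if "length vs \<le> Suc k" for vs
  proof (cases vs rule: rev_exhaust)
    case Nil then show ?thesis
      using d by (simp add: differentiable_imp_continuous_on differentiable_on_def)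
  next
    case (snoc us v)
    then show ?thesis
      using that Ck_continuous[OF s[rule_format, of v], of us] ddir_append[of us "[v]" f] by simp
  qed
  ultimately show "Ck (Suc k) f" by (auto simp: Ck_on_def)
qed

lemma frechet_derivative_eqI: "(f has_derivative f') (at x) \<Longrightarrow> frechet_derivative f (at x) v = f' v"
  by (metis frechet_derivative_at)

lemma ddir_lincomb:
  assumes "Ck k f" "Ck k g" "length vs \<le> k"
  shows "ddir vs (\<lambda>x. a * f x + b * g x) = (\<lambda>x. a * ddir vs f x + b * ddir vs g x)"
  using assms(3)
proof (induction vs)
  case (Cons v vs)
  have "((\<lambda>x. a * ddir vs f x + b * ddir vs g x) has_derivative
      (\<lambda>v. a * ddir (v # vs) f x + b * ddir (v # vs) g x)) (at x)" for x
    by (intro derivative_intros Ck_has_derivative[OF assms(1)] Ck_has_derivative[OF assms(2)])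
       (use Cons.prems in auto)
  from frechet_derivative_eqI[OF this] Cons show ?case by auto
qed simp

lemma Ck_lincomb:
  assumes "Ck k f" "Ck k g" shows "Ck k (\<lambda>x. a * f x + b * g x)"
proof -
  have "ddir vs (\<lambda>x. a * f x + b * g x) differentiable at x" if "length vs < k" for vs x
    using that unfolding ddir_lincomb[OF assms less_imp_le[OF that]]
    by (intro differentiable_add differentiable_mult differentiable_const
        Ck_differentiable[OF assms(1)] Ck_differentiable[OF assms(2)])
  moreover have "continuous_on UNIV (ddir vs (\<lambda>x. a * f x + b * g x))" if "length vs \<le> k" for vs
    unfolding ddir_lincomb[OF assms that]
    by (intro continuous_intros Ck_continuous[OF assms(1)] Ck_continuous[OF assms(2)] that)
  ultimately show ?thesis unfolding Ck_on_def by auto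
qed

lemma ddir_const: "ddir vs (\<lambda>x. c) = (\<lambda>x. if vs = [] then c else 0)"
  by (induction vs) (auto simp: frechet_derivative_const)

lemma Ck_const: "Ck k (\<lambda>x. c)"
  unfolding Ck_on_def ddir_const by auto

lemma Ck_add: "Ck k f \<Longrightarrow> Ck k g \<Longrightarrow> Ck k (\<lambda>x. f x + g x)"
  using Ck_lincomb[of k f g 1 1] by simp

lemma Ck_diff: "Ck k f \<Longrightarrow> Ck k g \<Longrightarrow> Ck k (\<lambda>x. f x - g x)"
  using Ck_lincomb[of k f g 1 "-1"] by simp

lemma Ck_cmult: "Ck k f \<Longrightarrow> Ck k (\<lambda>x. c * f x)"
  using Ck_lincomb[of k f f c 0] by simp

lemma ddir_diff:
  "Ck k f \<Longrightarrow> Ck k g \<Longrightarrow> length vs \<le> k \<Longrightarrow> ddir vs (\<lambda>x. f x - g x) = (\<lambda>x. ddir vs f x - ddir vs g x)"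
  using ddir_lincomb[of k f g vs 1 "-1"] by simp

lemma ddir_add:
  "Ck k f \<Longrightarrow> Ck k g \<Longrightarrow> length vs \<le> k \<Longrightarrow> ddir vs (\<lambda>x. f x + g x) = (\<lambda>x. ddir vs f x + ddir vs g x)"
  using ddir_lincomb[of k f g vs 1 1] by simp

lemma ddir_cmult:
  "Ck k f \<Longrightarrow> length vs \<le> k \<Longrightarrow> ddir vs (\<lambda>x. c * f x) = (\<lambda>x. c * ddir vs f x)"
  using ddir_lincomb[of k f f vs c 0] by simp

lemma Ck_sum: "(\<And>i. i \<in> I \<Longrightarrow> Ck k (f i)) \<Longrightarrow> Ck k (\<lambda>x. \<Sum>i\<in>I. c i * f i x)"
  by (induction I rule: infinite_finite_induct) (auto intro!: Ck_const Ck_add Ck_cmult)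

lemma ddir_sum:
  "(\<And>i. i \<in> I \<Longrightarrow> Ck k (f i)) \<Longrightarrow> length vs \<le> k \<Longrightarrow>
   ddir vs (\<lambda>x. \<Sum>i\<in>I. c i * f i x) = (\<lambda>x. \<Sum>i\<in>I. c i * ddir vs (f i) x)"
proof (induction I rule: infinite_finite_induct)
  case (insert i I)
  have "ddir vs (\<lambda>x. c i * f i x + (\<Sum>i\<in>I. c i * f i x)) =
    (\<lambda>x. ddir vs (\<lambda>x. c i * f i x) x + ddir vs (\<lambda>x. \<Sum>i\<in>I. c i * f i x) x)"
    by (rule ddir_add[of k]) (use insert in \<open>auto intro!: Ck_sum Ck_cmult\<close>)
  then show ?case using insert by (simp add: ddir_cmult[of k])
qed (simp_all add: ddir_const)

lemma ddir1_mult: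
  assumes "Ck (Suc k) f" "Ck (Suc k) g"
  shows "ddir [v] (\<lambda>x. f x * g x) = (\<lambda>x. ddir [v] f x * g x + f x * ddir [v] g x)"
proof
  fix x
  have "((\<lambda>x. f x * g x) has_derivative (\<lambda>v. f x * ddir [v] g x + ddir [v] f x * g x)) (at x)"
    using Ck_has_derivative[OF assms(1), of "[]" x] Ck_has_derivative[OF assms(2), of "[]" x]
    by (intro has_derivative_mult) auto
  from frechet_derivative_eqI[OF this] show "ddir [v] (\<lambda>x. f x * g x) x = ddir [v] f x * g x + f x * ddir [v] g x"
    by simp
qed

lemma Ck_mult: "Ck k f \<Longrightarrow> Ck k g \<Longrightarrow> Ck k (\<lambda>x. f x * g x)"
proof (induction k arbitrary: f g)
  case 0 then show ?case unfolding Ck_0 by (intro continuous_intros)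
next
  case (Suc k)
  have "(\<lambda>x. f x * g x) differentiable at x" for x
    using Ck_differentiable[OF Suc.prems(1), of "[]" x] Ck_differentiable[OF Suc.prems(2), of "[]" x]
    by (intro differentiable_mult) auto
  moreover have "Ck k (ddir [v] (\<lambda>x. f x * g x))" for v
    unfolding ddir1_mult[OF Suc.prems]
    by (intro Ck_add Suc.IH Ck_ddir[OF Suc.prems(1)] Ck_ddir[OF Suc.prems(2)]
        Ck_mono[OF Suc.prems(1)] Ck_mono[OF Suc.prems(2)]) auto
  ultimately show ?case unfolding Ck_Suc_iff by blast
qed

lemma Ck_prod: "finite I \<Longrightarrow> (\<And>i. i \<in> I \<Longrightarrow> Ck k (f i)) \<Longrightarrow> Ck k (\<lambda>x. \<Prod>i\<in>I. f i x)"
  by (induction I rule: finite_induct) (auto intro!: Ck_const Ck_mult)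

lemma ddir_affine:
  assumes "Ck k f" "length vs \<le> k"
  shows "ddir vs (\<lambda>z. f (c *\<^sub>R (z - y))) = (\<lambda>z. c ^ length vs * ddir vs f (c *\<^sub>R (z - y)))"
  using assms(2)
proof (induction vs)
  case (Cons v vs)
  have "((\<lambda>z. c ^ length vs * ddir vs f (c *\<^sub>R (z - y))) has_derivative
      (\<lambda>v. c ^ length vs * (ddir (c *\<^sub>R v # vs) f (c *\<^sub>R (z - y))))) (at z)" for z
  proof -
    have 1: "((\<lambda>z. c *\<^sub>R (z - y)) has_derivative (\<lambda>v. c *\<^sub>R v)) (at z)"
      by (auto intro!: derivative_eq_intros)
    have "((ddir vs f \<circ> (\<lambda>z. c *\<^sub>R (z - y))) has_derivative
        (\<lambda>v. ddir (v # vs) f (c *\<^sub>R (z - y))) \<circ> (\<lambda>v. c *\<^sub>R v)) (at z)"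
      by (intro diff_chain_at 1 Ck_has_derivative[OF assms(1)]) (use Cons.prems in auto)
    then show ?thesis unfolding o_def by (intro has_derivative_mult_right)
  qed
  note D = frechet_derivative_eqI[OF this]
  \<comment> \<open>The chain rule yields the direction \<open>c *\<^sub>R v\<close>; linearity of
    the derivative in its direction extracts the factor \<open>c\<close>.\<close>
  have "linear (\<lambda>v. ddir (v # vs) f x)" for x
    by (rule has_derivative_linear[OF Ck_has_derivative[OF assms(1)]]) (use Cons.prems in auto)
  from linear_scale[OF this] have "ddir (c *\<^sub>R v # vs) f x = c * ddir (v # vs) f x" for x
    by (simp only: real_scaleR_def)
  moreover have "ddir vs (\<lambda>z. f (c *\<^sub>R (z - y))) = (\<lambda>z. c ^ length vs * ddir vs f (c *\<^sub>R (z - y)))"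
    using Cons by simp
  ultimately show ?case by (intro ext) (simp add: D)
qed simp

lemma Ck_affine:
  assumes "Ck k f" shows "Ck k (\<lambda>z. f (c *\<^sub>R (z - y)))"
proof -
  have 1: "(\<lambda>z. c *\<^sub>R (z - y)) differentiable at x" for x
    by (auto intro!: derivative_eq_intros simp: differentiable_def)
  have "ddir vs (\<lambda>z. f (c *\<^sub>R (z - y))) differentiable at x" if "length vs < k" for vs x
    using differentiable_chain_at[OF 1 Ck_differentiable[OF assms that]]
    unfolding ddir_affine[OF assms less_imp_le[OF that]]
    by (auto simp: o_def)
  moreover have "continuous_on UNIV (ddir vs (\<lambda>z. f (c *\<^sub>R (z - y))))" if "length vs \<le> k" for vs
    unfolding ddir_affine[OF assms that]
    by (intro continuous_intros continuous_on_compose2[OF Ck_continuous[OF assms that]]) auto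
  ultimately show ?thesis unfolding Ck_on_def by auto
qed

lemma ddir_eq_0:
  assumes "open S" "\<And>x. x \<in> S \<Longrightarrow> f x = 0" "x \<in> S" shows "ddir vs f x = 0"
  using assms(3)
proof (induction vs arbitrary: x)
  case (Cons v vs)
  have "(ddir vs f has_derivative (\<lambda>_. 0)) (at x)"
    by (rule has_derivative_transform_within_open[of "\<lambda>_. 0" _ x UNIV S]) (use Cons assms(1) in auto)
  from frechet_derivative_eqI[OF this] show ?case by simp
qed (use assms in auto)

lemma notin_supp_eq_0: "x \<notin> supp f \<Longrightarrow> f x = 0"
  using closure_subset[of "{x. f x \<noteq> 0}"] unfolding supp_def by (metis (mono_tags, lifting) mem_Collect_eq subset_iff)

lemma closed_supp [simp]: "closed (supp f)"
  unfolding supp_def by (rule closed_closure)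

lemma ddir_notin_supp: "x \<notin> supp f \<Longrightarrow> ddir vs f x = 0"
  by (rule ddir_eq_0[of "- supp f"]) (simp_all add: notin_supp_eq_0 open_Compl)

lemma supp_subset: "closed S \<Longrightarrow> (\<And>x. x \<notin> S \<Longrightarrow> f x = 0) \<Longrightarrow> supp f \<subseteq> S"
  unfolding supp_def by (intro closure_minimal) auto


text \<open>A $C^k$ bound with an amplitude \<open>A\<close> and an inverse length \<open>L\<close>:
  every derivative costs a factor \<open>L\<close>. A wavelet of scale \<open>n\<close> has
  \<open>L = 2 ^ n\<close> and an amplitude independent of \<open>n\<close>. Restricting to basis
  directions leaves finitely many derivatives of each order, so a finite bound exists.\<close>

definition Cb :: "nat \<Rightarrow> real \<Rightarrow> real \<Rightarrow> (real ^ 'd \<Rightarrow> real) \<Rightarrow> bool" where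
  "Cb k A L f \<longleftrightarrow> Ck k f \<and> 0 \<le> A \<and> 0 \<le> L \<and>
     (\<forall>vs x. length vs \<le> k \<longrightarrow> set vs \<subseteq> Basis \<longrightarrow> \<bar>ddir vs f x\<bar> \<le> A * L ^ length vs)"

lemma CbD: "Cb k A L f \<Longrightarrow> length vs \<le> k \<Longrightarrow> set vs \<subseteq> Basis \<Longrightarrow> \<bar>ddir vs f x\<bar> \<le> A * L ^ length vs"
  by (auto simp: Cb_def)

lemma CbD0: "Cb k A L f \<Longrightarrow> \<bar>f x\<bar> \<le> A"
  using CbD[of k A L f "[]" x] by simp

lemma Cb_nonneg: "Cb k A L f \<Longrightarrow> 0 \<le> A" "Cb k A L f \<Longrightarrow> 0 \<le> L"
  by (auto simp: Cb_def)

lemma Cb_Ck: "Cb k A L f \<Longrightarrow> Ck k f"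
  by (auto simp: Cb_def)

lemma Cb_mono:
  fixes f :: "real ^ 'd \<Rightarrow> real"
  shows "Cb k A L f \<Longrightarrow> j \<le> k \<Longrightarrow> A \<le> A' \<Longrightarrow> L \<le> L' \<Longrightarrow> Cb j A' L' f"
  unfolding Cb_def
proof (intro conjI allI impI; (elim conjE)?)
  fix vs :: "(real ^ 'd) list" and x
  assume a: "0 \<le> A" "0 \<le> L" "A \<le> A'" "L \<le> L'" "j \<le> k" "length vs \<le> j" "set vs \<subseteq> Basis"
    "\<forall>vs x. length vs \<le> k \<longrightarrow> set vs \<subseteq> Basis \<longrightarrow> \<bar>ddir vs f x\<bar> \<le> A * L ^ length vs"
  then have "\<bar>ddir vs f x\<bar> \<le> A * L ^ length vs" by simp
  also have "\<dots> \<le> A' * L' ^ length vs" using a by (intro mult_mono power_mono) auto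
  finally show "\<bar>ddir vs f x\<bar> \<le> A' * L' ^ length vs" .
qed (auto intro: Ck_mono)

lemma Cb_ddir1:
  assumes "Cb (Suc k) A L f" "v \<in> Basis" shows "Cb k (A * L) L (ddir [v] f)"
proof -
  have "\<bar>ddir vs (ddir [v] f) x\<bar> \<le> A * L * L ^ length vs"
    if "length vs \<le> k" "set vs \<subseteq> Basis" for vs x
    using CbD[OF assms(1), of "vs @ [v]" x] that assms(2) unfolding ddir_append by (simp add: mult.assoc)
  moreover have "Ck k (ddir [v] f)" by (rule Ck_ddir[OF Cb_Ck[OF assms(1)]]) simp
  ultimately show ?thesis using assms(1) by (auto simp: Cb_def)
qed

text \<open>The binomial expansion of $(L+M)^j$ is the Leibniz formula in disguise, which is why no
  combinatorial constant appears. In the induction the two terms of the product rule carry the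
  factors \<open>L\<close> and \<open>M\<close>, and these add up.\<close>

lemma Cb_mult: "Cb k A L f \<Longrightarrow> Cb k B M g \<Longrightarrow> Cb k (A * B) (L + M) (\<lambda>x. f x * g x)"
proof (induction k arbitrary: A B f g)
  case 0
  then have "\<bar>f x * g x\<bar> \<le> A * B" for x
    using CbD0[OF 0(1), of x] CbD0[OF 0(2), of x] unfolding abs_mult by (intro mult_mono) auto
  with 0 show ?case unfolding Cb_def by (auto intro!: Ck_mult)
next
  case (Suc k)
  have nn: "0 \<le> A" "0 \<le> B" "0 \<le> L" "0 \<le> M" using Suc.prems by (auto simp: Cb_def)
  have ck: "Ck (Suc k) f" "Ck (Suc k) g" using Suc.prems by (auto simp: Cb_def)
  have "\<bar>ddir vs (\<lambda>x. f x * g x) x\<bar> \<le> A * B * (L + M) ^ length vs"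
    if l: "length vs \<le> Suc k" and b: "set vs \<subseteq> Basis" for vs x
  proof (cases vs rule: rev_exhaust)
    case Nil
    then show ?thesis using CbD0[OF Suc.prems(1), of x] CbD0[OF Suc.prems(2), of x] nn
      by (simp add: abs_mult mult_mono)
  next
    case (snoc us v)
    have us: "length us \<le> k" "set us \<subseteq> Basis" "v \<in> Basis" using l b snoc by auto
    have f': "Cb k (A * L) L (ddir [v] f)" and g': "Cb k (B * M) M (ddir [v] g)"
      using Cb_ddir1[OF Suc.prems(1) us(3)] Cb_ddir1[OF Suc.prems(2) us(3)] by auto
    have f0: "Cb k A L f" and g0: "Cb k B M g"
      by (rule Cb_mono[OF Suc.prems(1)]; simp) (rule Cb_mono[OF Suc.prems(2)]; simp)
    have "ddir vs (\<lambda>x. f x * g x) x = ddir us (\<lambda>x. ddir [v] f x * g x + f x * ddir [v] g x) x"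
      unfolding snoc ddir_append ddir1_mult[OF ck] ..
    also have "\<dots> = ddir us (\<lambda>x. ddir [v] f x * g x) x + ddir us (\<lambda>x. f x * ddir [v] g x) x"
      unfolding ddir_add[OF Ck_mult[OF Cb_Ck[OF f'] Cb_Ck[OF g0]] Ck_mult[OF Cb_Ck[OF f0] Cb_Ck[OF g']] us(1)] ..
    finally have "\<bar>ddir vs (\<lambda>x. f x * g x) x\<bar> \<le> (A * L) * B * (L + M) ^ length us + A * (B * M) * (L + M) ^ length us"
      using CbD[OF Suc.IH[OF f' g0] us(1,2), of x] CbD[OF Suc.IH[OF f0 g'] us(1,2), of x] by linarith
    also have "\<dots> = A * B * (L + M) ^ length vs" unfolding snoc by (simp add: algebra_simps)
    finally show ?thesis .
  qed
  then show ?case unfolding Cb_def using nn by (auto intro!: Ck_mult ck)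
qed

lemma Cb_affine: "Cb k A L f \<Longrightarrow> c \<ge> 0 \<Longrightarrow> Cb k A (c * L) (\<lambda>z. f (c *\<^sub>R (z - y)))"
  unfolding Cb_def
  by (auto intro!: Ck_affine simp: ddir_affine abs_mult power_mult_distrib mult.left_commute[of A]
      intro!: mult_left_mono)

lemma Cb_dilate: "Cb k A L f \<Longrightarrow> Cb k A (2 ^ n * L) (dilate n x f)"
  unfolding dilate_def by (rule Cb_affine) auto

lemma Cb_cmult: "Cb k A L f \<Longrightarrow> Cb k (\<bar>c\<bar> * A) L (\<lambda>z. c * f z)"
  unfolding Cb_def by (auto intro!: Ck_cmult simp: ddir_cmult abs_mult mult.assoc mult_left_mono)

lemma compact_supp_bounded_ddir:
  assumes "Ck k f" "compact (supp f)" "length vs \<le> k"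
  shows "\<exists>B. \<forall>x. \<bar>ddir vs f x\<bar> \<le> B"
proof -
  have "bounded (ddir vs f ` supp f)"
    by (intro compact_imp_bounded compact_continuous_image assms(2)
        continuous_on_subset[OF Ck_continuous[OF assms(1,3)]]) auto
  then obtain B where B: "\<And>x. x \<in> supp f \<Longrightarrow> \<bar>ddir vs f x\<bar> \<le> B" unfolding bounded_iff by auto
  then have "\<bar>ddir vs f x\<bar> \<le> max B 0" for x
    by (cases "x \<in> supp f") (force simp: ddir_notin_supp)+
  then show ?thesis by blast
qed

text \<open>Words of basis vectors take the place of multi-indices. A mixed derivative is listed
  once for every order of its factors; this absorbs the multinomial coefficients, so the Taylor term
  of degree \<open>j\<close> just carries \<open>1 / fact j\<close>.\<close>

definition BL :: "nat \<Rightarrow> (real ^ 'd) list set" where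
  "BL j = {l. set l \<subseteq> Basis \<and> length l = j}"

lemma finite_BL [simp]: "finite (BL j)"
  unfolding BL_def by (rule finite_lists_length_eq) auto

lemma compact_supp_Cb:
  fixes f :: "real ^ 'd \<Rightarrow> real"
  assumes "Ck k f" "compact (supp f)"
  shows "\<exists>A. Cb k A 1 f"
proof -
  have "\<forall>vs. \<exists>B. length vs \<le> k \<longrightarrow> (\<forall>x. \<bar>ddir vs f x\<bar> \<le> B)"
    using compact_supp_bounded_ddir[OF assms] by blast
  then obtain B where B: "\<And>vs x. length vs \<le> k \<Longrightarrow> \<bar>ddir vs f x\<bar> \<le> B vs" by metis
  define T where "T = (\<Union>j\<le>k. BL j :: (real ^ 'd) list set)"
  have fin: "finite T" unfolding T_def by auto
  have "\<bar>ddir vs f x\<bar> \<le> (\<Sum>vs\<in>T. \<bar>B vs\<bar>)" if "length vs \<le> k" "set vs \<subseteq> Basis" for vs x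
  proof -
    have "vs \<in> T" using that unfolding T_def BL_def by auto
    then have "\<bar>B vs\<bar> \<le> (\<Sum>vs\<in>T. \<bar>B vs\<bar>)" by (intro member_le_sum fin) auto
    with B[OF that(1), of x] show ?thesis by linarith
  qed
  then have "Cb k (\<Sum>vs\<in>T. \<bar>B vs\<bar>) 1 f" unfolding Cb_def using assms by (auto intro: sum_nonneg)
  then show ?thesis by blast
qed

section \<open>Monomials indexed by words, and Taylor's formula\<close>

definition mono_of :: "(real ^ 'd) list \<Rightarrow> real ^ 'd \<Rightarrow> real" where
  "mono_of l z = prod_list (map (\<lambda>v. v \<bullet> z) l)"

lemma mono_of_simps [simp]: "mono_of [] z = 1" "mono_of (v # l) z = (v \<bullet> z) * mono_of l z"
  by (auto simp: mono_of_def)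

lemma mono_of_append: "mono_of (l @ m) z = mono_of l z * mono_of m z"
  by (induction l) auto

lemma mono_of_scaleR: "mono_of l (c *\<^sub>R z) = c ^ length l * mono_of l z"
  by (induction l) auto

lemma continuous_mono_of [continuous_intros]:
  "continuous_on S f \<Longrightarrow> continuous_on S (\<lambda>x. mono_of l (f x))"
  by (induction l) (auto intro!: continuous_intros)

lemma mono_of_bound: "set l \<subseteq> Basis \<Longrightarrow> \<bar>mono_of l z\<bar> \<le> norm z ^ length l"
proof (induction l)
  case (Cons v l)
  then have "\<bar>v \<bullet> z\<bar> \<le> norm z" using Basis_le_norm[of v z] by (simp add: inner_commute)
  with Cons show ?case by (simp add: abs_mult mult_mono)
qed simp

definition taylor_term :: "nat \<Rightarrow> (real ^ 'd \<Rightarrow> real) \<Rightarrow> real ^ 'd \<Rightarrow> real ^ 'd \<Rightarrow> real" where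
  "taylor_term j u x h = (\<Sum>l\<in>BL j. ddir l u x * mono_of l h)"

lemma BL_0: "BL 0 = {[]}" by (auto simp: BL_def)

lemma BL_Suc: "BL (Suc j) = (\<lambda>(b, l). b # l) ` (Basis \<times> BL j)"
  by (auto simp: BL_def image_iff length_Suc_conv)

lemma sum_BL_Suc: "(\<Sum>l\<in>BL (Suc j). F l) = (\<Sum>b\<in>Basis. \<Sum>l\<in>BL j. F (b # l))"
  unfolding BL_Suc sum.cartesian_product
  by (subst sum.reindex) (auto simp: inj_on_def case_prod_unfold)

lemma taylor_term_0 [simp]: "taylor_term 0 u x h = u x"
  by (simp add: taylor_term_def BL_0)

text \<open>Differentiating along the ray prepends one basis vector \<open>b\<close> to each word
  and produces the factor \<open>b \<bullet> h\<close>, which is the matching new factor of the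
  monomial. The terms thus form the chain of derivatives that \<open>Maclaurin\<close> asks
  for.\<close>

lemma taylor_term_derivative:
  assumes "Ck k u" "j < k"
  shows "((\<lambda>t. taylor_term j u (x + t *\<^sub>R h) h) has_real_derivative taylor_term (Suc j) u (x + t *\<^sub>R h) h) (at t)"
proof -
  have D: "((\<lambda>t. ddir l u (x + t *\<^sub>R h)) has_real_derivative (\<Sum>b\<in>Basis. (b \<bullet> h) * ddir (b # l) u (x + t *\<^sub>R h))) (at t)"
    if l: "length l = j" for l
  proof -
    let ?D = "\<lambda>v. ddir (v # l) u (x + t *\<^sub>R h)"
    have hd: "(ddir l u has_derivative ?D) (at (x + t *\<^sub>R h))"
      by (rule Ck_has_derivative[OF assms(1)]) (use l assms in auto)
    have "((\<lambda>t. x + t *\<^sub>R h) has_derivative (\<lambda>s. s *\<^sub>R h)) (at t)"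
      by (auto intro!: derivative_eq_intros)
    from diff_chain_at[OF this hd] have 1: "((\<lambda>t. ddir l u (x + t *\<^sub>R h)) has_derivative (\<lambda>s. ?D (s *\<^sub>R h))) (at t)"
      by (simp add: o_def)
    have lin: "linear ?D" by (rule has_derivative_linear[OF hd])
    have "?D h = ?D (\<Sum>b\<in>Basis. (b \<bullet> h) *\<^sub>R b)" by (simp only: euclidean_representation inner_commute[of _ h])
    also have "\<dots> = (\<Sum>b\<in>Basis. (b \<bullet> h) * ?D b)"
      unfolding linear_sum[OF lin] linear_scale[OF lin] real_scaleR_def ..
    finally have "?D (s *\<^sub>R h) = s * (\<Sum>b\<in>Basis. (b \<bullet> h) * ?D b)" for s
      by (simp only: linear_scale[OF lin] real_scaleR_def)
    with 1 show ?thesis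
      by (simp only: has_field_derivative_def mult_commute_abs)
  qed
  have "((\<lambda>t. taylor_term j u (x + t *\<^sub>R h) h) has_real_derivative
     (\<Sum>l\<in>BL j. (\<Sum>b\<in>Basis. (b \<bullet> h) * ddir (b # l) u (x + t *\<^sub>R h)) * mono_of l h)) (at t)"
    unfolding taylor_term_def by (intro DERIV_sum DERIV_cmult_right D) (auto simp: BL_def)
  also have "(\<Sum>l\<in>BL j. (\<Sum>b\<in>Basis. (b \<bullet> h) * ddir (b # l) u (x + t *\<^sub>R h)) * mono_of l h) =
     taylor_term (Suc j) u (x + t *\<^sub>R h) h"
    unfolding taylor_term_def sum_BL_Suc
    by (subst sum.swap) (auto simp: sum_distrib_left sum_distrib_right mult_ac intro!: sum.cong)
  finally show ?thesis .
qed

lemma taylor_lagrange: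
  assumes "Ck k u"
  shows "\<exists>t. 0 \<le> t \<and> t \<le> 1 \<and>
    u (x + h) = (\<Sum>j<k. taylor_term j u x h / fact j) + taylor_term k u (x + t *\<^sub>R h) h / fact k"
proof (cases "k = 0")
  \<comment> \<open>With \<open>k = 0\<close> the sum is empty and the remainder is \<open>u\<close>
    itself at the end of the segment.\<close>
  case True then show ?thesis by (intro exI[of _ 1]) auto
next
  case False
  have "\<exists>t::real. 0 < t \<and> t < 1 \<and> u (x + 1 *\<^sub>R h) =
     (\<Sum>m<k. taylor_term m u (x + 0 *\<^sub>R h) h / fact m * 1 ^ m) + taylor_term k u (x + t *\<^sub>R h) h / fact k * 1 ^ k"
    by (rule Maclaurin) (use False assms in \<open>auto intro!: taylor_term_derivative[of k]\<close>)
  then show ?thesis by (auto intro: less_imp_le)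
qed

section \<open>Continuous functions with bounded support\<close>

text \<open>Formulated for every Euclidean space because it is applied to pairs as well: on the
  product it supplies the integrability for \<open>cc_Fubini\<close>.\<close>

definition cc :: "('a::euclidean_space \<Rightarrow> real) \<Rightarrow> bool" where
  "cc f \<longleftrightarrow> continuous_on UNIV f \<and> (\<exists>\<rho>. \<forall>x. \<rho> < norm x \<longrightarrow> f x = 0)"

lemma cc_continuous: "cc f \<Longrightarrow> continuous_on UNIV f"
  by (auto simp: cc_def)

lemma cc_continuous_on: "cc f \<Longrightarrow> continuous_on S f"
  by (auto simp: cc_def intro: continuous_on_subset)

lemma ccE:
  assumes "cc f" obtains \<rho> where "\<rho> > 0" "\<forall>x. \<rho> < norm x \<longrightarrow> f x = 0"
proof -
  obtain \<rho> where "\<And>x. \<rho> < norm x \<Longrightarrow> f x = 0" using assms by (auto simp: cc_def)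
  then show thesis by (intro that[of "max 1 \<rho>"]) auto
qed

lemma ccI: "continuous_on UNIV f \<Longrightarrow> (\<And>x. \<rho> < norm x \<Longrightarrow> f x = 0) \<Longrightarrow> cc f"
  by (auto simp: cc_def)

lemma cc_0 [simp]: "cc (\<lambda>x. 0)" by (auto simp: cc_def)

lemma cc_mult1: assumes "cc f" "continuous_on UNIV g" shows "cc (\<lambda>x. f x * g x)"
proof -
  obtain \<rho> where "0 < \<rho>" and "\<forall>x. \<rho> < norm x \<longrightarrow> f x = 0" using assms(1) by (rule ccE)
  then show ?thesis
    by (intro ccI[of _ \<rho>] continuous_on_mult cc_continuous[OF assms(1)] assms(2)) auto
qed

lemma cc_mult2: "cc g \<Longrightarrow> continuous_on UNIV f \<Longrightarrow> cc (\<lambda>x. f x * g x)"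
  using cc_mult1[of g f] by (simp add: mult.commute)

lemma cc_mult: "cc f \<Longrightarrow> cc g \<Longrightarrow> cc (\<lambda>x. f x * g x)"
  by (intro cc_mult1 cc_continuous)

lemma cc_add: assumes "cc f" "cc g" shows "cc (\<lambda>x. f x + g x)"
proof -
  obtain \<rho> where "0 < \<rho>" and 1: "\<forall>x. \<rho> < norm x \<longrightarrow> f x = 0" using assms(1) by (rule ccE)
  note 1 = 1[rule_format]
  obtain \<rho>' where "0 < \<rho>'" and 2: "\<forall>x. \<rho>' < norm x \<longrightarrow> g x = 0" using assms(2) by (rule ccE)
  note 2 = 2[rule_format]
  show ?thesis
    by (rule ccI[of _ "max \<rho> \<rho>'"]) (use 1 2 in \<open>auto intro!: continuous_on_add assms[THEN cc_continuous]\<close>)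
qed

lemma cc_cmult: "cc f \<Longrightarrow> cc (\<lambda>x. c * f x)"
  by (intro cc_mult2) auto

lemma cc_diff: "cc f \<Longrightarrow> cc g \<Longrightarrow> cc (\<lambda>x. f x - g x)"
  using cc_add[of f "\<lambda>x. (-1) * g x"] cc_cmult[of g "-1"] by simp

lemma cc_sum: "(\<And>i. i \<in> I \<Longrightarrow> cc (f i)) \<Longrightarrow> cc (\<lambda>x. \<Sum>i\<in>I. f i x)"
  by (induction I rule: infinite_finite_induct) (auto intro!: cc_add)

lemma cc_abs: assumes "cc f" shows "cc (\<lambda>x. \<bar>f x\<bar>)"
proof -
  obtain \<rho> where "0 < \<rho>" and "\<forall>x. \<rho> < norm x \<longrightarrow> f x = 0" using assms(1) by (rule ccE)
  then show ?thesis
    by (intro ccI[of _ \<rho>] continuous_on_rabs cc_continuous[OF assms]) auto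
qed

lemma cc_power: "cc f \<Longrightarrow> 0 < n \<Longrightarrow> cc (\<lambda>x. f x ^ n)"
  by (cases n) (auto intro!: cc_mult1 continuous_on_power dest: cc_continuous)

lemma cc_integrable: assumes "cc f" shows "integrable lborel f"
proof -
  obtain \<rho> where "0 < \<rho>" and \<rho>: "\<forall>x. \<rho> < norm x \<longrightarrow> f x = 0" using assms by (rule ccE)
  note \<rho> = \<rho>[rule_format]
  have "integrable lborel (\<lambda>x. indicator (cball 0 \<rho>) x *\<^sub>R f x)"
    by (intro borel_integrable_compact cc_continuous_on assms) auto
  also have "(\<lambda>x. indicator (cball 0 \<rho>) x *\<^sub>R f x) = f"
    using \<rho> by (auto simp: fun_eq_iff indicator_def not_le)
  finally show ?thesis .
qed

lemma cc_measurable [intro]: "cc f \<Longrightarrow> f \<in> borel_measurable borel"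
  by (intro borel_measurable_continuous_onI cc_continuous)

lemma cc_uniformly_continuous:
  assumes "cc f" "e > 0"
  obtains d where "d > 0" "\<forall>x y. dist x y \<le> d \<longrightarrow> \<bar>f x - f y\<bar> \<le> e"
proof -
  obtain \<rho> where "0 < \<rho>" and \<rho>: "\<forall>x. \<rho> < norm x \<longrightarrow> f x = 0" using assms(1) by (rule ccE)
  note \<rho> = \<rho>[rule_format]
  \<comment> \<open>The radius is enlarged by 1 so that two points at distance at most 1 either both
    lie in this ball, where compactness applies, or both lie outside the support.\<close>
  have "uniformly_continuous_on (cball 0 (\<rho> + 1)) f"
    by (intro compact_uniformly_continuous cc_continuous_on assms) auto
  then obtain d where d: "d > 0" "\<And>x y. norm x \<le> \<rho> + 1 \<Longrightarrow> norm y \<le> \<rho> + 1 \<Longrightarrow> dist x y < d \<Longrightarrow> dist (f x) (f y) < e"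
    unfolding uniformly_continuous_on_def using assms(2) by (metis dist_commute mem_cball_0)
  have "\<bar>f x - f y\<bar> \<le> e" if xy: "dist x y \<le> min (d / 2) 1" for x y
  proof -
    have n: "\<bar>norm x - norm y\<bar> \<le> 1"
      using xy norm_triangle_ineq3[of x y] by (simp add: dist_norm)
    show ?thesis
    proof (cases "norm x \<le> \<rho> + 1 \<and> norm y \<le> \<rho> + 1")
      case True then show ?thesis using d(2)[of x y] d(1) xy by (auto simp: dist_real_def)
    next
      case False then show ?thesis using n \<rho>[of x] \<rho>[of y] assms(2) by auto
    qed
  qed
  then show thesis using d(1) by (intro that[of "min (d/2) 1"]) auto
qed

lemma integral_affine:
  fixes f :: "'a::euclidean_space \<Rightarrow> real"
  assumes "f \<in> borel_measurable borel" "c \<noteq> 0"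
  shows "(LINT x|lborel. f x) = \<bar>c\<bar> ^ DIM('a) * (LINT x|lborel. f (t + c *\<^sub>R x))"
proof -
  have "(LINT x|lborel. f x) = (LINT x|density (distr lborel borel (\<lambda>x. t + c *\<^sub>R x)) (\<lambda>_. \<bar>c\<bar>^DIM('a)). f x)"
    by (subst lborel_affine[OF assms(2), of t]) simp
  also have "\<dots> = (LINT x|distr lborel borel (\<lambda>x. t + c *\<^sub>R x). \<bar>c\<bar>^DIM('a) *\<^sub>R f x)"
    using assms by (intro integral_density) auto
  also have "\<dots> = (LINT x|lborel. \<bar>c\<bar>^DIM('a) *\<^sub>R f (t + c *\<^sub>R x))"
    using assms by (intro integral_distr) auto
  finally show ?thesis by simp
qed

lemma cc_affine:
  fixes f :: "'a::euclidean_space \<Rightarrow> real"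
  assumes "cc f" "c \<noteq> 0" shows "cc (\<lambda>x. f (t + c *\<^sub>R x))"
proof -
  obtain \<rho> where "0 < \<rho>" and \<rho>: "\<forall>x. \<rho> < norm x \<longrightarrow> f x = 0" using assms(1) by (rule ccE)
  note \<rho> = \<rho>[rule_format]
  show ?thesis
  proof (rule ccI[of _ "(\<rho> + norm t) / \<bar>c\<bar>"])
    show "continuous_on UNIV (\<lambda>x. f (t + c *\<^sub>R x))"
      by (intro continuous_on_compose2[OF cc_continuous[OF assms(1)]] continuous_intros) auto
    fix x :: 'a assume "(\<rho> + norm t) / \<bar>c\<bar> < norm x"
    then have "\<rho> + norm t < norm (c *\<^sub>R x)" using assms(2) by (simp add: field_simps)
    then have "\<rho> < norm (t + c *\<^sub>R x)" using norm_triangle_ineq4[of "t + c *\<^sub>R x" t] by simp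
    then show "f (t + c *\<^sub>R x) = 0" by (rule \<rho>)
  qed
qed

text \<open>A nonempty open set contains a box of positive volume and so is not null. By this,
  identities between continuous representatives of $L^2$ functions hold at every point.\<close>

lemma AE_continuous_eq_0:
  fixes f :: "'a::euclidean_space \<Rightarrow> real"
  assumes "AE x in lborel. x \<in> S \<longrightarrow> f x = 0" "open S" "continuous_on S f" "x \<in> S"
  shows "f x = 0"
proof (rule ccontr)
  assume n: "f x \<noteq> 0"
  have "open {y \<in> S. f y \<noteq> 0}"
  proof -
    have "{y \<in> S. f y \<noteq> 0} = S \<inter> f -` (- {0})" by auto
    then show ?thesis using continuous_open_preimage[OF assms(3,2), of "- {0}"] by (simp add: open_Compl)
  qed
  then obtain a b where ab: "box a b \<subseteq> {y \<in> S. f y \<noteq> 0}" "x \<in> box a b" "\<forall>i\<in>Basis. a \<bullet> i < b \<bullet> i"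
    by (rule open_contains_box[of _ x]) (use n assms(4) in auto)
  have "AE y in lborel. y \<notin> box a b" using assms(1) by eventually_elim (use ab in auto)
  then have "emeasure lborel (box a b) = 0" by (subst (asm) AE_iff_measurable[of "box a b"]) auto
  moreover have "0 < emeasure lborel (box a b)"
    using ab(3) unfolding emeasure_lborel_box_eq
    by (auto intro!: prod_pos simp: inner_diff_left less_imp_le)
  ultimately show False by simp
qed

lemma AE_continuous_eq:
  fixes f g :: "'a::euclidean_space \<Rightarrow> real"
  assumes "AE x in lborel. f x = g x" "continuous_on UNIV f" "continuous_on UNIV g"
  shows "f = g"
proof
  fix x show "f x = g x"
    using AE_continuous_eq_0[of UNIV "\<lambda>x. f x - g x" x] assms by (auto intro!: continuous_intros)
qed

lemma continuous_integral_pos: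
  fixes f :: "'a::euclidean_space \<Rightarrow> real"
  assumes "continuous_on UNIV f" "integrable lborel f" "\<And>x. f x \<ge> 0" "f a > 0"
  shows "(LINT x|lborel. f x) > 0"
proof -
  have "(LINT x|lborel. f x) \<noteq> 0"
    using integral_nonneg_eq_0_iff_AE[of lborel f] assms AE_continuous_eq[of f "\<lambda>_. 0"] by auto
  moreover have "(LINT x|lborel. f x) \<ge> 0" using assms by simp
  ultimately show ?thesis by linarith
qed

lemma ccI_compact_supp: assumes "continuous_on UNIV f" "compact (supp f)" shows "cc f"
proof -
  obtain B where "\<And>x. x \<in> supp f \<Longrightarrow> norm x \<le> B"
    using compact_imp_bounded[OF assms(2)] unfolding bounded_iff by auto
  then show ?thesis using notin_supp_eq_0[of _ f] by (intro ccI[of _ B] assms) force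
qed

lemma cc_compact_supp: assumes "cc (f :: real ^ 'd \<Rightarrow> real)" shows "compact (supp f)"
proof -
  obtain \<rho> where "0 < \<rho>" and "\<forall>x. \<rho> < norm x \<longrightarrow> f x = 0" using assms(1) by (rule ccE)
  then have "supp f \<subseteq> cball 0 \<rho>" by (intro supp_subset) (auto simp: not_le)
  then show ?thesis by (meson bounded_cball bounded_subset closed_supp compact_eq_bounded_closed)
qed

lemma Crc_cc: "f \<in> Crc r U \<Longrightarrow> cc f"
  unfolding Crc_def by (auto intro!: ccI_compact_supp Ck_continuous_on)

lemma Crc_Ck: "f \<in> Crc r U \<Longrightarrow> Ck r f"
  unfolding Crc_def by auto

lemma cc_ddir: assumes "f \<in> Crc r U" "length vs \<le> r" shows "cc (ddir vs f)"
proof -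
  have "Ck r f" "compact (supp f)" using assms by (auto simp: Crc_def)
  have "supp (ddir vs f) \<subseteq> supp f" by (intro supp_subset) (auto simp: ddir_notin_supp)
  then have "compact (supp (ddir vs f))" using \<open>compact (supp f)\<close>
    by (metis closed_supp compact_Int_closed inf.absorb_iff2)
  then show ?thesis using Ck_continuous[OF \<open>Ck r f\<close> assms(2)] by (rule ccI_compact_supp[rotated])
qed


section \<open>Smooth bump functions, mollification and cutoffs\<close>

text \<open>The functions $P(1/t) e^{-1/t}$, extended by zero, form a class that is closed under
  differentiation, so their smoothness is a plain induction. The building block of the bump
  functions is \<open>flat 1\<close>.\<close>

definition flat :: "real poly \<Rightarrow> real \<Rightarrow> real" where
  "flat p t = (if t \<le> 0 then 0 else poly p (1 / t) * exp (- (1 / t)))"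

lemma tendsto_poly_exp: "((\<lambda>s::real. poly p s * exp (- s)) \<longlongrightarrow> 0) at_top"
proof -
  have "((\<lambda>s. \<Sum>i\<le>degree p. coeff p i * (s ^ i / exp s)) \<longlongrightarrow> (\<Sum>i\<le>degree p. coeff p i * 0)) at_top"
    by (intro tendsto_sum tendsto_mult tendsto_const tendsto_power_div_exp_0)
  then show ?thesis by (simp add: poly_altdef exp_minus sum_distrib_right divide_inverse mult.assoc)
qed

text \<open>Put $s = 1/t$, so that $d/dt = -s^2 d/ds$; applied to $p(s) e^{-s}$ this gives $s^2 (p -
  p')(s) e^{-s}$.\<close>

lemma flat_deriv: "(flat p has_real_derivative flat ([:0, 0, 1:] * (p - pderiv p)) t) (at t)"
proof -
  consider "t < 0" | "t > 0" | "t = 0" by linarith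
  then show ?thesis
  proof cases
    case 1
    have "((\<lambda>_. 0) has_real_derivative 0) (at t)" by simp
    from has_field_derivative_transform_within_open[OF this, of "{..<0}" "flat p"] show ?thesis
      using 1 by (auto simp: flat_def)
  next
    case 2
    have "((\<lambda>t. poly p (1 / t) * exp (- (1 / t))) has_real_derivative
       flat ([:0, 0, 1:] * (p - pderiv p)) t) (at t)"
      using 2 by (auto intro!: derivative_eq_intros DERIV_chain2[OF poly_DERIV] simp: flat_def field_simps power2_eq_square)
    from has_field_derivative_transform_within_open[OF this, of "{0<..}" "flat p"] show ?thesis
      using 2 by (auto simp: flat_def)
  next
    case 3
    have "((\<lambda>h. flat p h / h) \<longlongrightarrow> 0) (at_right 0)"
    proof -
      \<comment> \<open>The difference quotient at 0 again has the form polynomial times exponential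
        in \<open>inverse h\<close>: division by \<open>h\<close> multiplies the polynomial by its
        variable, which is \<open>pCons 0 p\<close>.\<close>
      have "((\<lambda>h::real. poly (pCons 0 p) (inverse h) * exp (- inverse h)) \<longlongrightarrow> 0) (at_right 0)"
        by (rule filterlim_compose[OF tendsto_poly_exp filterlim_inverse_at_top_right])
      then show ?thesis
        by (rule tendsto_cong[THEN iffD1, rotated])
           (auto simp: flat_def eventually_at_right_field field_simps intro!: exI[of _ 1])
    qed
    moreover have "((\<lambda>h. flat p h / h) \<longlongrightarrow> 0) (at_left 0)"
      by (rule tendsto_eventually) (auto simp: flat_def eventually_at_left_field intro!: exI[of _ "-1"])
    ultimately have "((\<lambda>h. flat p h / h) \<longlongrightarrow> 0) (at 0)" by (rule filterlim_split_at[rotated])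
    then show ?thesis using 3 by (simp add: DERIV_def flat_def)
  qed
qed

lemma Ck_flat: "Ck k (\<lambda>x. flat p (a \<bullet> x + c))"
proof (induction k arbitrary: p)
  case 0
  have "continuous_on UNIV (flat p)"
    by (rule DERIV_continuous_on) (rule flat_deriv[THEN has_field_derivative_at_within])
  then show ?case unfolding Ck_0 by (rule continuous_on_compose2) (auto intro!: continuous_intros)
next
  case (Suc k)
  let ?q = "[:0, 0, 1:] * (p - pderiv p)"
  have D: "((\<lambda>x. flat p (a \<bullet> x + c)) has_derivative (\<lambda>v. (a \<bullet> v) * flat ?q (a \<bullet> x + c))) (at x)" for x
  proof -
    have "((\<lambda>x. a \<bullet> x + c) has_derivative (\<lambda>v. a \<bullet> v)) (at x)" by (auto intro!: derivative_eq_intros)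
    from has_derivative_compose[OF this flat_deriv[unfolded has_field_derivative_def]]
    show ?thesis by (simp add: mult.commute)
  qed
  then have "(\<lambda>x. flat p (a \<bullet> x + c)) differentiable at x" for x by (auto simp: differentiable_def)
  moreover have "ddir [v] (\<lambda>x. flat p (a \<bullet> x + c)) = (\<lambda>x. (a \<bullet> v) * flat ?q (a \<bullet> x + c))" for v
    using frechet_derivative_eqI[OF D] by auto
  ultimately show ?case unfolding Ck_Suc_iff using Suc by (auto intro!: Ck_cmult)
qed

lemma flat_1_nonneg: "flat 1 t \<ge> 0" by (simp add: flat_def)

definition bump :: "real ^ 'd \<Rightarrow> real" where
  "bump x = (\<Prod>b\<in>Basis. flat 1 (b \<bullet> x + 1) * flat 1 ((- b) \<bullet> x + 1))"

lemma Ck_bump: "Ck k bump"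
  unfolding bump_def by (intro Ck_prod Ck_mult Ck_flat) auto

lemma bump_nonneg: "bump x \<ge> 0"
  unfolding bump_def by (intro prod_nonneg mult_nonneg_nonneg flat_1_nonneg ballI)

lemma bump_0: "bump 0 > 0"
  unfolding bump_def by (intro prod_pos mult_pos_pos) (auto simp: flat_def)

text \<open>The product is supported in the cube where all coordinates are at most 1 in absolute
  value, and the Euclidean norm is at most the sum of these \<open>CARD('d)\<close> absolute
  values.\<close>

lemma bump_eq_0: assumes "norm (x :: real ^ 'd) > real CARD('d)" shows "bump x = 0"
proof (rule ccontr)
  assume "bump x \<noteq> 0"
  then have "\<bar>x \<bullet> b\<bar> \<le> 1" if "b \<in> Basis" for b
    using that unfolding bump_def by (auto simp: flat_def inner_commute split: if_splits)
  then have "(\<Sum>b\<in>Basis. \<bar>x \<bullet> b\<bar>) \<le> (\<Sum>b\<in>(Basis :: (real^'d) set). 1)" by (intro sum_mono)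
  then show False using norm_le_l1[of x] assms by simp
qed

lemma mollifier_exists:
  assumes "\<delta> > 0"
  obtains \<rho> :: "real ^ 'd \<Rightarrow> real" where "\<forall>k. Ck k \<rho>" "\<forall>x. \<rho> x \<ge> 0" "\<forall>x. \<delta> < norm x \<longrightarrow> \<rho> x = 0"
    "cc \<rho>" "(LINT x|lborel. \<rho> x) = 1"
proof -
  define c where "c = real CARD('d) / \<delta>"
  have c: "c > 0" using assms by (simp add: c_def)
  define g where "g = (\<lambda>x :: real ^ 'd. bump (c *\<^sub>R (x - 0)))"
  have g: "Ck k g" for k unfolding g_def by (intro Ck_affine Ck_bump)
  have g0: "g x = 0" if "\<delta> < norm x" for x
    unfolding g_def by (rule bump_eq_0) (use that c assms in \<open>simp add: c_def field_simps\<close>)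
  have "cc g" using g0 by (rule ccI[OF Ck_continuous_on[OF g]])
  then have Z: "(LINT x|lborel. g x) > 0" (is "?Z > 0")
    by (intro continuous_integral_pos[of _ 0] cc_continuous cc_integrable) (auto simp: g_def bump_0 bump_nonneg)
  show thesis
  proof
    show "\<forall>k. Ck k (\<lambda>x. (1 / ?Z) * g x)" by (intro allI Ck_cmult g)
    show "cc (\<lambda>x. (1 / ?Z) * g x)" by (intro cc_cmult \<open>cc g\<close>)
    show "(LINT x|lborel. (1 / ?Z) * g x) = 1" using Z by simp
  qed (use Z g0 in \<open>auto simp: g_def bump_nonneg\<close>)
qed

section \<open>Convolution with a compactly supported function\<close>

definition conv :: "(real ^ 'd \<Rightarrow> real) \<Rightarrow> (real ^ 'd \<Rightarrow> real) \<Rightarrow> real ^ 'd \<Rightarrow> real" where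
  "conv w G x = (LINT y|lborel. w y * G (x - y))"

text \<open>One box serves all \<open>G\<close> and all \<open>x\<close>, since it only has to
  contain the support of \<open>w\<close>. Convolutions become integrals over a fixed compact
  interval, to which the theorems on continuity and differentiation under the integral
  apply.\<close>

lemma conv_box:
  fixes w :: "real ^ 'd \<Rightarrow> real"
  assumes "cc w" obtains a b where "\<forall>G x. continuous_on UNIV G \<longrightarrow> conv w G x = integral (cbox a b) (\<lambda>y. w y * G (x - y))"
proof -
  obtain \<rho> where "0 < \<rho>" and \<rho>: "\<forall>x. \<rho> < norm x \<longrightarrow> w x = 0" using assms by (rule ccE)
  note \<rho> = \<rho>[rule_format]
  obtain a :: "real ^ 'd" where "cball 0 \<rho> \<subseteq> cbox (-a) a"
    by (rule bounded_subset_cbox_symmetric[OF bounded_cball])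
  then have w0: "w y = 0" if "y \<notin> cbox (-a) a" for y
    using that \<rho>[of y] by (auto simp: subset_iff not_le[symmetric])
  have "conv w G x = integral (cbox (-a) a) (\<lambda>y. w y * G (x - y))" if "continuous_on UNIV G" for G x
  proof -
    have "cc (\<lambda>y. w y * G (x - y))"
      by (intro cc_mult1 assms continuous_on_compose2[OF that] continuous_intros) auto
    then have "conv w G x = integral UNIV (\<lambda>y. w y * G (x - y))"
      unfolding conv_def by (intro integral_lborel[symmetric] cc_integrable)
    also have "\<dots> = integral UNIV (\<lambda>y. if y \<in> cbox (-a) a then w y * G (x - y) else 0)"
      using w0 by (intro integral_cong) auto
    finally show ?thesis by (simp only: Henstock_Kurzweil_Integration.integral_restrict_UNIV)
  qed
  then show thesis by (intro that) blast
qed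

lemma conv_continuous: assumes "cc w" "continuous_on UNIV G" shows "continuous_on UNIV (conv w G)"
proof -
  obtain a b where ab: "\<forall>G x. continuous_on UNIV G \<longrightarrow> conv w G x = integral (cbox a b) (\<lambda>y. w y * G (x - y))"
    by (rule conv_box[OF assms(1)])
  note ab = ab[rule_format]
  have "continuous_on UNIV (\<lambda>x. integral (cbox a b) (\<lambda>y. w y * G (x - y)))"
    unfolding case_prod_unfold
    by (rule integral_continuous_on_param)
       (auto simp: case_prod_unfold intro!: continuous_intros continuous_on_compose2[OF assms(2)]
          continuous_on_compose2[OF cc_continuous[OF assms(1)]])
  then show ?thesis using ab[OF assms(2)] by simp
qed

text \<open>The derivative falls on \<open>G\<close> alone, so \<open>w\<close> may be merely
  continuous. With \<open>conv_commute\<close> one can choose which of two factors is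
  differentiated.\<close>

lemma conv_has_derivative:
  fixes G :: "real ^ 'd \<Rightarrow> real"
  assumes "cc w" "Ck 1 G"
  shows "(conv w G has_derivative (\<lambda>v. conv w (ddir [v] G) x)) (at x)"
proof -
  obtain a b where ab: "\<forall>G x. continuous_on UNIV G \<longrightarrow> conv w G x = integral (cbox a b) (\<lambda>y. w y * G (x - y))"
    by (rule conv_box[OF assms(1)])
  note ab = ab[rule_format]
  have cG: "continuous_on UNIV G" by (rule Ck_continuous_on[OF assms(2)])
  have cD: "continuous_on UNIV (ddir [v] G)" for v by (rule Ck_continuous[OF assms(2)]) simp
  define fx where "fx = (\<lambda>x t. Blinfun (\<lambda>v. w t * ddir [v] G (x - t)))"
  have hd: "(G has_derivative (\<lambda>v. ddir [v] G x)) (at x)" for x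
    using Ck_has_derivative[OF assms(2), of "[]" x] by simp
  have fx: "blinfun_apply (fx x t) = (\<lambda>v. w t * ddir [v] G (x - t))" for x t
    unfolding fx_def
    by (intro bounded_linear_Blinfun_apply bounded_linear_const_mult has_derivative_bounded_linear[OF hd])
  have cont: "continuous_on (UNIV \<times> cbox a b) (\<lambda>(x, t). fx x t)"
    by (rule continuous_on_blinfun_componentwise)
       (auto simp: case_prod_unfold fx simp del: ddir.simps intro!: continuous_intros continuous_on_compose2[OF cD]
          continuous_on_compose2[OF cc_continuous[OF assms(1)]])
  have "((\<lambda>x. integral (cbox a b) (\<lambda>y. w y * G (x - y))) has_derivative
      blinfun_apply (integral (cbox a b) (fx x))) (at x within UNIV)"
  proof (rule leibniz_rule[where U = UNIV])
    fix x t
    have "((\<lambda>x. G (x - t)) has_derivative (\<lambda>v. ddir [v] G (x - t))) (at x)"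
    proof -
      have "((\<lambda>x. x - t) has_derivative (\<lambda>v. v)) (at x)" by (auto intro!: derivative_eq_intros)
      from has_derivative_compose[OF this hd] show ?thesis by simp
    qed
    then show "((\<lambda>x. w t * G (x - t)) has_derivative blinfun_apply (fx x t)) (at x within UNIV)"
      unfolding fx by (intro has_derivative_mult_right) auto
  next
    show "(\<lambda>t. w t * G (x - t)) integrable_on cbox a b" for x
      by (intro integrable_continuous continuous_intros continuous_on_compose2[OF cG] cc_continuous_on assms) auto
  qed (use cont in auto)
  moreover have "blinfun_apply (integral (cbox a b) (fx x)) v = conv w (ddir [v] G) x" for v
  proof -
    have "fx x integrable_on cbox a b"
      by (intro integrable_continuous continuous_on_compose2[OF cont, of _ "\<lambda>t. (x, t)", simplified] continuous_intros) auto
    then show ?thesis by (simp only: blinfun_apply_integral fx ab[OF cD])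
  qed
  then have "blinfun_apply (integral (cbox a b) (fx x)) = (\<lambda>v. conv w (ddir [v] G) x)" by (rule ext)
  moreover have "conv w G = (\<lambda>x. integral (cbox a b) (\<lambda>y. w y * G (x - y)))" using ab[OF cG] by (rule ext)
  ultimately show ?thesis by (simp only:)
qed

lemma ddir_conv:
  assumes "cc w" "Ck k G" "length vs \<le> k" shows "ddir vs (conv w G) = conv w (ddir vs G)"
  using assms(3)
proof (induction vs)
  case (Cons v vs)
  have "Ck 1 (ddir vs G)" by (rule Ck_ddir[OF assms(2)]) (use Cons.prems in auto)
  from frechet_derivative_eqI[OF conv_has_derivative[OF assms(1) this]]
  show ?case using Cons by simp
qed simp

lemma Ck_conv:
  assumes "cc w" "Ck k G" shows "Ck k (conv w G)"
proof -
  have "ddir vs (conv w G) differentiable at x" if "length vs < k" for vs x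
  proof -
    have "Ck 1 (ddir vs G)" by (rule Ck_ddir[OF assms(2)]) (use that in auto)
    from conv_has_derivative[OF assms(1) this, of x] show ?thesis
      unfolding ddir_conv[OF assms less_imp_le[OF that]] differentiable_def by blast
  qed
  moreover have "continuous_on UNIV (ddir vs (conv w G))" if "length vs \<le> k" for vs
    unfolding ddir_conv[OF assms that] by (rule conv_continuous[OF assms(1) Ck_continuous[OF assms(2) that]])
  ultimately show ?thesis unfolding Ck_on_def by auto
qed

lemma conv_commute: assumes "cc w" "cc G" shows "conv w G = conv G w"
proof
  fix x
  have "(\<lambda>y. w y * G (x - y)) \<in> borel_measurable borel"
    using assms[THEN cc_measurable] by measurable
  from integral_affine[OF this, of "-1" x] show "conv w G x = conv G w x"
    by (simp add: conv_def mult.commute)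
qed

lemma conv_close:
  assumes "cc \<rho>" "\<And>x. \<rho> x \<ge> 0" "\<And>x. \<delta> < norm x \<Longrightarrow> \<rho> x = 0" "(LINT x|lborel. \<rho> x) = 1"
    and "continuous_on UNIV u" "\<And>y. norm y \<le> \<delta> \<Longrightarrow> \<bar>u (x - y) - u x\<bar> \<le> e"
  shows "\<bar>conv \<rho> u x - u x\<bar> \<le> e"
proof -
  have i: "integrable lborel (\<lambda>y. \<rho> y * u (x - y))"
    by (intro cc_integrable cc_mult1 assms continuous_on_compose2[OF assms(5)] continuous_intros) auto
  have "conv \<rho> u x - u x = (LINT y|lborel. \<rho> y * u (x - y)) - (LINT y|lborel. \<rho> y * u x)"
    using assms(4) by (simp add: conv_def)
  also have "\<dots> = (LINT y|lborel. \<rho> y * u (x - y) - \<rho> y * u x)"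
    using i cc_integrable[OF assms(1)] by (intro Bochner_Integration.integral_diff[symmetric]) auto
  finally have *: "conv \<rho> u x - u x = (LINT y|lborel. \<rho> y * (u (x - y) - u x))" by (simp add: algebra_simps)
  have "\<bar>conv \<rho> u x - u x\<bar> \<le> (LINT y|lborel. \<bar>\<rho> y * (u (x - y) - u x)\<bar>)"
    unfolding * by (rule integral_abs_bound)
  also have "\<dots> \<le> (LINT y|lborel. \<rho> y * e)"
  proof (rule integral_mono)
    show "integrable lborel (\<lambda>y. \<bar>\<rho> y * (u (x - y) - u x)\<bar>)"
      by (intro cc_integrable cc_abs cc_mult1 assms continuous_intros continuous_on_compose2[OF assms(5)]) auto
    show "integrable lborel (\<lambda>y. \<rho> y * e)" using cc_integrable[OF assms(1)] by auto
    show "\<bar>\<rho> y * (u (x - y) - u x)\<bar> \<le> \<rho> y * e" for y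
      using assms(2)[of y] assms(3)[of y] assms(6)[of y]
      by (cases "norm y \<le> \<delta>") (auto simp: abs_mult intro!: mult_left_mono)
  qed
  finally show ?thesis using assms(4) by simp
qed

lemma conv_eq_0:
  assumes "\<And>x. \<delta> < norm x \<Longrightarrow> \<rho> x = 0" "\<And>y. norm y \<le> \<delta> \<Longrightarrow> u (x - y) = 0"
  shows "conv \<rho> u x = 0"
proof -
  have "(\<lambda>y. \<rho> y * u (x - y)) = (\<lambda>_. 0)" using assms by (metis linorder_not_le mult_eq_0_iff)
  then show ?thesis by (simp add: conv_def)
qed

lemma Cinf_cI: "(\<And>k. Ck k f) \<Longrightarrow> compact (supp f) \<Longrightarrow> supp f \<subseteq> U \<Longrightarrow> f \<in> Cinf_c U"
  unfolding Cinf_c_def Crc_def by auto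

lemma compact_supp_neighbourhood: "closed S \<Longrightarrow> bounded S \<Longrightarrow> supp f \<subseteq> S \<Longrightarrow> compact (supp f)"
  by (meson bounded_subset closed_supp compact_eq_bounded_closed)

theorem mollify:
  fixes g :: "real ^ 'd \<Rightarrow> real"
  assumes g: "g \<in> Crc r UNIV" and e: "e > 0"
  obtains h where "h \<in> Cinf_c UNIV" "supp h \<subseteq> (\<Union>x\<in>supp g. cball x e)" "Cb r e 1 (\<lambda>x. h x - g x)"
proof -
  have ck: "Ck r g" and cs: "compact (supp g)" using g by (auto simp: Crc_def)
  define T where "T = (\<Union>j\<le>r. BL j :: (real ^ 'd) list set)"
  have fin: "finite T" unfolding T_def by auto
  define d where "d = (\<lambda>vs. SOME d. d > 0 \<and> (\<forall>x y. dist x y \<le> d \<longrightarrow> \<bar>ddir vs g x - ddir vs g y\<bar> \<le> e))"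
  have d: "d vs > 0 \<and> (\<forall>x y. dist x y \<le> d vs \<longrightarrow> \<bar>ddir vs g x - ddir vs g y\<bar> \<le> e)" if "vs \<in> T" for vs
  proof -
    have "length vs \<le> r" using that by (auto simp: T_def BL_def)
    then have "cc (ddir vs g)" by (rule cc_ddir[OF g])
    then obtain d where "d > 0" "\<forall>x y. dist x y \<le> d \<longrightarrow> \<bar>ddir vs g x - ddir vs g y\<bar> \<le> e"
      using e by (rule cc_uniformly_continuous)
    then have "\<exists>d>0. \<forall>x y. dist x y \<le> d \<longrightarrow> \<bar>ddir vs g x - ddir vs g y\<bar> \<le> e"
      by (intro exI[of _ d] conjI)
    then show ?thesis unfolding d_def by (rule someI_ex)
  qed
  \<comment> \<open>The finitely many moduli of continuity control the derivatives; the entry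
    \<open>e\<close> keeps the support of the mollification within distance
    \<open>e\<close>.\<close>
  define \<delta> where "\<delta> = Min (insert e (d ` T))"
  have \<delta>: "\<delta> > 0" "\<delta> \<le> e" "\<And>vs. vs \<in> T \<Longrightarrow> \<delta> \<le> d vs" unfolding \<delta>_def using fin e d by auto
  obtain \<rho> :: "real ^ 'd \<Rightarrow> real" where \<rho>: "\<forall>k. Ck k \<rho>" "\<forall>x. \<rho> x \<ge> 0" "\<forall>x. \<delta> < norm x \<longrightarrow> \<rho> x = 0"
    "cc \<rho>" "(LINT x|lborel. \<rho> x) = 1" by (rule mollifier_exists[OF \<delta>(1)])
  note \<rho> = \<rho>[rule_format]
  have ccg: "cc g" using g by (rule Crc_cc)
  \<comment> \<open>In this order the derivatives fall on the smooth factor, which gives smoothness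
    of \<open>h\<close>. In the commuted order \<open>h'\<close> they fall on \<open>g\<close>,
    which shows that the derivatives of \<open>h\<close> are local averages of those of
    \<open>g\<close>.\<close>
  define h where "h = conv g \<rho>"
  have h': "h = conv \<rho> g" unfolding h_def by (rule conv_commute[OF ccg \<rho>(4)])
  have hk: "Ck k h" for k unfolding h_def by (rule Ck_conv[OF ccg \<rho>(1)])
  have cl: "compact (\<Union>x\<in>supp g. cball x e)" by (rule compact_minkowski_sum_cball[OF cs])
  have sup: "supp h \<subseteq> (\<Union>x\<in>supp g. cball x e)"
  proof (rule supp_subset[OF compact_imp_closed[OF cl]])
    fix x assume x: "x \<notin> (\<Union>x\<in>supp g. cball x e)"
    show "h x = 0" unfolding h'
    proof (rule conv_eq_0[OF \<rho>(3)])
      fix y :: "real ^ 'd" assume "norm y \<le> \<delta>"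
      then have "x \<in> cball (x - y) e" using \<delta>(2) by (simp add: dist_norm)
      then show "g (x - y) = 0" using x notin_supp_eq_0[of "x - y" g] by blast
    qed
  qed
  have "\<bar>ddir vs (\<lambda>x. h x - g x) x\<bar> \<le> e" if "length vs \<le> r" "set vs \<subseteq> Basis" for vs x
  proof -
    have vsT: "vs \<in> T" using that unfolding T_def BL_def by auto
    have "ddir vs (\<lambda>x. h x - g x) x = ddir vs h x - ddir vs g x"
      by (simp add: ddir_diff[OF hk ck that(1)])
    also have "ddir vs h x = conv \<rho> (ddir vs g) x" unfolding h' ddir_conv[OF \<rho>(4) ck that(1)] ..
    also have "\<bar>conv \<rho> (ddir vs g) x - ddir vs g x\<bar> \<le> e"
    proof (rule conv_close[OF \<rho>(4,2,3,5)])
      fix y :: "real ^ 'd" assume "norm y \<le> \<delta>"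
      then show "\<bar>ddir vs g (x - y) - ddir vs g x\<bar> \<le> e"
        using \<delta>(3)[OF vsT] by (intro d[OF vsT, THEN conjunct2, rule_format]) (simp add: dist_norm)
    qed (use Ck_continuous[OF ck that(1)] in auto)
    finally show ?thesis .
  qed
  then have "Cb r e 1 (\<lambda>x. h x - g x)" unfolding Cb_def using e by (auto intro!: Ck_diff hk ck)
  moreover have "h \<in> Cinf_c UNIV"
    by (intro Cinf_cI hk compact_supp_neighbourhood[OF _ _ sup] compact_imp_closed compact_imp_bounded cl) auto
  ultimately show thesis using sup by (intro that[of h]) auto
qed

theorem smooth_cutoff:
  fixes K :: "(real ^ 'd) set"
  assumes K: "compact K" "K \<subseteq> U" "open U"
  obtains \<theta> where "\<theta> \<in> Cinf_c U" "\<And>x. x \<in> K \<Longrightarrow> \<theta> x = 1"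
proof (cases "K = {}")
  \<comment> \<open>The empty set is treated apart because \<open>infdist\<close> to it is 0
    everywhere.\<close>
  case True
  have "(\<lambda>x. 0) \<in> Cinf_c U" by (rule Cinf_cI) (auto simp: Ck_const supp_def)
  then show thesis using True by (intro that) auto
next
  case False
  obtain e where e: "e > 0" "(\<Union>x\<in>K. cball x e) \<subseteq> U"
    using compact_subset_open_imp_cball_epsilon_subset[OF K(1,3,2)] by blast
  \<comment> \<open>The function \<open>w\<close> below is 1 up to distance \<open>\<delta>\<close>
    from \<open>K\<close> and 0 beyond \<open>2 * \<delta>\<close>. Averaging over radius
    \<open>\<delta>\<close> keeps the value 1 on \<open>K\<close> and spreads the support to at most
    \<open>3 * \<delta> = e\<close>.\<close>
  define \<delta> where "\<delta> = e / 3"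
  have \<delta>: "\<delta> > 0" using e by (simp add: \<delta>_def)
  define w where "w = (\<lambda>x. max 0 (min 1 (2 - infdist x K / \<delta>)))"
  have w1: "w x = 1" if "infdist x K \<le> \<delta>" for x using that \<delta> by (auto simp: w_def field_simps)
  have w0: "w x = 0" if "infdist x K \<ge> 2 * \<delta>" for x using that \<delta> by (auto simp: w_def field_simps)
  have infd: "\<exists>a\<in>K. infdist x K = dist x a" for x
    using infdist_attains_inf[of K x] K(1) False by (metis compact_imp_closed)
  obtain B where B: "\<And>x. x \<in> K \<Longrightarrow> norm x \<le> B"
    using compact_imp_bounded[OF K(1)] unfolding bounded_iff by auto
  have "w x = 0" if "B + 2 * \<delta> < norm x" for x
  proof -
    obtain a where "a \<in> K" "infdist x K = dist x a" using infd by blast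
    then show ?thesis using that B[of a] norm_triangle_ineq2[of x a] by (intro w0) (auto simp: dist_norm)
  qed
  then have ccw: "cc w" by (rule ccI[rotated]) (use \<delta> in \<open>auto simp: w_def intro!: continuous_intros\<close>)
  obtain \<rho> :: "real ^ 'd \<Rightarrow> real" where \<rho>: "\<forall>k. Ck k \<rho>" "\<forall>x. \<rho> x \<ge> 0" "\<forall>x. \<delta> < norm x \<longrightarrow> \<rho> x = 0"
    "cc \<rho>" "(LINT x|lborel. \<rho> x) = 1" by (rule mollifier_exists[OF \<delta>])
  note \<rho> = \<rho>[rule_format]
  define \<theta> where "\<theta> = conv w \<rho>"
  have \<theta>': "\<theta> = conv \<rho> w" unfolding \<theta>_def by (rule conv_commute[OF ccw \<rho>(4)])
  have cl: "compact (\<Union>x\<in>K. cball x e)" by (rule compact_minkowski_sum_cball[OF K(1)])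
  have inf3: "infdist (x - y) K \<le> infdist x K + norm y" "infdist x K \<le> infdist (x - y) K + norm y" for x y
    using infdist_triangle[of "x - y" K x] infdist_triangle[of x K "x - y"] by (auto simp: dist_norm norm_minus_commute)
  have sup: "supp \<theta> \<subseteq> (\<Union>x\<in>K. cball x e)"
  proof (rule supp_subset[OF compact_imp_closed[OF cl]])
    fix x assume x: "x \<notin> (\<Union>x\<in>K. cball x e)"
    obtain a where "a \<in> K" "infdist x K = dist x a" using infd by blast
    then have i: "infdist x K > e" using x by (auto simp: dist_commute not_le)
    show "\<theta> x = 0" unfolding \<theta>'
    proof (rule conv_eq_0[OF \<rho>(3)])
      fix y :: "real ^ 'd" assume "norm y \<le> \<delta>"
      then show "w (x - y) = 0" using i inf3(2)[of x y] by (intro w0) (simp add: \<delta>_def)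
    qed
  qed
  have "\<theta> x = 1" if "x \<in> K" for x
  proof -
    have "\<bar>conv \<rho> w x - w x\<bar> \<le> 0"
    proof (rule conv_close[OF \<rho>(4,2,3,5)])
      fix y :: "real ^ 'd" assume "norm y \<le> \<delta>"
      then have "w (x - y) = 1" "w x = 1" using inf3(1)[of x y] that \<delta> by (auto intro!: w1)
      then show "\<bar>w (x - y) - w x\<bar> \<le> 0" by simp
    qed (use ccw cc_continuous in auto)
    moreover have "w x = 1" using that \<delta> by (intro w1) auto
    ultimately show ?thesis unfolding \<theta>' by simp
  qed
  moreover have "\<theta> \<in> Cinf_c U"
    by (intro Cinf_cI compact_supp_neighbourhood[OF _ _ sup] compact_imp_closed compact_imp_bounded cl)
       (use sup e in \<open>auto simp: \<theta>_def intro!: Ck_conv ccw \<rho>(1)\<close>)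
  ultimately show thesis by (intro that[of \<theta>])
qed


section \<open>Dyadic lattices\<close>

lemma lattice_scale: "(1 / 2 ^ n) *\<^sub>R x \<in> lattice n \<longleftrightarrow> x \<in> lattice 0"
  by (auto simp: lattice_def)

lemma lattice_scale': "x \<in> lattice n \<longleftrightarrow> 2 ^ n *\<^sub>R x \<in> lattice 0"
  by (auto simp: lattice_def)

lemma lattice_near: "\<exists>y\<in>lattice n. norm (x - y) \<le> real CARD('d) / 2 ^ n" for x :: "real ^ 'd"
proof
  define y where "y = (\<chi> i. real_of_int \<lfloor>2 ^ n * x $ i\<rfloor> / 2 ^ n)"
  show "y \<in> lattice n" by (auto simp: lattice_def y_def)
  have "\<bar>x $ i - y $ i\<bar> \<le> 1 / 2 ^ n" for i
  proof -
    have "real_of_int \<lfloor>2 ^ n * x $ i\<rfloor> \<le> 2 ^ n * x $ i" "2 ^ n * x $ i \<le> real_of_int \<lfloor>2 ^ n * x $ i\<rfloor> + 1" by linarith+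
    moreover have "x $ i - y $ i = (2 ^ n * x $ i - real_of_int \<lfloor>2 ^ n * x $ i\<rfloor>) / 2 ^ n"
      by (simp add: y_def diff_divide_distrib)
    ultimately show ?thesis
      using divide_right_mono[of "2 ^ n * x $ i - real_of_int \<lfloor>2 ^ n * x $ i\<rfloor>" 1 "2 ^ n"]
        \<open>2 ^ n * x $ i \<le> real_of_int \<lfloor>2 ^ n * x $ i\<rfloor> + 1\<close> by simp
  qed
  then have "(\<Sum>i\<in>UNIV. \<bar>(x - y) $ i\<bar>) \<le> (\<Sum>i\<in>(UNIV::'d set). 1 / 2 ^ n)" by (intro sum_mono) simp
  then show "norm (x - y) \<le> real CARD('d) / 2 ^ n" using norm_le_l1_cart[of "x - y"] by simp
qed

text \<open>Every coordinate, multiplied by \<open>2 ^ n\<close>, ranges over the integers of an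
  interval of length \<open>2 * (2 ^ n * \<rho>)\<close>. For \<open>\<rho>\<close> proportional to
  \<open>1 / 2 ^ n\<close> the count is independent of \<open>n\<close>: this is the finite overlap
  of the wavelets of one scale.\<close>

lemma lattice_ball_card:
  fixes z :: "real ^ 'd"
  assumes "\<rho> \<ge> 0"
  shows "finite (lattice n \<inter> cball z \<rho>)"
    and "real (card (lattice n \<inter> cball z \<rho>)) \<le> (2 * (2 ^ n * \<rho>) + 1) ^ CARD('d)"
proof -
  let ?t = "2 ^ n * \<rho>"
  define J where "J = (\<lambda>i. {\<lceil>2 ^ n * z $ i - ?t\<rceil>..\<lfloor>2 ^ n * z $ i + ?t\<rfloor>})"
  define g where "g = (\<lambda>k :: 'd \<Rightarrow> int. (\<chi> i. real_of_int (k i) / 2 ^ n) :: real ^ 'd)"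
  have sub: "lattice n \<inter> cball z \<rho> \<subseteq> g ` (PiE UNIV J)"
  proof
    fix x assume x: "x \<in> lattice n \<inter> cball z \<rho>"
    define k where "k = (\<lambda>i. \<lfloor>2 ^ n * x $ i\<rfloor>)"
    have k: "real_of_int (k i) = 2 ^ n * x $ i" for i
      using x unfolding k_def lattice_def by (auto elim!: Ints_cases)
    have "\<bar>x $ i - z $ i\<bar> \<le> \<rho>" for i
      using x component_le_norm_cart[of "x - z" i] by (auto simp: dist_norm norm_minus_commute)
    then have "\<bar>2 ^ n * (x $ i - z $ i)\<bar> \<le> ?t" for i
      unfolding abs_mult by (auto intro!: mult_mono)
    then have "\<bar>2 ^ n * x $ i - 2 ^ n * z $ i\<bar> \<le> ?t" for i by (simp add: right_diff_distrib)
    then have "k i \<in> J i" for i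
      unfolding J_def using k[of i] by (auto simp: ceiling_le_iff le_floor_iff abs_le_iff algebra_simps)
    then have "k \<in> PiE UNIV J" by auto
    moreover have "x = g k" unfolding g_def by (simp add: vec_eq_iff k)
    ultimately show "x \<in> g ` (PiE UNIV J)" by blast
  qed
  have fJ: "finite (PiE UNIV J)" by (intro finite_PiE) (auto simp: J_def)
  show "finite (lattice n \<inter> cball z \<rho>)" by (rule finite_subset[OF sub]) (use fJ in auto)
  have "card (lattice n \<inter> cball z \<rho>) \<le> card (PiE UNIV J)"
    using card_mono[OF _ sub] card_image_le[OF fJ, of g] fJ by fastforce
  also have "\<dots> = (\<Prod>i\<in>UNIV. card (J i))" by (rule card_PiE) auto
  finally have "real (card (lattice n \<inter> cball z \<rho>)) \<le> (\<Prod>i\<in>UNIV. real (card (J i)))"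
    unfolding of_nat_prod[symmetric] of_nat_le_iff .
  also have "\<dots> \<le> (\<Prod>i\<in>(UNIV::'d set). 2 * ?t + 1)"
  proof (intro prod_mono conjI)
    fix i
    have "real (card (J i)) \<le> max 0 (real_of_int \<lfloor>2 ^ n * z $ i + ?t\<rfloor> - real_of_int \<lceil>2 ^ n * z $ i - ?t\<rceil> + 1)"
      unfolding J_def by auto
    also have "\<dots> \<le> 2 * ?t + 1" using assms by (auto simp: le_ceiling_iff) linarith
    finally show "real (card (J i)) \<le> 2 * ?t + 1" .
  qed auto
  finally show "real (card (lattice n \<inter> cball z \<rho>)) \<le> (2 * ?t + 1) ^ CARD('d)" by simp
qed

lemma emeasure_cball_le:
  fixes z :: "real ^ 'd"
  assumes "\<rho> \<ge> 0"
  shows "emeasure lborel (cball z \<rho>) \<le> ennreal ((2 * \<rho>) ^ CARD('d))"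
proof -
  let ?a = "z - (\<chi> i. \<rho>)" and ?b = "z + (\<chi> i. \<rho>)"
  have "cball z \<rho> \<subseteq> cbox ?a ?b"
  proof
    fix x assume "x \<in> cball z \<rho>"
    then have "\<bar>x $ i - z $ i\<bar> \<le> \<rho>" for i
      using component_le_norm_cart[of "x - z" i] by (auto simp: dist_norm norm_minus_commute)
    then show "x \<in> cbox ?a ?b" by (auto simp: mem_box_cart abs_le_iff algebra_simps)
  qed
  then have "emeasure lborel (cball z \<rho>) \<le> emeasure lborel (cbox ?a ?b)" by (intro emeasure_mono) auto
  also have "emeasure lborel (cbox ?a ?b) = ennreal (\<Prod>b\<in>Basis. (?b - ?a) \<bullet> b)"
    using assms by (auto simp: emeasure_lborel_cbox_eq Basis_vec_def inner_axis inner_diff_left inner_add_left)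
  also have "(\<Prod>b\<in>Basis. (?b - ?a) \<bullet> b) = (\<Prod>b\<in>(Basis::(real^'d) set). 2 * \<rho>)"
    by (intro prod.cong) (auto simp: Basis_vec_def inner_axis inner_diff_left inner_add_left)
  finally show ?thesis by simp
qed


section \<open>Square integrable functions\<close>

lemma L2D: "f \<in> L2 \<Longrightarrow> f \<in> borel_measurable borel" "f \<in> L2 \<Longrightarrow> integrable lborel (\<lambda>x. (f x)\<^sup>2)"
  by (auto simp: L2_def)

lemma cc_L2: "cc f \<Longrightarrow> f \<in> L2"
  unfolding L2_def by (auto intro!: cc_integrable cc_power)

lemma L2_mult_integrable:
  assumes "f \<in> L2" "g \<in> L2" shows "integrable lborel (\<lambda>x. f x * g x)"
proof (rule Bochner_Integration.integrable_bound[of lborel "\<lambda>x. (f x)\<^sup>2 + (g x)\<^sup>2"])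
  show "(\<lambda>x. f x * g x) \<in> borel_measurable lborel" using L2D(1)[OF assms(1)] L2D(1)[OF assms(2)] by simp
  have "\<bar>f x * g x\<bar> \<le> (f x)\<^sup>2 + (g x)\<^sup>2" for x
    using sum_squares_bound[of "\<bar>f x\<bar>" "\<bar>g x\<bar>"] abs_ge_zero[of "f x * g x"] unfolding abs_mult power2_abs by linarith
  then show "AE x in lborel. norm (f x * g x) \<le> norm ((f x)\<^sup>2 + (g x)\<^sup>2)" by simp
qed (use assms[THEN L2D(2)] in auto)

lemma L2_lincomb:
  assumes "f \<in> L2" "g \<in> L2" shows "(\<lambda>x. a * f x + b * g x) \<in> L2"
  unfolding L2_def
proof (intro CollectI conjI)
  show "(\<lambda>x. a * f x + b * g x) \<in> borel_measurable lborel"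
    using L2D(1)[OF assms(1)] L2D(1)[OF assms(2)] by simp
  have "(\<lambda>x. (a * f x + b * g x)\<^sup>2) = (\<lambda>x. a\<^sup>2 * (f x)\<^sup>2 + 2 * a * b * (f x * g x) + b\<^sup>2 * (g x)\<^sup>2)"
    by (auto simp: power2_eq_square algebra_simps)
  then show "integrable lborel (\<lambda>x. (a * f x + b * g x)\<^sup>2)"
    using assms[THEN L2D(2)] L2_mult_integrable[OF assms] by simp
qed

lemma L2_diff: "f \<in> L2 \<Longrightarrow> g \<in> L2 \<Longrightarrow> (\<lambda>x. f x - g x) \<in> L2"
  using L2_lincomb[of f g 1 "-1"] by simp

lemma L2_0: "(\<lambda>x. 0) \<in> L2" by (auto simp: L2_def)

lemma L2_sum: "(\<And>i. i \<in> I \<Longrightarrow> f i \<in> L2) \<Longrightarrow> (\<lambda>x. \<Sum>i\<in>I. c i * f i x) \<in> L2"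
proof (induction I rule: infinite_finite_induct)
  case (insert i I)
  then show ?case using L2_lincomb[of "f i" "\<lambda>x. \<Sum>i\<in>I. c i * f i x" "c i" 1] by auto
qed (auto simp: L2_0)

lemma L2_inner_commute: "L2_inner f g = L2_inner g f"
  by (simp add: L2_inner_def mult.commute)

lemma L2_inner_lincomb:
  assumes "f \<in> L2" "g \<in> L2" "h \<in> L2"
  shows "L2_inner (\<lambda>x. a * f x + b * g x) h = a * L2_inner f h + b * L2_inner g h"
proof -
  have "L2_inner (\<lambda>x. a * f x + b * g x) h = (LINT x|lborel. a * (f x * h x) + b * (g x * h x))"
    by (simp add: L2_inner_def algebra_simps)
  also have "\<dots> = a * L2_inner f h + b * L2_inner g h"
    using L2_mult_integrable[OF assms(1,3)] L2_mult_integrable[OF assms(2,3)] by (simp add: L2_inner_def)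
  finally show ?thesis .
qed

lemma L2_inner_diff:
  "f \<in> L2 \<Longrightarrow> g \<in> L2 \<Longrightarrow> h \<in> L2 \<Longrightarrow> L2_inner (\<lambda>x. f x - g x) h = L2_inner f h - L2_inner g h"
  using L2_inner_lincomb[of f g h 1 "-1"] by simp

lemma L2_inner_cmult: "L2_inner (\<lambda>x. c * f x) h = c * L2_inner f h"
  by (simp add: L2_inner_def mult.assoc)

lemma L2_inner_sum:
  "(\<And>i. i \<in> I \<Longrightarrow> f i \<in> L2) \<Longrightarrow> h \<in> L2 \<Longrightarrow> L2_inner (\<lambda>x. \<Sum>i\<in>I. c i * f i x) h = (\<Sum>i\<in>I. c i * L2_inner (f i) h)"
proof (induction I rule: infinite_finite_induct)
  case (insert i I)
  then show ?case
    using L2_inner_lincomb[of "f i" "\<lambda>x. \<Sum>i\<in>I. c i * f i x" h "c i" 1] by (auto intro!: L2_sum)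
qed (auto simp: L2_inner_def)

lemma L2_inner_nonneg: "0 \<le> L2_inner f f"
  by (simp add: L2_inner_def)

lemma L2_inner_self_eq_0:
  assumes "f \<in> L2" shows "L2_inner f f = 0 \<longleftrightarrow> (AE x in lborel. f x = 0)"
  using integral_nonneg_eq_0_iff_AE[of lborel "\<lambda>x. (f x)\<^sup>2"] L2D(2)[OF assms]
  by (simp add: L2_inner_def power2_eq_square)

lemma L2_inner_cong_AE:
  assumes "AE x in lborel. f x = g x" "f \<in> borel_measurable borel" "g \<in> borel_measurable borel" "h \<in> borel_measurable borel"
  shows "L2_inner f h = L2_inner g h"
  unfolding L2_inner_def by (rule integral_cong_AE) (use assms in auto)

lemma L2_Cauchy_Schwarz:
  assumes "f \<in> L2" "g \<in> L2" shows "\<bar>L2_inner f g\<bar> \<le> L2_norm f * L2_norm g"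
proof -
  define A B C where "A = L2_inner f f" and "B = L2_inner f g" and "C = L2_inner g g"
  have "B\<^sup>2 \<le> A * C"
  proof (cases "C = 0")
    case True
    then have "AE x in lborel. g x = 0" using L2_inner_self_eq_0[OF assms(2)] by (simp add: C_def)
    then have "B = L2_inner (\<lambda>_. 0) f" unfolding B_def L2_inner_commute[of f]
      using assms[THEN L2D(1)] by (intro L2_inner_cong_AE) auto
    then show ?thesis using True by (simp add: L2_inner_def)
  next
    case False
    then have C: "C > 0" using L2_inner_nonneg[of g] by (simp add: C_def)
    \<comment> \<open>This is \<open>C\<close> times the component of \<open>f\<close> orthogonal to
      \<open>g\<close>; its squared norm is \<open>C * (A * C - B\<^sup>2)\<close>.\<close>
    let ?h = "\<lambda>x. C * f x + (- B) * g x"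
    have h: "?h \<in> L2" by (intro L2_lincomb assms)
    have "L2_inner ?h ?h = C * L2_inner f ?h + (- B) * L2_inner g ?h" by (intro L2_inner_lincomb assms h)
    also have "L2_inner f ?h = C * A + (- B) * B"
      using L2_inner_lincomb[OF assms assms(1), of C "-B"] L2_inner_commute[of f ?h] L2_inner_commute[of g f]
      by (simp add: A_def B_def)
    also have "L2_inner g ?h = C * B + (- B) * C"
      using L2_inner_lincomb[OF assms assms(2), of C "-B"] L2_inner_commute[of g ?h]
      by (simp add: C_def B_def)
    finally have "0 \<le> C * (A * C - B\<^sup>2)" using L2_inner_nonneg[of ?h] by (simp add: algebra_simps power2_eq_square)
    then show ?thesis using C by (simp add: zero_le_mult_iff)
  qed
  then have "sqrt (B\<^sup>2) \<le> sqrt (A * C)" by (rule real_sqrt_le_mono)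
  then show ?thesis by (simp add: A_def B_def C_def L2_norm_def real_sqrt_mult)
qed

lemma L2_norm_sq: "(L2_norm f)\<^sup>2 = L2_inner f f"
  by (simp add: L2_norm_def L2_inner_nonneg)

lemma L2_norm_nonneg: "0 \<le> L2_norm f" by (simp add: L2_norm_def L2_inner_nonneg)

definition ortho_part :: "'i set \<Rightarrow> ('i \<Rightarrow> real ^ 'd \<Rightarrow> real) \<Rightarrow> (real ^ 'd \<Rightarrow> real) \<Rightarrow> real ^ 'd \<Rightarrow> real" where
  "ortho_part J e u = (\<lambda>x. \<Sum>i\<in>J. L2_inner u (e i) * e i x)"

lemma subspace_lincomb:
  "L2_closed_subspace S \<Longrightarrow> f \<in> S \<Longrightarrow> g \<in> S \<Longrightarrow> (\<lambda>x. a * f x + b * g x) \<in> S"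
  unfolding L2_closed_subspace_def by simp

lemma subspace_sum:
  assumes "L2_closed_subspace S" "\<And>i. i \<in> I \<Longrightarrow> f i \<in> S"
  shows "(\<lambda>x. \<Sum>i\<in>I. c i * f i x) \<in> S"
  using assms(2)
proof (induction I rule: infinite_finite_induct)
  case (insert i I)
  have "f i \<in> S" "(\<lambda>x. \<Sum>i\<in>I. c i * f i x) \<in> S" using insert by auto
  from subspace_lincomb[OF assms(1) this, of "c i" 1]
  show ?case using insert by simp
qed (use assms(1) in \<open>auto simp: L2_closed_subspace_def\<close>)

text \<open>If all coefficients outside a finite \<open>J\<close> vanish, as happens for compactly
  supported \<open>u\<close>, the orthogonal projection is a finite sum. The residual is orthogonal
  to every basis element, hence to their span, and by density and Cauchy-Schwarz to all of
  \<open>S\<close>.\<close>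

lemma onb_ortho_part:
  assumes onb: "L2_onb I e S" and S: "S \<subseteq> L2" and u: "u \<in> L2" and J: "finite J" "J \<subseteq> I"
    and z: "\<And>i. i \<in> I - J \<Longrightarrow> L2_inner u (e i) = 0" and h: "h \<in> S"
  shows "L2_inner (\<lambda>x. u x - ortho_part J e u x) h = 0"
proof -
  let ?P = "ortho_part J e u"
  let ?D = "\<lambda>x. u x - ?P x"
  have eS: "e i \<in> S" if "i \<in> I" for i using onb that by (auto simp: L2_onb_def)
  then have eL: "e i \<in> L2" if "i \<in> I" for i using that S by auto
  have P: "?P \<in> L2" unfolding ortho_part_def by (intro L2_sum eL) (use J in auto)
  have D: "?D \<in> L2" by (intro L2_diff u P)
  have e0: "L2_inner ?D (e i) = 0" if i: "i \<in> I" for i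
  proof -
    have "L2_inner ?P (e i) = (\<Sum>j\<in>J. L2_inner u (e j) * L2_inner (e j) (e i))"
      unfolding ortho_part_def by (intro L2_inner_sum eL i) (use J in auto)
    also have "\<dots> = (\<Sum>j\<in>J. if j = i then L2_inner u (e j) else 0)"
      using onb i J(2) by (intro sum.cong) (auto simp: L2_onb_def)
    also have "\<dots> = L2_inner u (e i)" using J(1) z[of i] i by auto
    finally show ?thesis using L2_inner_diff[OF u P eL[OF i]] by simp
  qed
  have "\<bar>L2_inner ?D h\<bar> \<le> L2_norm ?D * \<epsilon>" if "\<epsilon> > 0" for \<epsilon>
  proof -
    have "L2_dense_in {\<lambda>x. \<Sum>i\<in>J. c i * e i x | J c. finite J \<and> J \<subseteq> I} S"
      using onb by (simp add: L2_onb_def)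
    then have "\<exists>g\<in>{\<lambda>x. \<Sum>i\<in>J. c i * e i x | J c. finite J \<and> J \<subseteq> I}. L2_norm (\<lambda>x. h x - g x) < \<epsilon>"
      using h that by (simp add: L2_dense_in_def)
    then obtain K c where K: "finite K" "K \<subseteq> I" and
      lt: "L2_norm (\<lambda>x. h x - (\<Sum>i\<in>K. c i * e i x)) < \<epsilon>" by auto
    let ?g = "\<lambda>x. \<Sum>i\<in>K. c i * e i x"
    have hL: "h \<in> L2" and gL: "?g \<in> L2" using h S K eL by (auto intro!: L2_sum)
    have "L2_inner ?g ?D = (\<Sum>i\<in>K. c i * L2_inner (e i) ?D)" by (intro L2_inner_sum D eL) (use K in auto)
    also have "\<dots> = 0" using K(2) e0 by (intro sum.neutral) (auto simp: L2_inner_commute)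
    finally have "L2_inner ?D h = L2_inner ?D (\<lambda>x. h x - ?g x)"
      using L2_inner_diff[OF hL gL D] L2_inner_commute[of ?D] by simp
    also have "\<bar>\<dots>\<bar> \<le> L2_norm ?D * L2_norm (\<lambda>x. h x - ?g x)" by (intro L2_Cauchy_Schwarz D L2_diff hL gL)
    also have "\<dots> \<le> L2_norm ?D * \<epsilon>" using lt L2_norm_nonneg by (intro mult_left_mono) auto
    finally show ?thesis .
  qed
  note b = this
  show ?thesis
  proof (rule ccontr)
    assume n: "L2_inner ?D h \<noteq> 0"
    let ?N = "L2_norm ?D"
    have N: "?N \<ge> 0" by (rule L2_norm_nonneg)
    have "\<bar>L2_inner ?D h\<bar> \<le> ?N * (\<bar>L2_inner ?D h\<bar> / (2 * (?N + 1)))" using n N by (intro b) auto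
    also have "\<dots> < \<bar>L2_inner ?D h\<bar>" using n N by (simp add: field_simps add_pos_nonneg)
    finally show False by simp
  qed
qed

text \<open>The finite expansion shows that the description under \<open>SOME\<close> in
  \<open>L2_proj\<close> can be met. Any other function meeting it differs from the expansion by an
  element of \<open>S\<close> that is orthogonal to \<open>S\<close>, hence by a function that
  vanishes almost everywhere.\<close>

lemma L2_proj_AE:
  assumes cl: "L2_closed_subspace S" and onb: "L2_onb I e S" and u: "u \<in> L2" and J: "finite J" "J \<subseteq> I"
    and z: "\<And>i. i \<in> I - J \<Longrightarrow> L2_inner u (e i) = 0"
  shows "AE x in lborel. L2_proj S u x = ortho_part J e u x" and "L2_proj S u \<in> S" and "ortho_part J e u \<in> S"
proof -
  let ?P = "ortho_part J e u" and ?Q = "L2_proj S u"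
  have SL: "S \<subseteq> L2" using cl by (auto simp: L2_closed_subspace_def)
  show P: "?P \<in> S" unfolding ortho_part_def
    by (intro subspace_sum cl) (use onb J in \<open>auto simp: L2_onb_def\<close>)
  have P': "\<forall>h\<in>S. L2_inner (\<lambda>x. u x - ?P x) h = 0" using onb_ortho_part[OF onb SL u J z] by blast
  have "?Q \<in> S \<and> (\<forall>h\<in>S. L2_inner (\<lambda>x. u x - ?Q x) h = 0)"
    unfolding L2_proj_def by (rule someI[of _ ?P]) (use P P' in blast)
  then have Q: "?Q \<in> S" and Q': "\<forall>h\<in>S. L2_inner (\<lambda>x. u x - ?Q x) h = 0" by auto
  show "?Q \<in> S" by (rule Q)
  have L: "?P \<in> L2" "?Q \<in> L2" using P Q SL by auto
  from subspace_lincomb[OF cl Q P, of 1 "-1"] have D: "(\<lambda>x. ?Q x - ?P x) \<in> S" by simp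
  then have DL: "(\<lambda>x. ?Q x - ?P x) \<in> L2" using SL by auto
  have "L2_inner (\<lambda>x. u x - ?P x) (\<lambda>x. ?Q x - ?P x) - L2_inner (\<lambda>x. u x - ?Q x) (\<lambda>x. ?Q x - ?P x)
     = L2_inner (\<lambda>x. (u x - ?P x) - (u x - ?Q x)) (\<lambda>x. ?Q x - ?P x)"
    by (intro L2_inner_diff[symmetric] L2_diff u L)
  then have "L2_inner (\<lambda>x. ?Q x - ?P x) (\<lambda>x. ?Q x - ?P x) = 0" using P' Q' D by simp
  then have "AE x in lborel. ?Q x - ?P x = 0" using L2_inner_self_eq_0[OF DL] by simp
  then show "AE x in lborel. ?Q x = ?P x" by simp
qed


section \<open>Projections of a multiresolution analysis\<close>

lemma L2_affine:
  fixes f :: "real ^ 'd \<Rightarrow> real"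
  assumes "f \<in> L2" "c \<noteq> 0" shows "(\<lambda>x. f (c *\<^sub>R x)) \<in> L2"
proof -
  have m: "(\<lambda>x. f (c *\<^sub>R x)) \<in> borel_measurable borel"
    using L2D(1)[OF assms(1)] by measurable
  let ?g = "\<lambda>x. (f x)\<^sup>2"
  have "integrable (density (distr lborel borel (\<lambda>x. 0 + c *\<^sub>R x)) (\<lambda>_. \<bar>c\<bar>^DIM(real^'d))) ?g"
    using L2D(2)[OF assms(1)] lborel_affine[OF assms(2), of "0 :: real ^ 'd"] by simp
  then have "integrable (distr lborel borel (\<lambda>x. 0 + c *\<^sub>R x)) (\<lambda>x. \<bar>c\<bar>^DIM(real^'d) *\<^sub>R ?g x)"
    using L2D(1)[OF assms(1)] by (subst (asm) integrable_density) auto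
  then have "integrable lborel (\<lambda>x. \<bar>c\<bar>^DIM(real^'d) *\<^sub>R ?g (0 + c *\<^sub>R x))"
    using L2D(1)[OF assms(1)] by (subst (asm) integrable_distr_eq) auto
  then have "integrable lborel (\<lambda>x. (f (c *\<^sub>R x))\<^sup>2)"
    using assms(2) by simp
  then show ?thesis using m by (simp add: L2_def)
qed

lemma L2_inner_affine:
  fixes f g :: "real ^ 'd \<Rightarrow> real"
  assumes "f \<in> L2" "g \<in> L2" "c \<noteq> 0"
  shows "L2_inner f g = \<bar>c\<bar> ^ CARD('d) * L2_inner (\<lambda>x. f (c *\<^sub>R x)) (\<lambda>x. g (c *\<^sub>R x))"
proof -
  have "(\<lambda>x. f x * g x) \<in> borel_measurable borel"
    using assms L2D(1) by (auto intro!: borel_measurable_times)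
  from integral_affine[OF this assms(3), of 0] show ?thesis by (simp add: L2_inner_def)
qed

locale wavelets =
  fixes r :: nat and R :: real and \<phi> :: "real ^ 'd \<Rightarrow> real" and \<psi> :: "nat \<Rightarrow> real ^ 'd \<Rightarrow> real"
    and V :: "int \<Rightarrow> (real ^ 'd \<Rightarrow> real) set"
  assumes wf: "wavelet_family r R \<phi> \<psi> V" and R_pos: "R > 0" and r_pos: "r \<ge> 1"
begin

text \<open>The scaling function gets the index \<open>0\<close>, so that the spaces \<open>V n\<close> and \<open>detail_space V n\<close>
  are treated uniformly, with \<open>I = {0}\<close> and \<open>I = IW\<close> respectively.\<close>

definition w :: "nat \<Rightarrow> real ^ 'd \<Rightarrow> real" where "w i = (if i = 0 then \<phi> else \<psi> i)"

definition IW :: "nat set" where "IW = {1..<2 ^ CARD('d)}"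

definition wl :: "nat \<Rightarrow> nat \<Rightarrow> real ^ 'd \<Rightarrow> real ^ 'd \<Rightarrow> real" where
  "wl i n x = dilate n x (w i)"

definition good :: "nat set \<Rightarrow> bool" where "good I \<longleftrightarrow> I = {0} \<or> I = IW"

definition Sp :: "nat set \<Rightarrow> nat \<Rightarrow> (real ^ 'd \<Rightarrow> real) set" where
  "Sp I n = (if I = {0} then V (int n) else detail_space V (int n))"

lemma finite_IW [simp]: "finite IW" by (simp add: IW_def)

lemma zero_notin_IW [simp]: "0 \<notin> IW" by (simp add: IW_def)

lemma IW_ne: "IW \<noteq> {0}" using zero_notin_IW by blast

lemma good_simps [simp]: "good {0}" "good IW" by (auto simp: good_def)

lemma good_finite: "good I \<Longrightarrow> finite I" by (auto simp: good_def)

lemma good_sub: "good I \<Longrightarrow> i \<in> I \<Longrightarrow> i \<in> insert 0 IW" by (auto simp: good_def)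

lemma Sp_simps [simp]: "Sp {0} n = V (int n)" "Sp IW n = detail_space V (int n)"
  using IW_ne by (auto simp: Sp_def)

lemma mra: "multiresolution V \<phi>" using wf by (simp add: wavelet_family_def)

lemma V_closed: "L2_closed_subspace (V n)" using mra by (simp add: multiresolution_def)

lemma V_L2: "V n \<subseteq> L2" using V_closed by (auto simp: L2_closed_subspace_def)

lemma V_Suc: "V n \<subseteq> V (n + 1)" using mra by (simp add: multiresolution_def)

lemma V_mono: "m \<le> n \<Longrightarrow> V (int m) \<subseteq> V (int n)"
proof (induction n)
  case (Suc n)
  then show ?case using V_Suc[of "int n"] by (cases "m = Suc n") (auto simp: add.commute)
qed simp

lemma V_scale: "f \<in> L2 \<Longrightarrow> f \<in> V n \<longleftrightarrow> (\<lambda>x. f ((2 powi (- n)) *\<^sub>R x)) \<in> V 0"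
  using mra by (simp add: multiresolution_def)

lemma V_scale_nat: "f \<in> L2 \<Longrightarrow> f \<in> V (int n) \<longleftrightarrow> (\<lambda>x. f ((1 / 2 ^ n) *\<^sub>R x)) \<in> V 0"
  using V_scale[of f "int n"] by (simp add: power_int_minus divide_inverse)

lemma w_Crc: "i \<in> insert 0 IW \<Longrightarrow> w i \<in> Crc r UNIV"
  using wf by (auto simp: wavelet_family_def w_def IW_def)

lemma w_supp: assumes "i \<in> insert 0 IW" "w i z \<noteq> 0" shows "norm z < R"
proof -
  have "supp (w i) \<subseteq> ball 0 R" using wf assms(1) by (auto simp: wavelet_family_def w_def IW_def)
  moreover have "z \<in> supp (w i)" using assms(2) notin_supp_eq_0 by blast
  ultimately show ?thesis by auto
qed

lemma w_cc: "i \<in> insert 0 IW \<Longrightarrow> cc (w i)" using w_Crc Crc_cc by blast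

lemma wl_supp: assumes "i \<in> insert 0 IW" "wl i n x z \<noteq> 0" shows "dist x z < R / 2 ^ n"
proof -
  have "w i (2 ^ n *\<^sub>R (z - x)) \<noteq> 0" using assms(2) by (simp add: wl_def dilate_def)
  then have "norm (2 ^ n *\<^sub>R (z - x)) < R" by (rule w_supp[OF assms(1)])
  then have "2 ^ n * norm (z - x) < R" by simp
  then show ?thesis by (simp add: dist_norm norm_minus_commute pos_less_divide_eq mult.commute)
qed

lemma wl_cc: "i \<in> insert 0 IW \<Longrightarrow> cc (wl i n x)"
  using cc_affine[OF w_cc, of i "2 ^ n" "- (2 ^ n *\<^sub>R x)"]
  by (simp add: wl_def dilate_def scaleR_diff_right)

lemma wl_L2: "i \<in> insert 0 IW \<Longrightarrow> wl i n x \<in> L2" by (intro cc_L2 wl_cc)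

lemma wl_Ck: "i \<in> insert 0 IW \<Longrightarrow> Ck r (wl i n x)"
  unfolding wl_def dilate_def by (intro Ck_affine Crc_Ck[OF w_Crc])

lemma wl_supp_cball: assumes "i \<in> insert 0 IW" shows "supp (wl i n x) \<subseteq> cball x (R / 2 ^ n)"
  by (rule supp_subset) (use wl_supp[OF assms, of n x] in force)+

lemma wl_Crc: "i \<in> insert 0 IW \<Longrightarrow> cball x (R / 2 ^ n) \<subseteq> U \<Longrightarrow> wl i n x \<in> Crc r U"
  using wl_supp_cball[of i n x] wl_Ck[of i n x] cc_compact_supp[OF wl_cc, of i n x] by (auto simp: Crc_def)

lemma detail_closed: "L2_closed_subspace (detail_space V n)"
  unfolding L2_closed_subspace_def
proof (intro conjI ballI allI impI)
  have sub: "detail_space V n \<subseteq> V (n + 1)" by (auto simp: detail_space_def)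
  show 1: "detail_space V n \<subseteq> L2" using sub V_L2 by blast
  show "(\<lambda>x. 0) \<in> detail_space V n"
    using V_closed[of "n + 1"] by (auto simp: detail_space_def L2_closed_subspace_def L2_inner_def)
  show "(\<lambda>x. a * f x + b * g x) \<in> detail_space V n" if "f \<in> detail_space V n" "g \<in> detail_space V n" for f g a b
    using that 1 V_L2[of n] subspace_lincomb[OF V_closed, of f "n + 1" g a b]
    by (auto simp: detail_space_def L2_inner_lincomb subset_iff)
  fix f assume f: "f \<in> L2" and d: "L2_dense_in (detail_space V n) {f}"
  have "L2_dense_in (V (n + 1)) {f}" using d sub unfolding L2_dense_in_def by blast
  then have fV: "f \<in> V (n + 1)" using V_closed[of "n + 1"] f by (auto simp: L2_closed_subspace_def)
  have "L2_inner f g = 0" if g: "g \<in> V n" for g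
  proof (rule ccontr)
    assume n0: "L2_inner f g \<noteq> 0"
    have gL: "g \<in> L2" using g V_L2 by blast
    let ?N = "L2_norm g"
    have N: "?N \<ge> 0" by (rule L2_norm_nonneg)
    have "\<bar>L2_inner f g\<bar> / (?N + 1) > 0" using n0 N by simp
    then have "\<exists>h\<in>detail_space V n. L2_norm (\<lambda>x. f x - h x) < \<bar>L2_inner f g\<bar> / (?N + 1)"
      using d by (simp add: L2_dense_in_def)
    then obtain h where h: "h \<in> detail_space V n" "L2_norm (\<lambda>x. f x - h x) < \<bar>L2_inner f g\<bar> / (?N + 1)" by (rule bexE)
    have hL: "h \<in> L2" using h 1 by blast
    have "L2_inner f g = L2_inner (\<lambda>x. f x - h x) g"
      using L2_inner_diff[OF f hL gL] h(1) g by (simp add: detail_space_def)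
    also have "\<bar>\<dots>\<bar> \<le> L2_norm (\<lambda>x. f x - h x) * ?N" by (intro L2_Cauchy_Schwarz L2_diff f hL gL)
    also have "\<dots> \<le> \<bar>L2_inner f g\<bar> / (?N + 1) * ?N" using h(2) N by (intro mult_right_mono) auto
    also have "\<dots> < \<bar>L2_inner f g\<bar>" using n0 N by (simp add: field_simps)
    finally show False by simp
  qed
  then show "f \<in> detail_space V n" using fV by (simp add: detail_space_def)
qed

lemma Sp_closed: "L2_closed_subspace (Sp I n)"
  by (simp add: Sp_def V_closed detail_closed)

lemma Sp_L2: "Sp I n \<subseteq> L2"
  using Sp_closed by (auto simp: L2_closed_subspace_def)

lemma scale_L2: "f \<in> L2 \<Longrightarrow> (\<lambda>x. f ((1 / 2 ^ n) *\<^sub>R x)) \<in> L2" "f \<in> L2 \<Longrightarrow> (\<lambda>x. f (2 ^ n *\<^sub>R x)) \<in> L2"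
  by (rule L2_affine; simp)+

text \<open>The axioms state the scaling relation for the spaces \<open>V\<close> only. It carries
  over to the detail spaces because a dilation multiplies all inner products by one nonzero constant
  and so preserves orthogonality.\<close>

lemma Sp_scale:
  assumes f: "f \<in> L2"
  shows "f \<in> Sp I n \<longleftrightarrow> (\<lambda>x. f ((1 / 2 ^ n) *\<^sub>R x)) \<in> Sp I 0"
proof (cases "I = {0}")
  case True then show ?thesis using V_scale_nat[OF f] by simp
next
  case False
  let ?f = "\<lambda>x. f ((1 / 2 ^ n) *\<^sub>R x)"
  have 1: "f \<in> V (int n + 1) \<longleftrightarrow> ?f \<in> V 1"
    using V_scale_nat[OF f, of "Suc n"] V_scale_nat[OF scale_L2(1)[OF f, of n], of 1] by (simp add: add.commute mult.commute)
  have 2: "(\<forall>g\<in>V (int n). L2_inner f g = 0) \<longleftrightarrow> (\<forall>g\<in>V 0. L2_inner ?f g = 0)"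
  proof (intro iffI ballI)
    fix g assume h: "\<forall>g\<in>V (int n). L2_inner f g = 0" and g: "g \<in> V 0"
    then have gL: "g \<in> L2" using V_L2 by blast
    have "(\<lambda>x. g (2 ^ n *\<^sub>R x)) \<in> V (int n)" using g by (subst V_scale_nat[OF scale_L2(2)[OF gL]]) simp
    then have "L2_inner f (\<lambda>x. g (2 ^ n *\<^sub>R x)) = 0" using h by blast
    then show "L2_inner ?f g = 0" using L2_inner_affine[OF scale_L2(1)[OF f, of n] gL, of "2 ^ n"] by simp
  next
    fix g assume h: "\<forall>g\<in>V 0. L2_inner ?f g = 0" and g: "g \<in> V (int n)"
    then have gL: "g \<in> L2" using V_L2 by blast
    have "(\<lambda>x. g ((1 / 2 ^ n) *\<^sub>R x)) \<in> V 0" using g V_scale_nat[OF gL] by simp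
    then have "L2_inner ?f (\<lambda>x. g ((1 / 2 ^ n) *\<^sub>R x)) = 0" using h by blast
    then show "L2_inner f g = 0" using L2_inner_affine[OF f gL, of "1 / 2 ^ n"] by simp
  qed
  show ?thesis using False 1 2 by (simp add: Sp_def detail_space_def)
qed

section \<open>Orthonormal wavelet bases and projections at every scale\<close>

definition el :: "nat \<Rightarrow> nat \<times> (real ^ 'd) \<Rightarrow> real ^ 'd \<Rightarrow> real" where
  "el n = (\<lambda>(i, x) z. sqrt (2 ^ (CARD('d) * n)) * wl i n x z)"

lemma onb_0: assumes "good I" shows "L2_onb (I \<times> lattice 0) (el 0) (Sp I 0)"
proof -
  have e: "el 0 = (\<lambda>(i, k) x. w i (x - k))" by (auto simp: el_def wl_def dilate_def fun_eq_iff)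
  show ?thesis
  proof (cases "I = {0}")
    case True
    have on: "L2_onb (lattice 0) (\<lambda>k x. \<phi> (x - k)) (V 0)" using mra by (simp add: multiresolution_def)
    have "L2_onb ({0} \<times> lattice 0) (\<lambda>(i, k) x. w i (x - k)) (V 0)"
      unfolding L2_onb_def
    proof (intro conjI)
      show "\<forall>i\<in>{0} \<times> lattice 0. (case i of (i, k) \<Rightarrow> \<lambda>x. w i (x - k)) \<in> V 0"
        using on by (auto simp: L2_onb_def w_def)
      show "\<forall>i\<in>{0} \<times> lattice 0. \<forall>j\<in>{0} \<times> lattice 0. L2_inner (case i of (i, k) \<Rightarrow> \<lambda>x. w i (x - k))
          (case j of (i, k) \<Rightarrow> \<lambda>x. w i (x - k)) = (if i = j then 1 else 0)"
        using on by (auto simp: L2_onb_def w_def)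
      have "{\<lambda>x. \<Sum>i\<in>J. c i * \<phi> (x - i) |J c. finite J \<and> J \<subseteq> lattice 0} \<subseteq>
        {\<lambda>x. \<Sum>i\<in>J. c i * (case i of (i, k) \<Rightarrow> \<lambda>x. w i (x - k)) x |J c. finite J \<and> J \<subseteq> {0} \<times> lattice 0}"
      proof safe
        fix J :: "(real^'d) set" and c assume J: "finite J" "J \<subseteq> lattice 0"
        let ?J = "(\<lambda>x. (0::nat, x)) ` J"
        have "(\<Sum>i\<in>J. c i * \<phi> (x - i)) = (\<Sum>i\<in>?J. c (snd i) * (case i of (i, k) \<Rightarrow> \<lambda>x. w i (x - k)) x)" for x
          by (subst sum.reindex) (auto simp: inj_on_def w_def)
        then show "\<exists>K c'. (\<lambda>x. \<Sum>i\<in>J. c i * \<phi> (x - i)) = (\<lambda>x. \<Sum>i\<in>K. c' i * (case i of (i, k) \<Rightarrow> \<lambda>x. w i (x - k)) x)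
            \<and> finite K \<and> K \<subseteq> {0} \<times> lattice 0"
          using J by (intro exI[of _ ?J] exI[of _ "\<lambda>i. c (snd i)"]) auto
      qed
      then show "L2_dense_in {\<lambda>x. \<Sum>i\<in>J. c i * (case i of (i, k) \<Rightarrow> \<lambda>x. w i (x - k)) x |J c. finite J \<and> J \<subseteq> {0} \<times> lattice 0} (V 0)"
        using on unfolding L2_onb_def L2_dense_in_def by (meson subsetD)
    qed
    then show ?thesis using True e by simp
  next
    case False
    then have I: "I = IW" using assms by (simp add: good_def)
    have on: "L2_onb (IW \<times> lattice 0) (\<lambda>(i, k) x. \<psi> i (x - k)) (detail_space V 0)"
      using wf by (simp add: wavelet_family_def IW_def)
    have eq: "el 0 p = (\<lambda>(i, k) x. \<psi> i (x - k)) p" if "p \<in> IW \<times> lattice 0" for p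
      using that zero_notin_IW by (auto simp: e w_def)
    have "L2_onb (IW \<times> lattice 0) (el 0) (detail_space V 0)"
      unfolding L2_onb_def
    proof (intro conjI)
      have "{\<lambda>x. \<Sum>i\<in>J. c i * (\<lambda>(i, k) x. \<psi> i (x - k)) i x |J c. finite J \<and> J \<subseteq> IW \<times> lattice 0} \<subseteq>
        {\<lambda>x. \<Sum>i\<in>J. c i * el 0 i x |J c. finite J \<and> J \<subseteq> IW \<times> lattice 0}"
      proof safe
        fix J :: "(nat \<times> (real^'d)) set" and c assume J: "finite J" "J \<subseteq> IW \<times> lattice 0"
        have "(\<lambda>x. \<Sum>i\<in>J. c i * (\<lambda>(i, k) x. \<psi> i (x - k)) i x) = (\<lambda>x. \<Sum>i\<in>J. c i * el 0 i x)"
          using J(2) by (intro ext sum.cong refl) (auto simp: eq)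
        then show "\<exists>K c'. (\<lambda>x. \<Sum>i\<in>J. c i * (\<lambda>(i, k) x. \<psi> i (x - k)) i x) = (\<lambda>x. \<Sum>i\<in>K. c' i * el 0 i x)
            \<and> finite K \<and> K \<subseteq> IW \<times> lattice 0"
          using J by (intro exI[of _ J] exI[of _ c]) auto
      qed
      then show "L2_dense_in {\<lambda>x. \<Sum>i\<in>J. c i * el 0 i x |J c. finite J \<and> J \<subseteq> IW \<times> lattice 0} (detail_space V 0)"
        using on unfolding L2_onb_def L2_dense_in_def by (meson subsetD)
    qed (use on in \<open>simp_all add: L2_onb_def eq\<close>)
    then show ?thesis using I by simp
  qed
qed

lemma el_scale: "el n (i, x) = (\<lambda>z. sqrt (2 ^ (CARD('d) * n)) * el 0 (i, 2 ^ n *\<^sub>R x) (2 ^ n *\<^sub>R z))"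
  by (auto simp: el_def wl_def dilate_def scaleR_diff_right)

text \<open>The basis of scale 0 is transported by the dilation with factor \<open>2 ^ n\<close>;
  the square root in \<open>el\<close> compensates the Jacobian. Since \<open>wl\<close> itself
  carries no normalisation, its squared norm is \<open>1 / 2 ^ (CARD('d) * n)\<close>.\<close>

lemma onb:
  assumes "good I" shows "L2_onb (I \<times> lattice n) (el n) (Sp I n)"
proof -
  note on = onb_0[OF assms]
  let ?c = "sqrt (2 ^ (CARD('d) * n))"
  have c: "?c > 0" "?c * ?c = 2 ^ (CARD('d) * n)" by auto
  have on1: "\<forall>p\<in>I \<times> lattice 0. el 0 p \<in> Sp I 0"
    and on2: "\<forall>p\<in>I \<times> lattice 0. \<forall>q\<in>I \<times> lattice 0. L2_inner (el 0 p) (el 0 q) = (if p = q then 1 else 0)"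
    using on unfolding L2_onb_def by blast+
  have eL: "el 0 p \<in> L2" if "p \<in> I \<times> lattice 0" for p
    using bspec[OF on1 that] Sp_L2 by blast
  have lat: "2 ^ n *\<^sub>R x \<in> lattice 0" if "x \<in> lattice n" for x :: "real ^ 'd" using that lattice_scale' by blast
  show ?thesis unfolding L2_onb_def
  proof (intro conjI ballI)
    fix p :: "nat \<times> (real ^ 'd)"
    assume p: "p \<in> I \<times> lattice n"
    obtain i x where px: "p = (i, x)" by force
    have e0': "(i, 2 ^ n *\<^sub>R x) \<in> I \<times> lattice 0" using p px lat by simp
    then have e0: "el 0 (i, 2 ^ n *\<^sub>R x) \<in> Sp I 0" using on1 by blast
    have L: "(\<lambda>z. el 0 (i, 2 ^ n *\<^sub>R x) (2 ^ n *\<^sub>R z)) \<in> L2"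
      by (rule scale_L2(2)[OF eL[OF e0']])
    have "(\<lambda>z. el 0 (i, 2 ^ n *\<^sub>R x) (2 ^ n *\<^sub>R z)) \<in> Sp I n"
      by (subst Sp_scale[OF L]) (use e0 in simp)
    from subspace_lincomb[OF Sp_closed this this, of ?c 0] show "el n p \<in> Sp I n" by (simp add: px el_scale[of n])
    fix q :: "nat \<times> (real ^ 'd)" assume q: "q \<in> I \<times> lattice n"
    obtain j y where qy: "q = (j, y)" by force
    have f0': "(j, 2 ^ n *\<^sub>R y) \<in> I \<times> lattice 0" using q qy lat by simp
    then have f0: "el 0 (j, 2 ^ n *\<^sub>R y) \<in> Sp I 0" using on1 by blast
    have "L2_inner (el n p) (el n q) = 2 ^ (CARD('d) * n) * L2_inner (\<lambda>z. el 0 (i, 2 ^ n *\<^sub>R x) (2 ^ n *\<^sub>R z)) (\<lambda>z. el 0 (j, 2 ^ n *\<^sub>R y) (2 ^ n *\<^sub>R z))"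
      unfolding px qy el_scale[of n] L2_inner_cmult L2_inner_commute[of _ "\<lambda>z. ?c * _ z"] using c(2)
      by (simp only: mult.assoc[symmetric] L2_inner_commute[of "\<lambda>z. el 0 (j, 2 ^ n *\<^sub>R y) (2 ^ n *\<^sub>R z)"])
    also have "\<dots> = L2_inner (el 0 (i, 2 ^ n *\<^sub>R x)) (el 0 (j, 2 ^ n *\<^sub>R y))"
      using L2_inner_affine[OF eL[OF e0'] eL[OF f0'], of "2 ^ n"]
      by (simp add: power_mult[symmetric] mult.commute[of n])
    also have "\<dots> = (if p = q then 1 else 0)"
      using bspec[OF bspec[OF on2 e0'] f0'] unfolding px qy by simp
    finally show "L2_inner (el n p) (el n q) = (if p = q then 1 else 0)" .
  next
    show "L2_dense_in {\<lambda>x. \<Sum>i\<in>J. c i * el n i x |J c. finite J \<and> J \<subseteq> I \<times> lattice n} (Sp I n)"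
      unfolding L2_dense_in_def
    proof (intro ballI allI impI)
      fix f and \<epsilon> :: real assume f: "f \<in> Sp I n" and \<epsilon>: "\<epsilon> > 0"
      have fL: "f \<in> L2" using f Sp_L2 by auto
      let ?f = "\<lambda>x. f ((1 / 2 ^ n) *\<^sub>R x)"
      have "?f \<in> Sp I 0" using f Sp_scale[OF fL] by blast
      moreover have "L2_dense_in {\<lambda>x. \<Sum>i\<in>J. c i * el 0 i x |J c. finite J \<and> J \<subseteq> I \<times> lattice 0} (Sp I 0)"
        using on by (simp add: L2_onb_def)
      ultimately have "\<exists>g\<in>{\<lambda>x. \<Sum>i\<in>J. c i * el 0 i x |J c. finite J \<and> J \<subseteq> I \<times> lattice 0}.
          L2_norm (\<lambda>x. ?f x - g x) < \<epsilon>" using \<epsilon> by (simp add: L2_dense_in_def)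
      then obtain J d where J: "finite J" "J \<subseteq> I \<times> lattice 0"
        and lt: "L2_norm (\<lambda>x. ?f x - (\<Sum>i\<in>J. d i * el 0 i x)) < \<epsilon>" by auto
      let ?g = "\<lambda>x. \<Sum>i\<in>J. d i * el 0 i x"
      have gL: "?g \<in> L2" by (intro L2_sum eL) (use J in auto)
      have hL: "(\<lambda>x. ?f x - ?g x) \<in> L2" by (intro L2_diff gL scale_L2 fL)
      let ?m = "\<lambda>(i, x). (i, (1 / 2 ^ n) *\<^sub>R x)"
      let ?J = "?m ` J"
      let ?d = "\<lambda>(i, x). d (i, 2 ^ n *\<^sub>R x) / ?c"
      have gs: "?g (2 ^ n *\<^sub>R z) = (\<Sum>p\<in>?J. ?d p * el n p z)" for z
      proof -
        have "(\<Sum>p\<in>?J. ?d p * el n p z) = (\<Sum>p\<in>J. ?d (?m p) * el n (?m p) z)"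
          by (subst sum.reindex) (auto simp: inj_on_def)
        also have "\<dots> = ?g (2 ^ n *\<^sub>R z)"
          using c(1) by (intro sum.cong) (auto simp: el_scale[of n])
        finally show ?thesis by simp
      qed
      \<comment> \<open>Passing from scale 0 to scale \<open>n\<close> divides the squared norm of
        the error by \<open>2 ^ (n * CARD('d))\<close>, so an approximation found at scale 0 does
        not deteriorate.\<close>
      have "(L2_norm (\<lambda>z. f z - ?g (2 ^ n *\<^sub>R z)))\<^sup>2 \<le> (L2_norm (\<lambda>x. ?f x - ?g x))\<^sup>2"
      proof -
        have "L2_inner (\<lambda>x. ?f x - ?g x) (\<lambda>x. ?f x - ?g x) =
           \<bar>2 ^ n\<bar> ^ CARD('d) * L2_inner (\<lambda>z. f z - ?g (2 ^ n *\<^sub>R z)) (\<lambda>z. f z - ?g (2 ^ n *\<^sub>R z))"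
          by (subst L2_inner_affine[OF hL hL, of "2 ^ n"]) auto
        also have "\<dots> \<ge> 1 * L2_inner (\<lambda>z. f z - ?g (2 ^ n *\<^sub>R z)) (\<lambda>z. f z - ?g (2 ^ n *\<^sub>R z))"
          by (intro mult_right_mono L2_inner_nonneg) (simp add: one_le_power)
        finally show ?thesis by (simp add: L2_norm_sq)
      qed
      then have "L2_norm (\<lambda>z. f z - ?g (2 ^ n *\<^sub>R z)) \<le> L2_norm (\<lambda>x. ?f x - ?g x)"
        by (rule power2_le_imp_le[OF _ L2_norm_nonneg])
      then have "L2_norm (\<lambda>z. f z - (\<Sum>p\<in>?J. ?d p * el n p z)) < \<epsilon>" using lt gs by simp
      moreover have "finite ?J" "?J \<subseteq> I \<times> lattice n" using J lattice_scale by (auto simp: subset_iff)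
      ultimately show "\<exists>g\<in>{\<lambda>x. \<Sum>i\<in>J. c i * el n i x |J c. finite J \<and> J \<subseteq> I \<times> lattice n}. L2_norm (\<lambda>x. f x - g x) < \<epsilon>"
        by (intro bexI[of _ "\<lambda>z. \<Sum>p\<in>?J. ?d p * el n p z"] CollectI exI[of _ ?J] exI[of _ ?d] conjI refl)
    qed
  qed
qed

lemma wl_inner:
  assumes "good I" "i \<in> I" "j \<in> I" "x \<in> lattice n" "y \<in> lattice n"
  shows "L2_inner (wl i n x) (wl j n y) = (if i = j \<and> x = y then 1 / 2 ^ (CARD('d) * n) else 0)"
proof -
  have "L2_inner (el n (i, x)) (el n (j, y)) = (if (i, x) = (j, y) then 1 else 0)"
    using onb[OF assms(1), of n] assms by (auto simp: L2_onb_def)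
  moreover have "L2_inner (el n (i, x)) (el n (j, y)) = 2 ^ (CARD('d) * n) * L2_inner (wl i n x) (wl j n y)"
    unfolding el_def prod.case L2_inner_cmult L2_inner_commute[of _ "\<lambda>z. sqrt (2 ^ (CARD('d) * n)) * _ z"]
    by (simp add: L2_inner_commute)
  ultimately show ?thesis by (auto simp: field_simps split: if_splits)
qed

text \<open>The orthogonal projection as a function with a value at every point. The sum at
  \<open>z\<close> runs over the lattice points whose wavelet can be nonzero at \<open>z\<close>, so
  it is finite for every \<open>g\<close>; the power of 2 makes up for the missing normalisation of
  \<open>wl\<close>.\<close>

definition PP :: "nat set \<Rightarrow> nat \<Rightarrow> (real ^ 'd \<Rightarrow> real) \<Rightarrow> real ^ 'd \<Rightarrow> real" where
  "PP I n g z = (\<Sum>i\<in>I. \<Sum>x\<in>lattice n \<inter> cball z (R / 2 ^ n). 2 ^ (CARD('d) * n) * L2_inner g (wl i n x) * wl i n x z)"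

lemma finite_near [simp]: "finite (lattice n \<inter> cball (z :: real ^ 'd) (R / 2 ^ n))"
  using lattice_ball_card(1)[of "R / 2 ^ n" n z] R_pos by simp

text \<open>Exchanges the index set that moves with \<open>z\<close> for a fixed one. Either set
  contains all lattice points with a nonzero term at \<open>z\<close>, the first by the support of
  the wavelets and the second by assumption.\<close>

lemma local_sum:
  assumes "i \<in> insert 0 IW" "finite F" "F \<subseteq> lattice n"
    "\<And>x. x \<in> lattice n \<Longrightarrow> wl i n x z \<noteq> 0 \<Longrightarrow> c x \<noteq> 0 \<Longrightarrow> x \<in> F"
  shows "(\<Sum>x\<in>lattice n \<inter> cball z (R / 2 ^ n). c x * wl i n x z) = (\<Sum>x\<in>F. c x * wl i n x z)"
proof -
  let ?N = "lattice n \<inter> cball z (R / 2 ^ n)"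
  have "(\<Sum>x\<in>?N. c x * wl i n x z) = (\<Sum>x\<in>?N \<inter> F. c x * wl i n x z)"
    by (rule sum.mono_neutral_right) (use assms(4) in auto)
  also have "\<dots> = (\<Sum>x\<in>F. c x * wl i n x z)"
  proof (rule sum.mono_neutral_left)
    show "\<forall>x\<in>F - ?N \<inter> F. c x * wl i n x z = 0"
      using assms(3) wl_supp[OF assms(1), of n _ z] by (auto simp: dist_commute) (metis less_imp_le)
  qed (use assms in auto)
  finally show ?thesis .
qed

lemma inner_eq_0:
  assumes "i \<in> insert 0 IW" "\<And>z. g z \<noteq> 0 \<Longrightarrow> dist x z < R / 2 ^ n \<Longrightarrow> False"
  shows "L2_inner g (wl i n x) = 0"
proof -
  have "(\<lambda>z. g z * wl i n x z) = (\<lambda>z. 0)" using assms(2) wl_supp[OF assms(1), of n x] by (metis mult_eq_0_iff)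
  then show ?thesis by (simp add: L2_inner_def)
qed

lemma coeff_supp:
  assumes "cc g" obtains F where "finite F" "F \<subseteq> lattice n"
    "\<forall>i\<in>insert 0 IW. \<forall>x\<in>lattice n. L2_inner g (wl i n x) \<noteq> 0 \<longrightarrow> x \<in> F"
proof -
  obtain \<rho> where "0 < \<rho>" and \<rho>: "\<forall>x. \<rho> < norm x \<longrightarrow> g x = 0" using assms by (rule ccE)
  let ?F = "lattice n \<inter> cball (0 :: real ^ 'd) (\<rho> + R)"
  show thesis
  proof (rule that[of ?F])
    show "finite ?F" using lattice_ball_card(1)[of "\<rho> + R" n "0 :: real ^ 'd"] \<open>0 < \<rho>\<close> R_pos by simp
    show "\<forall>i\<in>insert 0 IW. \<forall>x\<in>lattice n. L2_inner g (wl i n x) \<noteq> 0 \<longrightarrow> x \<in> ?F"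
    proof (intro ballI impI)
      fix i x assume i: "i \<in> insert 0 IW" and x: "x \<in> lattice n" and n0: "L2_inner g (wl i n x) \<noteq> 0"
      obtain z where z: "g z \<noteq> 0" "dist x z < R / 2 ^ n" using inner_eq_0[OF i] n0 by meson
      have "norm z \<le> \<rho>" using \<rho> z(1) not_le by blast
      moreover have "R / 2 ^ n \<le> R" using R_pos by (simp add: field_simps one_le_power)
      moreover have "norm x \<le> norm z + dist x z" using norm_triangle_ineq2[of x z] by (simp add: dist_norm)
      ultimately show "x \<in> ?F" using x z by auto
    qed
  qed auto
qed

lemma PP_eq:
  assumes "good I" "finite F" "F \<subseteq> lattice n"
    "\<forall>i\<in>insert 0 IW. \<forall>x\<in>lattice n. L2_inner g (wl i n x) \<noteq> 0 \<longrightarrow> x \<in> F"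
  shows "PP I n g = (\<lambda>z. \<Sum>i\<in>I. \<Sum>x\<in>F. 2 ^ (CARD('d) * n) * L2_inner g (wl i n x) * wl i n x z)"
proof (intro ext, unfold PP_def, rule sum.cong[OF refl])
  fix z i assume "i \<in> I" then have i: "i \<in> insert 0 IW" using good_sub[OF assms(1)] by blast
  show "(\<Sum>x\<in>lattice n \<inter> cball z (R / 2 ^ n). 2 ^ (CARD('d) * n) * L2_inner g (wl i n x) * wl i n x z) =
      (\<Sum>x\<in>F. 2 ^ (CARD('d) * n) * L2_inner g (wl i n x) * wl i n x z)"
    by (rule local_sum[OF i assms(2,3)]) (use assms(4) i in auto)
qed

lemma PP_cong:
  "(\<And>i x. i \<in> I \<Longrightarrow> x \<in> lattice n \<Longrightarrow> L2_inner g (wl i n x) = L2_inner h (wl i n x)) \<Longrightarrow> PP I n g = PP I n h"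
  by (intro ext, unfold PP_def) (intro sum.cong refl; simp)

lemma PP_cc: assumes "good I" "cc g" shows "cc (PP I n g)"
proof -
  obtain F where F: "finite F" "F \<subseteq> lattice n"
    "\<forall>i\<in>insert 0 IW. \<forall>x\<in>lattice n. L2_inner g (wl i n x) \<noteq> 0 \<longrightarrow> x \<in> F" using assms(2) by (rule coeff_supp)
  show ?thesis unfolding PP_eq[OF assms(1) F]
    by (intro cc_sum cc_cmult wl_cc good_sub[OF assms(1)])
qed

lemma PP_ortho:
  assumes "good I" "cc g"
  obtains J where "finite J" "J \<subseteq> I \<times> lattice n"
    "\<forall>p\<in>I \<times> lattice n - J. L2_inner g (el n p) = 0" "PP I n g = ortho_part J (el n) g"
proof -
  obtain F where F: "finite F" "F \<subseteq> lattice n"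
    "\<forall>i\<in>insert 0 IW. \<forall>x\<in>lattice n. L2_inner g (wl i n x) \<noteq> 0 \<longrightarrow> x \<in> F" using assms(2) by (rule coeff_supp)
  have el: "L2_inner g (el n (i, x)) = sqrt (2 ^ (CARD('d) * n)) * L2_inner g (wl i n x)" for i x
    unfolding el_def prod.case L2_inner_commute[of g] L2_inner_cmult ..
  show thesis
  proof (rule that[of "I \<times> F"])
    show "\<forall>p\<in>I \<times> lattice n - I \<times> F. L2_inner g (el n p) = 0"
    proof
      fix p assume p: "p \<in> I \<times> lattice n - I \<times> F"
      obtain i x where px: "p = (i, x)" by force
      have "i \<in> insert 0 IW" using p px good_sub[OF assms(1)] by blast
      then have "L2_inner g (wl i n x) = 0" using F(3) p px by blast
      then show "L2_inner g (el n p) = 0" by (simp add: px el)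
    qed
    show "PP I n g = ortho_part (I \<times> F) (el n) g"
      unfolding PP_eq[OF assms(1) F] ortho_part_def sum.cartesian_product
      by (intro ext sum.cong) (auto simp: el, simp add: el_def)
  qed (use F good_finite[OF assms(1)] in auto)
qed

lemma PP_in: assumes "good I" "cc g" shows "PP I n g \<in> Sp I n"
proof -
  obtain J where J: "finite J" "J \<subseteq> I \<times> lattice n"
    "\<forall>p\<in>I \<times> lattice n - J. L2_inner g (el n p) = 0" "PP I n g = ortho_part J (el n) g"
    by (rule PP_ortho[OF assms])
  show ?thesis unfolding J(4) by (rule L2_proj_AE(3)[OF Sp_closed onb[OF assms(1)] cc_L2[OF assms(2)] J(1,2)])
    (use J in auto)
qed

lemma L2_proj_PP:
  assumes "good I" "cc g"
  shows "AE z in lborel. L2_proj (Sp I n) g z = PP I n g z" "L2_proj (Sp I n) g \<in> borel_measurable borel"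
proof -
  obtain J where J: "finite J" "J \<subseteq> I \<times> lattice n"
    "\<forall>p\<in>I \<times> lattice n - J. L2_inner g (el n p) = 0" "PP I n g = ortho_part J (el n) g"
    by (rule PP_ortho[OF assms])
  show "AE z in lborel. L2_proj (Sp I n) g z = PP I n g z" unfolding J(4)
    by (rule L2_proj_AE(1)[OF Sp_closed onb[OF assms(1)] cc_L2[OF assms(2)] J(1,2)]) (use J in auto)
  have "L2_proj (Sp I n) g \<in> Sp I n"
    by (rule L2_proj_AE(2)[OF Sp_closed onb[OF assms(1)] cc_L2[OF assms(2)] J(1,2)]) (use J in auto)
  then show "L2_proj (Sp I n) g \<in> borel_measurable borel" using Sp_L2 L2D(1) by blast
qed

lemma PP_residual:
  assumes "good I" "cc g" "h \<in> Sp I n"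
  shows "L2_inner (\<lambda>z. g z - PP I n g z) h = 0"
proof -
  obtain J where J: "finite J" "J \<subseteq> I \<times> lattice n"
    "\<forall>p\<in>I \<times> lattice n - J. L2_inner g (el n p) = 0" "PP I n g = ortho_part J (el n) g"
    by (rule PP_ortho[OF assms(1,2)])
  show ?thesis unfolding J(4)
    by (rule onb_ortho_part[OF onb[OF assms(1)] Sp_L2 cc_L2[OF assms(2)] J(1,2) _ assms(3)]) (use J in auto)
qed

text \<open>The difference of \<open>g\<close> and its projection lies in the space and is
  orthogonal to it, so it vanishes almost everywhere, and then everywhere by continuity.\<close>

lemma PP_id:
  assumes "good I" "cc g" "g \<in> Sp I n" shows "PP I n g = g"
proof -
  let ?D = "\<lambda>z. g z - PP I n g z"
  have cD: "cc ?D" by (intro cc_diff PP_cc assms)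
  have "?D \<in> Sp I n" using subspace_lincomb[OF Sp_closed assms(3) PP_in[OF assms(1,2)], of 1 "-1"] by simp
  then have "L2_inner ?D ?D = 0" by (rule PP_residual[OF assms(1,2)])
  then have "AE z in lborel. g z = PP I n g z" using L2_inner_self_eq_0[OF cc_L2[OF cD]] by simp
  then show ?thesis using AE_continuous_eq cc_continuous[OF assms(2)] cc_continuous[OF PP_cc[OF assms(1,2)]] by metis
qed

lemma wl_in: assumes "good I" "i \<in> I" "x \<in> lattice n" shows "wl i n x \<in> Sp I n"
proof -
  have "el n (i, x) \<in> Sp I n" using onb[OF assms(1), of n] assms by (auto simp: L2_onb_def)
  from subspace_lincomb[OF Sp_closed this this, of "1 / sqrt (2 ^ (CARD('d) * n))" 0] show ?thesis
    by (simp add: el_def)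
qed

lemma detail_ortho: "f \<in> detail_space V n \<Longrightarrow> g \<in> V n \<Longrightarrow> L2_inner f g = 0"
  by (auto simp: detail_space_def)

text \<open>The splitting of \<open>V (n + 1)\<close> into \<open>V n\<close> and its complement, as
  an identity of continuous functions. Replacing \<open>g\<close> by its projection
  \<open>?u\<close> changes no coefficient of scale \<open>n\<close>; the part of \<open>?u\<close>
  that \<open>V n\<close> leaves over lies in the detail space and is reproduced by the projection
  there.\<close>

lemma PP_Suc:
  assumes "cc g" shows "PP {0} (Suc n) g z = PP {0} n g z + PP IW n g z"
proof -
  let ?u = "PP {0} (Suc n) g"
  have u: "cc ?u" "?u \<in> V (int n + 1)" using PP_cc[of "{0}" g] PP_in[of "{0}" g "Suc n"] assms
    by (auto simp: add.commute)
  have c: "L2_inner g h = L2_inner ?u h" if "h \<in> V (int n + 1)" for h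
  proof -
    have "h \<in> L2" using that V_L2 by blast
    then show ?thesis
      using PP_residual[of "{0}" g h "Suc n"] assms that
        L2_inner_diff[OF cc_L2[OF assms] cc_L2[OF u(1)], of h] by (simp add: add.commute)
  qed
  have wV: "wl i n x \<in> V (int n + 1)" if "i \<in> insert 0 IW" "x \<in> lattice n" for i x
    using that wl_in[of "{0}" 0 x n] wl_in[of IW i x n] V_Suc[of "int n"] by (auto simp: detail_space_def)
  have eq: "PP I n g = PP I n ?u" if "good I" for I
    by (rule PP_cong) (use c wV good_sub[OF that] in blast)
  let ?v = "\<lambda>z. ?u z - PP {0} n ?u z"
  have Pn: "PP {0} n ?u \<in> V (int n)" using PP_in[of "{0}" ?u n] u(1) by simp
  have cv: "cc ?v" by (intro cc_diff u(1) PP_cc) auto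
  have "?v \<in> V (int n + 1)" using subspace_lincomb[OF V_closed u(2), of "PP {0} n ?u" 1 "-1"] Pn V_Suc by auto
  then have vd: "?v \<in> detail_space V (int n)"
    using PP_residual[of "{0}" ?u _ n] u(1) by (auto simp: detail_space_def)
  have "PP IW n ?v = ?v" by (rule PP_id) (use cv vd in auto)
  moreover have "PP IW n ?v = PP IW n ?u"
  proof -
    have "L2_inner ?v (wl i n x) = L2_inner ?u (wl i n x)" if "i \<in> IW" "x \<in> lattice n" for i x
    proof -
      have "wl i n x \<in> detail_space V (int n)" using wl_in[of IW i x n] that by simp
      then have "L2_inner (PP {0} n ?u) (wl i n x) = 0" using detail_ortho Pn L2_inner_commute by metis
      then show ?thesis using L2_inner_diff[OF cc_L2[OF u(1)] cc_L2[OF PP_cc[of "{0}" ?u n]] wl_L2[of i n x]] that u(1)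
        by simp
    qed
    then show ?thesis by (rule PP_cong)
  qed
  ultimately show ?thesis using eq[of "{0}"] eq[of IW] by (simp add: fun_eq_iff)
qed

lemma PP_telescope:
  assumes "cc g" "k \<le> N" shows "PP {0} N g z = PP {0} k g z + (\<Sum>n\<in>{k..<N}. PP IW n g z)"
  using assms(2)
proof (induction N)
  case (Suc N)
  then show ?case using PP_Suc[OF assms(1), of N z] by (cases "k = Suc N") auto
qed simp

lemma PP_converges:
  assumes "cc g" "\<epsilon> > 0" shows "\<exists>N. \<forall>n\<ge>N. L2_norm (\<lambda>z. g z - PP {0} n g z) < \<epsilon>"
proof -
  have "L2_dense_in (\<Union>n. V n) L2" using mra by (simp add: multiresolution_def)
  then have "\<forall>\<epsilon>>0. \<exists>h\<in>\<Union>n. V n. L2_norm (\<lambda>z. g z - h z) < \<epsilon>"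
    unfolding L2_dense_in_def using cc_L2[OF assms(1)] by (rule bspec)
  then have "\<exists>h\<in>\<Union>n. V n. L2_norm (\<lambda>z. g z - h z) < \<epsilon>" using assms(2) by simp
  then obtain h m where h: "h \<in> V m" "L2_norm (\<lambda>z. g z - h z) < \<epsilon>" by auto
  have "L2_norm (\<lambda>z. g z - PP {0} n g z) < \<epsilon>" if "n \<ge> nat m" for n
  proof -
    let ?P = "PP {0} n g"
    have hn: "h \<in> V (int n)"
    proof -
      \<comment> \<open>Density is stated for all integer indices; a space of negative index is
        contained in \<open>V 0\<close>.\<close>
      have "V m \<subseteq> V (int (nat m))"
      proof (cases "m \<ge> 0")
        case False
        have "V m \<subseteq> V (m + int k)" for k
        proof (induction k)
          case (Suc k)
          then show ?case using V_Suc[of "m + int k"] by (auto simp: algebra_simps)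
        qed simp
        from this[of "nat (- m)"] show ?thesis using False by simp
      qed simp
      then show ?thesis using h(1) V_mono[OF that] by blast
    qed
    have L: "g \<in> L2" "h \<in> L2" "?P \<in> L2" using assms(1) cc_L2 hn V_L2 PP_cc[of "{0}" g n] by auto
    have PV: "?P \<in> V (int n)" using PP_in[of "{0}" g n] assms(1) by simp
    let ?a = "\<lambda>z. g z - ?P z" and ?b = "\<lambda>z. ?P z - h z"
    have "?b \<in> V (int n)" using subspace_lincomb[OF V_closed PV hn, of 1 "-1"] by simp
    then have ab: "L2_inner ?a ?b = 0" using PP_residual[of "{0}" g ?b n] assms(1) by simp
    have abL: "?a \<in> L2" "?b \<in> L2" by (intro L2_diff L)+
    \<comment> \<open>Pythagoras for \<open>g - h\<close>, written as the sum of the orthogonal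
      \<open>?a\<close> and \<open>?b\<close>: the projection is at least as close to
      \<open>g\<close> as \<open>h\<close> is.\<close>
    let ?s = "\<lambda>z. 1 * ?a z + 1 * ?b z"
    have "L2_inner ?s ?s = 1 * L2_inner ?a ?s + 1 * L2_inner ?b ?s"
      by (intro L2_inner_lincomb abL L2_lincomb)
    also have "L2_inner ?a ?s = L2_inner ?a ?a"
      using L2_inner_lincomb[OF abL abL(1), of 1 1] ab L2_inner_commute[of ?b ?a] L2_inner_commute[of ?a ?s] by simp
    also have "L2_inner ?b ?s = L2_inner ?b ?b"
      using L2_inner_lincomb[OF abL abL(2), of 1 1] ab L2_inner_commute[of ?b ?s] by simp
    finally have "L2_inner ?a ?a \<le> L2_inner (\<lambda>z. g z - h z) (\<lambda>z. g z - h z)"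
      using L2_inner_nonneg[of ?b] by simp
    then have "L2_norm ?a \<le> L2_norm (\<lambda>z. g z - h z)" by (simp add: L2_norm_def)
    then show ?thesis using h(2) by linarith
  qed
  then show ?thesis by blast
qed

end


section \<open>Vanishing moments and decay of wavelet coefficients\<close>

lemma cc_Fubini:
  fixes F :: "'a::euclidean_space \<Rightarrow> 'a \<Rightarrow> real"
  assumes "cc (\<lambda>p. F (fst p) (snd p))"
  shows "(LINT x|lborel. LINT z|lborel. F x z) = (LINT z|lborel. LINT x|lborel. F x z)"
proof -
  have "integrable (lborel \<Otimes>\<^sub>M lborel) (case_prod F)"
    using cc_integrable[OF assms] by (simp add: lborel_prod case_prod_beta')
  from lborel_pair.Fubini_integral[OF this] show ?thesis by simp
qed

lemma ddir_equicontinuous: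
  fixes f :: "real ^ 'd \<Rightarrow> real"
  assumes "f \<in> Crc r UNIV" "j \<le> r" "e > 0"
  obtains d where "d > 0" "\<forall>l\<in>BL j. \<forall>x y. dist x y \<le> d \<longrightarrow> \<bar>ddir l f x - ddir l f y\<bar> \<le> e"
proof -
  define d where "d = (\<lambda>l. SOME d. d > 0 \<and> (\<forall>x y. dist x y \<le> d \<longrightarrow> \<bar>ddir l f x - ddir l f y\<bar> \<le> e))"
  have d: "d l > 0 \<and> (\<forall>x y. dist x y \<le> d l \<longrightarrow> \<bar>ddir l f x - ddir l f y\<bar> \<le> e)" if "l \<in> BL j" for l
  proof -
    have "length l \<le> r" using that assms by (auto simp: BL_def)
    then have "cc (ddir l f)" by (rule cc_ddir[OF assms(1)])
    then obtain d where "d > 0" "\<forall>x y. dist x y \<le> d \<longrightarrow> \<bar>ddir l f x - ddir l f y\<bar> \<le> e"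
      using assms(3) by (rule cc_uniformly_continuous)
    then have "\<exists>d>0. \<forall>x y. dist x y \<le> d \<longrightarrow> \<bar>ddir l f x - ddir l f y\<bar> \<le> e"
      by (intro exI[of _ d] conjI)
    then show ?thesis unfolding d_def by (rule someI_ex)
  qed
  define \<delta> where "\<delta> = Min (insert 1 (d ` BL j))"
  have "\<delta> > 0" "\<And>l. l \<in> BL j \<Longrightarrow> \<delta> \<le> d l" unfolding \<delta>_def using d by auto
  then show thesis using d by (intro that[of \<delta>]) force+
qed

lemma small_imp_zero:
  fixes a C :: real assumes "\<And>e. e > 0 \<Longrightarrow> \<bar>a\<bar> \<le> e * C" shows "a = 0"
proof (rule ccontr)
  assume a: "a \<noteq> 0"
  have "\<bar>a\<bar> \<le> \<bar>a\<bar> / (2 * (\<bar>C\<bar> + 1)) * C" using a by (intro assms) auto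
  also have "\<dots> \<le> \<bar>a\<bar> / (2 * (\<bar>C\<bar> + 1)) * (\<bar>C\<bar> + 1)" by (intro mult_left_mono) auto
  also have "\<dots> = \<bar>a\<bar> / 2" by (simp add: field_simps)
  finally show False using a by simp
qed

context wavelets
begin

lemma inner_wl:
  assumes "cc g" "i \<in> insert 0 IW"
  shows "L2_inner g (wl i n x) = (LINT z|lborel. w i z * g (x + (1 / 2 ^ n) *\<^sub>R z)) / 2 ^ (CARD('d) * n)"
proof -
  have "(\<lambda>z. g z * wl i n x z) \<in> borel_measurable borel"
    using cc_measurable[OF assms(1)] cc_measurable[OF wl_cc[OF assms(2)]] by (intro borel_measurable_times) auto
  from integral_affine[OF this, of "1 / 2 ^ n" x]
  have "L2_inner g (wl i n x) = (1 / 2 ^ n) ^ CARD('d) * (LINT z|lborel. g (x + (1 / 2 ^ n) *\<^sub>R z) * w i z)"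
    by (simp add: L2_inner_def wl_def dilate_def)
  moreover have "(1 / 2 ^ n :: real) ^ CARD('d) = 1 / 2 ^ (CARD('d) * n)"
    by (simp add: power_one_over power_mult[symmetric] mult.commute)
  ultimately show ?thesis by (simp add: mult.commute[of "w i _"])
qed

lemma w_norm: "i \<in> insert 0 IW \<Longrightarrow> R < norm z \<Longrightarrow> w i z = 0"
  using w_supp[of i z] by force

lemma phi_V0: "\<phi> \<in> V 0" and phi_cc: "cc \<phi>" and phi_w: "\<phi> = w 0" and phi_wl: "\<phi> = wl 0 0 0"
proof -
  show 1: "\<phi> = w 0" by (simp add: w_def)
  then show 2: "\<phi> = wl 0 0 0" by (simp add: wl_def dilate_def)
  show "cc \<phi>" using w_cc[of 0] 1 by simp
  show "\<phi> \<in> V 0" using wl_in[of "{0}" 0 0 0] 2 by (simp add: lattice_def)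
qed

lemma near_card: "real (card (lattice n \<inter> cball (z :: real ^ 'd) (R / 2 ^ n))) \<le> (2 * R + 1) ^ CARD('d)"
  using lattice_ball_card(2)[of "R / 2 ^ n" n z] R_pos by simp

text \<open>If the integral vanished, the coefficients of \<open>\<phi>\<close> against fine scaling
  functions would only see the oscillation of \<open>\<phi>\<close>, so each would be at most
  \<open>e * m / 2 ^ (CARD('d) * n)\<close>. About \<open>2 ^ (CARD('d) * n)\<close> of them are
  nonzero and \<open>\<phi>\<close> belongs to \<open>V n\<close>, so expanding its squared norm in
  the basis gives a value below 1, whereas \<open>\<phi>\<close> is normalised.\<close>

lemma integral_phi_nonzero: "(LINT z|lborel. \<phi> z) \<noteq> 0"
proof
  assume int0: "(LINT z|lborel. \<phi> z) = 0"
  define m where "m = (LINT z|lborel. \<bar>\<phi> z\<bar>)"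
  define C where "C = (4 * R + 1) ^ CARD('d) * m\<^sup>2"
  have C: "C \<ge> 0" using R_pos by (simp add: C_def)
  define e where "e = 1 / (C + 2)"
  have e: "e > 0" "e \<le> 1" using C by (auto simp: e_def)
  obtain \<delta> where \<delta>: "\<delta> > 0" "\<forall>x y. dist x y \<le> \<delta> \<longrightarrow> \<bar>\<phi> x - \<phi> y\<bar> \<le> e"
    using phi_cc e(1) by (rule cc_uniformly_continuous)
  obtain n :: nat where n: "R / \<delta> < 2 ^ n" using real_arch_pow[of 2 "R / \<delta>"] by auto
  then have n': "R / 2 ^ n \<le> \<delta>" using \<delta>(1) by (simp add: field_simps)
  let ?F = "lattice n \<inter> cball (0 :: real ^ 'd) (2 * R)"
  have F: "finite ?F" "real (card ?F) \<le> (2 * (2 ^ n * (2 * R)) + 1) ^ CARD('d)"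
    using lattice_ball_card[of "2 * R" n "0 :: real ^ 'd"] R_pos by auto
  have cc0: "\<bar>L2_inner \<phi> (wl 0 n y)\<bar> \<le> e * m / 2 ^ (CARD('d) * n)" for y
  proof -
    have i: "integrable lborel (\<lambda>z. \<phi> z * \<phi> (y + (1 / 2 ^ n) *\<^sub>R z))"
      by (intro cc_integrable cc_mult phi_cc cc_affine) simp
    have "(LINT z|lborel. \<phi> z * \<phi> (y + (1 / 2 ^ n) *\<^sub>R z)) =
      (LINT z|lborel. \<phi> z * \<phi> (y + (1 / 2 ^ n) *\<^sub>R z)) - (LINT z|lborel. \<phi> z * \<phi> y)" using int0 by simp
    also have "\<dots> = (LINT z|lborel. \<phi> z * \<phi> (y + (1 / 2 ^ n) *\<^sub>R z) - \<phi> z * \<phi> y)"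
      using i cc_integrable[OF phi_cc] by (intro Bochner_Integration.integral_diff[symmetric]) auto
    also have "\<bar>\<dots>\<bar> \<le> (LINT z|lborel. \<bar>\<phi> z * \<phi> (y + (1 / 2 ^ n) *\<^sub>R z) - \<phi> z * \<phi> y\<bar>)"
      by (rule integral_abs_bound)
    also have "\<dots> \<le> (LINT z|lborel. \<bar>\<phi> z\<bar> * e)"
    proof (rule integral_mono)
      show "integrable lborel (\<lambda>z. \<bar>\<phi> z * \<phi> (y + (1 / 2 ^ n) *\<^sub>R z) - \<phi> z * \<phi> y\<bar>)"
        using i cc_integrable[OF phi_cc] by auto
      show "integrable lborel (\<lambda>z. \<bar>\<phi> z\<bar> * e)" using cc_integrable[OF cc_abs[OF phi_cc]] by auto
      fix z
      show "\<bar>\<phi> z * \<phi> (y + (1 / 2 ^ n) *\<^sub>R z) - \<phi> z * \<phi> y\<bar> \<le> \<bar>\<phi> z\<bar> * e"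
      proof (cases "norm z \<le> R")
        case True
        then have "dist (y + (1 / 2 ^ n) *\<^sub>R z) y \<le> \<delta>" using n' by (simp add: dist_norm field_simps)
        then have "\<bar>\<phi> (y + (1 / 2 ^ n) *\<^sub>R z) - \<phi> y\<bar> \<le> e" using \<delta>(2) by blast
        then show ?thesis unfolding right_diff_distrib[symmetric] abs_mult by (intro mult_left_mono) auto
      next
        case False then show ?thesis using w_norm[of 0 z] phi_w by simp
      qed
    qed
    also have "\<dots> = e * m" by (simp add: m_def)
    finally show ?thesis using inner_wl[OF phi_cc, of 0 n y] phi_w by (simp add: divide_right_mono)
  qed
  have Fz: "\<forall>i\<in>insert 0 {}. \<forall>x\<in>lattice n. L2_inner \<phi> (wl i n x) \<noteq> 0 \<longrightarrow> x \<in> ?F"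
  proof (intro ballI impI)
    fix i x assume i: "i \<in> insert 0 {}" and x: "x \<in> lattice n" and n0: "L2_inner \<phi> (wl i n x) \<noteq> 0"
    then obtain z where z: "\<phi> z \<noteq> 0" "dist x z < R / 2 ^ n" using inner_eq_0[where i = i and g = \<phi> and n = n and x = x] by auto
    have "norm z \<le> R" using w_norm[of 0 z] z(1) phi_w by force
    moreover have "R / 2 ^ n \<le> R" using R_pos by (simp add: field_simps one_le_power)
    moreover have "norm x \<le> norm z + dist x z" using norm_triangle_ineq2[of x z] by (simp add: dist_norm)
    ultimately show "x \<in> ?F" using x z by auto
  qed
  have "1 = L2_inner \<phi> \<phi>"
    using wl_inner[of "{0}" 0 0 0 0 0] phi_wl by (simp add: lattice_def)
  also have "\<dots> = L2_inner (PP {0} n \<phi>) \<phi>"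
    using PP_id[of "{0}" \<phi> n] phi_cc V_mono[of 0 n] phi_V0 by auto
  also have "PP {0} n \<phi> = (\<lambda>z. \<Sum>x\<in>?F. (2 ^ (CARD('d) * n) * L2_inner \<phi> (wl 0 n x)) * wl 0 n x z)"
    unfolding PP_def using Fz F by (intro ext) (simp, rule local_sum, auto)
  also have "L2_inner \<dots> \<phi> = (\<Sum>x\<in>?F. (2 ^ (CARD('d) * n) * L2_inner \<phi> (wl 0 n x)) * L2_inner (wl 0 n x) \<phi>)"
    by (intro L2_inner_sum wl_L2 cc_L2 phi_cc) auto
  also have "\<dots> \<le> (\<Sum>x\<in>?F. 2 ^ (CARD('d) * n) * (e * m / 2 ^ (CARD('d) * n))\<^sup>2)"
  proof (rule sum_mono)
    fix x
    have "(L2_inner \<phi> (wl 0 n x))\<^sup>2 \<le> (e * m / 2 ^ (CARD('d) * n))\<^sup>2"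
      using power_mono[OF cc0[of x], of 2] by simp
    then have "2 ^ (CARD('d) * n) * (L2_inner \<phi> (wl 0 n x))\<^sup>2 \<le> 2 ^ (CARD('d) * n) * (e * m / 2 ^ (CARD('d) * n))\<^sup>2"
      by (rule mult_left_mono) simp
    moreover have "(2 ^ (CARD('d) * n) * L2_inner \<phi> (wl 0 n x)) * L2_inner (wl 0 n x) \<phi> =
      2 ^ (CARD('d) * n) * (L2_inner \<phi> (wl 0 n x))\<^sup>2"
      by (simp only: L2_inner_commute[of "wl 0 n x"] power2_eq_square mult.assoc)
    ultimately show "(2 ^ (CARD('d) * n) * L2_inner \<phi> (wl 0 n x)) * L2_inner (wl 0 n x) \<phi> \<le>
        2 ^ (CARD('d) * n) * (e * m / 2 ^ (CARD('d) * n))\<^sup>2"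
      by (simp only:)
  qed
  also have "\<dots> = real (card ?F) * (e * m)\<^sup>2 / 2 ^ (CARD('d) * n)"
    by (simp add: power2_eq_square)
  also have "\<dots> \<le> ((4 * R + 1) * 2 ^ n) ^ CARD('d) * (e * m)\<^sup>2 / 2 ^ (CARD('d) * n)"
  proof (intro divide_right_mono mult_right_mono)
    have "(2 * (2 ^ n * (2 * R)) + 1) ^ CARD('d) \<le> ((4 * R + 1) * 2 ^ n) ^ CARD('d)"
      using R_pos by (intro power_mono) (auto simp: algebra_simps one_le_power)
    then show "real (card ?F) \<le> ((4 * R + 1) * 2 ^ n) ^ CARD('d)" using F(2) by linarith
  qed auto
  also have "((4 * R + 1) * 2 ^ n) ^ CARD('d) = (4 * R + 1) ^ CARD('d) * 2 ^ (CARD('d) * n)"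
    by (simp add: power_mult_distrib power_mult[symmetric] mult.commute)
  also have "(4 * R + 1) ^ CARD('d) * 2 ^ (CARD('d) * n) * (e * m)\<^sup>2 / 2 ^ (CARD('d) * n) = e\<^sup>2 * C"
    by (simp add: power_mult_distrib C_def)
  also have "\<dots> \<le> e * C" using e C by (intro mult_right_mono) (auto simp: power2_eq_square mult_left_le)
  also have "\<dots> < 1" using C by (simp add: e_def)
  finally show False by simp
qed

section \<open>Moments of the wavelets\<close>

definition mom :: "nat \<Rightarrow> (real ^ 'd) list \<Rightarrow> real" where
  "mom i l = (LINT z|lborel. mono_of l z * w i z)"

lemma mono_w_cc: "i \<in> insert 0 IW \<Longrightarrow> cc (\<lambda>z. mono_of l z * w i z)"
  by (intro cc_mult2 w_cc continuous_intros)

definition wint :: "nat \<Rightarrow> real" where "wint i = (LINT z|lborel. \<bar>w i z\<bar>)"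

lemma wint_nonneg: "wint i \<ge> 0" by (simp add: wint_def)

text \<open>Moments below order \<open>k\<close> annihilate the lower Taylor terms. The coefficients
  \<open>c l\<close> of the top order are left free because two choices are needed: the derivatives
  at \<open>x\<close> isolate the leading term for the proof of vanishing moments, and zero gives
  the decay of wavelet coefficients.\<close>

lemma taylor_wavelet:
  assumes u: "Ck k u" and i: "i \<in> insert 0 IW" and t: "t \<ge> 0"
    and van: "\<And>l. set l \<subseteq> Basis \<Longrightarrow> length l < k \<Longrightarrow> mom i l = 0"
    and A: "\<And>l y. l \<in> BL k \<Longrightarrow> norm y \<le> t * R \<Longrightarrow> \<bar>ddir l u (x + y) - c l\<bar> \<le> A"
  shows "\<bar>(LINT z|lborel. w i z * u (x + t *\<^sub>R z)) - t ^ k / fact k * (\<Sum>l\<in>BL k. c l * mom i l)\<bar>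
     \<le> A * t ^ k * (real (card (BL k :: (real^'d) list set)) * R ^ k * wint i)"
proof -
  let ?N = "real (card (BL k :: (real^'d) list set))"
  define q where "q = (\<lambda>z. (\<Sum>j<k. taylor_term j u x (t *\<^sub>R z) / fact j) + (\<Sum>l\<in>BL k. c l * mono_of l (t *\<^sub>R z)) / fact k)"
  \<comment> \<open>Words of length \<open>k\<close> exist, so the bound \<open>A\<close> is
    attained by some absolute value and is nonnegative.\<close>
  have BLne: "replicate k (SOME b. b \<in> Basis) \<in> (BL k :: (real^'d) list set)"
    by (auto simp: BL_def set_replicate_conv_if) (metis SOME_Basis)
  have A0: "A \<ge> 0" using A[OF BLne, of 0] t R_pos by force
  have qc: "continuous_on UNIV q"
    unfolding q_def taylor_term_def by (intro continuous_intros) auto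
  have uc: "continuous_on UNIV (\<lambda>z. u (x + t *\<^sub>R z))"
    by (intro continuous_on_compose2[OF Ck_continuous_on[OF u]] continuous_intros) auto
  have bound: "\<bar>u (x + t *\<^sub>R z) - q z\<bar> \<le> A * t ^ k * (?N * R ^ k)" if z: "norm z \<le> R" for z
  proof -
    obtain s where s: "0 \<le> s" "s \<le> 1" and
      eq: "u (x + t *\<^sub>R z) = (\<Sum>j<k. taylor_term j u x (t *\<^sub>R z) / fact j) + taylor_term k u (x + s *\<^sub>R (t *\<^sub>R z)) (t *\<^sub>R z) / fact k"
      using taylor_lagrange[OF u, of x "t *\<^sub>R z"] by blast
    have "u (x + t *\<^sub>R z) - q z = (\<Sum>l\<in>BL k. (ddir l u (x + s *\<^sub>R (t *\<^sub>R z)) - c l) * mono_of l (t *\<^sub>R z)) / fact k"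
      unfolding eq q_def taylor_term_def
      by (simp add: sum_subtractf left_diff_distrib diff_divide_distrib)
    also have "\<bar>\<dots>\<bar> \<le> \<bar>\<Sum>l\<in>BL k. (ddir l u (x + s *\<^sub>R (t *\<^sub>R z)) - c l) * mono_of l (t *\<^sub>R z)\<bar>"
      using fact_ge_1[of k, where 'a = real] by (simp add: divide_le_eq mult_le_cancel_left1)
    also have "\<dots> \<le> (\<Sum>l\<in>(BL k :: (real^'d) list set). A * (t ^ k * R ^ k))"
    proof (rule sum_abs[THEN order_trans], rule sum_mono)
      fix l :: "(real^'d) list" assume l: "l \<in> BL k"
      have "norm (s *\<^sub>R (t *\<^sub>R z)) = s * (t * norm z)" using s t by simp
      also have "\<dots> \<le> 1 * (t * R)" using s t z by (intro mult_mono) auto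
      finally have 1: "\<bar>ddir l u (x + s *\<^sub>R (t *\<^sub>R z)) - c l\<bar> \<le> A" by (intro A l) simp
      have "\<bar>mono_of l (t *\<^sub>R z)\<bar> \<le> norm (t *\<^sub>R z) ^ k" using mono_of_bound[of l "t *\<^sub>R z"] l by (auto simp: BL_def)
      also have "\<dots> \<le> (t * R) ^ k" using t z by (intro power_mono) (auto intro: mult_left_mono)
      finally have "\<bar>mono_of l (t *\<^sub>R z)\<bar> \<le> t ^ k * R ^ k" by (simp add: power_mult_distrib)
      with 1 show "\<bar>(ddir l u (x + s *\<^sub>R (t *\<^sub>R z)) - c l) * mono_of l (t *\<^sub>R z)\<bar> \<le> A * (t ^ k * R ^ k)"
        unfolding abs_mult by (intro mult_mono) auto
    qed
    finally show ?thesis by (simp add: mult_ac)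
  qed
  have wq: "(LINT z|lborel. w i z * q z) = t ^ k / fact k * (\<Sum>l\<in>BL k. c l * mom i l)"
  proof -
    have I: "integrable lborel (\<lambda>z. mono_of l z * w i z)" for l by (intro cc_integrable mono_w_cc i)
    have "(\<lambda>z. w i z * q z) = (\<lambda>z. (\<Sum>j<k. \<Sum>l\<in>BL j. (ddir l u x * t ^ j / fact j) * (mono_of l z * w i z)) +
        (\<Sum>l\<in>BL k. (c l * t ^ k / fact k) * (mono_of l z * w i z)))"
    proof
      fix z
      have 1: "w i z * (taylor_term j u x (t *\<^sub>R z) / fact j) = (\<Sum>l\<in>BL j. (ddir l u x * t ^ j / fact j) * (mono_of l z * w i z))" for j
        unfolding taylor_term_def sum_divide_distrib sum_distrib_left
        by (intro sum.cong) (auto simp: mono_of_scaleR BL_def)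
      have 2: "w i z * ((\<Sum>l\<in>BL k. c l * mono_of l (t *\<^sub>R z)) / fact k) = (\<Sum>l\<in>BL k. (c l * t ^ k / fact k) * (mono_of l z * w i z))"
        unfolding sum_divide_distrib sum_distrib_left
        by (intro sum.cong) (auto simp: mono_of_scaleR BL_def)
      show "w i z * q z = (\<Sum>j<k. \<Sum>l\<in>BL j. (ddir l u x * t ^ j / fact j) * (mono_of l z * w i z)) +
        (\<Sum>l\<in>BL k. (c l * t ^ k / fact k) * (mono_of l z * w i z))"
        unfolding q_def distrib_left sum_distrib_left[of "w i z" _ "{..<k}"] 1 2 ..
    qed
    then have "(LINT z|lborel. w i z * q z) =
      (\<Sum>j<k. \<Sum>l\<in>BL j. (ddir l u x * t ^ j / fact j) * mom i l) + (\<Sum>l\<in>BL k. (c l * t ^ k / fact k) * mom i l)"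
      using I by (simp add: Bochner_Integration.integral_add Bochner_Integration.integral_sum mom_def)
    also have "(\<Sum>j<k. \<Sum>l\<in>BL j. (ddir l u x * t ^ j / fact j) * mom i l) = 0"
      by (intro sum.neutral ballI) (auto simp: van BL_def)
    finally show ?thesis by (simp add: sum_distrib_left mult_ac)
  qed
  have i1: "integrable lborel (\<lambda>z. w i z * u (x + t *\<^sub>R z))" by (intro cc_integrable cc_mult1 w_cc i uc)
  have i2: "integrable lborel (\<lambda>z. w i z * q z)" by (intro cc_integrable cc_mult1 w_cc i qc)
  have "(LINT z|lborel. w i z * u (x + t *\<^sub>R z)) - (LINT z|lborel. w i z * q z) =
      (LINT z|lborel. w i z * u (x + t *\<^sub>R z) - w i z * q z)"
    using i1 i2 by (rule Bochner_Integration.integral_diff[symmetric])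
  also have "\<bar>\<dots>\<bar> \<le> (LINT z|lborel. \<bar>w i z * u (x + t *\<^sub>R z) - w i z * q z\<bar>)" by (rule integral_abs_bound)
  also have "\<dots> \<le> (LINT z|lborel. \<bar>w i z\<bar> * (A * t ^ k * (?N * R ^ k)))"
  proof (rule integral_mono)
    show "integrable lborel (\<lambda>z. \<bar>w i z * u (x + t *\<^sub>R z) - w i z * q z\<bar>)" using i1 i2 by auto
    show "integrable lborel (\<lambda>z. \<bar>w i z\<bar> * (A * t ^ k * (?N * R ^ k)))"
      using cc_integrable[OF cc_abs[OF w_cc[OF i]]] by auto
    fix z
    show "\<bar>w i z * u (x + t *\<^sub>R z) - w i z * q z\<bar> \<le> \<bar>w i z\<bar> * (A * t ^ k * (?N * R ^ k))"
    proof (cases "norm z \<le> R")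
      case True
      then show ?thesis using bound[OF True]
        unfolding right_diff_distrib[symmetric] abs_mult by (intro mult_left_mono) auto
    qed (use w_norm[OF i, of z] in auto)
  qed
  also have "\<dots> = A * t ^ k * (?N * R ^ k * wint i)" by (simp add: wint_def mult_ac)
  finally show ?thesis unfolding wq .
qed

text \<open>Each factor of the monomial in \<open>y - t *\<^sub>R z\<close> contributes a coordinate
  of \<open>y\<close> or \<open>- t\<close> times a coordinate of \<open>z\<close>. Choosing a
  coordinate of \<open>y\<close> even once leaves a moment of order below \<open>s\<close>, which
  vanishes, so only the product of all factors from \<open>z\<close> survives. The list
  \<open>l'\<close> collects the factors of \<open>z\<close> already chosen.\<close>

lemma moment_shift:
  assumes i: "i \<in> insert 0 IW" and van: "\<And>l. set l \<subseteq> Basis \<Longrightarrow> length l < s \<Longrightarrow> mom i l = 0"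
  shows "set l \<subseteq> Basis \<Longrightarrow> set l' \<subseteq> Basis \<Longrightarrow> length l + length l' \<le> s \<Longrightarrow>
    (LINT z|lborel. w i z * (mono_of l' z * mono_of l (y - t *\<^sub>R z))) = (- t) ^ length l * mom i (l' @ l)"
proof (induction l arbitrary: l')
  case Nil
  then show ?case by (simp add: mom_def mult.commute)
next
  case (Cons v l)
  have I: "integrable lborel (\<lambda>z. w i z * (mono_of l'' z * mono_of l (y - t *\<^sub>R z)))" for l''
    by (intro cc_integrable cc_mult1 w_cc i continuous_intros)
  have "(LINT z|lborel. w i z * (mono_of l' z * mono_of (v # l) (y - t *\<^sub>R z))) =
    (LINT z|lborel. (v \<bullet> y) * (w i z * (mono_of l' z * mono_of l (y - t *\<^sub>R z))) - t * (w i z * (mono_of (v # l') z * mono_of l (y - t *\<^sub>R z))))"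
    by (intro Bochner_Integration.integral_cong) (auto simp: algebra_simps inner_diff_right)
  also have "\<dots> = (v \<bullet> y) * (LINT z|lborel. w i z * (mono_of l' z * mono_of l (y - t *\<^sub>R z)))
     - t * (LINT z|lborel. w i z * (mono_of (v # l') z * mono_of l (y - t *\<^sub>R z)))"
    using I[of l'] I[of "v # l'"] by (simp add: Bochner_Integration.integral_diff del: mono_of_simps)
  also have "\<dots> = (v \<bullet> y) * ((- t) ^ length l * mom i (l' @ l)) - t * ((- t) ^ length l * mom i ((v # l') @ l))"
    using Cons.prems by (subst Cons.IH, simp, simp, simp, subst Cons.IH) auto
  also have "mom i (l' @ l) = 0" using Cons.prems by (intro van) auto
  also have "mom i ((v # l') @ l) = mom i (l' @ (v # l))"
    unfolding mom_def by (simp add: mono_of_append mult_ac)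
  finally show ?case by simp
qed

text \<open>The function \<open>\<phi>\<close> lies in \<open>V 0\<close>, hence in
  \<open>V n\<close>, and is therefore orthogonal to the details of scale \<open>n\<close>.
  Rescaling the inner product gives the integral.\<close>

lemma E_dyadic: assumes "i \<in> IW" "x \<in> lattice n" shows "(LINT z|lborel. w i z * \<phi> (x + (1 / 2 ^ n) *\<^sub>R z)) = 0"
proof -
  have "wl i n x \<in> detail_space V (int n)" using wl_in[of IW i x n] assms by simp
  moreover have "\<phi> \<in> V (int n)" using phi_V0 V_mono[of 0 n] by auto
  ultimately have "L2_inner \<phi> (wl i n x) = 0" using detail_ortho L2_inner_commute by metis
  then show ?thesis using inner_wl[OF phi_cc, of i n x] assms by simp
qed

text \<open>The integrals \<open>E t x = (LINT z|lborel. w i z * \<phi> (x + t *\<^sub>R z))\<close> vanish for dyadic \<open>t\<close> and \<open>x\<close>.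
  By Taylor expansion this annihilates the leading coefficient, a combination of derivatives of
  \<open>\<phi>\<close> at \<open>x\<close>, everywhere. Hence \<open>E t x = o(t ^ s)\<close> uniformly, and integrating \<open>E t\<close> against a
  monomial of degree \<open>s\<close> isolates one moment, multiplied by the integral of \<open>\<phi>\<close>.\<close>

theorem vanishing_moments:
  assumes i: "i \<in> IW" shows "set l \<subseteq> Basis \<Longrightarrow> length l \<le> r \<Longrightarrow> mom i l = 0"
proof (induction "length l" arbitrary: l rule: less_induct)
  case less
  define s where "s = length l"
  have s: "s \<le> r" using less by (simp add: s_def)
  have van: "mom i m = 0" if "set m \<subseteq> Basis" "length m < s" for m using less that s by (simp add: s_def)
  have i0: "i \<in> insert 0 IW" using i by simp
  have phi_Crc: "\<phi> \<in> Crc r UNIV" using w_Crc[of 0] phi_w by simp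
  have phi_Ck: "Ck s \<phi>" using Crc_Ck[OF phi_Crc] s by (rule Ck_mono)
  define E where "E = (\<lambda>t x. LINT z|lborel. w i z * \<phi> (x + t *\<^sub>R z))"
  define T where "T = (\<lambda>x. \<Sum>m\<in>BL s. ddir m \<phi> x * mom i m)"
  define C where "C = real (card (BL s :: (real^'d) list set)) * R ^ s * wint i"
  have C: "C \<ge> 0" using R_pos wint_nonneg by (simp add: C_def)
  have ET: "\<bar>E t x - t ^ s / fact s * T x\<bar> \<le> e * t ^ s * C"
    if "t \<ge> 0" "t * R \<le> \<delta>" "\<forall>m\<in>BL s. \<forall>x y. dist x y \<le> \<delta> \<longrightarrow> \<bar>ddir m \<phi> x - ddir m \<phi> y\<bar> \<le> e" for t \<delta> x e
    unfolding E_def T_def C_def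
    by (rule taylor_wavelet[OF phi_Ck i0 that(1) van]) (use that in \<open>auto simp: dist_norm\<close>)
  have T0: "T x = 0" for x
  proof (rule small_imp_zero)
    fix e :: real assume e: "e > 0"
    obtain \<delta> where \<delta>: "\<delta> > 0" "\<forall>m\<in>BL s. \<forall>x y. dist x y \<le> \<delta> \<longrightarrow> \<bar>ddir m \<phi> x - ddir m \<phi> y\<bar> \<le> e"
      by (rule ddir_equicontinuous[OF phi_Crc s e])
    \<comment> \<open>Fine enough for two distances to be below the modulus of continuity: the reach
      \<open>R / 2 ^ n\<close> of the Taylor expansion, and the distance from \<open>x\<close> to a
      point of the lattice.\<close>
    obtain n :: nat where n: "(R + real CARD('d)) / \<delta> < 2 ^ n" using real_arch_pow[of 2 "(R + real CARD('d)) / \<delta>"] by auto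
    have n': "(R + real CARD('d)) / 2 ^ n \<le> \<delta>" using n \<delta>(1) by (simp add: field_simps)
    obtain x0 where x0: "x0 \<in> lattice n" "norm (x - x0) \<le> real CARD('d) / 2 ^ n" using lattice_near by blast
    have "R / 2 ^ n \<ge> 0" "real CARD('d) / 2 ^ n \<ge> 0" "R / 2 ^ n + real CARD('d) / 2 ^ n \<le> \<delta>"
      using R_pos n' by (auto simp: add_divide_distrib)
    then have "R / 2 ^ n \<le> \<delta>" "norm (x - x0) \<le> \<delta>" using x0(2) by linarith+
    then have nR: "1 / 2 ^ n * R \<le> \<delta>" "dist x x0 \<le> \<delta>" by (simp_all add: dist_norm)
    have "\<bar>E (1 / 2 ^ n) x0 - (1 / 2 ^ n) ^ s / fact s * T x0\<bar> \<le> e * (1 / 2 ^ n) ^ s * C"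
      by (rule ET[OF _ nR(1) \<delta>(2)]) simp
    moreover have "E (1 / 2 ^ n) x0 = 0" unfolding E_def by (rule E_dyadic[OF i x0(1)])
    ultimately have "(1 / 2 ^ n) ^ s * (\<bar>T x0\<bar> / fact s) \<le> (1 / 2 ^ n) ^ s * (e * C)"
      by (simp add: abs_mult mult_ac)
    then have "\<bar>T x0\<bar> / fact s \<le> e * C" by (rule mult_left_le_imp_le) simp
    then have 1: "\<bar>T x0\<bar> \<le> e * (C * fact s)" by (simp add: divide_le_eq mult_ac)
    have "\<bar>T x - T x0\<bar> = \<bar>\<Sum>m\<in>BL s. (ddir m \<phi> x - ddir m \<phi> x0) * mom i m\<bar>"
      unfolding T_def by (simp add: sum_subtractf left_diff_distrib)
    also have "\<dots> \<le> (\<Sum>m\<in>BL s. e * \<bar>mom i m\<bar>)"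
      by (rule sum_abs[THEN order_trans], rule sum_mono)
         (use \<delta>(2) nR(2) in \<open>auto simp: abs_mult intro!: mult_right_mono\<close>)
    also have "\<dots> = e * (\<Sum>m\<in>BL s. \<bar>mom i m\<bar>)" by (simp add: sum_distrib_left)
    finally show "\<bar>T x\<bar> \<le> e * (C * fact s + (\<Sum>m\<in>BL s. \<bar>mom i m\<bar>))" using 1 by (simp add: distrib_left)
  qed
  have E0: "E t x = 0" if "2 * R < norm x" "0 \<le> t" "t \<le> 1" for t x
  proof -
    have "w i z * \<phi> (x + t *\<^sub>R z) = 0" for z
    proof (cases "norm z \<le> R")
      case True
      have "norm (t *\<^sub>R z) \<le> R" using True that mult_mono[of t 1 "norm z" R] by simp
      then have "R < norm (x + t *\<^sub>R z)" using that norm_triangle_ineq4[of "x + t *\<^sub>R z" "t *\<^sub>R z"] by simp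
      then show ?thesis using w_norm[of 0] phi_w by simp
    qed (use w_norm[OF i0] in simp)
    then have "(\<lambda>z. w i z * \<phi> (x + t *\<^sub>R z)) = (\<lambda>z. 0)" by (rule ext)
    then show ?thesis by (simp only: E_def) simp
  qed
  \<comment> \<open>Fubini and the translation \<open>y = x + t *\<^sub>R z\<close> turn the
    monomial in \<open>x\<close> into one in \<open>y - t *\<^sub>R z\<close>. By
    \<open>moment_shift\<close> the integral over \<open>z\<close> is then independent of
    \<open>y\<close>, and the integral of \<open>\<phi>\<close> splits off.\<close>
  have swap: "(LINT x|lborel. E t x * mono_of l x) = (- t) ^ s * mom i l * (LINT y|lborel. \<phi> y)" if t: "0 \<le> t" "t \<le> 1" for t
  proof -
    have ccF: "cc (\<lambda>p :: (real^'d) \<times> (real^'d). w i (snd p) * \<phi> (fst p + t *\<^sub>R snd p) * mono_of l (fst p))"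
    proof (rule ccI[of _ "3 * R"])
      show "continuous_on UNIV (\<lambda>p. w i (snd p) * \<phi> (fst p + t *\<^sub>R snd p) * mono_of l (fst p))"
        by (intro continuous_intros continuous_on_compose2[OF cc_continuous[OF w_cc[OF i0]]]
            continuous_on_compose2[OF cc_continuous[OF phi_cc]]) auto
      fix p :: "(real^'d) \<times> (real^'d)" assume p: "3 * R < norm p"
      show "w i (snd p) * \<phi> (fst p + t *\<^sub>R snd p) * mono_of l (fst p) = 0"
      proof (cases "norm (snd p) \<le> R")
        case True
        have "norm (t *\<^sub>R snd p) \<le> R" using True t mult_mono[of t 1 "norm (snd p)" R] by simp
        moreover have "norm p \<le> norm (fst p) + norm (snd p)" using norm_Pair_le[of "fst p" "snd p"] by simp
        ultimately have "R < norm (fst p + t *\<^sub>R snd p)"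
          using p True norm_triangle_ineq4[of "fst p + t *\<^sub>R snd p" "t *\<^sub>R snd p"] by simp
        then show ?thesis using w_norm[of 0] phi_w by simp
      qed (use w_norm[OF i0] in simp)
    qed
    have ccG: "cc (\<lambda>p :: (real^'d) \<times> (real^'d). w i (fst p) * \<phi> (snd p) * mono_of l (snd p - t *\<^sub>R fst p))"
    proof (rule ccI[of _ "2 * R"])
      show "continuous_on UNIV (\<lambda>p. w i (fst p) * \<phi> (snd p) * mono_of l (snd p - t *\<^sub>R fst p))"
        by (intro continuous_intros continuous_on_compose2[OF cc_continuous[OF w_cc[OF i0]]]
            continuous_on_compose2[OF cc_continuous[OF phi_cc]]) auto
      fix p :: "(real^'d) \<times> (real^'d)" assume p: "2 * R < norm p"
      have "norm p \<le> norm (fst p) + norm (snd p)" using norm_Pair_le[of "fst p" "snd p"] by simp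
      then have "R < norm (fst p) \<or> R < norm (snd p)" using p by linarith
      then show "w i (fst p) * \<phi> (snd p) * mono_of l (snd p - t *\<^sub>R fst p) = 0"
        using w_norm[OF i0] w_norm[of 0] phi_w by auto
    qed
    have "(LINT x|lborel. E t x * mono_of l x) = (LINT x|lborel. LINT z|lborel. w i z * \<phi> (x + t *\<^sub>R z) * mono_of l x)"
      unfolding E_def by simp
    also have "\<dots> = (LINT z|lborel. LINT x|lborel. w i z * \<phi> (x + t *\<^sub>R z) * mono_of l x)"
      by (rule cc_Fubini[where F = "\<lambda>x z. w i z * \<phi> (x + t *\<^sub>R z) * mono_of l x", OF ccF])
    also have "\<dots> = (LINT z|lborel. LINT y|lborel. w i z * \<phi> y * mono_of l (y - t *\<^sub>R z))"
    proof (rule Bochner_Integration.integral_cong[OF refl])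
      fix z
      have "continuous_on UNIV (\<lambda>x. w i z * \<phi> (x + t *\<^sub>R z) * mono_of l x)"
        by (intro continuous_intros continuous_on_compose2[OF cc_continuous[OF phi_cc]]) auto
      then have "(\<lambda>x. w i z * \<phi> (x + t *\<^sub>R z) * mono_of l x) \<in> borel_measurable borel"
        by (rule borel_measurable_continuous_onI)
      from integral_affine[OF this, of 1 "- (t *\<^sub>R z)"]
      show "(LINT x|lborel. w i z * \<phi> (x + t *\<^sub>R z) * mono_of l x) = (LINT y|lborel. w i z * \<phi> y * mono_of l (y - t *\<^sub>R z))"
        by (simp add: algebra_simps)
    qed
    also have "\<dots> = (LINT y|lborel. LINT z|lborel. w i z * \<phi> y * mono_of l (y - t *\<^sub>R z))"
      by (rule cc_Fubini[where F = "\<lambda>z y. w i z * \<phi> y * mono_of l (y - t *\<^sub>R z)", OF ccG])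
    also have "\<dots> = (LINT y|lborel. \<phi> y * (LINT z|lborel. w i z * (mono_of [] z * mono_of l (y - t *\<^sub>R z))))"
    proof (rule Bochner_Integration.integral_cong[OF refl])
      fix y
      have "(LINT z|lborel. w i z * \<phi> y * mono_of l (y - t *\<^sub>R z)) =
          (LINT z|lborel. \<phi> y * (w i z * (mono_of [] z * mono_of l (y - t *\<^sub>R z))))"
        by (rule Bochner_Integration.integral_cong) auto
      then show "(LINT z|lborel. w i z * \<phi> y * mono_of l (y - t *\<^sub>R z)) =
          \<phi> y * (LINT z|lborel. w i z * (mono_of [] z * mono_of l (y - t *\<^sub>R z)))"
        by (simp only: integral_mult_right_zero)
    qed
    also have "\<dots> = (LINT y|lborel. \<phi> y * ((- t) ^ s * mom i l))"
      using moment_shift[OF i0 van, where l = l and l' = "[]"] less by (simp add: s_def)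
    finally show ?thesis by simp
  qed
  let ?v = "(2 * (2 * R)) ^ CARD('d)"
  have "mom i l * (LINT y|lborel. \<phi> y) = 0"
  proof (rule small_imp_zero)
    fix e :: real assume e: "e > 0"
    obtain \<delta> where \<delta>: "\<delta> > 0" "\<forall>m\<in>BL s. \<forall>x y. dist x y \<le> \<delta> \<longrightarrow> \<bar>ddir m \<phi> x - ddir m \<phi> y\<bar> \<le> e"
      by (rule ddir_equicontinuous[OF phi_Crc s e])
    define t where "t = min 1 (\<delta> / R)"
    have t: "t > 0" "t \<le> 1" "t * R \<le> \<delta>" using \<delta>(1) R_pos by (auto simp: t_def min_def field_simps)
    let ?M = "e * t ^ s * C * (2 * R) ^ s"
    have M0: "?M \<ge> 0" using e t C R_pos by simp
    have bd: "\<bar>E t x * mono_of l x\<bar> \<le> ?M * indicator (cball 0 (2 * R)) x" for x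
    proof (cases "norm x \<le> 2 * R")
      case True
      have "\<bar>E t x\<bar> \<le> e * t ^ s * C" using ET[of t \<delta> e x] t \<delta> T0 by simp
      moreover have "\<bar>mono_of l x\<bar> \<le> norm x ^ s" using mono_of_bound[of l x] less by (simp add: s_def)
      moreover have "norm x ^ s \<le> (2 * R) ^ s" using True by (intro power_mono) auto
      ultimately have "\<bar>E t x\<bar> * \<bar>mono_of l x\<bar> \<le> (e * t ^ s * C) * (2 * R) ^ s" using e t C by (intro mult_mono) auto
      then show ?thesis using True by (simp add: abs_mult)
    qed (use E0[of x t] t in auto)
    have fin: "emeasure lborel (cball (0 :: real^'d) (2 * R)) < \<infinity>" by (rule emeasure_bounded_finite) simp
    have "\<bar>LINT x|lborel. E t x * mono_of l x\<bar> \<le> (LINT x|lborel. \<bar>E t x * mono_of l x\<bar>)" by (rule integral_abs_bound)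
    also have "\<dots> \<le> (LINT x|lborel. ?M * indicator (cball (0 :: real^'d) (2 * R)) x)"
    proof (rule Bochner_Integration.integral_mono')
      show "integrable lborel (\<lambda>x. ?M * indicator (cball (0 :: real^'d) (2 * R)) x)"
        using fin by (intro integrable_mult_right) (auto simp: less_top)
      show "0 \<le> ?M * indicator (cball 0 (2 * R)) x" for x :: "real^'d" by (intro mult_nonneg_nonneg M0) auto
    qed (rule bd)
    also have "\<dots> = ?M * measure lborel (cball (0 :: real^'d) (2 * R))" using fin by simp
    also have "\<dots> \<le> ?M * ?v"
    proof (rule mult_left_mono[OF _ M0])
      show "measure lborel (cball (0 :: real^'d) (2 * R)) \<le> ?v"
        unfolding measure_def using emeasure_cball_le[of "2 * R" "0 :: real^'d"] R_pos
        by (intro enn2real_leI) auto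
    qed
    \<comment> \<open>The power of \<open>t\<close> produced by \<open>moment_shift\<close> is the
      one in the bound on \<open>E\<close>, so it cancels and the arbitrary \<open>e\<close>
      remains.\<close>
    finally have "t ^ s * \<bar>mom i l * (LINT y|lborel. \<phi> y)\<bar> \<le> t ^ s * (e * (C * (2 * R) ^ s * ?v))"
      using swap[of t] t by (simp add: abs_mult power_abs mult_ac)
    then show "\<bar>mom i l * (LINT y|lborel. \<phi> y)\<bar> \<le> e * (C * (2 * R) ^ s * ?v)"
      by (rule mult_left_le_imp_le) (use t in simp)
  qed
  then show ?case using integral_phi_nonzero by simp
qed

section \<open>Decay of wavelet coefficients and derivatives of the projections\<close>

definition Kd :: real where
  "Kd = (\<Sum>i\<in>insert 0 IW. \<Sum>k\<le>r + 1. real (card (BL k :: (real^'d) list set)) * R ^ k * wint i)"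

lemma Kd_ge:
  assumes "i \<in> insert 0 IW" "k \<le> r + 1"
  shows "real (card (BL k :: (real^'d) list set)) * R ^ k * wint i \<le> Kd"
proof -
  have "real (card (BL k :: (real^'d) list set)) * R ^ k * wint i \<le> (\<Sum>k\<le>r + 1. real (card (BL k :: (real^'d) list set)) * R ^ k * wint i)"
    by (rule member_le_sum) (use assms R_pos wint_nonneg in auto)
  also have "\<dots> \<le> Kd" unfolding Kd_def
    by (rule member_le_sum[of i "insert 0 IW" "\<lambda>i. \<Sum>k\<le>r + 1. real (card (BL k :: (real^'d) list set)) * R ^ k * wint i"])
       (use assms R_pos wint_nonneg in \<open>auto intro!: sum_nonneg simp del: sum.atMost_Suc\<close>)
  finally show ?thesis .
qed

lemma Kd_nonneg: "Kd \<ge> 0"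
  unfolding Kd_def using R_pos wint_nonneg by (intro sum_nonneg) auto

lemma coeff_decay_aux:
  assumes u: "Cb k A L u" and cu: "cc u" and i: "i \<in> insert 0 IW" and k: "k \<le> r + 1"
    and van: "\<And>l. set l \<subseteq> Basis \<Longrightarrow> length l < k \<Longrightarrow> mom i l = 0"
  shows "2 ^ (CARD('d) * n) * \<bar>L2_inner u (wl i n x)\<bar> \<le> Kd * A * (L / 2 ^ n) ^ k"
proof -
  have AL: "A \<ge> 0" "L \<ge> 0" using u by (auto simp: Cb_def)
  have "\<bar>(LINT z|lborel. w i z * u (x + (1 / 2 ^ n) *\<^sub>R z)) - (1 / 2 ^ n) ^ k / fact k * (\<Sum>l\<in>BL k. 0 * mom i l)\<bar>
     \<le> (A * L ^ k) * (1 / 2 ^ n) ^ k * (real (card (BL k :: (real^'d) list set)) * R ^ k * wint i)"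
  proof (rule taylor_wavelet[OF Cb_Ck[OF u] i _ van])
    fix l :: "(real^'d) list" and y :: "real^'d" assume "l \<in> BL k"
    then show "\<bar>ddir l u (x + y) - 0\<bar> \<le> A * L ^ k" using CbD[OF u, of l "x + y"] by (auto simp: BL_def)
  qed auto
  also have "\<dots> \<le> (A * L ^ k) * (1 / 2 ^ n) ^ k * Kd" using AL by (intro mult_left_mono Kd_ge i k) auto
  finally show ?thesis by (simp add: inner_wl[OF cu i] abs_divide power_divide mult_ac)
qed

text \<open>Orders up to \<open>r + 1\<close> are available because the moments vanish up to order
  \<open>r\<close> inclusive. Order \<open>r\<close> is used for the off-diagonal decay; order
  \<open>r + 1\<close> leaves a spare factor \<open>1 / 2 ^ n\<close> after \<open>r\<close>
  derivatives and so gives convergence in $C^r$.\<close>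

theorem coeff_decay:
  "Cb k A L u \<Longrightarrow> cc u \<Longrightarrow> i \<in> IW \<Longrightarrow> k \<le> r + 1 \<Longrightarrow>
   2 ^ (CARD('d) * n) * \<bar>L2_inner u (wl i n x)\<bar> \<le> Kd * A * (L / 2 ^ n) ^ k"
  by (rule coeff_decay_aux) (auto intro!: vanishing_moments)

lemma coeff_bound:
  assumes "Cb k A L u" "cc u" "i \<in> insert 0 IW"
  shows "2 ^ (CARD('d) * n) * \<bar>L2_inner u (wl i n x)\<bar> \<le> Kd * A"
  using coeff_decay_aux[OF Cb_mono[OF assms(1), of 0 A L] assms(2,3), of n x] by simp

definition Aw :: real where
  "Aw = (\<Sum>i\<in>insert 0 IW. SOME A. Cb r A 1 (w i))"

lemma w_Cb: assumes "i \<in> insert 0 IW" shows "Cb r Aw 1 (w i)"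
proof -
  have ex: "Cb r (SOME A. Cb r A 1 (w i)) 1 (w i)" if "i \<in> insert 0 IW" for i
  proof (rule someI_ex[of "\<lambda>A. Cb r A 1 (w i)"])
    show "\<exists>A. Cb r A 1 (w i)"
      using w_Crc[OF that] by (intro compact_supp_Cb) (auto simp: Crc_def)
  qed
  have "(SOME A. Cb r A 1 (w i)) \<ge> 0" if "i \<in> insert 0 IW" for i by (rule Cb_nonneg(1)[OF ex[OF that]])
  then have "(SOME A. Cb r A 1 (w i)) \<le> Aw" unfolding Aw_def using assms by (intro member_le_sum) auto
  then show ?thesis using ex[OF assms] by (auto intro: Cb_mono)
qed

lemma Aw_nonneg: "Aw \<ge> 0" using w_Cb[of 0] by (simp add: Cb_def)

lemma wl_Cb: "i \<in> insert 0 IW \<Longrightarrow> Cb r Aw (2 ^ n) (wl i n x)"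
  using Cb_dilate[OF w_Cb, of i n x] by (simp add: wl_def)

text \<open>A product of three counts: the number of indices, the number of translates that overlap
  at a point, and the size of one wavelet with its derivatives.\<close>

definition KP :: real where "KP = real (Suc (card IW)) * (2 * R + 1) ^ CARD('d) * Aw"

lemma KP_nonneg: "KP \<ge> 0" using R_pos Aw_nonneg by (simp add: KP_def)

lemma sum_wl_Cb:
  assumes I: "I \<subseteq> insert 0 IW" and F: "finite F" "F \<subseteq> lattice n"
    and c: "\<And>i x. i \<in> I \<Longrightarrow> x \<in> F \<Longrightarrow> \<bar>c i x\<bar> \<le> A" and A: "A \<ge> 0"
  shows "Cb r (KP * A) (2 ^ n) (\<lambda>z. \<Sum>i\<in>I. \<Sum>x\<in>F. c i x * wl i n x z)"
proof -
  have fI: "finite I" by (rule finite_subset[OF I]) simp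
  have cI: "card I \<le> Suc (card IW)" using card_mono[OF _ I] by simp
  have ck: "Ck r (\<lambda>z. \<Sum>x\<in>F. c i x * wl i n x z)" if "i \<in> I" for i
    using that I by (intro Ck_sum wl_Ck) auto
  have ck2: "Ck r (\<lambda>z. \<Sum>i\<in>I. 1 * (\<Sum>x\<in>F. c i x * wl i n x z))" by (intro Ck_sum ck)
  have "\<bar>ddir vs (\<lambda>z. \<Sum>i\<in>I. 1 * (\<Sum>x\<in>F. c i x * wl i n x z)) z\<bar> \<le> KP * A * (2 ^ n) ^ length vs"
    if vs: "length vs \<le> r" "set vs \<subseteq> Basis" for vs z
  proof -
    let ?G = "F \<inter> (lattice n \<inter> cball z (R / 2 ^ n))"
    have "ddir vs (\<lambda>z. \<Sum>i\<in>I. 1 * (\<Sum>x\<in>F. c i x * wl i n x z)) z = (\<Sum>i\<in>I. \<Sum>x\<in>F. c i x * ddir vs (wl i n x) z)"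
    proof -
      have "ddir vs (\<lambda>z. \<Sum>x\<in>F. c i x * wl i n x z) z = (\<Sum>x\<in>F. c i x * ddir vs (wl i n x) z)" if "i \<in> I" for i
        using that I vs(1) by (subst ddir_sum[where k = r]) (auto intro!: wl_Ck)
      then show ?thesis using vs(1) by (subst ddir_sum[where k = r]) (auto intro!: ck)
    qed
    also have "\<bar>\<dots>\<bar> \<le> (\<Sum>i\<in>I. (2 * R + 1) ^ CARD('d) * (A * (Aw * (2 ^ n) ^ length vs)))"
    proof (rule sum_abs[THEN order_trans], rule sum_mono)
      fix i assume i: "i \<in> I"
      then have i0: "i \<in> insert 0 IW" using I by auto
      have "(\<Sum>x\<in>F. c i x * ddir vs (wl i n x) z) = (\<Sum>x\<in>?G. c i x * ddir vs (wl i n x) z)"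
      proof (rule sum.mono_neutral_right)
        show "\<forall>x\<in>F - ?G. c i x * ddir vs (wl i n x) z = 0"
        proof
          fix x assume "x \<in> F - ?G"
          then have "z \<notin> cball x (R / 2 ^ n)" using F(2) by (auto simp: dist_commute)
          then have "z \<notin> supp (wl i n x)" using wl_supp_cball[OF i0] by blast
          then show "c i x * ddir vs (wl i n x) z = 0" by (simp add: ddir_notin_supp)
        qed
      qed (use F in auto)
      also have "\<bar>\<dots>\<bar> \<le> (\<Sum>x\<in>?G. A * (Aw * (2 ^ n) ^ length vs))"
      proof (rule sum_abs[THEN order_trans], rule sum_mono)
        fix x assume "x \<in> ?G"
        then show "\<bar>c i x * ddir vs (wl i n x) z\<bar> \<le> A * (Aw * (2 ^ n) ^ length vs)"
          unfolding abs_mult using c[OF i, of x] CbD[OF wl_Cb[OF i0] vs, of n x z] A by (intro mult_mono) auto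
      qed
      also have "\<dots> = real (card ?G) * (A * (Aw * (2 ^ n) ^ length vs))" by simp
      also have "\<dots> \<le> (2 * R + 1) ^ CARD('d) * (A * (Aw * (2 ^ n) ^ length vs))"
      proof (rule mult_right_mono)
        have "card ?G \<le> card (lattice n \<inter> cball z (R / 2 ^ n))" by (intro card_mono) auto
        then show "real (card ?G) \<le> (2 * R + 1) ^ CARD('d)" using near_card[of n z] by linarith
      qed (use A Aw_nonneg in auto)
      finally show "\<bar>\<Sum>x\<in>F. c i x * ddir vs (wl i n x) z\<bar> \<le> (2 * R + 1) ^ CARD('d) * (A * (Aw * (2 ^ n) ^ length vs))" .
    qed
    also have "\<dots> = real (card I) * ((2 * R + 1) ^ CARD('d) * (A * (Aw * (2 ^ n) ^ length vs)))" by simp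
    also have "\<dots> \<le> real (Suc (card IW)) * ((2 * R + 1) ^ CARD('d) * (A * (Aw * (2 ^ n) ^ length vs)))"
      using cI R_pos A Aw_nonneg by (intro mult_right_mono) auto
    finally show ?thesis by (simp add: KP_def mult_ac)
  qed
  then show ?thesis using ck2 KP_nonneg A by (simp add: Cb_def)
qed

lemma PP_Cb:
  assumes I: "good I" and u: "cc u" and A: "A \<ge> 0"
    and c: "\<And>i x. i \<in> I \<Longrightarrow> 2 ^ (CARD('d) * n) * \<bar>L2_inner u (wl i n x)\<bar> \<le> A"
  shows "Cb r (KP * A) (2 ^ n) (PP I n u)"
proof -
  obtain F where F: "finite F" "F \<subseteq> lattice n"
    "\<forall>i\<in>insert 0 IW. \<forall>x\<in>lattice n. L2_inner u (wl i n x) \<noteq> 0 \<longrightarrow> x \<in> F" using u by (rule coeff_supp)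
  show ?thesis unfolding PP_eq[OF I F]
    by (rule sum_wl_Cb) (use good_sub[OF I] F c A in \<open>auto simp: abs_mult\<close>)
qed

lemma PP_Cb_decay:
  assumes "Cb k B L u" "cc u" "k \<le> r + 1"
  shows "Cb r (KP * (Kd * B * (L / 2 ^ n) ^ k)) (2 ^ n) (PP IW n u)"
  using Kd_nonneg Cb_nonneg[OF assms(1)]
  by (intro PP_Cb coeff_decay[OF assms(1,2) _ assms(3)] assms(2)) auto

lemma PP_Cb_bound:
  assumes "Cb k B L u" "cc u" shows "Cb r (KP * (Kd * B)) (2 ^ n) (PP {0} n u)"
  using Kd_nonneg Cb_nonneg[OF assms(1)]
  by (intro PP_Cb coeff_bound[OF assms] assms(2)) auto

end


section \<open>Norms of extended nonnegative functions\<close>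

lemma powr_convex_nonneg:
  fixes x y u v P :: real
  assumes "P \<ge> 1" "x \<ge> 0" "y \<ge> 0" "u \<ge> 0" "v \<ge> 0" "u + v = 1"
  shows "(u * x + v * y) powr P \<le> u * x powr P + v * y powr P"
proof -
  \<comment> \<open>Settles the case where \<open>x\<close> or \<open>y\<close> is 0: the remaining
    weight enters on the left with the power \<open>P\<close>, and weights are at most 1.\<close>
  have le: "a powr P \<le> a" if "0 \<le> a" "a \<le> 1" for a :: real
    using powr_mono'[of 1 P a] that assms(1) by (cases "a = 0") auto
  show ?thesis
  proof (cases "x = 0 \<or> y = 0")
    case True
    then show ?thesis
    proof
      assume "x = 0"
      then show ?thesis using assms le[of v] by (simp add: powr_mult mult_right_mono)
    next
      assume "y = 0"
      then show ?thesis using assms le[of u] by (simp add: powr_mult mult_right_mono)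
    qed
  next
    case False
    have "u = 1 - v" using assms(6) by simp
    moreover have "((1 - v) * x + v * y) powr P \<le> (1 - v) * x powr P + v * y powr P"
      using False convex_onD[OF powr_convex[OF assms(1)], of v x y] assms by simp
    ultimately show ?thesis by simp
  qed
qed

lemma powr_convex_on_nonneg: "P \<ge> 1 \<Longrightarrow> convex_on {0..} (\<lambda>x::real. x powr P)"
  unfolding convex_on_def using powr_convex_nonneg[of P] by auto

text \<open>Jensen's inequality for the mean of the \<open>a x\<close>; afterwards the number of
  terms is replaced by its bound \<open>N\<close>, which enters with the nonnegative power
  \<open>P - 1\<close>.\<close>

lemma sum_powr_le:
  fixes a :: "'a \<Rightarrow> real"
  assumes "finite A" "P \<ge> 1" "\<And>x. x \<in> A \<Longrightarrow> a x \<ge> 0" "real (card A) \<le> N" "N \<ge> 1"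
  shows "(\<Sum>x\<in>A. a x) powr P \<le> N powr (P - 1) * (\<Sum>x\<in>A. a x powr P)"
proof (cases "A = {}")
  case False
  let ?n = "real (card A)"
  have n: "?n > 0" using False assms(1) by (simp add: card_gt_0_iff)
  have "(\<Sum>x\<in>A. (1 / ?n) *\<^sub>R a x) powr P \<le> (\<Sum>x\<in>A. (1 / ?n) * (a x powr P))"
    using n by (intro convex_on_sum[OF assms(1) False powr_convex_on_nonneg[OF assms(2)]]) (auto simp: assms)
  then have "((\<Sum>x\<in>A. a x) / ?n) powr P \<le> (\<Sum>x\<in>A. a x powr P) / ?n"
    by (simp add: sum_divide_distrib)
  then have "(\<Sum>x\<in>A. a x) powr P \<le> ?n powr P * ((\<Sum>x\<in>A. a x powr P) / ?n)"
    using n assms(3) by (simp add: powr_divide sum_nonneg field_simps)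
  also have "\<dots> = ?n powr (P - 1) * (\<Sum>x\<in>A. a x powr P)"
    using n by (simp add: powr_diff)
  also have "\<dots> \<le> N powr (P - 1) * (\<Sum>x\<in>A. a x powr P)"
    using n assms by (intro mult_right_mono powr_mono2 sum_nonneg) auto
  finally show ?thesis .
qed simp

lemma enn_powr_ennreal: "x \<ge> 0 \<Longrightarrow> enn_powr (ennreal x) a = ennreal (x powr a)"
  by (simp add: enn_powr_def)

lemma enn_powr_top [simp]: "enn_powr \<top> a = \<top>"
  by (simp add: enn_powr_def)

lemma enn_powr_0 [simp]: "enn_powr 0 a = 0"
  by (simp add: enn_powr_def)

lemma enn_powr_mono: assumes "x \<le> y" "a \<ge> 0" shows "enn_powr x a \<le> enn_powr y a"
proof (cases "y = \<top>")
  case False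
  then obtain y' where y: "y = ennreal y'" "y' \<ge> 0" by (cases y) auto
  then obtain x' where x: "x = ennreal x'" "x' \<ge> 0" using assms(1) by (cases x) (auto simp: top_unique)
  show ?thesis using assms x y by (simp add: enn_powr_ennreal powr_mono2)
qed simp

lemma enn_powr_inverse: assumes "a > 0" shows "enn_powr (enn_powr x a) (1 / a) = x"
  using assms by (cases x) (auto simp: enn_powr_ennreal powr_powr)

lemma enn_powr_mult:
  assumes "a > 0" "c \<ge> 0" shows "enn_powr (ennreal c * x) a = ennreal (c powr a) * enn_powr x a"
proof (cases x)
  case (real y)
  then have "ennreal c * x = ennreal (c * y)" using assms by (simp add: ennreal_mult)
  then have "enn_powr (ennreal c * x) a = ennreal ((c * y) powr a)"
    using real assms by (simp add: enn_powr_ennreal)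
  also have "\<dots> = ennreal (c powr a) * ennreal (y powr a)"
    using real assms by (subst powr_mult) (auto simp: ennreal_mult)
  finally show ?thesis using real by (simp add: enn_powr_ennreal)
next
  case top
  then show ?thesis using assms by (cases "c = 0") (auto simp: ennreal_mult_top)
qed

lemma enn_powr_measurable [measurable]:
  assumes [measurable]: "g \<in> borel_measurable M" shows "(\<lambda>x. enn_powr (g x) a) \<in> borel_measurable M"
  unfolding enn_powr_def by measurable

lemma Lnorm_le_iff:
  assumes "1 \<le> P" "a \<ge> 0"
  shows "Lnorm M (ennreal P) g \<le> ennreal a \<longleftrightarrow> (\<integral>\<^sup>+ x. enn_powr (g x) P \<partial>M) \<le> ennreal (a powr P)"
proof -
  let ?I = "\<integral>\<^sup>+ x. enn_powr (g x) P \<partial>M"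
  have eq: "Lnorm M (ennreal P) g = enn_powr ?I (1 / P)" using assms by (simp add: Lnorm_def)
  have a: "enn_powr (ennreal (a powr P)) (1 / P) = ennreal a" using assms by (simp add: enn_powr_ennreal powr_powr)
  show ?thesis
  proof
    assume "Lnorm M (ennreal P) g \<le> ennreal a"
    then have "enn_powr (enn_powr ?I (1 / P)) P \<le> enn_powr (ennreal a) P" using assms unfolding eq by (intro enn_powr_mono) auto
    then show "?I \<le> ennreal (a powr P)" using enn_powr_inverse[of "1 / P" ?I] assms by (simp add: enn_powr_ennreal)
  next
    assume "?I \<le> ennreal (a powr P)"
    then have "enn_powr ?I (1 / P) \<le> enn_powr (ennreal (a powr P)) (1 / P)" using assms by (intro enn_powr_mono) auto
    then show "Lnorm M (ennreal P) g \<le> ennreal a" unfolding eq a .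
  qed
qed

lemma ennreal_exponent_cases:
  assumes "(1::ennreal) \<le> p" obtains "p = \<top>" | P where "p = ennreal P" "1 \<le> P"
  using assms by (cases p) (auto simp: ennreal_1[symmetric] simp del: ennreal_1)

lemma Lnorm_mono_AE:
  assumes "1 \<le> p" "f \<in> borel_measurable M" "AE x in M. f x \<le> g x" shows "Lnorm M p f \<le> Lnorm M p g"
  using assms(1)
proof (cases rule: ennreal_exponent_cases)
  case 1 then show ?thesis using assms by (simp add: Lnorm_def esssup_AE_mono)
next
  case (2 P)
  have "AE x in M. enn_powr (f x) P \<le> enn_powr (g x) P"
    using assms(3) by eventually_elim (use 2 in \<open>auto intro: enn_powr_mono\<close>)
  then have "(\<integral>\<^sup>+ x. enn_powr (f x) P \<partial>M) \<le> (\<integral>\<^sup>+ x. enn_powr (g x) P \<partial>M)"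
    by (rule nn_integral_mono_AE)
  then show ?thesis using 2 by (auto simp: Lnorm_def intro!: enn_powr_mono)
qed

lemma Lnorm_cong_AE:
  assumes "1 \<le> p" "f \<in> borel_measurable M" "g \<in> borel_measurable M" "AE x in M. f x = g x"
  shows "Lnorm M p f = Lnorm M p g"
  using assms by (intro antisym Lnorm_mono_AE) auto

lemma Lnorm_cmult_le:
  assumes "1 \<le> p" "g \<in> borel_measurable M" "c \<ge> 0"
  shows "Lnorm M p (\<lambda>x. ennreal c * g x) \<le> ennreal c * Lnorm M p g"
  using assms(1)
proof (cases rule: ennreal_exponent_cases)
  case 1
  have "AE x in M. ennreal c * g x \<le> ennreal c * esssup M g"
    using esssup_AE[of g M] by eventually_elim (rule mult_left_mono; simp)
  then show ?thesis using assms(2) 1 by (simp add: Lnorm_def) (rule esssup_I; simp)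
next
  case (2 P)
  have "Lnorm M p (\<lambda>x. ennreal c * g x) = enn_powr (ennreal (c powr P) * (\<integral>\<^sup>+ x. enn_powr (g x) P \<partial>M)) (1 / P)"
    using 2 assms by (simp add: Lnorm_def enn_powr_mult nn_integral_cmult)
  also have "\<dots> = ennreal ((c powr P) powr (1 / P)) * Lnorm M p g" using 2 by (subst enn_powr_mult) (auto simp: Lnorm_def)
  also have "\<dots> = ennreal c * Lnorm M p g" using 2 assms(3) by (simp add: powr_powr)
  finally show ?thesis by simp
qed

text \<open>By convexity: divided by numbers \<open>a\<close> and \<open>b\<close> slightly above
  the norms, the two functions enter \<open>f + g\<close> as \<open>a + b\<close> times a convex
  combination. The slack \<open>e\<close> keeps \<open>a\<close> and \<open>b\<close> positive when
  a norm is 0 and is removed at the end.\<close>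

theorem Minkowski:
  assumes "1 \<le> p" and [measurable]: "f \<in> borel_measurable M" "g \<in> borel_measurable M"
  shows "Lnorm M p (\<lambda>x. f x + g x) \<le> Lnorm M p f + Lnorm M p g"
  using assms(1)
proof (cases rule: ennreal_exponent_cases)
  case 1
  have "AE x in M. f x + g x \<le> esssup M f + esssup M g"
    using esssup_AE[of f M] esssup_AE[of g M] by eventually_elim (rule add_mono)
  then show ?thesis using 1 by (simp add: Lnorm_def) (rule esssup_I; simp)
next
  case (2 P)
  show ?thesis
  proof (rule ennreal_le_epsilon)
    fix e :: real assume fin: "Lnorm M p f + Lnorm M p g < \<top>" and e: "0 < e"
    obtain A where A: "Lnorm M p f = ennreal A" "A \<ge> 0" using fin by (cases "Lnorm M p f") auto
    obtain B where B: "Lnorm M p g = ennreal B" "B \<ge> 0" using fin by (cases "Lnorm M p g") auto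
    define a b where "a = A + e / 2" and "b = B + e / 2"
    have ab: "a > 0" "b > 0" "A \<le> a" "B \<le> b" "a + b = A + B + e" using e A B by (auto simp: a_def b_def)
    have fa: "(\<integral>\<^sup>+ x. enn_powr (f x) P \<partial>M) \<le> ennreal (a powr P)"
      using A ab 2 by (subst Lnorm_le_iff[symmetric]) auto
    have gb: "(\<integral>\<^sup>+ x. enn_powr (g x) P \<partial>M) \<le> ennreal (b powr P)"
      using B ab 2 by (subst Lnorm_le_iff[symmetric]) auto
    \<comment> \<open>The coefficients that the convexity inequality puts in front of the two
      powers; they satisfy \<open>u * a powr P + v * b powr P = (a + b) powr P\<close>.\<close>
    define u v where "u = (a + b) powr P * (a / (a + b)) * (1 / a powr P)"
      and "v = (a + b) powr P * (b / (a + b)) * (1 / b powr P)"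
    have uv: "u \<ge> 0" "v \<ge> 0" using ab by (auto simp: u_def v_def)
    have pt: "enn_powr (f x + g x) P \<le> ennreal u * enn_powr (f x) P + ennreal v * enn_powr (g x) P" for x
    proof (cases "f x = \<top> \<or> g x = \<top>")
      case True
      have "u > 0" "v > 0" using ab by (auto simp: u_def v_def)
      then show ?thesis using True by (auto simp: ennreal_mult_top)
    next
      case False
      then obtain s t where s: "f x = ennreal s" "s \<ge> 0" and t: "g x = ennreal t" "t \<ge> 0"
        by (cases "f x"; cases "g x") auto
      have "(s + t) powr P = ((a + b) * (a / (a + b) * (s / a) + b / (a + b) * (t / b))) powr P"
        using ab(1,2) by (simp add: add_divide_distrib[symmetric])
      also have "\<dots> = (a + b) powr P * (a / (a + b) * (s / a) + b / (a + b) * (t / b)) powr P"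
        by (rule powr_mult)
      also have "\<dots> \<le> (a + b) powr P * (a / (a + b) * (s / a) powr P + b / (a + b) * (t / b) powr P)"
      proof (intro mult_left_mono powr_convex_nonneg)
        show "a / (a + b) + b / (a + b) = 1" using ab(1,2) by (simp add: add_divide_distrib[symmetric])
      qed (use ab(1,2) s t 2 in auto)
      also have "\<dots> = u * s powr P + v * t powr P"
        using ab s t by (simp add: u_def v_def powr_divide algebra_simps)
      finally have "ennreal ((s + t) powr P) \<le> ennreal (u * s powr P + v * t powr P)" by (rule ennreal_leI)
      then show ?thesis using s t uv
        by (simp add: enn_powr_ennreal ennreal_plus[symmetric] ennreal_mult[symmetric] del: ennreal_plus)
    qed
    have "(\<integral>\<^sup>+ x. enn_powr (f x + g x) P \<partial>M) \<le> (\<integral>\<^sup>+ x. ennreal u * enn_powr (f x) P + ennreal v * enn_powr (g x) P \<partial>M)"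
      by (intro nn_integral_mono pt)
    also have "\<dots> = ennreal u * (\<integral>\<^sup>+ x. enn_powr (f x) P \<partial>M) + ennreal v * (\<integral>\<^sup>+ x. enn_powr (g x) P \<partial>M)"
      by (simp add: nn_integral_add nn_integral_cmult)
    also have "\<dots> \<le> ennreal u * ennreal (a powr P) + ennreal v * ennreal (b powr P)"
      by (intro add_mono mult_left_mono fa gb) auto
    also have "\<dots> = ennreal (u * a powr P + v * b powr P)"
      using uv by (simp add: ennreal_mult)
    also have "u * a powr P + v * b powr P = (a + b) powr P"
    proof -
      have "u * a powr P = (a + b) powr P * (a / (a + b))" "v * b powr P = (a + b) powr P * (b / (a + b))"
        using ab(1,2) by (auto simp: u_def v_def)
      moreover have "a / (a + b) + b / (a + b) = 1" using ab(1,2) by (simp add: add_divide_distrib[symmetric])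
      ultimately show ?thesis by (simp only: distrib_left[symmetric] mult_1_right)
    qed
    finally have "Lnorm M p (\<lambda>x. f x + g x) \<le> ennreal (a + b)"
      using 2 ab by (simp add: Lnorm_le_iff)
    also have "\<dots> = Lnorm M p f + Lnorm M p g + ennreal e" using A B e ab by simp
    finally show "Lnorm M p (\<lambda>x. f x + g x) \<le> Lnorm M p f + Lnorm M p g + ennreal e" .
  qed
qed

lemma Lnorm_component: assumes "1 \<le> q" shows "g n \<le> Lnorm (count_space UNIV) q g"
  using assms
proof (cases rule: ennreal_exponent_cases)
  case 1
  have "AE n in count_space UNIV. g n \<le> esssup (count_space UNIV) g" by (rule esssup_AE)
  then show ?thesis using 1 by (simp add: AE_count_space Lnorm_def)
next
  case (2 P)
  have "enn_powr (g n) P = (\<integral>\<^sup>+ m. enn_powr (g n) P * indicator {n} m \<partial>count_space UNIV)"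
    by (simp add: nn_integral_cmult)
  also have "\<dots> \<le> (\<integral>\<^sup>+ m. enn_powr (g m) P \<partial>count_space UNIV)"
    by (intro nn_integral_mono) (auto simp: indicator_def)
  finally have "enn_powr (enn_powr (g n) P) (1 / P) \<le> enn_powr (\<integral>\<^sup>+ m. enn_powr (g m) P \<partial>count_space UNIV) (1 / P)"
    using 2 by (intro enn_powr_mono) auto
  then show ?thesis using 2 by (simp add: enn_powr_inverse Lnorm_def)
qed

text \<open>Every \<open>b n\<close> is at most \<open>S\<close>, so its power \<open>P\<close> is
  at most \<open>S powr (P - 1) * b n\<close>. A summable majorant thus controls all exponents
  \<open>q\<close> at once.\<close>

lemma Lnorm_seq_le:
  assumes "1 \<le> q" "summable b" "\<And>n. b n \<ge> 0" "\<And>n. g n \<le> ennreal (b n)" "suminf b \<le> S" "S > 0"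
  shows "Lnorm (count_space UNIV) q g \<le> ennreal S"
proof -
  have bS: "b n \<le> S" for n
    using sum_le_suminf[OF assms(2), of "{n}"] assms(3,5) by auto
  show ?thesis using assms(1)
  proof (cases rule: ennreal_exponent_cases)
    case 1
    have "AE n in count_space UNIV. g n \<le> ennreal S"
      using order_trans[OF assms(4) ennreal_leI[OF bS]] by (simp add: AE_count_space)
    then show ?thesis using 1 by (auto simp: Lnorm_def intro!: esssup_I)
  next
    case (2 P)
    have "(\<integral>\<^sup>+ n. enn_powr (g n) P \<partial>count_space UNIV) \<le> (\<integral>\<^sup>+ n. ennreal (S powr (P - 1) * b n) \<partial>count_space UNIV)"
    proof (rule nn_integral_mono)
      fix n
      have "enn_powr (g n) P \<le> ennreal (b n powr P)"
        using enn_powr_mono[OF assms(4), of P n] 2 assms(3) by (simp add: enn_powr_ennreal)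
      also have "b n powr P \<le> S powr (P - 1) * b n"
      proof (cases "b n = 0")
        case False
        then have "b n > 0" using assms(3)[of n] by simp
        then have "b n powr P = b n powr (P - 1) * b n" by (simp add: powr_diff)
        also have "\<dots> \<le> S powr (P - 1) * b n" using bS assms(3) 2 by (intro mult_right_mono powr_mono2) auto
        finally show ?thesis .
      qed (use 2 in simp)
      finally show "enn_powr (g n) P \<le> ennreal (S powr (P - 1) * b n)" by (simp add: ennreal_leI)
    qed
    also have "\<dots> = ennreal (\<Sum>n. S powr (P - 1) * b n)"
      using assms by (subst nn_integral_count_space_nat) (auto intro!: suminf_ennreal2 summable_mult)
    also have "(\<Sum>n. S powr (P - 1) * b n) = S powr (P - 1) * suminf b" using assms(2) by (rule suminf_mult)
    also have "\<dots> \<le> S powr (P - 1) * S" using assms by (intro mult_left_mono) auto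
    also have "\<dots> = S powr P" using assms(6) by (simp add: powr_diff)
    finally show ?thesis using 2 assms(6) by (simp add: Lnorm_le_iff ennreal_leI)
  qed
qed

text \<open>The constant \<open>v + 1\<close> dominates $v^{1/p}$ for every finite exponent as well
  as the value 1 that belongs to the essential supremum.\<close>

lemma Lnorm_bounded_support:
  assumes "1 \<le> p" "D \<in> sets M" "emeasure M D \<le> ennreal v" "v \<ge> 0" "g \<in> borel_measurable M"
    "\<And>x. x \<in> space M \<Longrightarrow> g x \<le> ennreal A * indicator D x" "A \<ge> 0"
  shows "Lnorm M p g \<le> ennreal (A * (v + 1))"
  using assms(1)
proof (cases rule: ennreal_exponent_cases)
  case 1
  have "AE x in M. g x \<le> ennreal (A * (v + 1))"
  proof (rule AE_I2)
    fix x assume x: "x \<in> space M"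
    have "g x \<le> ennreal A * indicator D x" by (rule assms(6)[OF x])
    also have "\<dots> \<le> ennreal A" by (auto simp: indicator_def)
    also have "\<dots> \<le> ennreal (A * (v + 1))" using assms by (intro ennreal_leI) (simp add: mult_le_cancel_left1)
    finally show "g x \<le> ennreal (A * (v + 1))" .
  qed
  then show ?thesis using assms(5) 1 by (auto simp: Lnorm_def intro!: esssup_I)
next
  case (2 P)
  have "(\<integral>\<^sup>+ x. enn_powr (g x) P \<partial>M) \<le> (\<integral>\<^sup>+ x. ennreal (A powr P) * indicator D x \<partial>M)"
  proof (rule nn_integral_mono)
    fix x assume x: "x \<in> space M"
    show "enn_powr (g x) P \<le> ennreal (A powr P) * indicator D x"
      using enn_powr_mono[OF assms(6)[OF x], of P] 2 assms(7) by (auto simp: indicator_def enn_powr_ennreal split: if_splits)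
  qed
  also have "\<dots> = ennreal (A powr P) * emeasure M D" using assms(2) by (simp add: nn_integral_cmult)
  also have "\<dots> \<le> ennreal (A powr P) * ennreal v" by (intro mult_left_mono assms(3)) auto
  also have "\<dots> \<le> ennreal ((A * (v + 1)) powr P)"
  proof -
    have "v \<le> (v + 1) powr P" using powr_mono[of 1 P "v + 1"] 2 assms(4) by simp
    then have "A powr P * v \<le> (A * (v + 1)) powr P" using assms by (simp add: powr_mult mult_left_mono)
    then show ?thesis using assms by (simp add: ennreal_mult[symmetric] ennreal_leI)
  qed
  finally show ?thesis using 2 assms by (subst 2(1), subst Lnorm_le_iff) auto
qed

text \<open>Hoelder's inequality against an indicator, with the crude constant \<open>v + 1\<close>.
  For finite exponents it follows from \<open>s \<le> 1 + s powr P\<close>, applied to the quotient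
  of \<open>g x\<close> by a number \<open>a\<close> above the norm; taking \<open>a\<close>
  strictly above keeps the division meaningful when the norm is 0.\<close>

lemma nn_integral_le_Lnorm:
  assumes "1 \<le> p" and [measurable]: "D \<in> sets M" and "emeasure M D \<le> ennreal v" "v \<ge> 0" and [measurable]: "g \<in> borel_measurable M"
  shows "(\<integral>\<^sup>+ x. g x * indicator D x \<partial>M) \<le> ennreal (v + 1) * Lnorm M p g"
proof (cases "Lnorm M p g")
  case top
  then show ?thesis using assms(4) by (simp add: ennreal_mult_top)
next
  case (real N)
  have *: "(\<integral>\<^sup>+ x. g x * indicator D x \<partial>M) \<le> ennreal ((v + 1) * a)" if a: "a > N" for a
    using assms(1)
  proof (cases rule: ennreal_exponent_cases)
    case 1
    have "AE x in M. g x \<le> ennreal N" using esssup_AE[of g M] real 1 by (simp add: Lnorm_def)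
    then have "AE x in M. g x * indicator D x \<le> ennreal N * indicator D x"
      by eventually_elim (auto simp: indicator_def)
    then have "(\<integral>\<^sup>+ x. g x * indicator D x \<partial>M) \<le> (\<integral>\<^sup>+ x. ennreal N * indicator D x \<partial>M)"
      by (rule nn_integral_mono_AE)
    also have "\<dots> \<le> ennreal N * ennreal v" using assms(3) by (simp add: nn_integral_cmult mult_left_mono)
    also have "\<dots> \<le> ennreal ((v + 1) * a)" using real a assms(4)
      by (subst ennreal_mult[symmetric]) (auto intro!: ennreal_leI simp: mult.commute[of N] intro: mult_mono)
    finally show ?thesis .
  next
    case (2 P)
    have a0: "a > 0" using a real by simp
    have "(\<integral>\<^sup>+ x. enn_powr (g x) P \<partial>M) \<le> ennreal (a powr P)"
      using real a a0 2 by (subst Lnorm_le_iff[symmetric]) (auto intro: ennreal_leI)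
    then have i: "ennreal (a / a powr P) * (\<integral>\<^sup>+ x. enn_powr (g x) P \<partial>M) \<le> ennreal (a / a powr P) * ennreal (a powr P)"
      by (rule mult_left_mono) simp
    have "(\<integral>\<^sup>+ x. g x * indicator D x \<partial>M) \<le> (\<integral>\<^sup>+ x. ennreal a * indicator D x + ennreal (a / a powr P) * enn_powr (g x) P \<partial>M)"
    proof (rule nn_integral_mono)
      fix x
      have "g x \<le> ennreal a + ennreal (a / a powr P) * enn_powr (g x) P"
      proof (cases "g x")
        case top then show ?thesis using a0 by (simp add: ennreal_mult_top)
      next
        case (real s)
        have "s / a \<le> 1 + (s / a) powr P"
        proof (cases "s / a \<le> 1")
          case True then show ?thesis by (smt (verit) powr_ge_zero)
        next
          case False
          then have "(s / a) powr 1 \<le> (s / a) powr P" using 2 by (intro powr_mono) auto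
          moreover have "(s / a) powr 1 = s / a" by (rule powr_one) (use False in linarith)
          ultimately show ?thesis by linarith
        qed
        then have "s \<le> a + a / a powr P * s powr P" using a0 real by (simp add: powr_divide field_simps)
        then show ?thesis using real a0
          by (simp add: enn_powr_ennreal ennreal_mult[symmetric] ennreal_plus[symmetric] ennreal_leI del: ennreal_plus)
      qed
      then show "g x * indicator D x \<le> ennreal a * indicator D x + ennreal (a / a powr P) * enn_powr (g x) P"
        by (auto simp: indicator_def)
    qed
    also have "\<dots> = ennreal a * emeasure M D + ennreal (a / a powr P) * (\<integral>\<^sup>+ x. enn_powr (g x) P \<partial>M)"
      by (simp add: nn_integral_add nn_integral_cmult)
    also have "\<dots> \<le> ennreal a * ennreal v + ennreal (a / a powr P) * ennreal (a powr P)"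
      by (rule add_mono[OF mult_left_mono[OF assms(3)] i]) simp
    also have "\<dots> = ennreal ((v + 1) * a)" using a0 assms(4)
      by (simp add: ennreal_mult[symmetric] ennreal_plus[symmetric] algebra_simps del: ennreal_plus)
    finally show ?thesis .
  qed
  show ?thesis
  proof (rule ennreal_le_epsilon)
    fix e :: real assume e: "0 < e"
    have "(\<integral>\<^sup>+ x. g x * indicator D x \<partial>M) \<le> ennreal ((v + 1) * (N + e / (v + 1)))" by (rule *) (use e assms(4) in simp)
    also have "(v + 1) * (N + e / (v + 1)) = (v + 1) * N + e" using assms(4) by (simp add: field_simps)
    also have "ennreal ((v + 1) * N + e) = ennreal (v + 1) * Lnorm M p g + ennreal e"
      using real e assms(4) by (simp add: ennreal_mult)
    finally show "(\<integral>\<^sup>+ x. g x * indicator D x \<partial>M) \<le> ennreal (v + 1) * Lnorm M p g + ennreal e" .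
  qed
qed

text \<open>A weighted $l^p$ norm is at most \<open>\<Lambda>\<close>, with the root cleared. The
  weight in use is \<open>1 / 2 ^ (CARD('d) * n)\<close>, the volume of a cell of the lattice, which
  makes this norm comparable to the $L^p$ norm of the wavelet sum.\<close>

definition coef_ok :: "ennreal \<Rightarrow> real \<Rightarrow> 'a set \<Rightarrow> ('a \<Rightarrow> real) \<Rightarrow> real \<Rightarrow> bool" where
  "coef_ok p wt J c \<Lambda> \<longleftrightarrow>
     (if p = \<top> then \<forall>x\<in>J. \<bar>c x\<bar> \<le> \<Lambda>
      else (\<Sum>x\<in>J. wt * \<bar>c x\<bar> powr enn2real p) \<le> \<Lambda> powr enn2real p)"

text \<open>A discrete Schur test. The number \<open>N\<close> bounds the rows, by counting the
  \<open>x\<close> within \<open>\<rho>\<close> of \<open>z\<close>, and also the columns, by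
  comparing the volume of a ball with \<open>wt\<close>. Jensen in the rows contributes
  \<open>N powr (P - 1)\<close> and integration of the columns one more factor
  \<open>N\<close>.\<close>

theorem Schur_bound:
  fixes J :: "(real ^ 'd) set"
  assumes p: "1 \<le> p" and J: "finite J" and k: "\<And>x z. x \<in> J \<Longrightarrow> \<bar>k x z\<bar> \<le> (if dist z x \<le> \<rho> then \<kappa> else 0)"
    and meas: "\<And>x. x \<in> J \<Longrightarrow> k x \<in> borel_measurable borel"
    and N: "\<And>z. real (card (J \<inter> cball z \<rho>)) \<le> N" "N \<ge> 1" and \<kappa>: "\<kappa> \<ge> 0" and \<rho>: "\<rho> \<ge> 0"
    and wt: "wt > 0" "(2 * \<rho>) ^ CARD('d) \<le> N * wt" and ok: "coef_ok p wt J c \<Lambda>" and \<Lambda>: "\<Lambda> \<ge> 0"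
  shows "Lnorm lborel p (\<lambda>z. ennreal \<bar>\<Sum>x\<in>J. c x * k x z\<bar>) \<le> ennreal (\<kappa> * N * \<Lambda>)"
proof -
  let ?G = "\<lambda>z. J \<inter> cball z \<rho>"
  have pt: "\<bar>\<Sum>x\<in>J. c x * k x z\<bar> \<le> \<kappa> * (\<Sum>x\<in>?G z. \<bar>c x\<bar>)" for z
  proof -
    have "(\<Sum>x\<in>J. c x * k x z) = (\<Sum>x\<in>?G z. c x * k x z)"
    proof (rule sum.mono_neutral_right)
      show "\<forall>x\<in>J - ?G z. c x * k x z = 0"
      proof
        fix x assume "x \<in> J - ?G z" then show "c x * k x z = 0" using k[of x z] by auto
      qed
    qed (use J in auto)
    also have "\<bar>\<dots>\<bar> \<le> (\<Sum>x\<in>?G z. \<kappa> * \<bar>c x\<bar>)"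
    proof (rule sum_abs[THEN order_trans], rule sum_mono)
      fix x assume "x \<in> ?G z"
      then have "\<bar>k x z\<bar> \<le> \<kappa>" using k[of x z] by auto
      then show "\<bar>c x * k x z\<bar> \<le> \<kappa> * \<bar>c x\<bar>" by (simp add: abs_mult mult.commute[of \<kappa>] mult_left_mono)
    qed
    finally show ?thesis by (simp add: sum_distrib_left)
  qed
  have m: "(\<lambda>z. ennreal \<bar>\<Sum>x\<in>J. c x * k x z\<bar>) \<in> borel_measurable lborel"
    using meas by simp
  show ?thesis using p
  proof (cases rule: ennreal_exponent_cases)
    case 1
    have "\<bar>\<Sum>x\<in>J. c x * k x z\<bar> \<le> \<kappa> * N * \<Lambda>" for z
    proof -
      have "(\<Sum>x\<in>?G z. \<bar>c x\<bar>) \<le> (\<Sum>x\<in>?G z. \<Lambda>)" using ok 1 by (intro sum_mono) (auto simp: coef_ok_def)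
      also have "\<dots> \<le> N * \<Lambda>" using N(1)[of z] \<Lambda> by (simp add: mult_right_mono)
      finally have "\<kappa> * (\<Sum>x\<in>?G z. \<bar>c x\<bar>) \<le> \<kappa> * (N * \<Lambda>)" using \<kappa> by (rule mult_left_mono)
      then show ?thesis using pt[of z] by (simp add: mult.assoc)
    qed
    then show ?thesis using m 1 by (auto simp: Lnorm_def intro!: esssup_I ennreal_leI)
  next
    case (2 P)
    let ?K = "\<kappa> powr P * N powr (P - 1)"
    have K: "?K \<ge> 0" by simp
    have okP: "(\<Sum>x\<in>J. wt * \<bar>c x\<bar> powr P) \<le> \<Lambda> powr P" using ok 2 by (simp add: coef_ok_def)
    have "(\<integral>\<^sup>+ z. enn_powr (ennreal \<bar>\<Sum>x\<in>J. c x * k x z\<bar>) P \<partial>lborel) \<le>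
       (\<integral>\<^sup>+ z. (\<Sum>x\<in>J. ennreal (?K * \<bar>c x\<bar> powr P) * indicator (cball x \<rho>) z) \<partial>lborel)"
    proof (rule nn_integral_mono)
      fix z
      have "\<bar>\<Sum>x\<in>J. c x * k x z\<bar> powr P \<le> (\<kappa> * (\<Sum>x\<in>?G z. \<bar>c x\<bar>)) powr P"
        using 2 by (intro powr_mono2 pt) auto
      also have "\<dots> = \<kappa> powr P * (\<Sum>x\<in>?G z. \<bar>c x\<bar>) powr P" by (rule powr_mult)
      also have "\<dots> \<le> \<kappa> powr P * (N powr (P - 1) * (\<Sum>x\<in>?G z. \<bar>c x\<bar> powr P))"
        using J 2 N by (intro mult_left_mono sum_powr_le) auto
      also have "\<dots> = (\<Sum>x\<in>?G z. ?K * \<bar>c x\<bar> powr P)" by (simp add: sum_distrib_left mult.assoc)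
      also have "\<dots> = (\<Sum>x\<in>J. ?K * \<bar>c x\<bar> powr P * indicator (cball x \<rho>) z)"
        using J by (intro sum.mono_neutral_cong_left) (auto simp: indicator_def dist_commute)
      finally have "ennreal (\<bar>\<Sum>x\<in>J. c x * k x z\<bar> powr P) \<le> ennreal (\<Sum>x\<in>J. ?K * \<bar>c x\<bar> powr P * indicator (cball x \<rho>) z)"
        by (rule ennreal_leI)
      also have "\<dots> = (\<Sum>x\<in>J. ennreal (?K * \<bar>c x\<bar> powr P * indicator (cball x \<rho>) z))"
        by (intro sum_ennreal[symmetric]) auto
      also have "\<dots> = (\<Sum>x\<in>J. ennreal (?K * \<bar>c x\<bar> powr P) * indicator (cball x \<rho>) z)"
        by (intro sum.cong) (auto simp: indicator_def)
      finally show "enn_powr (ennreal \<bar>\<Sum>x\<in>J. c x * k x z\<bar>) P \<le> (\<Sum>x\<in>J. ennreal (?K * \<bar>c x\<bar> powr P) * indicator (cball x \<rho>) z)"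
        by (simp add: enn_powr_ennreal)
    qed
    also have "\<dots> = (\<Sum>x\<in>J. ennreal (?K * \<bar>c x\<bar> powr P) * emeasure lborel (cball x \<rho>))"
    proof (subst nn_integral_sum)
      show "(\<Sum>x\<in>J. \<integral>\<^sup>+ z. ennreal (?K * \<bar>c x\<bar> powr P) * indicator (cball x \<rho>) z \<partial>lborel) =
          (\<Sum>x\<in>J. ennreal (?K * \<bar>c x\<bar> powr P) * emeasure lborel (cball x \<rho>))"
        by (intro sum.cong refl nn_integral_cmult_indicator) simp
      show "(\<lambda>z. ennreal (?K * \<bar>c x\<bar> powr P) * indicator (cball x \<rho>) z) \<in> borel_measurable lborel" for x
        by (intro borel_measurable_times_ennreal borel_measurable_const borel_measurable_indicator) simp
    qed
    also have "\<dots> \<le> (\<Sum>x\<in>J. ennreal (?K * \<bar>c x\<bar> powr P) * ennreal (N * wt))"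
      using emeasure_cball_le[OF \<rho>] wt(2)
      by (intro sum_mono mult_left_mono) (auto intro: order_trans ennreal_leI)
    also have "\<dots> = (\<Sum>x\<in>J. ennreal (?K * N * (wt * \<bar>c x\<bar> powr P)))"
      using N(2) wt(1) by (auto intro!: sum.cong arg_cong[of _ _ ennreal] simp: ennreal_mult[symmetric] mult_ac)
    also have "\<dots> = ennreal (\<Sum>x\<in>J. ?K * N * (wt * \<bar>c x\<bar> powr P))" using N(2) wt(1) by (intro sum_ennreal) auto
    also have "(\<Sum>x\<in>J. ?K * N * (wt * \<bar>c x\<bar> powr P)) = ?K * N * (\<Sum>x\<in>J. wt * \<bar>c x\<bar> powr P)" by (rule sum_distrib_left[symmetric])
    also have "ennreal \<dots> \<le> ennreal (?K * N * \<Lambda> powr P)"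
      using N(2) by (intro ennreal_leI mult_left_mono okP) auto
    also have "?K * N * \<Lambda> powr P = (\<kappa> * N * \<Lambda>) powr P"
      using N(2) \<kappa> \<Lambda> by (simp add: powr_mult powr_diff)
    finally show ?thesis using 2 \<kappa> N(2) \<Lambda> by (simp add: Lnorm_le_iff)
  qed
qed


section \<open>Estimates for Besov norms\<close>

lemma Lnorm_seq_le':
  assumes "1 \<le> q" "summable b" "\<And>n. b n \<ge> 0" "\<And>n. g n \<le> ennreal (b n)" "suminf b \<le> S"
  shows "Lnorm (count_space UNIV) q g \<le> ennreal S"
proof (rule ennreal_le_epsilon)
  fix e :: real assume e: "0 < e"
  have S: "S \<ge> 0" using suminf_nonneg[OF assms(2,3)] assms(5) by linarith
  have "Lnorm (count_space UNIV) q g \<le> ennreal (S + e)"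
    by (rule Lnorm_seq_le[OF assms(1-4)]) (use assms(5) e S in auto)
  then show "Lnorm (count_space UNIV) q g \<le> ennreal S + ennreal e" using S e by simp
qed

text \<open>The row sum of a matrix that decays geometrically with the distance from the diagonal:
  one geometric series on either side.\<close>

lemma summable_dist_power:
  fixes \<delta> :: real and n :: nat
  assumes \<delta>: "0 \<le> \<delta>" "\<delta> < 1"
  defines "h \<equiv> \<lambda>m. \<delta> ^ (if m \<le> n then n - m else m - n)"
  shows "summable h" "suminf h \<le> 2 / (1 - \<delta>)"
proof -
  have tail: "h (m + n) = \<delta> ^ m" for m by (auto simp: h_def)
  have sg: "summable (\<lambda>m. \<delta> ^ m)" using \<delta> by (intro summable_geometric) simp
  then show s: "summable h" using summable_iff_shift[of h n] tail by simp
  have "(\<Sum>m<n. h m) = (\<Sum>m<n. \<delta> ^ (n - m))" by (intro sum.cong) (auto simp: h_def)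
  also have "\<dots> = (\<Sum>m<n. \<delta> ^ Suc m)"
    by (rule sum.reindex_bij_witness[of _ "\<lambda>m. n - Suc m" "\<lambda>m. n - Suc m"]) (auto simp: Suc_diff_Suc)
  also have "\<dots> \<le> (\<Sum>m<n. \<delta> ^ m)" using \<delta> by (intro sum_mono) (simp add: mult_left_le_one_le)
  also have "\<dots> \<le> (\<Sum>m. \<delta> ^ m)" using \<delta> by (intro sum_le_suminf sg) auto
  finally have "(\<Sum>m<n. h m) \<le> 1 / (1 - \<delta>)" using \<delta> by (simp add: suminf_geometric)
  moreover have "suminf h = (\<Sum>m. h (m + n)) + (\<Sum>m<n. h m)" by (rule suminf_split_initial_segment[OF s])
  moreover have "(\<Sum>m. h (m + n)) = 1 / (1 - \<delta>)" using \<delta> tail by (simp add: suminf_geometric)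
  ultimately show "suminf h \<le> 2 / (1 - \<delta>)" by (simp add: add_divide_distrib[symmetric])
qed

lemma Cinf_c_Ck: "\<theta> \<in> Cinf_c U \<Longrightarrow> Ck k \<theta>"
  by (auto simp: Cinf_c_def Crc_def)

lemma Cinf_c_Crc: "\<theta> \<in> Cinf_c U \<Longrightarrow> \<theta> \<in> Crc k U"
  by (auto simp: Cinf_c_def)

lemma Cinf_c_cc: "\<theta> \<in> Cinf_c U \<Longrightarrow> cc \<theta>"
  using Crc_cc Cinf_c_Crc by blast

lemma Cinf_c_supp: "\<theta> \<in> Cinf_c U \<Longrightarrow> supp \<theta> \<subseteq> U" "\<theta> \<in> Cinf_c U \<Longrightarrow> compact (supp \<theta>)"
  using Cinf_c_Crc[of \<theta> U 0] by (auto simp: Crc_def)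

lemma Cinf_c_Cb: "\<theta> \<in> Cinf_c U \<Longrightarrow> \<exists>A. Cb k A 1 \<theta>"
  using compact_supp_Cb Cinf_c_Ck Cinf_c_supp by blast

context wavelets
begin

lemma PP_add:
  assumes "cc f" "cc g" "good I"
  shows "PP I n (\<lambda>z. f z + g z) z = PP I n f z + PP I n g z"
proof -
  have "L2_inner (\<lambda>z. f z + g z) (wl i n x) = L2_inner f (wl i n x) + L2_inner g (wl i n x)" if "i \<in> I" for i x
    using L2_inner_lincomb[OF cc_L2[OF assms(1)] cc_L2[OF assms(2)] wl_L2[OF good_sub[OF assms(3) that]], of 1 1] by simp
  then show ?thesis unfolding PP_def by (simp add: algebra_simps sum.distrib)
qed

lemma PP_cmult: "PP I n (\<lambda>z. c * g z) z = c * PP I n g z"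
  unfolding PP_def by (simp add: L2_inner_cmult sum_distrib_left mult_ac)

lemma PP_sum:
  assumes "\<And>x. x \<in> J \<Longrightarrow> cc (f x)" "good I"
  shows "PP I n (\<lambda>z. \<Sum>x\<in>J. c x * f x z) z = (\<Sum>x\<in>J. c x * PP I n (f x) z)"
  using assms(1)
proof (induction J rule: infinite_finite_induct)
  case (insert x J)
  then have "PP I n (\<lambda>z. c x * f x z + (\<Sum>x\<in>J. c x * f x z)) z = c x * PP I n (f x) z + (\<Sum>x\<in>J. c x * PP I n (f x) z)"
    using PP_add[of "\<lambda>z. c x * f x z" "\<lambda>z. \<Sum>x\<in>J. c x * f x z" I n z] assms(2) by (simp add: cc_cmult cc_sum PP_cmult)
  then show ?case using insert by simp
qed (simp_all add: PP_def L2_inner_def)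

lemma PP_supp:
  assumes "good I" "\<And>z. \<rho> < norm z \<Longrightarrow> u z = 0" "\<rho> + 2 * R < norm z"
  shows "PP I n u z = 0"
  unfolding PP_def
proof (intro sum.neutral ballI)
  fix i x assume i: "i \<in> I" and x: "x \<in> lattice n \<inter> cball z (R / 2 ^ n)"
  have R2: "R / 2 ^ n \<le> R" using R_pos by (simp add: field_simps one_le_power)
  have "L2_inner u (wl i n x) = 0"
  proof (rule inner_eq_0[OF good_sub[OF assms(1) i]])
    fix z' assume z': "u z' \<noteq> 0" "dist x z' < R / 2 ^ n"
    have "dist z x \<le> R" using x R2 by auto
    moreover have "dist x z' \<le> R" using z' R2 by auto
    moreover have "norm z' \<le> \<rho>" using assms(2)[of z'] z'(1) by force
    moreover have "norm z \<le> norm z' + dist z x + dist x z'"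
      using dist_triangle[of z z' x] norm_triangle_sub[of z z'] by (simp add: dist_norm)
    ultimately show False using assms(3) by linarith
  qed
  then show "2 ^ (CARD('d) * n) * L2_inner u (wl i n x) * wl i n x z = 0" by simp
qed

definition bl :: "nat set \<Rightarrow> nat \<Rightarrow> ennreal \<Rightarrow> (real ^ 'd \<Rightarrow> real) \<Rightarrow> ennreal" where
  "bl I n p g = Lnorm lborel p (\<lambda>z. ennreal \<bar>PP I n g z\<bar>)"

lemma PP_meas: "good I \<Longrightarrow> cc g \<Longrightarrow> (\<lambda>z. ennreal \<bar>PP I n g z\<bar>) \<in> borel_measurable lborel"
  using cc_measurable[OF PP_cc] by simp

text \<open>Replaces the representatives picked by \<open>L2_proj\<close> with the explicit
  continuous projections. They agree almost everywhere, which the $L^p$ norms do not see; all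
  estimates below can then be pointwise.\<close>

lemma Besov_eq:
  assumes "1 \<le> p" "cc g"
  shows "Besov_norm V \<alpha> p q g = bl {0} 0 p g +
    Lnorm (count_space UNIV) q (\<lambda>n. ennreal (2 powr (\<alpha> * real n)) * bl IW n p g)"
proof -
  have "Lnorm lborel p (\<lambda>x. ennreal \<bar>L2_proj (Sp I n) g x\<bar>) = bl I n p g" if "good I" for I n
    unfolding bl_def
  proof (rule Lnorm_cong_AE[OF assms(1) _ PP_meas[OF that assms(2)]])
    show "AE x in lborel. ennreal \<bar>L2_proj (Sp I n) g x\<bar> = ennreal \<bar>PP I n g x\<bar>"
      using L2_proj_PP(1)[OF that assms(2), of n] by eventually_elim simp
  qed (use L2_proj_PP(2)[OF that assms(2), of n] in simp)
  from this[of "{0}" 0] this[of IW] show ?thesis by (simp add: Besov_norm_def)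
qed

lemma bl_add: "1 \<le> p \<Longrightarrow> cc f \<Longrightarrow> cc g \<Longrightarrow> good I \<Longrightarrow> bl I n p (\<lambda>z. f z + g z) \<le> bl I n p f + bl I n p g"
  unfolding bl_def
proof -
  assume a: "1 \<le> p" "cc f" "cc g" "good I"
  have "Lnorm lborel p (\<lambda>z. ennreal \<bar>PP I n (\<lambda>z. f z + g z) z\<bar>) \<le>
    Lnorm lborel p (\<lambda>z. ennreal \<bar>PP I n f z\<bar> + ennreal \<bar>PP I n g z\<bar>)"
    using a PP_meas[of I "\<lambda>z. f z + g z" n]
    by (intro Lnorm_mono_AE) (auto intro!: cc_add ennreal_leI simp: PP_add ennreal_plus[symmetric] simp del: ennreal_plus)
  also have "\<dots> \<le> Lnorm lborel p (\<lambda>z. ennreal \<bar>PP I n f z\<bar>) + Lnorm lborel p (\<lambda>z. ennreal \<bar>PP I n g z\<bar>)"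
    using a by (intro Minkowski PP_meas)
  finally show "Lnorm lborel p (\<lambda>z. ennreal \<bar>PP I n (\<lambda>z. f z + g z) z\<bar>) \<le>
    Lnorm lborel p (\<lambda>z. ennreal \<bar>PP I n f z\<bar>) + Lnorm lborel p (\<lambda>z. ennreal \<bar>PP I n g z\<bar>)" .
qed

lemma bl_cmult: assumes "1 \<le> p" "cc g" "good I" shows "bl I n p (\<lambda>z. c * g z) \<le> ennreal \<bar>c\<bar> * bl I n p g"
proof -
  have "(\<lambda>z. ennreal \<bar>PP I n (\<lambda>z. c * g z) z\<bar>) = (\<lambda>z. ennreal \<bar>c\<bar> * ennreal \<bar>PP I n g z\<bar>)"
    by (simp add: PP_cmult abs_mult ennreal_mult)
  then show ?thesis unfolding bl_def using Lnorm_cmult_le[OF assms(1) PP_meas[OF assms(3,2)], of "\<bar>c\<bar>" n] by simp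
qed

end

locale besov = wavelets r R \<phi> \<psi> V
  for r R and \<phi> :: "real ^ 'd \<Rightarrow> real" and \<psi> V +
  fixes p q :: ennreal and \<alpha> :: real
  assumes p: "1 \<le> p" and q: "1 \<le> q" and \<alpha>: "\<bar>\<alpha>\<bar> < real r"
begin

abbreviation BN :: "(real ^ 'd \<Rightarrow> real) \<Rightarrow> ennreal" where "BN \<equiv> Besov_norm V \<alpha> p q"

lemma BN_add: assumes "cc f" "cc g" shows "BN (\<lambda>z. f z + g z) \<le> BN f + BN g"
proof -
  let ?L = "Lnorm (count_space UNIV) q" and ?w = "\<lambda>n. ennreal (2 powr (\<alpha> * real n))"
  have "?L (\<lambda>n. ?w n * bl IW n p (\<lambda>z. f z + g z)) \<le> ?L (\<lambda>n. ?w n * bl IW n p f + ?w n * bl IW n p g)"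
    using bl_add[OF p assms, of IW] by (intro Lnorm_mono_AE q) (auto intro!: mult_left_mono simp: distrib_left[symmetric])
  also have "\<dots> \<le> ?L (\<lambda>n. ?w n * bl IW n p f) + ?L (\<lambda>n. ?w n * bl IW n p g)" by (intro Minkowski q) auto
  finally have F: "?L (\<lambda>n. ?w n * bl IW n p (\<lambda>z. f z + g z)) \<le> ?L (\<lambda>n. ?w n * bl IW n p f) + ?L (\<lambda>n. ?w n * bl IW n p g)" .
  show ?thesis
    unfolding Besov_eq[OF p assms(1)] Besov_eq[OF p assms(2)] Besov_eq[OF p cc_add[OF assms]]
    using add_mono[OF bl_add[OF p assms good_simps(1), of 0] F] by (simp add: ac_simps)
qed

lemma BN_cmult: assumes "cc g" shows "BN (\<lambda>z. c * g z) \<le> ennreal \<bar>c\<bar> * BN g"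
proof -
  let ?L = "Lnorm (count_space UNIV) q" and ?w = "\<lambda>n. ennreal (2 powr (\<alpha> * real n))"
  have "?L (\<lambda>n. ?w n * bl IW n p (\<lambda>z. c * g z)) \<le> ?L (\<lambda>n. ennreal \<bar>c\<bar> * (?w n * bl IW n p g))"
    using bl_cmult[OF p assms, of IW] by (intro Lnorm_mono_AE q) (auto intro!: mult_left_mono simp: mult.left_commute[of "ennreal \<bar>c\<bar>"])
  also have "\<dots> \<le> ennreal \<bar>c\<bar> * ?L (\<lambda>n. ?w n * bl IW n p g)" by (intro Lnorm_cmult_le q) auto
  finally show ?thesis
    unfolding Besov_eq[OF p assms(1)] Besov_eq[OF p cc_cmult[OF assms]] distrib_left
    using add_mono[OF bl_cmult[OF p assms, of "{0}" 0 c]] by simp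
qed

lemma BN_0: "BN (\<lambda>z. 0) = 0"
  using BN_cmult[of "\<lambda>z. 0" 0] by simp

lemma BN_commute: assumes "cc f" "cc g" shows "BN (\<lambda>z. f z - g z) = BN (\<lambda>z. g z - f z)"
proof -
  have "BN (\<lambda>z. f z - g z) \<le> BN (\<lambda>z. g z - f z)" if "cc f" "cc g" for f g
    using BN_cmult[OF cc_diff[OF that(2,1)], of "-1"] by simp
  then show ?thesis using assms by (intro antisym) auto
qed

lemma BN_diff_triangle:
  assumes "cc f" "cc g" "cc h" shows "BN (\<lambda>z. f z - h z) \<le> BN (\<lambda>z. f z - g z) + BN (\<lambda>z. g z - h z)"
  using BN_add[OF cc_diff[OF assms(1,2)] cc_diff[OF assms(2,3)]] by simp

lemma BN_sum:
  "finite I \<Longrightarrow> (\<And>i. i \<in> I \<Longrightarrow> cc (f i)) \<Longrightarrow> BN (\<lambda>z. \<Sum>i\<in>I. f i z) \<le> (\<Sum>i\<in>I. BN (f i))"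
proof (induction I rule: finite_induct)
  case (insert i I)
  then have "BN (\<lambda>z. f i z + (\<Sum>i\<in>I. f i z)) \<le> BN (f i) + BN (\<lambda>z. \<Sum>i\<in>I. f i z)" by (intro BN_add cc_sum) auto
  also have "\<dots> \<le> BN (f i) + (\<Sum>i\<in>I. BN (f i))" using insert by (intro add_left_mono) auto
  finally show ?case using insert by simp
qed (simp add: BN_0)

lemma BN_le:
  assumes "cc g" "bl {0} 0 p g \<le> ennreal a" "\<And>n. bl IW n p g \<le> ennreal (b n)" "\<And>n. b n \<ge> 0" "a \<ge> 0"
    "\<And>n. 2 powr (\<alpha> * real n) * b n \<le> c n" "summable c" "suminf c \<le> S"
  shows "BN g \<le> ennreal (a + S)"
proof -
  have c0: "c n \<ge> 0" for n using assms(4,6)[of n] by (meson mult_nonneg_nonneg order_trans powr_ge_zero)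
  have "ennreal (2 powr (\<alpha> * real n)) * bl IW n p g \<le> ennreal (c n)" for n
  proof -
    have "ennreal (2 powr (\<alpha> * real n)) * bl IW n p g \<le> ennreal (2 powr (\<alpha> * real n)) * ennreal (b n)"
      by (intro mult_left_mono assms) auto
    also have "\<dots> = ennreal (2 powr (\<alpha> * real n) * b n)" using assms(4) by (simp add: ennreal_mult)
    also have "\<dots> \<le> ennreal (c n)" by (intro ennreal_leI assms)
    finally show ?thesis .
  qed
  then have "Lnorm (count_space UNIV) q (\<lambda>n. ennreal (2 powr (\<alpha> * real n)) * bl IW n p g) \<le> ennreal S"
    by (rule Lnorm_seq_le'[OF q assms(7) c0 _ assms(8)])
  moreover have "S \<ge> 0" using suminf_nonneg[OF assms(7) c0] assms(8) by linarith
  ultimately show ?thesis unfolding Besov_eq[OF p assms(1)] using assms(2,5) by (simp add: add_mono)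
qed

section \<open>Decay away from the diagonal\<close>

definition decay_rate :: real where "decay_rate = 2 powr (\<bar>\<alpha>\<bar> - real r)"

lemma decay_rate: "0 < decay_rate" "decay_rate < 1"
  using \<alpha> powr_less_mono[of "\<bar>\<alpha>\<bar> - real r" 0 2] by (auto simp: decay_rate_def)

lemma decay_rate_power: "decay_rate ^ k = 2 powr (\<bar>\<alpha>\<bar> * real k) / (2 ^ k) ^ r"
proof -
  have "decay_rate ^ k = 2 powr ((\<bar>\<alpha>\<bar> - real r) * real k)" by (simp add: decay_rate_def powr_powr flip: powr_realpow)
  also have "\<dots> = 2 powr (\<bar>\<alpha>\<bar> * real k) / 2 powr real (k * r)"
  proof -
    have "(\<bar>\<alpha>\<bar> - real r) * real k = \<bar>\<alpha>\<bar> * real k - real (k * r)" by (simp add: algebra_simps)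
    then show ?thesis by (simp only: powr_diff)
  qed
  also have "2 powr real (k * r) = ((2::real) ^ k) ^ r" by (subst powr_realpow) (simp_all add: power_mult)
  finally show ?thesis .
qed

text \<open>Passing from scale \<open>n\<close> to scale \<open>m\<close> at distance
  \<open>k\<close> changes the weight by at most \<open>2 powr (\<bar>\<alpha>\<bar> * k)\<close>,
  while the moments gain $2^{-rk}$. The quotient is a power of \<open>decay_rate\<close>, and this
  is below 1 exactly because \<open>\<bar>\<alpha>\<bar> < r\<close>.\<close>

lemma off_diagonal:
  "2 powr (\<alpha> * real m) * ((if m \<le> n then 2 ^ m / 2 ^ n else 2 ^ n / 2 ^ m) ^ r) \<le>
   2 powr (\<alpha> * real n) * decay_rate ^ (if m \<le> n then n - m else m - n)"
proof -
  define k where "k = (if m \<le> n then n - m else m - n)"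
  have e: "(if m \<le> n then 2 ^ m / 2 ^ n else 2 ^ n / 2 ^ m) = (1::real) / 2 ^ k"
    by (auto simp: k_def power_diff)
  have "\<alpha> * (real m - real n) \<le> \<bar>\<alpha>\<bar> * \<bar>real m - real n\<bar>" by (metis abs_ge_self abs_mult)
  moreover have "\<bar>real m - real n\<bar> = real k" by (auto simp: k_def)
  ultimately have "\<alpha> * real m \<le> \<alpha> * real n + \<bar>\<alpha>\<bar> * real k" by (simp add: right_diff_distrib)
  then have "2 powr (\<alpha> * real m) \<le> 2 powr (\<alpha> * real n) * 2 powr (\<bar>\<alpha>\<bar> * real k)"
    by (simp flip: powr_add)
  then have "2 powr (\<alpha> * real m) * (1 / (2 ^ k) ^ r) \<le> 2 powr (\<alpha> * real n) * 2 powr (\<bar>\<alpha>\<bar> * real k) * (1 / (2 ^ k) ^ r)"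
    by (intro mult_right_mono) auto
  then show ?thesis unfolding e k_def[symmetric] decay_rate_power by (simp add: power_one_over)
qed

text \<open>The embedding of $C^r$ functions supported in a fixed ball: their blocks have size
  $2^{-rn}$, which beats the weight \<open>2 powr (\<alpha> * n)\<close>. The constant is uniform in
  \<open>u\<close>, so $C^r$-small errors are small in the Besov norm.\<close>

lemma BN_Cr:
  assumes \<rho>: "\<rho> \<ge> 0" and L: "L \<ge> 0"
  obtains C where "C \<ge> 0" "\<forall>A u. Cb r A L u \<longrightarrow> (\<forall>z. \<rho> < norm z \<longrightarrow> u z = 0) \<longrightarrow> BN u \<le> ennreal (C * A)"
proof -
  define v where "v = (2 * (\<rho> + 2 * R)) ^ CARD('d)"
  have v: "v \<ge> 0" "emeasure lborel (cball (0::real^'d) (\<rho> + 2 * R)) \<le> ennreal v"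
    using \<rho> R_pos emeasure_cball_le[of "\<rho> + 2 * R" "0::real^'d"] by (auto simp: v_def)
  define C where "C = KP * Kd * (v + 1) + KP * Kd * L ^ r * (v + 1) * (1 / (1 - decay_rate))"
  have C: "C \<ge> 0" unfolding C_def using KP_nonneg Kd_nonneg v L decay_rate by simp
  have "BN u \<le> ennreal (C * A)" if u: "Cb r A L u" and z: "\<forall>z. \<rho> < norm z \<longrightarrow> u z = 0" for A u
  proof -
    have A: "A \<ge> 0" by (rule Cb_nonneg(1)[OF u])
    have cu: "cc u" using z by (intro ccI[of _ \<rho>] Ck_continuous_on[OF Cb_Ck[OF u]]) auto
    have bl: "bl I n p u \<le> ennreal (B * (v + 1))" if I: "good I" and B: "Cb r B (2 ^ n) (PP I n u)" for I n B
      unfolding bl_def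
    proof (rule Lnorm_bounded_support[OF p _ v(2,1) PP_meas[OF I cu]])
      fix x
      show "ennreal \<bar>PP I n u x\<bar> \<le> ennreal B * indicator (cball 0 (\<rho> + 2 * R)) x"
        using CbD0[OF B, of x] PP_supp[OF I, of \<rho> u x n] z by (auto simp: indicator_def intro: ennreal_leI)
    qed (use Cb_nonneg[OF B] in auto)
    define b where "b = (\<lambda>n::nat. KP * (Kd * A * (L / 2 ^ n) ^ r) * (v + 1))"
    have "BN u \<le> ennreal (KP * (Kd * A) * (v + 1) + KP * Kd * A * L ^ r * (v + 1) * (1 / (1 - decay_rate)))"
    proof (rule BN_le[OF cu, where b = b and c = "\<lambda>n. KP * Kd * A * L ^ r * (v + 1) * decay_rate ^ n"])
      show "bl {0} 0 p u \<le> ennreal (KP * (Kd * A) * (v + 1))" by (intro bl PP_Cb_bound[OF u cu]) auto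
      show "bl IW n p u \<le> ennreal (b n)" for n unfolding b_def by (intro bl PP_Cb_decay[OF u cu]) auto
      show "b n \<ge> 0" for n unfolding b_def using KP_nonneg Kd_nonneg v L A by simp
      show "KP * (Kd * A) * (v + 1) \<ge> 0" using KP_nonneg Kd_nonneg v A by simp
      show "2 powr (\<alpha> * real n) * b n \<le> KP * Kd * A * L ^ r * (v + 1) * decay_rate ^ n" for n
      proof -
        have "2 powr (\<alpha> * real n) * (1 / 2 ^ n) ^ r \<le> decay_rate ^ n"
        proof (cases "n = 0")
          case False
          then show ?thesis using off_diagonal[of n 0] by (simp)
        qed simp
        then have "KP * Kd * A * L ^ r * (v + 1) * (2 powr (\<alpha> * real n) * (1 / 2 ^ n) ^ r) \<le> KP * Kd * A * L ^ r * (v + 1) * decay_rate ^ n"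
          using KP_nonneg Kd_nonneg v L A by (intro mult_left_mono) auto
        then show ?thesis by (simp add: b_def power_divide power_one_over mult_ac)
      qed
      show "summable (\<lambda>n. KP * Kd * A * L ^ r * (v + 1) * decay_rate ^ n)"
        using decay_rate by (intro summable_mult summable_geometric) auto
      show "(\<Sum>n. KP * Kd * A * L ^ r * (v + 1) * decay_rate ^ n) \<le> KP * Kd * A * L ^ r * (v + 1) * (1 / (1 - decay_rate))"
        using decay_rate by (subst suminf_mult) (auto intro!: summable_geometric simp: suminf_geometric)
    qed
    also have "KP * (Kd * A) * (v + 1) + KP * Kd * A * L ^ r * (v + 1) * (1 / (1 - decay_rate)) = C * A"
      by (simp add: C_def algebra_simps)
    finally show ?thesis .
  qed
  then show thesis by (intro that[OF C]) blast
qed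

text \<open>The moments of the finer of the two wavelets are tested against the coarser one
  multiplied by \<open>\<theta>\<close>. For \<open>m \<le> n\<close> the finer one is
  \<open>wl i n x\<close>, and the change of normalisation adds the quotient of powers of 2 in
  \<open>\<kappa>\<close>. For \<open>m > n\<close> the finer ones are those projected on; they need
  vanishing moments, so \<open>I = {0}\<close> has to be excluded.\<close>

lemma block_kernel:
  assumes \<theta>: "Cb r A\<theta> L\<theta> \<theta>" and i: "i \<in> IW" and I: "good I" and mn: "I = {0} \<Longrightarrow> m \<le> n" and x: "x \<in> lattice n"
  defines "\<kappa> \<equiv> KP * Kd * (A\<theta> * Aw) * (L\<theta> + 1) ^ r *
      (if m \<le> n then 2 ^ (CARD('d) * m) / 2 ^ (CARD('d) * n) * (2 ^ m / 2 ^ n) ^ r else (2 ^ n / 2 ^ m) ^ r)"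
  shows "\<bar>PP I m (\<lambda>z. \<theta> z * wl i n x z) z\<bar> \<le> (if dist z x \<le> 3 * R / 2 ^ min m n then \<kappa> else 0)"
proof -
  let ?u = "\<lambda>z. \<theta> z * wl i n x z"
  have i0: "i \<in> insert 0 IW" using i by simp
  have c\<theta>: "continuous_on UNIV \<theta>" by (rule Ck_continuous_on[OF Cb_Ck[OF \<theta>]])
  have L: "L\<theta> \<ge> 0" "A\<theta> \<ge> 0" using Cb_nonneg[OF \<theta>] by auto
  have cu: "cc (\<lambda>z. \<theta> z * wl j k y z)" if "j \<in> insert 0 IW" for j k y by (intro cc_mult2 wl_cc that c\<theta>)
  have Cu: "Cb r (A\<theta> * Aw) ((L\<theta> + 1) * 2 ^ k) (\<lambda>z. \<theta> z * wl j k y z)" if "j \<in> insert 0 IW" for j k y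
  proof (rule Cb_mono[OF Cb_mult[OF \<theta> wl_Cb[OF that, of k y]]])
    show "L\<theta> + 2 ^ k \<le> (L\<theta> + 1) * 2 ^ k" using L mult_left_mono[of 1 "2 ^ k" L\<theta>] by (simp add: distrib_right one_le_power)
  qed auto
  show ?thesis
  proof (cases "dist z x \<le> 3 * R / 2 ^ min m n")
    case True
    have "\<bar>PP I m ?u z\<bar> \<le> \<kappa>"
    proof (cases "m \<le> n")
      case m: True
      let ?c = "Kd * (A\<theta> * Aw) * ((L\<theta> + 1) * 2 ^ m / 2 ^ n) ^ r"
      have "Cb r (KP * (2 ^ (CARD('d) * m) / 2 ^ (CARD('d) * n) * ?c)) (2 ^ m) (PP I m ?u)"
      proof (rule PP_Cb[OF I cu[OF i0]])
        show "0 \<le> 2 ^ (CARD('d) * m) / 2 ^ (CARD('d) * n) * ?c" using Kd_nonneg L Aw_nonneg by simp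
        fix j y assume j: "j \<in> I"
        have j0: "j \<in> insert 0 IW" by (rule good_sub[OF I j])
        \<comment> \<open>The factor \<open>\<theta>\<close> is moved onto the coarser wavelet, so
          that the moments of \<open>wl i n x\<close> can act.\<close>
        have sw: "L2_inner ?u (wl j m y) = L2_inner (\<lambda>z. \<theta> z * wl j m y z) (wl i n x)"
          by (simp add: L2_inner_def mult_ac)
        have "2 ^ (CARD('d) * n) * \<bar>L2_inner (\<lambda>z. \<theta> z * wl j m y z) (wl i n x)\<bar> \<le> ?c"
          using coeff_decay[OF Cu[OF j0] cu[OF j0] i, of n] by simp
        then have "2 ^ (CARD('d) * m) / 2 ^ (CARD('d) * n) * (2 ^ (CARD('d) * n) * \<bar>L2_inner (\<lambda>z. \<theta> z * wl j m y z) (wl i n x)\<bar>)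
           \<le> 2 ^ (CARD('d) * m) / 2 ^ (CARD('d) * n) * ?c" by (rule mult_left_mono) simp
        then show "2 ^ (CARD('d) * m) * \<bar>L2_inner ?u (wl j m y)\<bar> \<le> 2 ^ (CARD('d) * m) / 2 ^ (CARD('d) * n) * ?c"
          unfolding sw by simp
      qed
      from CbD0[OF this, of z] show ?thesis using m by (simp add: \<kappa>_def power_mult_distrib power_divide mult_ac)
    next
      case False
      then have "I = IW" using I mn by (auto simp: good_def)
      have "Cb r (KP * (Kd * (A\<theta> * Aw) * ((L\<theta> + 1) * 2 ^ n / 2 ^ m) ^ r)) (2 ^ m) (PP IW m ?u)"
        by (rule PP_Cb_decay[OF Cu[OF i0] cu[OF i0]]) simp
      from CbD0[OF this, of z] have "\<bar>PP I m ?u z\<bar> \<le> KP * (Kd * (A\<theta> * Aw) * ((L\<theta> + 1) * 2 ^ n / 2 ^ m) ^ r)"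
        using \<open>I = IW\<close> by simp
      then show ?thesis using False by (simp add: \<kappa>_def power_mult_distrib power_divide mult_ac)
    qed
    then show ?thesis using True by simp
  next
    case False
    \<comment> \<open>A nonzero term would lead from \<open>z\<close> to \<open>x\<close> through
      \<open>y\<close> and \<open>z'\<close> in three steps of length at most
      \<open>R / 2 ^ min m n\<close> each.\<close>
    have "PP I m ?u z = 0" unfolding PP_def
    proof (intro sum.neutral ballI)
      fix j y assume j: "j \<in> I" and y: "y \<in> lattice m \<inter> cball z (R / 2 ^ m)"
      have "L2_inner ?u (wl j m y) = 0"
      proof (rule inner_eq_0[OF good_sub[OF I j]])
        fix z' assume z': "?u z' \<noteq> 0" "dist y z' < R / 2 ^ m"
        have 1: "dist x z' < R / 2 ^ n" using z'(1) wl_supp[OF i0, of n x z'] by auto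
        have le: "R / 2 ^ k \<le> R / 2 ^ min m n" if "k = m \<or> k = n" for k
          using R_pos that by (intro divide_left_mono power_increasing) auto
        have "dist z x \<le> dist z y + dist y z' + dist x z'"
          using dist_triangle[of z x y] dist_triangle[of y x z'] by (simp add: dist_commute)
        also have "\<dots> \<le> 3 * (R / 2 ^ min m n)" using y z'(2) 1 le[of m] le[of n] by auto
        finally show False using False by simp
      qed
      then show "2 ^ (CARD('d) * m) * L2_inner ?u (wl j m y) * wl j m y z = 0" by simp
    qed
    then show ?thesis using False by simp
  qed
qed

text \<open>For \<open>m \<le> n\<close> about \<open>2 ^ (CARD('d) * (n - m))\<close> fine wavelets
  reach a given point. This growth of \<open>N\<close> cancels the change of normalisation in
  \<open>\<kappa>\<close>, and what remains is the moment gain to the power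
  \<open>r\<close>.\<close>

lemma block_bound:
  assumes \<theta>: "Cb r A\<theta> L\<theta> \<theta>" and i: "i \<in> IW" and I: "good I" and mn: "I = {0} \<Longrightarrow> m \<le> n"
    and J: "finite J" "J \<subseteq> lattice n" and ok: "coef_ok p (1 / 2 ^ (CARD('d) * n)) J c \<Lambda>" and \<Lambda>: "\<Lambda> \<ge> 0"
  shows "bl I m p (\<lambda>z. \<theta> z * (\<Sum>x\<in>J. c x * wl i n x z)) \<le>
    ennreal (KP * Kd * (A\<theta> * Aw) * (L\<theta> + 1) ^ r * (6 * R + 1) ^ CARD('d) * \<Lambda> *
      (if m \<le> n then 2 ^ m / 2 ^ n else 2 ^ n / 2 ^ m) ^ r)"
proof -
  let ?C = "KP * Kd * (A\<theta> * Aw) * (L\<theta> + 1) ^ r"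
  let ?k = "\<lambda>x. PP I m (\<lambda>z. \<theta> z * wl i n x z)"
  define \<kappa> where "\<kappa> = ?C * (if m \<le> n then 2 ^ (CARD('d) * m) / 2 ^ (CARD('d) * n) * (2 ^ m / 2 ^ n) ^ r else (2 ^ n / 2 ^ m) ^ r)"
  define N :: real where "N = (6 * R + 1) ^ CARD('d) * (if m \<le> n then 2 ^ (CARD('d) * n) / 2 ^ (CARD('d) * m) else 1)"
  have L: "L\<theta> \<ge> 0" "A\<theta> \<ge> 0" using Cb_nonneg[OF \<theta>] by auto
  have c\<theta>: "continuous_on UNIV \<theta>" by (rule Ck_continuous_on[OF Cb_Ck[OF \<theta>]])
  have cu: "cc (\<lambda>z. \<theta> z * wl i n x z)" for x by (intro cc_mult2 wl_cc c\<theta>) (use i in simp)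
  have C: "?C \<ge> 0" using KP_nonneg Kd_nonneg L Aw_nonneg by simp
  have pw: "(2::real) ^ (CARD('d) * k) = (2 ^ k) ^ CARD('d)" for k by (simp add: power_mult[symmetric] mult.commute)
  have eq: "(\<lambda>z. ennreal \<bar>PP I m (\<lambda>z. \<theta> z * (\<Sum>x\<in>J. c x * wl i n x z)) z\<bar>) = (\<lambda>z. ennreal \<bar>\<Sum>x\<in>J. c x * ?k x z\<bar>)"
    using PP_sum[of J "\<lambda>x z. \<theta> z * wl i n x z" I m c] cu I by (simp add: sum_distrib_left mult_ac)
  have "Lnorm lborel p (\<lambda>z. ennreal \<bar>\<Sum>x\<in>J. c x * ?k x z\<bar>) \<le> ennreal (\<kappa> * N * \<Lambda>)"
  proof (rule Schur_bound[OF p J(1), where \<rho> = "3 * R / 2 ^ min m n" and wt = "1 / 2 ^ (CARD('d) * n)"])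
    show "\<bar>?k x z\<bar> \<le> (if dist z x \<le> 3 * R / 2 ^ min m n then \<kappa> else 0)" if "x \<in> J" for x z
      unfolding \<kappa>_def by (rule block_kernel[OF \<theta> i I mn]) (use J that in auto)
    show "?k x \<in> borel_measurable borel" for x using cc_measurable[OF PP_cc[OF I cu]] .
    show N1: "N \<ge> 1"
    proof -
      have "(6 * R + 1) ^ CARD('d) \<ge> 1" using R_pos by (intro one_le_power) auto
      moreover have "(2::real) ^ (CARD('d) * m) \<le> 2 ^ (CARD('d) * n)" if "m \<le> n" using that by (intro power_increasing) auto
      ultimately show ?thesis using mult_mono[of 1 "(6 * R + 1) ^ CARD('d)" 1 "2 ^ (CARD('d) * n) / 2 ^ (CARD('d) * m)"]
        by (auto simp: N_def)
    qed
    show "real (card (J \<inter> cball z (3 * R / 2 ^ min m n))) \<le> N" for z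
    proof -
      have "card (J \<inter> cball z (3 * R / 2 ^ min m n)) \<le> card (lattice n \<inter> cball z (3 * R / 2 ^ min m n))"
        using J R_pos by (intro card_mono lattice_ball_card) auto
      then have "real (card (J \<inter> cball z (3 * R / 2 ^ min m n))) \<le> real (card (lattice n \<inter> cball z (3 * R / 2 ^ min m n)))"
        by simp
      also have "\<dots> \<le> (2 * (2 ^ n * (3 * R / 2 ^ min m n)) + 1) ^ CARD('d)" using R_pos by (intro lattice_ball_card) auto
      also have "\<dots> \<le> ((6 * R + 1) * (if m \<le> n then 2 ^ n / 2 ^ m else 1)) ^ CARD('d)"
      proof (rule power_mono)
        have "(2::real) ^ n / 2 ^ m \<ge> 1" if "m \<le> n" using that by (simp add: power_increasing)
        then show "2 * (2 ^ n * (3 * R / 2 ^ min m n)) + 1 \<le> (6 * R + 1) * (if m \<le> n then 2 ^ n / 2 ^ m else 1)"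
          by (auto simp: min_def algebra_simps)
      qed (use R_pos in auto)
      also have "\<dots> = N" by (auto simp: N_def pw power_mult_distrib power_divide)
      finally show ?thesis .
    qed
    show "(2 * (3 * R / 2 ^ min m n)) ^ CARD('d) \<le> N * (1 / 2 ^ (CARD('d) * n))"
    proof -
      have "(2 * (3 * R / 2 ^ min m n)) ^ CARD('d) = (6 * R) ^ CARD('d) / 2 ^ (CARD('d) * min m n)"
        by (simp add: pw power_divide)
      also have "\<dots> \<le> (6 * R + 1) ^ CARD('d) / 2 ^ (CARD('d) * min m n)"
        using R_pos by (intro divide_right_mono power_mono) auto
      also have "\<dots> = N * (1 / 2 ^ (CARD('d) * n))" by (auto simp: N_def min_def)
      finally show ?thesis .
    qed
  qed (use R_pos C ok \<Lambda> in \<open>auto simp: \<kappa>_def\<close>)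
  also have "\<kappa> * N * \<Lambda> = ?C * (6 * R + 1) ^ CARD('d) * \<Lambda> * (if m \<le> n then 2 ^ m / 2 ^ n else 2 ^ n / 2 ^ m) ^ r"
    by (auto simp: \<kappa>_def N_def)
  finally show ?thesis unfolding bl_def eq .
qed

text \<open>The product of one scale of the series with \<open>\<theta>\<close> spreads over all
  scales, but its blocks decay geometrically in the distance to \<open>n\<close>, so their sum costs
  only a constant. The first summand of \<open>C\<close> accounts for the block in
  \<open>V 0\<close>.\<close>

theorem BN_block:
  assumes "\<theta> \<in> Cinf_c U"
  obtains C where "C \<ge> 0" "\<forall>n i J c \<Lambda>. i \<in> IW \<longrightarrow> finite J \<longrightarrow> J \<subseteq> lattice n \<longrightarrow>
    coef_ok p (1 / 2 ^ (CARD('d) * n)) J c \<Lambda> \<longrightarrow> \<Lambda> \<ge> 0 \<longrightarrow>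
    BN (\<lambda>z. \<theta> z * (\<Sum>x\<in>J. c x * wl i n x z)) \<le> ennreal (C * \<Lambda> * 2 powr (\<alpha> * real n))"
proof -
  obtain A where \<theta>: "Cb r A 1 \<theta>" using Cinf_c_Cb[OF assms] by blast
  define C1 where "C1 = KP * Kd * (A * Aw) * (1 + 1) ^ r * (6 * R + 1) ^ CARD('d)"
  have C1: "C1 \<ge> 0" using KP_nonneg Kd_nonneg Cb_nonneg[OF \<theta>] Aw_nonneg R_pos by (simp add: C1_def)
  define C where "C = C1 + C1 * (2 / (1 - decay_rate))"
  have C: "C \<ge> 0" using C1 decay_rate by (simp add: C_def)
  have "BN (\<lambda>z. \<theta> z * (\<Sum>x\<in>J. c x * wl i n x z)) \<le> ennreal (C * \<Lambda> * 2 powr (\<alpha> * real n))"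
    if i: "i \<in> IW" and J: "finite J" "J \<subseteq> lattice n" and ok: "coef_ok p (1 / 2 ^ (CARD('d) * n)) J c \<Lambda>" and \<Lambda>: "\<Lambda> \<ge> 0"
    for n i J c \<Lambda>
  proof -
    let ?g = "\<lambda>z. \<theta> z * (\<Sum>x\<in>J. c x * wl i n x z)"
    let ?q = "\<lambda>m. (if m \<le> n then 2 ^ m / 2 ^ n else 2 ^ n / 2 ^ m :: real) ^ r"
    let ?h = "\<lambda>m. decay_rate ^ (if m \<le> n then n - m else m - n)"
    have cg: "cc ?g" by (intro cc_mult Cinf_c_cc[OF assms] cc_sum cc_cmult wl_cc) (use i in simp)
    have "BN ?g \<le> ennreal (C1 * \<Lambda> * 2 powr (\<alpha> * real n) + C1 * \<Lambda> * 2 powr (\<alpha> * real n) * (2 / (1 - decay_rate)))"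
    proof (rule BN_le[OF cg, where b = "\<lambda>m. C1 * \<Lambda> * ?q m" and c = "\<lambda>m. C1 * \<Lambda> * 2 powr (\<alpha> * real n) * ?h m"])
      have "bl {0} 0 p ?g \<le> ennreal (C1 * \<Lambda> * ?q 0)"
        using block_bound[OF \<theta> i _ _ J ok \<Lambda>, of "{0}" 0] by (simp add: C1_def)
      also have "\<dots> \<le> ennreal (C1 * \<Lambda> * 2 powr (\<alpha> * real n))"
      proof (intro ennreal_leI mult_left_mono)
        have "?q 0 \<le> 2 powr (\<alpha> * real n) * ?h 0" using off_diagonal[of 0 n] by simp
        also have "\<dots> \<le> 2 powr (\<alpha> * real n) * 1" using decay_rate by (intro mult_left_mono power_le_one) auto
        finally show "?q 0 \<le> 2 powr (\<alpha> * real n)" by simp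
      qed (use C1 \<Lambda> in auto)
      finally show "bl {0} 0 p ?g \<le> ennreal (C1 * \<Lambda> * 2 powr (\<alpha> * real n))" .
      show "bl IW m p ?g \<le> ennreal (C1 * \<Lambda> * ?q m)" for m
        using block_bound[OF \<theta> i _ _ J ok \<Lambda>, of IW m] IW_ne by (simp add: C1_def)
      show "2 powr (\<alpha> * real m) * (C1 * \<Lambda> * ?q m) \<le> C1 * \<Lambda> * 2 powr (\<alpha> * real n) * ?h m" for m
        using mult_left_mono[OF off_diagonal[of m n], of "C1 * \<Lambda>"] C1 \<Lambda> by (simp add: mult_ac)
      show "summable (\<lambda>m. C1 * \<Lambda> * 2 powr (\<alpha> * real n) * ?h m)"
        using decay_rate by (intro summable_mult summable_dist_power) auto
      show "(\<Sum>m. C1 * \<Lambda> * 2 powr (\<alpha> * real n) * ?h m) \<le> C1 * \<Lambda> * 2 powr (\<alpha> * real n) * (2 / (1 - decay_rate))"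
      proof -
        have "(\<Sum>m. C1 * \<Lambda> * 2 powr (\<alpha> * real n) * ?h m) = C1 * \<Lambda> * 2 powr (\<alpha> * real n) * suminf ?h"
          using decay_rate by (intro suminf_mult summable_dist_power) auto
        also have "\<dots> \<le> C1 * \<Lambda> * 2 powr (\<alpha> * real n) * (2 / (1 - decay_rate))"
          using decay_rate C1 \<Lambda> by (intro mult_left_mono summable_dist_power) auto
        finally show ?thesis .
      qed
    qed (use C1 \<Lambda> in auto)
    also have "C1 * \<Lambda> * 2 powr (\<alpha> * real n) + C1 * \<Lambda> * 2 powr (\<alpha> * real n) * (2 / (1 - decay_rate)) = C * \<Lambda> * 2 powr (\<alpha> * real n)"
      by (simp add: C_def algebra_simps)
    finally show ?thesis .
  qed
  then show thesis by (intro that[OF C]) blast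
qed

section \<open>Duality between the Besov norm and $C^r$ test functions\<close>

lemma duality_block:
  assumes g: "cc g" and \<zeta>: "cc \<zeta>" and I: "good I" and B: "Cb r B (2 ^ n) (PP I n \<zeta>)"
    and supp: "\<And>z. \<rho> < norm z \<Longrightarrow> \<zeta> z = 0" and v: "v \<ge> 0" "emeasure lborel (cball (0::real^'d) (\<rho> + 2 * R)) \<le> ennreal v"
    and fin: "bl I n p g \<le> ennreal b" and b: "b \<ge> 0"
  shows "\<bar>L2_inner (PP I n g) \<zeta>\<bar> \<le> B * ((v + 1) * b)"
proof -
  let ?P = "PP I n g" and ?Q = "PP I n \<zeta>" and ?D = "cball (0::real^'d) (\<rho> + 2 * R)"
  have B0: "B \<ge> 0" by (rule Cb_nonneg(1)[OF B])
  have cP: "cc ?P" "cc ?Q" by (intro PP_cc I g \<zeta>)+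
  have "L2_inner (\<lambda>z. \<zeta> z - ?Q z) ?P = 0" by (rule PP_residual[OF I \<zeta> PP_in[OF I g]])
  then have "L2_inner ?P \<zeta> = L2_inner ?P ?Q"
    using L2_inner_diff[OF cc_L2[OF \<zeta>] cc_L2[OF cP(2)] cc_L2[OF cP(1)]] by (simp add: L2_inner_commute)
  also have "\<bar>\<dots>\<bar> \<le> (LINT z|lborel. \<bar>?P z * ?Q z\<bar>)" unfolding L2_inner_def by (rule integral_abs_bound)
  finally have 1: "\<bar>L2_inner ?P \<zeta>\<bar> \<le> (LINT z|lborel. \<bar>?P z * ?Q z\<bar>)" .
  have "ennreal (LINT z|lborel. \<bar>?P z * ?Q z\<bar>) = (\<integral>\<^sup>+ z. ennreal \<bar>?P z * ?Q z\<bar> \<partial>lborel)"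
    by (intro nn_integral_eq_integral[symmetric] cc_integrable cc_abs cc_mult cP) auto
  also have "\<dots> \<le> (\<integral>\<^sup>+ z. ennreal B * (ennreal \<bar>?P z\<bar> * indicator ?D z) \<partial>lborel)"
  proof (rule nn_integral_mono)
    fix z
    show "ennreal \<bar>?P z * ?Q z\<bar> \<le> ennreal B * (ennreal \<bar>?P z\<bar> * indicator ?D z)"
    proof (cases "norm z \<le> \<rho> + 2 * R")
      case True
      have "\<bar>?P z * ?Q z\<bar> \<le> B * \<bar>?P z\<bar>"
        using CbD0[OF B, of z] by (simp add: abs_mult mult.commute[of B] mult_left_mono)
      then show ?thesis using True B0 by (simp add: ennreal_mult[symmetric] ennreal_leI)
    next
      case False
      then have "?Q z = 0" using PP_supp[OF I supp, where z = z and n = n] by simp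
      then show ?thesis by simp
    qed
  qed
  also have "\<dots> = ennreal B * (\<integral>\<^sup>+ z. ennreal \<bar>?P z\<bar> * indicator ?D z \<partial>lborel)"
    by (intro nn_integral_cmult borel_measurable_times_ennreal borel_measurable_indicator PP_meas I g) simp
  also have "\<dots> \<le> ennreal B * (ennreal (v + 1) * bl I n p g)"
    unfolding bl_def by (intro mult_left_mono nn_integral_le_Lnorm p v PP_meas I g) auto
  also have "\<dots> \<le> ennreal B * (ennreal (v + 1) * ennreal b)" by (intro mult_left_mono fin) auto
  also have "\<dots> = ennreal (B * ((v + 1) * b))" using B0 v b by (simp add: ennreal_mult)
  finally have "(LINT z|lborel. \<bar>?P z * ?Q z\<bar>) \<le> B * ((v + 1) * b)" using B0 v b by (simp add: ennreal_le_iff)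
  with 1 show ?thesis by linarith
qed

text \<open>In the pairing with one block of \<open>g\<close>, the test function can be replaced by
  its own block, since the residual is orthogonal. That block has size $2^{-rn}$, which outweighs
  the bound \<open>b / 2 powr (\<alpha> * n)\<close> on the block of \<open>g\<close>. The blocks
  sum to projections of \<open>g\<close>, and these converge in $L^2$.\<close>

theorem duality:
  assumes \<rho>: "\<rho> \<ge> 0"
  obtains C where "C \<ge> 0" "\<forall>g \<zeta> B b. cc g \<longrightarrow> Cb r B 1 \<zeta> \<longrightarrow> (\<forall>z. \<rho> < norm z \<longrightarrow> \<zeta> z = 0) \<longrightarrow>
    BN g \<le> ennreal b \<longrightarrow> b \<ge> 0 \<longrightarrow> \<bar>L2_inner g \<zeta>\<bar> \<le> C * B * b"
proof -
  define v where "v = (2 * (\<rho> + 2 * R)) ^ CARD('d)"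
  have v: "v \<ge> 0" "emeasure lborel (cball (0::real^'d) (\<rho> + 2 * R)) \<le> ennreal v"
    using \<rho> R_pos emeasure_cball_le[of "\<rho> + 2 * R" "0::real^'d"] by (auto simp: v_def)
  define C where "C = KP * Kd * (v + 1) * (1 + 1 / (1 - decay_rate))"
  have C: "C \<ge> 0" unfolding C_def using KP_nonneg Kd_nonneg v decay_rate by simp
  have "\<bar>L2_inner g \<zeta>\<bar> \<le> C * B * b"
    if g: "cc g" and \<zeta>: "Cb r B 1 \<zeta>" and supp: "\<forall>z. \<rho> < norm z \<longrightarrow> \<zeta> z = 0" and BNb: "BN g \<le> ennreal b" and b: "b \<ge> 0"
    for g \<zeta> B b
  proof -
    have c\<zeta>: "cc \<zeta>" using supp by (intro ccI[of _ \<rho>] Ck_continuous_on[OF Cb_Ck[OF \<zeta>]]) auto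
    have B: "B \<ge> 0" by (rule Cb_nonneg(1)[OF \<zeta>])
    have bl0: "bl {0} 0 p g \<le> ennreal b"
      using BNb unfolding Besov_eq[OF p g] by (meson add_increasing2 dual_order.trans order_refl zero_le)
    have bln: "bl IW n p g \<le> ennreal (b / 2 powr (\<alpha> * real n))" for n
    proof -
      let ?w = "2 powr (\<alpha> * real n)"
      have "ennreal ?w * bl IW n p g \<le> ennreal b"
        using BNb Lnorm_component[OF q, of "\<lambda>n. ennreal (2 powr (\<alpha> * real n)) * bl IW n p g" n] unfolding Besov_eq[OF p g]
        by (meson add_increasing dual_order.trans order_refl zero_le)
      then have "ennreal (1 / ?w) * (ennreal ?w * bl IW n p g) \<le> ennreal (1 / ?w) * ennreal b" by (rule mult_left_mono) simp
      then show ?thesis using b by (simp add: mult.assoc[symmetric] ennreal_mult[symmetric])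
    qed
    have s0: "\<bar>L2_inner (PP {0} 0 g) \<zeta>\<bar> \<le> (KP * (Kd * B)) * ((v + 1) * b)"
      by (rule duality_block[OF g c\<zeta> _ PP_Cb_bound[OF \<zeta> c\<zeta>] _ v bl0 b]) (use supp in auto)
    have sn: "\<bar>L2_inner (PP IW n g) \<zeta>\<bar> \<le> KP * Kd * B * (v + 1) * b * decay_rate ^ n" for n
    proof -
      have "\<bar>L2_inner (PP IW n g) \<zeta>\<bar> \<le> (KP * (Kd * B * (1 / 2 ^ n) ^ r)) * ((v + 1) * (b / 2 powr (\<alpha> * real n)))"
        by (rule duality_block[OF g c\<zeta> _ PP_Cb_decay[OF \<zeta> c\<zeta>] _ v bln]) (use supp b in auto)
      also have "\<dots> = KP * Kd * B * (v + 1) * b * ((1 / 2 ^ n) ^ r * 2 powr (- \<alpha> * real n))"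
        by (simp add: powr_minus divide_inverse mult_ac)
      also have "(1 / 2 ^ n) ^ r * 2 powr (- \<alpha> * real n) \<le> decay_rate ^ n"
      proof -
        have "2 powr (- \<alpha> * real n) \<le> 2 powr (\<bar>\<alpha>\<bar> * real n)" by (intro powr_mono mult_right_mono) auto
        then show ?thesis unfolding decay_rate_power by (simp add: power_one_over divide_right_mono)
      qed
      finally show ?thesis using KP_nonneg Kd_nonneg B v b by (simp add: mult_left_mono)
    qed
    have PN: "\<bar>L2_inner (PP {0} N g) \<zeta>\<bar> \<le> C * B * b" for N
    proof -
      let ?T = "\<lambda>n. PP IW n g"
      have "PP {0} N g = (\<lambda>z. 1 * PP {0} 0 g z + 1 * (\<Sum>n\<in>{0..<N}. 1 * ?T n z))"
        using PP_telescope[OF g, of 0 N] by auto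
      moreover have "L2_inner \<dots> \<zeta> = 1 * L2_inner (PP {0} 0 g) \<zeta> + 1 * (\<Sum>n\<in>{0..<N}. 1 * L2_inner (?T n) \<zeta>)"
        using PP_cc[OF _ g] c\<zeta>
        by (subst L2_inner_lincomb, simp_all add: cc_L2 L2_sum[where c = "\<lambda>_. 1", simplified])
           (subst L2_inner_sum[where c = "\<lambda>_. 1", simplified], auto intro: cc_L2)
      ultimately have eq: "L2_inner (PP {0} N g) \<zeta> = L2_inner (PP {0} 0 g) \<zeta> + (\<Sum>n\<in>{0..<N}. L2_inner (?T n) \<zeta>)"
        by simp
      have "\<bar>L2_inner (PP {0} N g) \<zeta>\<bar> \<le> \<bar>L2_inner (PP {0} 0 g) \<zeta>\<bar> + (\<Sum>n\<in>{0..<N}. \<bar>L2_inner (?T n) \<zeta>\<bar>)"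
        using sum_abs[of "\<lambda>n. L2_inner (?T n) \<zeta>" "{0..<N}"] abs_triangle_ineq[of "L2_inner (PP {0} 0 g) \<zeta>" "\<Sum>n\<in>{0..<N}. L2_inner (?T n) \<zeta>"]
        unfolding eq by linarith
      also have "\<dots> \<le> (KP * (Kd * B)) * ((v + 1) * b) + (\<Sum>n\<in>{0..<N}. KP * Kd * B * (v + 1) * b * decay_rate ^ n)"
        by (intro add_mono s0 sum_mono sn)
      also have "(\<Sum>n\<in>{0..<N}. KP * Kd * B * (v + 1) * b * decay_rate ^ n) = KP * Kd * B * (v + 1) * b * (\<Sum>n\<in>{0..<N}. decay_rate ^ n)"
        by (rule sum_distrib_left[symmetric])
      also have "\<dots> \<le> KP * Kd * B * (v + 1) * b * (1 / (1 - decay_rate))"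
      proof (rule mult_left_mono)
        have "(\<Sum>n\<in>{0..<N}. decay_rate ^ n) \<le> (\<Sum>n. decay_rate ^ n)" using decay_rate by (intro sum_le_suminf summable_geometric) auto
        then show "(\<Sum>n\<in>{0..<N}. decay_rate ^ n) \<le> 1 / (1 - decay_rate)" using decay_rate by (simp add: suminf_geometric)
      qed (use KP_nonneg Kd_nonneg B v b in simp)
      finally show ?thesis by (simp add: C_def algebra_simps)
    qed
    show ?thesis
    proof (rule field_le_epsilon)
      fix e :: real assume e: "e > 0"
      let ?Z = "L2_norm \<zeta>"
      have Z: "?Z \<ge> 0" by (rule L2_norm_nonneg)
      have "e / (?Z + 1) > 0" using e Z by simp
      then obtain N where N: "L2_norm (\<lambda>z. g z - PP {0} N g z) < e / (?Z + 1)" using PP_converges[OF g] by blast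
      have L: "g \<in> L2" "PP {0} N g \<in> L2" "\<zeta> \<in> L2" using g c\<zeta> PP_cc[of "{0}" g N] cc_L2 by auto
      have "\<bar>L2_inner g \<zeta> - L2_inner (PP {0} N g) \<zeta>\<bar> \<le> L2_norm (\<lambda>z. g z - PP {0} N g z) * ?Z"
        unfolding L2_inner_diff[OF L, symmetric] by (intro L2_Cauchy_Schwarz L2_diff L)
      also have "\<dots> \<le> e / (?Z + 1) * ?Z" using N Z by (intro mult_right_mono) auto
      also have "\<dots> \<le> e" using e Z by (simp add: field_simps)
      finally show "\<bar>L2_inner g \<zeta>\<bar> \<le> C * B * b + e" using PN[of N] by linarith
    qed
  qed
  then show thesis by (intro that[OF C]) blast
qed

end


section \<open>Convergence of the projections in $C^r$\<close>

lemma line_derivative: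
  fixes f :: "real ^ 'd \<Rightarrow> real"
  assumes "Ck k f" "length vs < k"
  shows "((\<lambda>t. ddir vs f (z + t *\<^sub>R v)) has_real_derivative ddir (v # vs) f (z + t *\<^sub>R v)) (at t)"
proof -
  let ?D = "\<lambda>u. ddir (u # vs) f (z + t *\<^sub>R v)"
  have hd: "(ddir vs f has_derivative ?D) (at (z + t *\<^sub>R v))" by (rule Ck_has_derivative[OF assms])
  have "((\<lambda>t. z + t *\<^sub>R v) has_derivative (\<lambda>s. s *\<^sub>R v)) (at t)" by (auto intro!: derivative_eq_intros)
  from diff_chain_at[OF this hd] have 1: "((\<lambda>t. ddir vs f (z + t *\<^sub>R v)) has_derivative (\<lambda>s. ?D (s *\<^sub>R v))) (at t)"
    by (simp add: o_def)
  have "?D (s *\<^sub>R v) = s * ?D v" for s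
    using linear_scale[OF has_derivative_linear[OF hd], of s v] by (simp only: real_scaleR_def)
  with 1 show ?thesis by (simp only: has_field_derivative_def mult_commute_abs)
qed

lemma line_bound:
  fixes f :: "real ^ 'd \<Rightarrow> real"
  assumes "Ck k f" "length vs < k" "\<And>y. \<bar>ddir (v # vs) f y\<bar> \<le> B"
  shows "\<bar>ddir vs f (z + t *\<^sub>R v) - ddir vs f z\<bar> \<le> B * \<bar>t\<bar>"
proof -
  have "norm (ddir vs f (z + t *\<^sub>R v) - ddir vs f (z + 0 *\<^sub>R v)) \<le> B * norm (t - 0)"
    by (rule field_differentiable_bound[of UNIV "\<lambda>t. ddir vs f (z + t *\<^sub>R v)" "\<lambda>t. ddir (v # vs) f (z + t *\<^sub>R v)"])
       (use assms(3) line_derivative[OF assms(1,2)] in \<open>auto simp del: ddir.simps\<close>)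
  then show ?thesis by simp
qed

text \<open>A converse of the mean value bound. It lets an estimate on a derivative pass to a limit
  in which only the undifferentiated functions are known to converge.\<close>

lemma derivative_le_of_lipschitz:
  fixes f :: "real ^ 'd \<Rightarrow> real"
  assumes "Ck k f" "length vs < k" "\<And>t. \<bar>ddir vs f (z + t *\<^sub>R v) - ddir vs f z\<bar> \<le> B * \<bar>t\<bar>"
  shows "\<bar>ddir (v # vs) f z\<bar> \<le> B"
proof -
  have "((\<lambda>h. (ddir vs f (z + h *\<^sub>R v) - ddir vs f z) / h) \<longlongrightarrow> ddir (v # vs) f z) (at 0)"
    using line_derivative[OF assms(1,2), of z v 0] by (simp add: DERIV_def del: ddir.simps)
  then have "((\<lambda>h. \<bar>(ddir vs f (z + h *\<^sub>R v) - ddir vs f z) / h\<bar>) \<longlongrightarrow> \<bar>ddir (v # vs) f z\<bar>) (at 0)"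
    by (rule tendsto_rabs)
  moreover have "\<forall>\<^sub>F h in at 0. \<bar>(ddir vs f (z + h *\<^sub>R v) - ddir vs f z) / h\<bar> \<le> B"
    unfolding eventually_at_filter
  proof (rule always_eventually, intro allI impI)
    fix h :: real assume "h \<noteq> 0"
    then show "\<bar>(ddir vs f (z + h *\<^sub>R v) - ddir vs f z) / h\<bar> \<le> B" using assms(3)[of h] by (simp add: abs_divide divide_le_eq)
  qed
  ultimately show ?thesis by (intro tendsto_upperbound) auto
qed

lemma Cb_add: "Cb k A L f \<Longrightarrow> Cb k B L g \<Longrightarrow> Cb k (A + B) L (\<lambda>x. f x + g x)"
proof -
  assume f: "Cb k A L f" and g: "Cb k B L g"
  have "\<bar>ddir vs (\<lambda>x. f x + g x) x\<bar> \<le> (A + B) * L ^ length vs" if "length vs \<le> k" "set vs \<subseteq> Basis" for vs x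
    using CbD[OF f that, of x] CbD[OF g that, of x]
    by (simp add: ddir_add[OF Cb_Ck[OF f] Cb_Ck[OF g] that(1)] distrib_right)
  then show ?thesis using f g by (auto simp: Cb_def intro!: Ck_add)
qed

lemma Cb_0: "L \<ge> 0 \<Longrightarrow> Cb k 0 L (\<lambda>x. 0)"
  by (auto simp: Cb_def Ck_const ddir_const)

lemma Cb_sum: "L \<ge> 0 \<Longrightarrow> (\<And>i. i \<in> I \<Longrightarrow> Cb k (A i) L (f i)) \<Longrightarrow> Cb k (\<Sum>i\<in>I. A i) L (\<lambda>x. \<Sum>i\<in>I. f i x)"
  by (induction I rule: infinite_finite_induct) (auto intro!: Cb_add simp: Cb_0)

context wavelets
begin

text \<open>Coefficients decay with the power \<open>r + 1\<close> of \<open>1 / 2 ^ n\<close>,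
  while up to \<open>r\<close> derivatives cost at most \<open>(2 ^ n) ^ r\<close>; one factor is
  left over.\<close>

lemma PP_Cb_1:
  assumes "Cb (r + 1) A 1 u" "cc u"
  shows "Cb r (KP * Kd * A / 2 ^ n) 1 (PP IW n u)"
proof -
  have B: "Cb r (KP * (Kd * A * (1 / 2 ^ n) ^ (r + 1))) (2 ^ n) (PP IW n u)"
    by (rule PP_Cb_decay[OF assms]) simp
  have A: "A \<ge> 0" by (rule Cb_nonneg(1)[OF assms(1)])
  have "\<bar>ddir vs (PP IW n u) x\<bar> \<le> KP * Kd * A / 2 ^ n * 1 ^ length vs" if vs: "length vs \<le> r" "set vs \<subseteq> Basis" for vs x
  proof -
    have "\<bar>ddir vs (PP IW n u) x\<bar> \<le> KP * (Kd * A * (1 / 2 ^ n) ^ (r + 1)) * (2 ^ n) ^ length vs" by (rule CbD[OF B vs])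
    also have "\<dots> \<le> KP * (Kd * A * (1 / 2 ^ n) ^ (r + 1)) * (2 ^ n) ^ r"
      using vs KP_nonneg Kd_nonneg A by (intro mult_left_mono power_increasing) auto
    also have "\<dots> = KP * Kd * A / 2 ^ n" by (simp add: power_one_over)
    finally show ?thesis by simp
  qed
  then show ?thesis using Cb_Ck[OF B] KP_nonneg Kd_nonneg A by (simp add: Cb_def)
qed

lemma PP_diff_Cb:
  assumes u: "Cb (r + 1) A 1 u" "cc u" and nm: "n \<le> m"
  shows "Cb r (2 * KP * Kd * A / 2 ^ n) 1 (\<lambda>z. PP {0} n u z - PP {0} m u z)"
proof -
  have A: "A \<ge> 0" by (rule Cb_nonneg(1)[OF u(1)])
  have "Cb r (\<Sum>j\<in>{n..<m}. KP * Kd * A / 2 ^ j) 1 (\<lambda>z. \<Sum>j\<in>{n..<m}. PP IW j u z)"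
    by (intro Cb_sum PP_Cb_1 u) auto
  moreover have "(\<Sum>j\<in>{n..<m}. KP * Kd * A / 2 ^ j) \<le> 2 * KP * Kd * A / 2 ^ n"
  proof -
    have "(\<Sum>j\<in>{n..<m}. (1::real) / 2 ^ j) = 2 / 2 ^ n - 2 / 2 ^ m" using nm
    proof (induction m rule: dec_induct)
      case (step k)
      have "(2::real) / 2 ^ k = 1 / 2 ^ k + 1 / 2 ^ k" "(2::real) / 2 ^ Suc k = 1 / 2 ^ k"
        by (simp_all flip: add_divide_distrib)
      then show ?case using step by simp
    qed simp
    then have "(\<Sum>j\<in>{n..<m}. (1::real) / 2 ^ j) \<le> 2 / 2 ^ n" by simp
    then have "KP * Kd * A * (\<Sum>j\<in>{n..<m}. 1 / 2 ^ j) \<le> KP * Kd * A * (2 / 2 ^ n)"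
      using KP_nonneg Kd_nonneg A by (intro mult_left_mono) auto
    then show ?thesis by (simp add: sum_distrib_left mult_ac)
  qed
  ultimately have "Cb r (2 * KP * Kd * A / 2 ^ n) 1 (\<lambda>z. \<Sum>j\<in>{n..<m}. PP IW j u z)"
    by (rule Cb_mono[OF _ order_refl]) simp
  from Cb_cmult[OF this, of "-1"] show ?thesis using PP_telescope[OF u(2) nm] by simp
qed

text \<open>Differences of projections are small in $C^r$, but a priori their limit is identified
  only in $L^2$. The values are settled first: a gap at one point would persist on a ball and show
  up in $L^2$. Each further derivative is bounded by Lipschitz estimates for the differences, in
  which \<open>m\<close> tends to infinity.\<close>

theorem PP_Cr_error:
  assumes u: "Cb (r + 1) A 1 u" "cc u"
  shows "Cb r (2 * KP * Kd * A / 2 ^ n) 1 (\<lambda>z. PP {0} n u z - u z)"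
proof -
  define e where "e = (\<lambda>n::nat. 2 * KP * Kd * A / 2 ^ n)"
  have A: "A \<ge> 0" by (rule Cb_nonneg(1)[OF u(1)])
  have e0: "e n \<ge> 0" for n using KP_nonneg Kd_nonneg A by (simp add: e_def)
  have e_lim: "e \<longlonglongrightarrow> 0"
    unfolding e_def by (rule LIMSEQ_divide_realpow_zero) simp
  have ccP: "cc (PP {0} n u)" for n by (intro PP_cc u) auto
  have CkP: "Ck r (PP {0} n u)" for n by (rule Cb_Ck[OF PP_Cb_bound[OF u]])
  have Cku: "Ck r u" by (rule Ck_mono[OF Cb_Ck[OF u(1)]]) simp
  have D: "Cb r (e n) 1 (\<lambda>z. PP {0} n u z - PP {0} m u z)" if "n \<le> m" for n m
    unfolding e_def by (rule PP_diff_Cb[OF u that])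
  have base: "\<bar>PP {0} n u z - u z\<bar> \<le> e n" for n z
  proof (rule ccontr)
    assume neg: "\<not> \<bar>PP {0} n u z - u z\<bar> \<le> e n"
    define d where "d = (\<bar>PP {0} n u z - u z\<bar> - e n) / 2"
    have d: "d > 0" using neg by (simp add: d_def)
    have cf: "cc (\<lambda>z. PP {0} n u z - u z)" by (intro cc_diff ccP u)
    obtain \<delta> where \<delta>: "\<delta> > 0" "\<forall>x y. dist x y \<le> \<delta> \<longrightarrow> \<bar>(PP {0} n u x - u x) - (PP {0} n u y - u y)\<bar> \<le> d"
      using cf d by (rule cc_uniformly_continuous)
    let ?v = "measure lborel (ball z \<delta>)"
    have fin: "emeasure lborel (ball z \<delta>) < \<infinity>" by (rule emeasure_bounded_finite) simp
    have "emeasure lborel (ball z \<delta>) > 0"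
    proof (rule ccontr)
      assume "\<not> emeasure lborel (ball z \<delta>) > 0"
      then have "AE x in lborel. x \<in> ball z \<delta> \<longrightarrow> (1::real) = 0"
        by (intro AE_I[of _ _ "ball z \<delta>"]) auto
      from AE_continuous_eq_0[OF this open_ball _ centre_in_ball[THEN iffD2, OF \<delta>(1)]] show False by simp
    qed
    then have v: "?v > 0" using fin by (simp add: measure_def enn2real_positive_iff)
    have big: "d * indicator (ball z \<delta>) y \<le> \<bar>PP {0} m u y - u y\<bar>" if m: "n \<le> m" for m y
    proof (cases "y \<in> ball z \<delta>")
      case True
      then have "dist z y \<le> \<delta>" by simp
      then have "\<bar>(PP {0} n u z - u z) - (PP {0} n u y - u y)\<bar> \<le> d" using \<delta>(2) by blast
      moreover have "\<bar>PP {0} n u y - PP {0} m u y\<bar> \<le> e n" by (rule CbD0[OF D[OF m]])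
      moreover have "\<bar>PP {0} n u z - u z\<bar> = 2 * d + e n" by (simp add: d_def field_simps)
      ultimately have "d \<le> \<bar>PP {0} m u y - u y\<bar>" by linarith
      then show ?thesis using True by simp
    qed simp
    have "sqrt (d\<^sup>2 * ?v) > 0" using d v by simp
    then obtain N where N: "\<forall>m\<ge>N. L2_norm (\<lambda>z. u z - PP {0} m u z) < sqrt (d\<^sup>2 * ?v)" using PP_converges[OF u(2)] by blast
    define m where "m = max n N"
    let ?f = "\<lambda>y. u y - PP {0} m u y"
    have "d\<^sup>2 * ?v = (LINT y|lborel. d\<^sup>2 * indicator (ball z \<delta>) y)" using fin by simp
    also have "\<dots> \<le> L2_inner ?f ?f" unfolding L2_inner_def
    proof (rule integral_mono)
      show "integrable lborel (\<lambda>y. d\<^sup>2 * indicator (ball z \<delta>) y)" using fin by auto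
      show "integrable lborel (\<lambda>y. ?f y * ?f y)" by (intro cc_integrable cc_mult cc_diff ccP u)
      fix y
      show "d\<^sup>2 * indicator (ball z \<delta>) y \<le> ?f y * ?f y"
      proof (cases "y \<in> ball z \<delta>")
        case True
        then have "d \<le> \<bar>?f y\<bar>" using big[of m y] by (simp add: m_def abs_minus_commute)
        then have "d\<^sup>2 \<le> \<bar>?f y\<bar>\<^sup>2" using d by (intro power_mono) auto
        then show ?thesis using True by (simp add: power2_eq_square)
      qed simp
    qed
    finally have "sqrt (d\<^sup>2 * ?v) \<le> L2_norm ?f" by (simp add: L2_norm_def)
    then show False using N by (auto simp: m_def not_less[symmetric])
  qed
  have all: "\<forall>n z. \<bar>ddir vs (\<lambda>z. PP {0} n u z - u z) z\<bar> \<le> e n" if "length vs \<le> r" "set vs \<subseteq> Basis" for vs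
    using that
  proof (induction vs)
    case Nil then show ?case using base by simp
  next
    case (Cons v vs)
    have l: "length vs < r" using Cons.prems by simp
    let ?F = "\<lambda>n. ddir vs (\<lambda>z. PP {0} n u z - u z)"
    have IH: "\<bar>?F n z\<bar> \<le> e n" for n z using Cons by auto
    show ?case
    proof (intro allI, rule derivative_le_of_lipschitz[where k = r, OF Ck_diff[OF CkP Cku] l])
      fix n z t
      \<comment> \<open>The mean value bound applies to the difference of the projections
        \<open>n\<close> and \<open>m\<close>; replacing projection \<open>m\<close> by
        \<open>u\<close> costs \<open>e m\<close> at either end of the segment, by the induction
        hypothesis.\<close>
      have "\<bar>?F n (z + t *\<^sub>R v) - ?F n z\<bar> \<le> e n * \<bar>t\<bar> + 2 * e m" if m: "n \<le> m" for m
      proof -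
        let ?G = "ddir vs (\<lambda>z. PP {0} n u z - PP {0} m u z)"
        have G: "?G y = ?F n y - ?F m y" for y
          using l by (simp add: ddir_diff[OF CkP CkP] ddir_diff[OF CkP Cku])
        have "\<bar>?G (z + t *\<^sub>R v) - ?G z\<bar> \<le> e n * \<bar>t\<bar>"
          by (rule line_bound[OF Ck_diff[OF CkP CkP] l])
             (use CbD[OF D[OF m], of "v # vs"] Cons.prems in \<open>auto simp del: ddir.simps\<close>)
        then show ?thesis unfolding G using IH[of m z] IH[of m "z + t *\<^sub>R v"] by linarith
      qed
      then have "\<forall>\<^sub>F m in sequentially. \<bar>?F n (z + t *\<^sub>R v) - ?F n z\<bar> \<le> e n * \<bar>t\<bar> + 2 * e m"
        by (auto simp: eventually_sequentially)
      moreover have "(\<lambda>m. e n * \<bar>t\<bar> + 2 * e m) \<longlonglongrightarrow> e n * \<bar>t\<bar> + 2 * 0" by (intro tendsto_intros e_lim)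
      ultimately have "\<bar>?F n (z + t *\<^sub>R v) - ?F n z\<bar> \<le> e n * \<bar>t\<bar> + 2 * 0" by (intro tendsto_lowerbound) auto
      then show "\<bar>?F n (z + t *\<^sub>R v) - ?F n z\<bar> \<le> e n * \<bar>t\<bar>" by simp
    qed
  qed
  then have "Cb r (e n) 1 (\<lambda>z. PP {0} n u z - u z)"
    using e0 by (auto simp: Cb_def intro!: Ck_diff CkP Cku)
  then show ?thesis by (simp add: e_def)
qed

text \<open>The reproducing kernel of \<open>Sp I n\<close>.\<close>

definition Ker :: "nat set \<Rightarrow> nat \<Rightarrow> real ^ 'd \<Rightarrow> real ^ 'd \<Rightarrow> real" where
  "Ker I n z = (\<lambda>y. \<Sum>i\<in>I. \<Sum>x\<in>lattice n \<inter> cball z (R / 2 ^ n). (2 ^ (CARD('d) * n) * wl i n x z) * wl i n x y)"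

lemma Ker_cc: "good I \<Longrightarrow> cc (Ker I n z)"
  unfolding Ker_def by (intro cc_sum cc_cmult wl_cc good_sub[of I])

lemma PP_Ker:
  assumes "good I" "cc g" shows "PP I n g z = L2_inner (Ker I n z) g"
proof -
  have L: "wl i n x \<in> L2" if "i \<in> I" for i x by (intro wl_L2 good_sub[OF assms(1) that])
  have "L2_inner (Ker I n z) g = (\<Sum>i\<in>I. 1 * L2_inner (\<lambda>y. \<Sum>x\<in>lattice n \<inter> cball z (R / 2 ^ n). (2 ^ (CARD('d) * n) * wl i n x z) * wl i n x y) g)"
  proof -
    have "(\<lambda>y. \<Sum>x\<in>lattice n \<inter> cball z (R / 2 ^ n). (2 ^ (CARD('d) * n) * wl i n x z) * wl i n x y) \<in> L2" if "i \<in> I" for i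
      by (intro L2_sum L that)
    from L2_inner_sum[OF this cc_L2[OF assms(2)], of I "\<lambda>i. i" "\<lambda>_. 1"] show ?thesis by (simp add: Ker_def)
  qed
  also have "\<dots> = (\<Sum>i\<in>I. \<Sum>x\<in>lattice n \<inter> cball z (R / 2 ^ n). (2 ^ (CARD('d) * n) * wl i n x z) * L2_inner (wl i n x) g)"
    by (intro sum.cong refl, subst mult_1, rule L2_inner_sum[OF L cc_L2[OF assms(2)]])
  finally show ?thesis unfolding PP_def by (simp add: L2_inner_commute[of g] mult_ac)
qed

text \<open>By \<open>PP_Ker\<close> and \<open>PP_Suc\<close> the difference of the two sides is
  orthogonal to every \<open>cc\<close> function, in particular to itself. This is the refinement
  relation in a form to which a linear form on wavelets can be applied.\<close>

lemma Ker_Suc: "Ker {0} (Suc n) z = (\<lambda>y. Ker {0} n z y + Ker IW n z y)"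
proof -
  let ?D = "\<lambda>y. Ker {0} (Suc n) z y - (1 * Ker {0} n z y + 1 * Ker IW n z y)"
  have c: "cc (Ker {0} (Suc n) z)" "cc (Ker {0} n z)" "cc (Ker IW n z)" by (intro Ker_cc; simp)+
  have c2: "cc (\<lambda>y. 1 * Ker {0} n z y + 1 * Ker IW n z y)" by (intro cc_add cc_cmult c)
  have cD: "cc ?D" by (intro cc_diff c c2)
  have "L2_inner ?D ?D = L2_inner (Ker {0} (Suc n) z) ?D - (1 * L2_inner (Ker {0} n z) ?D + 1 * L2_inner (Ker IW n z) ?D)"
    by (simp only: L2_inner_diff[OF cc_L2[OF c(1)] cc_L2[OF c2] cc_L2[OF cD]]
        L2_inner_lincomb[OF cc_L2[OF c(2)] cc_L2[OF c(3)] cc_L2[OF cD]])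
  also have "\<dots> = 0" using PP_Ker[OF _ cD] PP_Suc[OF cD, of n z] by simp
  finally have "AE y in lborel. ?D y = 0" using L2_inner_self_eq_0[OF cc_L2[OF cD]] by simp
  then have "?D = (\<lambda>_. 0)" using AE_continuous_eq[of ?D "\<lambda>_. 0"] cc_continuous[OF cD] by simp
  then show ?thesis by (auto simp: fun_eq_iff)
qed

end


section \<open>Linear spans of families of functions\<close>

text \<open>Adding one multiple of a generator at a time makes bounds for linear forms an easy
  induction.\<close>

inductive_set wspan :: "(real ^ 'd \<Rightarrow> real) set \<Rightarrow> (real ^ 'd \<Rightarrow> real) set" for W where
  zero: "(\<lambda>x. 0) \<in> wspan W"
| step: "f \<in> wspan W \<Longrightarrow> w \<in> W \<Longrightarrow> (\<lambda>x. f x + c * w x) \<in> wspan W"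

lemma wspan_base: "w \<in> W \<Longrightarrow> w \<in> wspan W"
  using wspan.step[OF wspan.zero, of w W 1] by simp

lemma wspan_lincomb:
  assumes f: "f \<in> wspan W" and g: "g \<in> wspan W" shows "(\<lambda>x. a * f x + b * g x) \<in> wspan W"
proof -
  have cm: "(\<lambda>x. a * f x) \<in> wspan W" using f
  proof induction
    case (step f w c)
    from wspan.step[OF step.IH step.hyps(2), of "a * c"] show ?case by (simp add: algebra_simps)
  qed (simp add: wspan.zero)
  show ?thesis using g
  proof induction
    case (step g w c)
    from wspan.step[OF step.IH step.hyps(2), of "b * c"] show ?case by (simp add: algebra_simps)
  qed (simp add: cm)
qed

lemma wspan_sum: "(\<And>i. i \<in> I \<Longrightarrow> f i \<in> wspan W) \<Longrightarrow> (\<lambda>x. \<Sum>i\<in>I. c i * f i x) \<in> wspan W"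
proof (induction I rule: infinite_finite_induct)
  case (insert i I)
  then show ?case using wspan_lincomb[of "f i" W "\<lambda>x. \<Sum>i\<in>I. c i * f i x" "c i" 1] by simp
qed (simp_all add: wspan.zero)

lemma wspan_trans: assumes "W \<subseteq> wspan W'" shows "wspan W \<subseteq> wspan W'"
proof
  fix f assume "f \<in> wspan W"
  then show "f \<in> wspan W'"
  proof induction
    case (step f w c)
    then show ?case using wspan_lincomb[of f W' w 1 c] assms by auto
  qed (rule wspan.zero)
qed

definition lin_on :: "(real ^ 'd \<Rightarrow> real) set \<Rightarrow> ((real ^ 'd \<Rightarrow> real) \<Rightarrow> real) \<Rightarrow> bool" where
  "lin_on S s \<longleftrightarrow> (\<forall>f\<in>S. \<forall>g\<in>S. \<forall>a b. s (\<lambda>x. a * f x + b * g x) = a * s f + b * s g)"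

lemma lin_onD: "lin_on S s \<Longrightarrow> f \<in> S \<Longrightarrow> g \<in> S \<Longrightarrow> s (\<lambda>x. a * f x + b * g x) = a * s f + b * s g"
  by (simp add: lin_on_def)

lemma lin_on_0: "lin_on (wspan W) s \<Longrightarrow> s (\<lambda>x. 0) = 0"
  using lin_onD[of "wspan W" s "\<lambda>x. 0" "\<lambda>x. 0" 0 0] by (simp add: wspan.zero)

lemma lin_on_sum:
  assumes "lin_on (wspan W) s"
  shows "(\<And>i. i \<in> I \<Longrightarrow> f i \<in> wspan W) \<Longrightarrow> s (\<lambda>x. \<Sum>i\<in>I. c i * f i x) = (\<Sum>i\<in>I. c i * s (f i))"
proof (induction I rule: infinite_finite_induct)
  case (insert i I)
  then show ?case
    using lin_onD[OF assms, of "f i" "\<lambda>x. \<Sum>i\<in>I. c i * f i x" "c i" 1] wspan_sum[of I f W c] by simp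
qed (simp_all add: lin_on_0[OF assms])

lemma Crc_lincomb: assumes "f \<in> Crc r U" "g \<in> Crc r U" shows "(\<lambda>x. a * f x + b * g x) \<in> Crc r U"
proof -
  have sub: "supp (\<lambda>x. a * f x + b * g x) \<subseteq> supp f \<union> supp g"
    by (rule supp_subset) (auto simp: notin_supp_eq_0)
  have "compact (supp f \<union> supp g)" using assms by (auto simp: Crc_def)
  then have "compact (supp (\<lambda>x. a * f x + b * g x))"
    by (intro compact_supp_neighbourhood[OF _ _ sub] compact_imp_closed compact_imp_bounded)
  then show ?thesis using assms sub by (auto simp: Crc_def intro!: Ck_lincomb)
qed

lemma zero_Crc: "(\<lambda>x. 0) \<in> Crc r U"
  by (auto simp: Crc_def Ck_const supp_def)

lemma zero_Cinf_c: "(\<lambda>x. 0) \<in> Cinf_c U"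
  by (auto simp: Cinf_c_def zero_Crc)

lemma wspan_Crc: assumes "W \<subseteq> Crc r U" shows "wspan W \<subseteq> Crc r U"
proof
  fix f assume "f \<in> wspan W"
  then show "f \<in> Crc r U"
  proof induction
    case (step f w c)
    then show ?case using Crc_lincomb[of f r U w 1 c] assms by auto
  qed (rule zero_Crc)
qed


section \<open>The completion\<close>

text \<open>Values may be infinite and subtraction truncates, so the Cauchy condition is phrased
  additively. It forces the limes superior below the limes inferior.\<close>

lemma ennreal_Cauchy_lim:
  fixes x :: "nat \<Rightarrow> ennreal"
  assumes "\<And>e::real. e > 0 \<Longrightarrow> \<exists>N. \<forall>i\<ge>N. \<forall>j\<ge>N. x i \<le> x j + ennreal e"
  shows "x \<longlonglongrightarrow> lim x"
proof -
  have "limsup x \<le> liminf x"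
  proof (rule ennreal_le_epsilon)
    fix e :: real assume "0 < e"
    then obtain N where N: "\<forall>i\<ge>N. \<forall>j\<ge>N. x i \<le> x j + ennreal e" using assms by blast
    have "limsup x - ennreal e \<le> x j" if "j \<ge> N" for j
    proof -
      have "limsup x \<le> x j + ennreal e"
        by (rule Limsup_bounded) (use N that in \<open>auto simp: eventually_sequentially\<close>)
      then show ?thesis by (simp add: ennreal_minus_le_iff add.commute)
    qed
    then have "limsup x - ennreal e \<le> liminf x"
      by (intro Liminf_bounded) (auto simp: eventually_sequentially)
    then show "limsup x \<le> liminf x + ennreal e" by (simp add: ennreal_minus_le_iff add.commute)
  qed
  then have "limsup x = liminf x" using Liminf_le_Limsup[of sequentially x] by (intro antisym) auto
  then have "x \<longlonglongrightarrow> liminf x" by (intro Liminf_eq_Limsup) auto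
  then show ?thesis using limI by metis
qed

lemma ennreal_tendsto_0_iff:
  fixes x :: "nat \<Rightarrow> ennreal"
  shows "x \<longlonglongrightarrow> 0 \<longleftrightarrow> (\<forall>e::real>0. \<exists>N. \<forall>n\<ge>N. x n \<le> ennreal e)"
proof
  assume "x \<longlonglongrightarrow> 0"
  then show "\<forall>e::real>0. \<exists>N. \<forall>n\<ge>N. x n \<le> ennreal e"
    using order_tendstoD(2)[of x 0 sequentially] by (force simp: eventually_sequentially intro: less_imp_le)
next
  assume h: "\<forall>e::real>0. \<exists>N. \<forall>n\<ge>N. x n \<le> ennreal e"
  show "x \<longlonglongrightarrow> 0"
  proof (rule order_tendstoI)
    fix a :: ennreal assume "0 < a"
    then obtain c where c: "0 < c" "c < a" using dense by blast
    then obtain e where e: "c = ennreal e" "e > 0" by (cases c) auto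
    then obtain N where "\<forall>n\<ge>N. x n \<le> ennreal e" using h by blast
    then show "\<forall>\<^sub>F n in sequentially. x n < a" using c e by (auto simp: eventually_sequentially intro!: exI[of _ N])
  qed simp
qed

text \<open>Outside \<open>U\<close> nothing is known about \<open>f\<close>. The product is
  continuous on \<open>U\<close> and on the complement of \<open>supp \<theta>\<close>, and these
  two open sets cover the space.\<close>

lemma cc_cutoff_mult:
  assumes "\<theta> \<in> Cinf_c U" "open U" "continuous_on U f" shows "cc (\<lambda>x. \<theta> x * f x)"
proof -
  have c\<theta>: "cc \<theta>" by (rule Cinf_c_cc[OF assms(1)])
  have "continuous_on U (\<lambda>x. \<theta> x * f x)" by (intro continuous_intros assms cc_continuous_on c\<theta>)
  moreover have "continuous_on (- supp \<theta>) (\<lambda>x. \<theta> x * f x)"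
    by (rule continuous_on_eq[of _ "\<lambda>_. 0"]) (auto simp: notin_supp_eq_0)
  ultimately have "continuous_on (U \<union> - supp \<theta>) (\<lambda>x. \<theta> x * f x)"
    using assms(2) by (intro continuous_on_open_Un) (auto simp: open_Compl)
  moreover have "U \<union> - supp \<theta> = UNIV" using Cinf_c_supp(1)[OF assms(1)] by auto
  moreover obtain \<rho> where "0 < \<rho>" and "\<forall>x. \<rho> < norm x \<longrightarrow> \<theta> x = 0" using c\<theta> by (rule ccE)
  ultimately show ?thesis by (intro ccI[of _ \<rho>]) auto
qed

lemma Cinf_continuous: "f \<in> Cinf U \<Longrightarrow> continuous_on U f"
  unfolding Cinf_def Ck_on_def by (metis (no_types, lifting) ddir.simps(1) le0 list.size(3) mem_Collect_eq)

lemma Cinf_c_Cinf: "f \<in> Cinf_c UNIV \<Longrightarrow> f \<in> Cinf U"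
  unfolding Cinf_def Cinf_c_def Crc_def Ck_on_def by (auto intro: continuous_on_subset)

locale besov_on = besov r R \<phi> \<psi> V p q \<alpha>
  for r R and \<phi> :: "real ^ 'd \<Rightarrow> real" and \<psi> V p q \<alpha> +
  fixes U :: "(real ^ 'd) set"
  assumes open_U: "open U"
begin

abbreviation "cau \<equiv> Besov_cauchy V U \<alpha> p q"
abbreviation "eqv \<equiv> Besov_equiv V U \<alpha> p q"
abbreviation "bsp \<equiv> Besov_loc V U \<alpha> p q"
abbreviation "bdist \<equiv> Besov_loc_dist V \<alpha> p q"

definition dB :: "(real ^ 'd \<Rightarrow> real) \<Rightarrow> (real ^ 'd \<Rightarrow> real) \<Rightarrow> (real ^ 'd \<Rightarrow> real) \<Rightarrow> ennreal" where
  "dB \<theta> f g = BN (\<lambda>x. \<theta> x * (f x - g x))"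

lemma cut_cc:
  "\<theta> \<in> Cinf_c U \<Longrightarrow> continuous_on U f \<Longrightarrow> cc (\<lambda>x. \<theta> x * f x)"
  by (rule cc_cutoff_mult[OF _ open_U])

lemma dB_commute:
  assumes "\<theta> \<in> Cinf_c U" "continuous_on U f" "continuous_on U g" shows "dB \<theta> f g = dB \<theta> g f"
  using BN_commute[OF cut_cc[OF assms(1,2)] cut_cc[OF assms(1,3)]] by (simp add: dB_def right_diff_distrib)

lemma dB_triangle:
  assumes "\<theta> \<in> Cinf_c U" "continuous_on U f" "continuous_on U g" "continuous_on U h"
  shows "dB \<theta> f h \<le> dB \<theta> f g + dB \<theta> g h"
  using BN_diff_triangle[OF cut_cc[OF assms(1,2)] cut_cc[OF assms(1,3)] cut_cc[OF assms(1,4)]]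
  by (simp add: dB_def right_diff_distrib)

lemma dB_same: "dB \<theta> f f = 0"
  by (simp add: dB_def BN_0)

lemma cau_iff: "h \<in> cau \<longleftrightarrow> (\<forall>j. h j \<in> Cinf U) \<and>
    (\<forall>\<theta>\<in>Cinf_c U. \<forall>e>0. \<exists>N. \<forall>i\<ge>N. \<forall>j\<ge>N. dB \<theta> (h i) (h j) < e)"
  by (simp add: Besov_cauchy_def dB_def)

lemma cau_cont: "h \<in> cau \<Longrightarrow> continuous_on U (h j)"
  by (simp add: cau_iff Cinf_continuous)

lemma cauD: "h \<in> cau \<Longrightarrow> \<theta> \<in> Cinf_c U \<Longrightarrow> (e::real) > 0 \<Longrightarrow> \<exists>N. \<forall>i\<ge>N. \<forall>j\<ge>N. dB \<theta> (h i) (h j) \<le> ennreal e"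
  using cau_iff[of h] by (metis ennreal_less_zero_iff less_imp_le)

lemma eqv_iff: "(g, h) \<in> eqv \<longleftrightarrow> g \<in> cau \<and> h \<in> cau \<and> (\<forall>\<theta>\<in>Cinf_c U. (\<lambda>j. dB \<theta> (g j) (h j)) \<longlonglongrightarrow> 0)"
  by (simp add: Besov_equiv_def dB_def)

lemma eqv_refl: "h \<in> cau \<Longrightarrow> (h, h) \<in> eqv"
  by (simp add: eqv_iff dB_same)

lemma rep_eqv: assumes "h \<in> cau" shows "(h, rep (eqv `` {h})) \<in> eqv"
proof -
  have "rep (eqv `` {h}) \<in> eqv `` {h}" unfolding rep_def by (rule someI[of _ h]) (simp add: eqv_refl[OF assms])
  then show ?thesis by simp
qed

lemma class_in: "h \<in> cau \<Longrightarrow> eqv `` {h} \<in> bsp"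
  unfolding Besov_loc_def by (rule quotientI)

lemma rep_cau: assumes "F \<in> bsp" shows "rep F \<in> cau"
proof -
  obtain h where "h \<in> cau" "F = eqv `` {h}" using assms unfolding Besov_loc_def by (rule quotientE)
  then show ?thesis using rep_eqv[of h] eqv_iff by blast
qed

text \<open>The definition of \<open>bdist\<close> uses the operator \<open>lim\<close>. Here the
  limit is shown to exist, so that estimates for sequences can be passed to it.\<close>

lemma dist_lim:
  assumes F: "F \<in> bsp" and G: "G \<in> bsp" and \<theta>: "\<theta> \<in> Cinf_c U"
  shows "(\<lambda>j. dB \<theta> (rep F j) (rep G j)) \<longlonglongrightarrow> bdist \<theta> F G"
  unfolding Besov_loc_dist_def dB_def[symmetric]
proof (rule ennreal_Cauchy_lim)
  fix e :: real assume e: "e > 0"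
  note cF = cau_cont[OF rep_cau[OF F]] and cG = cau_cont[OF rep_cau[OF G]]
  obtain N where N: "\<forall>i\<ge>N. \<forall>j\<ge>N. dB \<theta> (rep F i) (rep F j) \<le> ennreal (e / 2)"
    using cauD[OF rep_cau[OF F] \<theta>, of "e / 2"] e by auto
  obtain M where M: "\<forall>i\<ge>M. \<forall>j\<ge>M. dB \<theta> (rep G i) (rep G j) \<le> ennreal (e / 2)"
    using cauD[OF rep_cau[OF G] \<theta>, of "e / 2"] e by auto
  show "\<exists>N. \<forall>i\<ge>N. \<forall>j\<ge>N. dB \<theta> (rep F i) (rep G i) \<le> dB \<theta> (rep F j) (rep G j) + ennreal e"
  proof (intro exI allI impI)
    fix i j assume i: "max N M \<le> i" and j: "max N M \<le> j"
    have "dB \<theta> (rep F i) (rep G i) \<le> dB \<theta> (rep F i) (rep F j) + dB \<theta> (rep F j) (rep G i)"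
      by (intro dB_triangle \<theta> cF cG)
    also have "\<dots> \<le> dB \<theta> (rep F i) (rep F j) + (dB \<theta> (rep F j) (rep G j) + dB \<theta> (rep G j) (rep G i))"
      by (intro add_left_mono dB_triangle \<theta> cF cG)
    also have "\<dots> \<le> ennreal (e / 2) + (dB \<theta> (rep F j) (rep G j) + ennreal (e / 2))"
      using N M i j by (intro add_mono) auto
    also have "\<dots> = dB \<theta> (rep F j) (rep G j) + ennreal (e / 2 + e / 2)"
      using e by (subst ennreal_plus) (auto simp: ac_simps)
    finally show "dB \<theta> (rep F i) (rep G i) \<le> dB \<theta> (rep F j) (rep G j) + ennreal e" by simp
  qed
qed

lemma dist_triangle:
  assumes "F \<in> bsp" "G \<in> bsp" "H \<in> bsp" "\<theta> \<in> Cinf_c U"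
  shows "bdist \<theta> F H \<le> bdist \<theta> F G + bdist \<theta> G H"
proof (rule LIMSEQ_le)
  show "(\<lambda>j. dB \<theta> (rep F j) (rep H j)) \<longlonglongrightarrow> bdist \<theta> F H" by (rule dist_lim[OF assms(1,3,4)])
  show "(\<lambda>j. dB \<theta> (rep F j) (rep G j) + dB \<theta> (rep G j) (rep H j)) \<longlonglongrightarrow> bdist \<theta> F G + bdist \<theta> G H"
    by (intro tendsto_add dist_lim assms)
  show "\<exists>N. \<forall>j\<ge>N. dB \<theta> (rep F j) (rep H j) \<le> dB \<theta> (rep F j) (rep G j) + dB \<theta> (rep G j) (rep H j)"
    using dB_triangle[OF assms(4)] cau_cont rep_cau assms by blast
qed

lemma dist_same: assumes "F \<in> bsp" "\<theta> \<in> Cinf_c U" shows "bdist \<theta> F F = 0"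
  using dist_lim[OF assms(1,1,2)] by (simp add: dB_same LIMSEQ_const_iff)

text \<open>Allows distances in the completion to be estimated with any convenient Cauchy sequences:
  the representatives chosen by \<open>rep\<close> differ from them by sequences that tend to zero
  in every seminorm.\<close>

lemma dist_class_le:
  assumes g: "g \<in> cau" and h: "h \<in> cau" and \<theta>: "\<theta> \<in> Cinf_c U" and c: "\<forall>n\<ge>N. dB \<theta> (g n) (h n) \<le> c"
  shows "bdist \<theta> (eqv `` {g}) (eqv `` {h}) \<le> c"
proof -
  let ?F = "rep (eqv `` {g})" and ?G = "rep (eqv `` {h})"
  have F: "?F \<in> cau" "(\<lambda>j. dB \<theta> (g j) (?F j)) \<longlonglongrightarrow> 0" and G: "?G \<in> cau" "(\<lambda>j. dB \<theta> (h j) (?G j)) \<longlonglongrightarrow> 0"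
    using rep_eqv[OF g] rep_eqv[OF h] \<theta> by (auto simp: eqv_iff)
  have lim: "(\<lambda>j. dB \<theta> (g j) (?F j) + (c + dB \<theta> (h j) (?G j))) \<longlonglongrightarrow> 0 + (c + 0)"
    by (intro tendsto_add F(2) G(2) tendsto_const)
  have "dB \<theta> (?F j) (?G j) \<le> dB \<theta> (g j) (?F j) + (c + dB \<theta> (h j) (?G j))" if j: "j \<ge> N" for j
  proof -
    note cs = cau_cont[OF F(1)] cau_cont[OF G(1)] cau_cont[OF g] cau_cont[OF h]
    have "dB \<theta> (?F j) (?G j) \<le> dB \<theta> (?F j) (g j) + dB \<theta> (g j) (?G j)" by (intro dB_triangle \<theta> cs)
    also have "\<dots> \<le> dB \<theta> (?F j) (g j) + (dB \<theta> (g j) (h j) + dB \<theta> (h j) (?G j))"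
      by (intro add_left_mono dB_triangle \<theta> cs)
    also have "\<dots> \<le> dB \<theta> (?F j) (g j) + (c + dB \<theta> (h j) (?G j))"
      using c j by (intro add_left_mono add_right_mono) auto
    finally show ?thesis using dB_commute[OF \<theta> cs(1) cs(3), of j j] by simp
  qed
  then have "bdist \<theta> (eqv `` {g}) (eqv `` {h}) \<le> 0 + (c + 0)"
    by (intro LIMSEQ_le[OF dist_lim[OF class_in[OF g] class_in[OF h] \<theta>] lim]) blast
  then show ?thesis by simp
qed

end


section \<open>A compact family of distributions\<close>

lemma coef_ok_bound:
  assumes "1 \<le> p" "wt > 0" "\<Lambda> \<ge> 0"
  shows "\<exists>B. \<forall>J c. finite J \<longrightarrow> coef_ok p wt J c \<Lambda> \<longrightarrow> (\<forall>x\<in>J. \<bar>c x\<bar> \<le> B)"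
  using assms(1)
proof (cases rule: ennreal_exponent_cases)
  case 1 then show ?thesis by (auto simp: coef_ok_def intro!: exI[of _ \<Lambda>])
next
  case (2 P)
  have "\<bar>c x\<bar> \<le> (\<Lambda> powr P / wt) powr (1 / P)" if J: "finite J" and ok: "coef_ok p wt J c \<Lambda>" and x: "x \<in> J"
    for J :: "'a set" and c x
  proof -
    have "wt * \<bar>c x\<bar> powr P \<le> (\<Sum>x\<in>J. wt * \<bar>c x\<bar> powr P)"
      using assms J x by (intro member_le_sum) auto
    also have "\<dots> \<le> \<Lambda> powr P" using ok 2 by (simp add: coef_ok_def)
    finally have "\<bar>c x\<bar> powr P \<le> \<Lambda> powr P / wt" using assms(2) by (simp add: field_simps)
    then have "(\<bar>c x\<bar> powr P) powr (1 / P) \<le> (\<Lambda> powr P / wt) powr (1 / P)" using 2 by (intro powr_mono2) auto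
    then show ?thesis using 2 by (simp add: powr_powr)
  qed
  then show ?thesis by blast
qed

lemma closed_coef_ok:
  fixes f :: "'a \<Rightarrow> 'b::topological_space \<Rightarrow> real"
  assumes "1 \<le> p" "\<And>x. x \<in> J \<Longrightarrow> continuous_on UNIV (f x)"
  shows "closed {s. coef_ok p wt J (\<lambda>x. f x s) \<Lambda>}"
  using assms(1)
proof (cases rule: ennreal_exponent_cases)
  case 1
  have "{s. coef_ok p wt J (\<lambda>x. f x s) \<Lambda>} = (\<Inter>x\<in>J. {s. \<bar>f x s\<bar> \<le> \<Lambda>})" using 1 by (auto simp: coef_ok_def)
  moreover have "closed {s. \<bar>f x s\<bar> \<le> \<Lambda>}" if "x \<in> J" for x
    by (intro closed_Collect_le continuous_intros assms that)
  ultimately show ?thesis by auto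
next
  case (2 P)
  have "closed {s. (\<Sum>x\<in>J. wt * \<bar>f x s\<bar> powr P) \<le> \<Lambda> powr P}"
  proof (rule closed_Collect_le)
    have "continuous_on UNIV (\<lambda>s. \<bar>f x s\<bar> powr P)" if "x \<in> J" for x
      by (rule continuous_on_powr') (use assms(2)[OF that] 2 in \<open>auto intro!: continuous_intros\<close>)
    then show "continuous_on UNIV (\<lambda>s. \<Sum>x\<in>J. wt * \<bar>f x s\<bar> powr P)"
      by (intro continuous_on_sum continuous_on_mult continuous_on_const)
  qed auto
  then show ?thesis using 2 by (simp add: coef_ok_def)
qed

lemma compact_box_functions: "compact {s :: 'a \<Rightarrow> real. \<forall>f. \<bar>s f\<bar> \<le> B f}"
proof -
  have "compactin (product_topology (\<lambda>_::'a. euclideanreal) UNIV) (PiE UNIV (\<lambda>f. {- B f..B f}))"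
    by (subst compactin_PiE) auto
  moreover have "PiE UNIV (\<lambda>f. {- B f..B f}) = {s. \<forall>f. \<bar>s f\<bar> \<le> B f}"
    by (simp add: PiE_UNIV_domain Pi_def abs_le_iff minus_le_iff conj_commute)
  ultimately show ?thesis by (simp add: euclidean_product_topology)
qed

lemma finite_lattice_compact: assumes "compact A" shows "finite (lattice n \<inter> A :: (real ^ 'd) set)"
proof -
  obtain B where "\<forall>x\<in>A. norm x \<le> B" using compact_imp_bounded[OF assms] unfolding bounded_iff by blast
  then have "lattice n \<inter> A \<subseteq> lattice n \<inter> cball 0 (max B 0)" by auto
  then show ?thesis by (rule finite_subset) (rule lattice_ball_card, simp)
qed

lemma wavelets_inI:
  fixes \<eta> :: "real ^ 'd \<Rightarrow> real"
  assumes "\<eta> = dilate n x \<phi> \<or> (\<exists>i\<in>{1..<2 ^ CARD('d)}. \<eta> = dilate n x (\<psi> i))"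
    "x \<in> lattice n" "supp \<eta> \<subseteq> U"
  shows "\<eta> \<in> wavelets_in U \<phi> \<psi>"
  using assms unfolding wavelets_in_def by blast

lemma adapted_cball:
  fixes K :: "(real ^ 'd) set"
  assumes "adapted U R K k" "x \<in> K" "n \<ge> k" "R > 0" shows "cball x (R / 2 ^ n) \<subseteq> U"
proof -
  have le: "R / 2 ^ n \<le> R / 2 ^ k" using assms(3,4) by (intro divide_left_mono power_increasing) auto
  have "U = UNIV \<or> R / 2 ^ k < setdist K (- U)" using assms(1,2) by (auto simp: adapted_def)
  then show ?thesis
  proof
    assume s: "R / 2 ^ k < setdist K (- U)"
    show ?thesis
    proof (rule ccontr)
      assume "\<not> cball x (R / 2 ^ n) \<subseteq> U"
      then obtain y where "y \<in> cball x (R / 2 ^ n)" and y2: "y \<notin> U" by blast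
      then have y: "dist x y \<le> R / 2 ^ n" "y \<notin> U" by auto
      then have "setdist K (- U) \<le> dist x y" using assms(2) by (intro setdist_le_dist) auto
      then show False using s y le by linarith
    qed
  qed auto
qed

text \<open>The deterministic setting. Each set of the exhaustion has its own bound
  \<open>lam j\<close>, and the coefficients have a regularity \<open>\<alpha>'\<close> whose
  surplus over \<open>\<alpha>\<close> makes the series converge geometrically.\<close>

locale coefficient_bounds = besov_on r R \<phi> \<psi> V p q \<alpha> U
  for r R and \<phi> :: "real ^ 'd \<Rightarrow> real" and \<psi> V p q \<alpha> U +
  fixes K :: "nat \<Rightarrow> (real ^ 'd) set" and k :: "nat \<Rightarrow> nat" and \<alpha>' :: real and lam :: "nat \<Rightarrow> real"
  assumes \<alpha>_less: "\<alpha> < \<alpha>'" and lam: "\<And>j. lam j \<ge> 0"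
    and exhaust: "\<And>L. compact L \<Longrightarrow> L \<subseteq> U \<Longrightarrow> \<exists>n. L \<subseteq> K n"
    and adapt: "\<And>n. adapted U R (K n) (k n)"
begin

lemma K_compact: "compact (K j)" and K_sub: "K j \<subseteq> U"
  using adapt[of j] by (auto simp: adapted_def)

lemma K_cball: "x \<in> K j \<Longrightarrow> n \<ge> k j \<Longrightarrow> cball x (R / 2 ^ n) \<subseteq> U"
  by (rule adapted_cball[OF adapt _ _ R_pos])

text \<open>If \<open>U\<close> is not the whole space, then the adaptedness of sets that come arbitrarily close to
  the boundary forces the scales to be arbitrarily fine.\<close>

lemma neighbourhood_in_K:
  assumes L: "compact L" "L \<subseteq> U"
  obtains j where "\<forall>x\<in>L. cball x (R / 2 ^ k j) \<subseteq> K j"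
proof (cases "U = UNIV \<or> L = {}")
  case True
  have "compact (\<Union>x\<in>L. cball x R)" by (rule compact_minkowski_sum_cball[OF L(1)])
  moreover have "(\<Union>x\<in>L. cball x R) \<subseteq> U" using True by auto
  ultimately obtain j where j: "(\<Union>x\<in>L. cball x R) \<subseteq> K j" using exhaust by blast
  have "R / 2 ^ k j \<le> R" using R_pos by (simp add: field_simps one_le_power)
  then have "cball x (R / 2 ^ k j) \<subseteq> cball x R" for x :: "real ^ 'd" by (rule subset_cball)
  then have "\<forall>x\<in>L. cball x (R / 2 ^ k j) \<subseteq> K j" using j by blast
  then show thesis by (rule that)
next
  case False
  obtain \<delta> where \<delta>: "\<delta> > 0" "(\<Union>x\<in>L. cball x \<delta>) \<subseteq> U"
    using compact_subset_open_imp_cball_epsilon_subset[OF L(1) open_U L(2)] by blast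
  obtain a b where a: "a \<in> L" and b: "b \<in> - U" using False by auto
  have ne: "- U \<noteq> {}" using b by auto
  have cU: "closed (- U)" using open_U by (simp add: closed_Compl)
  let ?f = "\<lambda>t. infdist (a + t *\<^sub>R (b - a)) (- U)"
  \<comment> \<open>The segment from a point of \<open>L\<close> to a point outside \<open>U\<close>
    contains a point of \<open>U\<close> at distance at most \<open>\<delta>\<close> from the
    complement. It is added to the compact set that \<open>K j\<close> has to contain.\<close>
  have "\<exists>t\<ge>0. t \<le> 1 \<and> ?f t = min \<delta> (?f 0)"
  proof (rule IVT2')
    show "?f 1 \<le> min \<delta> (?f 0)" using b \<delta>(1) by (simp add: infdist_nonneg)
    show "continuous_on {0..1} ?f" by (intro continuous_intros)
  qed auto
  then obtain t where t: "?f t = min \<delta> (?f 0)" by blast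
  define c where "c = a + t *\<^sub>R (b - a)"
  have "?f 0 > 0" using a L(2) infdist_pos_not_in_closed[OF cU ne, of a] by auto
  then have c: "0 < infdist c (- U)" "infdist c (- U) \<le> \<delta>" using t \<delta>(1) by (auto simp: c_def)
  then have cU': "c \<in> U" using infdist_zero[of c "- U"] by (metis ComplI less_irrefl)
  have "compact (insert c (\<Union>x\<in>L. cball x \<delta>))"
    by (intro compact_insert compact_minkowski_sum_cball L)
  moreover have "insert c (\<Union>x\<in>L. cball x \<delta>) \<subseteq> U" using \<delta>(2) cU' by auto
  ultimately have "\<exists>j. insert c (\<Union>x\<in>L. cball x \<delta>) \<subseteq> K j" by (rule exhaust)
  then obtain j where j: "insert c (\<Union>x\<in>L. cball x \<delta>) \<subseteq> K j" ..
  have "R / 2 ^ k j < setdist (K j) (- U)" using adapt[of j] j ne by (auto simp: adapted_def)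
  also have "\<dots> \<le> setdist {c} (- U)" using j by (intro setdist_subset_left) auto
  also have "\<dots> \<le> \<delta>" using c(2) by (simp add: infdist_eq_setdist)
  finally have "R / 2 ^ k j \<le> \<delta>" by simp
  then have "cball x (R / 2 ^ k j) \<subseteq> cball x \<delta>" for x :: "real ^ 'd" by (rule subset_cball)
  then have "\<forall>x\<in>L. cball x (R / 2 ^ k j) \<subseteq> K j" using j by blast
  then show thesis by (rule that)
qed

section \<open>Linear forms on the span of the wavelets in the domain\<close>

definition W :: "(real ^ 'd \<Rightarrow> real) set" where "W = wavelets_in U \<phi> \<psi>"

definition wavelet_span :: "(real ^ 'd \<Rightarrow> real) set" where "wavelet_span = wspan W"

lemma wl_W:
  assumes "i \<in> insert 0 IW" "x \<in> lattice n" "supp (wl i n x) \<subseteq> U" shows "wl i n x \<in> W"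
proof -
  have "wl i n x = dilate n x \<phi> \<or> (\<exists>i'\<in>{1..<2 ^ CARD('d)}. wl i n x = dilate n x (\<psi> i'))"
    using assms(1) by (cases "i = 0") (auto simp: wl_def w_def IW_def)
  then show ?thesis unfolding W_def using assms(2,3) by (intro wavelets_inI)
qed

lemma W_cases:
  assumes "\<eta> \<in> W" obtains i n x where "i \<in> insert 0 IW" "x \<in> lattice n" "\<eta> = wl i n x" "supp \<eta> \<subseteq> U"
proof -
  obtain n x where x: "x \<in> lattice n" and U: "supp \<eta> \<subseteq> U"
    and d: "\<eta> = dilate n x \<phi> \<or> (\<exists>i\<in>IW. \<eta> = dilate n x (\<psi> i))"
    using assms unfolding W_def wavelets_in_def IW_def by blast
  from d show thesis
  proof
    assume "\<eta> = dilate n x \<phi>"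
    then show thesis using that[of 0 x n] x U by (simp add: wl_def w_def)
  next
    assume "\<exists>i\<in>IW. \<eta> = dilate n x (\<psi> i)"
    then obtain i where "i \<in> IW" "\<eta> = dilate n x (\<psi> i)" by blast
    moreover from this have "i \<noteq> 0" using zero_notin_IW by metis
    ultimately show thesis using that[of i x n] x U by (simp add: wl_def w_def)
  qed
qed

lemma W_Crc: "W \<subseteq> Crc r U"
proof
  fix \<eta> assume "\<eta> \<in> W"
  then obtain i n x where e: "i \<in> insert 0 IW" "\<eta> = wl i n x" "supp \<eta> \<subseteq> U" by (rule W_cases)
  then show "\<eta> \<in> Crc r U" using wl_Ck[OF e(1), of n x] cc_compact_supp[OF wl_cc[OF e(1)], of n x] by (simp add: Crc_def)
qed

lemma wavelet_span_Crc: "wavelet_span \<subseteq> Crc r U"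
  unfolding wavelet_span_def by (rule wspan_Crc[OF W_Crc])

lemma wl_K_W: "i \<in> insert 0 IW \<Longrightarrow> x \<in> lattice n \<Longrightarrow> x \<in> K j \<Longrightarrow> n \<ge> k j \<Longrightarrow> wl i n x \<in> W"
  using K_cball[of x j n] wl_supp_cball[of i n x] by (intro wl_W) auto

lemma W_wavelet_span: "\<eta> \<in> W \<Longrightarrow> \<eta> \<in> wavelet_span"
  unfolding wavelet_span_def by (rule wspan_base)

text \<open>Forms are total functions here, and the value 0 outside \<open>wavelet_span\<close>
  keeps the remaining coordinates bounded. The set can then be placed in a product of compact
  intervals.\<close>

definition admissible_forms :: "((real ^ 'd \<Rightarrow> real) \<Rightarrow> real) set" where
  "admissible_forms = {s. (\<forall>f. f \<notin> wavelet_span \<longrightarrow> s f = 0) \<and> lin_on wavelet_span s \<and>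
     (\<forall>j. \<forall>x\<in>lattice (k j) \<inter> K j. \<bar>s (wl 0 (k j) x)\<bar> \<le> lam j) \<and>
     (\<forall>j. \<forall>n\<ge>k j. \<forall>i\<in>IW. coef_ok p (1 / 2 ^ (CARD('d) * n)) (lattice n \<inter> K j)
         (\<lambda>x. 2 ^ (CARD('d) * n) * s (wl i n x)) (lam j * 2 powr (- (\<alpha>' * real n))))}"

lemma admissible_forms_lin: "s \<in> admissible_forms \<Longrightarrow> lin_on (wspan W) s"
  by (simp add: admissible_forms_def wavelet_span_def)

lemma admissible_forms_coef:
  "s \<in> admissible_forms \<Longrightarrow> n \<ge> k j \<Longrightarrow> i \<in> IW \<Longrightarrow> coef_ok p (1 / 2 ^ (CARD('d) * n)) (lattice n \<inter> K j)
         (\<lambda>x. 2 ^ (CARD('d) * n) * s (wl i n x)) (lam j * 2 powr (- (\<alpha>' * real n)))"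
  by (simp add: admissible_forms_def)

text \<open>The functions whose values the bounds in \<open>admissible_forms\<close> reach directly.
  The set \<open>W\<close> asks only that the support lie in \<open>U\<close>, so it also holds, for
  instance, scaling functions of other scales.\<close>

definition base :: "(real ^ 'd \<Rightarrow> real) set" where
  "base = {\<eta>. \<exists>j. (\<exists>x\<in>lattice (k j) \<inter> K j. \<eta> = wl 0 (k j) x) \<or>
                   (\<exists>n\<ge>k j. \<exists>i\<in>IW. \<exists>x\<in>lattice n \<inter> K j. \<eta> = wl i n x)}"

lemma coeff_in_K:
  assumes "supp \<eta> \<subseteq> L" "\<forall>x\<in>L. cball x (R / 2 ^ k j) \<subseteq> K j" "n \<ge> k j"
  shows "\<forall>i\<in>insert 0 IW. \<forall>x\<in>lattice n. L2_inner \<eta> (wl i n x) \<noteq> 0 \<longrightarrow> x \<in> lattice n \<inter> K j"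
proof (intro ballI impI)
  fix i x assume i: "i \<in> insert 0 IW" and x: "x \<in> lattice n" and ne: "L2_inner \<eta> (wl i n x) \<noteq> 0"
  obtain z where z: "\<eta> z \<noteq> 0" "dist x z < R / 2 ^ n" using inner_eq_0[OF i] ne by meson
  have "z \<in> L" using z(1) assms(1) notin_supp_eq_0 by blast
  moreover have "R / 2 ^ n \<le> R / 2 ^ k j" using R_pos assms(3) by (intro divide_left_mono power_increasing) auto
  ultimately have "x \<in> K j" using assms(2) z(2) by (force simp: dist_commute)
  then show "x \<in> lattice n \<inter> K j" using x by simp
qed

lemma W_PP: assumes "\<eta> \<in> W" shows "\<exists>m. \<forall>N\<ge>m. PP {0} N \<eta> = \<eta>"
proof -
  obtain i m x where e: "i \<in> insert 0 IW" "x \<in> lattice m" "\<eta> = wl i m x" "supp \<eta> \<subseteq> U" using assms by (rule W_cases)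
  have "\<eta> \<in> V (int (Suc m))"
    using e wl_in[of "{0}" 0 x m] wl_in[of IW i x m] V_Suc[of "int m"]
    by (auto simp: detail_space_def add.commute)
  then have "\<eta> \<in> Sp {0} N" if "N \<ge> Suc m" for N using V_mono[OF that] by auto
  then have "PP {0} N \<eta> = \<eta>" if "N \<ge> Suc m" for N using PP_id[of "{0}" \<eta> N] e(1,3) wl_cc that by simp
  then show ?thesis by blast
qed

text \<open>An element of \<open>W\<close> equals its projection on all sufficiently fine
  \<open>V N\<close>. Choosing a set \<open>K j\<close> that surrounds its support and telescoping
  down to the scale \<open>k j\<close> expresses it through \<open>base\<close>. So the bounds
  extend to every function in the span, which gives the intervals for the compactness.\<close>

lemma W_base: "W \<subseteq> wspan base"
proof
  fix \<eta> assume "\<eta> \<in> W"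
  then obtain m where m: "\<forall>N\<ge>m. PP {0} N \<eta> = \<eta>" using W_PP by blast
  have \<eta>: "\<eta> \<in> Crc r U" using \<open>\<eta> \<in> W\<close> W_Crc by blast
  have c: "cc \<eta>" by (rule Crc_cc[OF \<eta>])
  have "supp \<eta> \<subseteq> U" using \<eta> by (simp add: Crc_def)
  then obtain j where j: "\<forall>x\<in>supp \<eta>. cball x (R / 2 ^ k j) \<subseteq> K j"
    using neighbourhood_in_K[OF cc_compact_supp[OF c]] by blast
  define N where "N = max m (k j)"
  have "\<eta> = PP {0} N \<eta>" using m by (simp add: N_def)
  also have "\<dots> = (\<lambda>z. 1 * PP {0} (k j) \<eta> z + 1 * (\<Sum>n\<in>{k j..<N}. 1 * PP IW n \<eta> z))"
    using PP_telescope[OF c, of "k j" N] by (auto simp: N_def)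
  also have "\<dots> \<in> wspan base"
  proof (intro wspan_lincomb wspan_sum)
    have F: "finite (lattice n \<inter> K j)" for n by (rule finite_lattice_compact[OF K_compact])
    show "PP {0} (k j) \<eta> \<in> wspan base"
    proof -
      have "PP {0} (k j) \<eta> = (\<lambda>z. \<Sum>x\<in>lattice (k j) \<inter> K j. (2 ^ (CARD('d) * k j) * L2_inner \<eta> (wl 0 (k j) x)) * wl 0 (k j) x z)"
        using PP_eq[of "{0}" "lattice (k j) \<inter> K j" "k j" \<eta>] F coeff_in_K[OF order_refl j order_refl] by simp
      also have "\<dots> \<in> wspan base" by (intro wspan_sum wspan_base) (auto simp: base_def)
      finally show ?thesis .
    qed
    fix n assume n: "n \<in> {k j..<N}"
    have "PP IW n \<eta> = (\<lambda>z. \<Sum>i\<in>IW. 1 * (\<Sum>x\<in>lattice n \<inter> K j. (2 ^ (CARD('d) * n) * L2_inner \<eta> (wl i n x)) * wl i n x z))"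
      using PP_eq[of IW "lattice n \<inter> K j" n \<eta>] F coeff_in_K[OF order_refl j, of n] n by simp
    also have "\<dots> \<in> wspan base"
    proof (intro wspan_sum wspan_base)
      fix i x assume "i \<in> IW" "x \<in> lattice n \<inter> K j"
      then show "wl i n x \<in> base" using n unfolding base_def
        by (intro CollectI exI[of _ j] disjI2 exI[of _ n] conjI bexI[of _ i] bexI[of _ x]) auto
    qed
    finally show "PP IW n \<eta> \<in> wspan base" .
  qed
  finally show "\<eta> \<in> wspan base" .
qed

lemma base_W: "base \<subseteq> W"
  by (auto simp: base_def intro: wl_K_W)

lemma admissible_forms_bounded: assumes "f \<in> wavelet_span" shows "\<exists>B. \<forall>s\<in>admissible_forms. \<bar>s f\<bar> \<le> B"
proof -
  have bb: "\<exists>B. \<forall>s\<in>admissible_forms. \<bar>s w\<bar> \<le> B" if w: "w \<in> base" for w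
  proof -
    consider j x where "x \<in> lattice (k j) \<inter> K j" "w = wl 0 (k j) x"
      | j n i x where "n \<ge> k j" "i \<in> IW" "x \<in> lattice n \<inter> K j" "w = wl i n x"
      using w unfolding base_def by blast
    then show ?thesis
    proof cases
      case (1 j x)
      then have "\<forall>s\<in>admissible_forms. \<bar>s w\<bar> \<le> lam j" by (simp add: admissible_forms_def)
      then show ?thesis by blast
    next
      case (2 j n i x)
      have "\<exists>B. \<forall>(J :: (real ^ 'd) set) c. finite J \<longrightarrow> coef_ok p (1 / 2 ^ (CARD('d) * n)) J c (lam j * 2 powr (- (\<alpha>' * real n))) \<longrightarrow> (\<forall>x\<in>J. \<bar>c x\<bar> \<le> B)"
        by (rule coef_ok_bound[OF p]) (use lam in auto)
      then obtain B where B: "\<forall>(J :: (real ^ 'd) set) c. finite J \<longrightarrow> coef_ok p (1 / 2 ^ (CARD('d) * n)) J c (lam j * 2 powr (- (\<alpha>' * real n))) \<longrightarrow> (\<forall>x\<in>J. \<bar>c x\<bar> \<le> B)" ..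
      have "\<bar>s w\<bar> \<le> B / 2 ^ (CARD('d) * n)" if s: "s \<in> admissible_forms" for s
      proof -
        have "\<bar>2 ^ (CARD('d) * n) * s (wl i n x)\<bar> \<le> B"
          using B[rule_format, OF finite_lattice_compact[OF K_compact] admissible_forms_coef[OF s 2(1,2)] 2(3)] .
        then show ?thesis using 2(4) by (simp add: abs_mult field_simps)
      qed
      then show ?thesis by blast
    qed
  qed
  have "f \<in> wspan base" using assms wspan_trans[OF W_base] by (auto simp: wavelet_span_def)
  then show ?thesis
  proof induction
    case zero
    have "\<bar>s (\<lambda>x. 0)\<bar> \<le> 0" if "s \<in> admissible_forms" for s using lin_on_0[OF admissible_forms_lin[OF that]] by simp
    then show ?case by blast
  next
    case (step f w c)
    obtain B where B: "\<forall>s\<in>admissible_forms. \<bar>s f\<bar> \<le> B" using step by blast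
    obtain B' where B': "\<forall>s\<in>admissible_forms. \<bar>s w\<bar> \<le> B'" using bb step by blast
    have fW: "f \<in> wspan W" using step(1) wspan_trans[of base W] base_W wspan_base by blast
    have wW: "w \<in> wspan W" using step(2) base_W wspan_base by blast
    have "\<bar>s (\<lambda>x. f x + c * w x)\<bar> \<le> B + \<bar>c\<bar> * B'" if s: "s \<in> admissible_forms" for s
    proof -
      have "s (\<lambda>x. f x + c * w x) = s f + c * s w" using lin_onD[OF admissible_forms_lin[OF s] fW wW, of 1 c] by simp
      also have "\<bar>\<dots>\<bar> \<le> \<bar>s f\<bar> + \<bar>c\<bar> * \<bar>s w\<bar>" using abs_triangle_ineq[of "s f" "c * s w"] by (simp add: abs_mult)
      also have "\<dots> \<le> B + \<bar>c\<bar> * B'" using B B' s by (intro add_mono mult_left_mono) auto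
      finally show ?thesis .
    qed
    then show ?case by blast
  qed
qed

definition form_bound :: "(real ^ 'd \<Rightarrow> real) \<Rightarrow> real" where
  "form_bound f = (if f \<in> wavelet_span then SOME B. \<forall>s\<in>admissible_forms. \<bar>s f\<bar> \<le> B else 0)"

lemma form_bound: "s \<in> admissible_forms \<Longrightarrow> \<bar>s f\<bar> \<le> form_bound f"
proof (cases "f \<in> wavelet_span")
  case True
  assume s: "s \<in> admissible_forms"
  have "\<forall>s\<in>admissible_forms. \<bar>s f\<bar> \<le> form_bound f" unfolding form_bound_def using True by simp (rule someI_ex[OF admissible_forms_bounded[OF True]])
  then show ?thesis using s by blast
qed (simp add: admissible_forms_def form_bound_def)

lemma admissible_forms_compact: "compact admissible_forms"
proof -
  have cont: "continuous_on UNIV (\<lambda>s :: (real ^ 'd \<Rightarrow> real) \<Rightarrow> real. s f)" for f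
    by (rule continuous_on_product_coordinates)
  have c1: "closed {s. \<forall>f. f \<notin> wavelet_span \<longrightarrow> s f = (0::real)}"
  proof -
    have "{s. \<forall>f. f \<notin> wavelet_span \<longrightarrow> s f = (0::real)} = (\<Inter>f\<in>- wavelet_span. {s. s f = 0})" by auto
    then show ?thesis by (auto intro!: closed_INT closed_Collect_eq cont)
  qed
  have c2: "closed {s. lin_on wavelet_span s}"
  proof -
    have "{s. lin_on wavelet_span s} = (\<Inter>f\<in>wavelet_span. \<Inter>g\<in>wavelet_span. \<Inter>a. \<Inter>b. {s. s (\<lambda>x. a * f x + b * g x) = a * s f + b * s g})"
      by (auto simp: lin_on_def)
    then show ?thesis by (auto intro!: closed_INT closed_Collect_eq continuous_intros cont)
  qed
  have c3: "closed {s. \<forall>j. \<forall>x\<in>lattice (k j) \<inter> K j. \<bar>s (wl 0 (k j) x)\<bar> \<le> lam j}"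
  proof -
    have "{s. \<forall>j. \<forall>x\<in>lattice (k j) \<inter> K j. \<bar>s (wl 0 (k j) x)\<bar> \<le> lam j} =
      (\<Inter>j. \<Inter>x\<in>lattice (k j) \<inter> K j. {s. \<bar>s (wl 0 (k j) x)\<bar> \<le> lam j})" by auto
    then show ?thesis by (auto intro!: closed_INT closed_Collect_le continuous_intros cont)
  qed
  have c4: "closed {s. \<forall>j. \<forall>n\<ge>k j. \<forall>i\<in>IW. coef_ok p (1 / 2 ^ (CARD('d) * n)) (lattice n \<inter> K j)
         (\<lambda>x. 2 ^ (CARD('d) * n) * s (wl i n x)) (lam j * 2 powr (- (\<alpha>' * real n)))}"
  proof -
    have "{s. \<forall>j. \<forall>n\<ge>k j. \<forall>i\<in>IW. coef_ok p (1 / 2 ^ (CARD('d) * n)) (lattice n \<inter> K j)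
         (\<lambda>x. 2 ^ (CARD('d) * n) * s (wl i n x)) (lam j * 2 powr (- (\<alpha>' * real n)))} =
      (\<Inter>j. \<Inter>n\<in>{k j..}. \<Inter>i\<in>IW. {s. coef_ok p (1 / 2 ^ (CARD('d) * n)) (lattice n \<inter> K j)
         (\<lambda>x. 2 ^ (CARD('d) * n) * s (wl i n x)) (lam j * 2 powr (- (\<alpha>' * real n)))})" by auto
    then show ?thesis by (auto intro!: closed_INT closed_coef_ok p continuous_intros cont)
  qed
  have "admissible_forms = {s. \<forall>f. f \<notin> wavelet_span \<longrightarrow> s f = 0} \<inter> {s. lin_on wavelet_span s} \<inter>
     {s. \<forall>j. \<forall>x\<in>lattice (k j) \<inter> K j. \<bar>s (wl 0 (k j) x)\<bar> \<le> lam j} \<inter>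
     {s. \<forall>j. \<forall>n\<ge>k j. \<forall>i\<in>IW. coef_ok p (1 / 2 ^ (CARD('d) * n)) (lattice n \<inter> K j)
         (\<lambda>x. 2 ^ (CARD('d) * n) * s (wl i n x)) (lam j * 2 powr (- (\<alpha>' * real n)))}"
    by (auto simp: admissible_forms_def)
  then have "closed admissible_forms" using c1 c2 c3 c4 by (simp add: closed_Int)
  from compact_Int_closed[OF compact_box_functions[of form_bound] this] have "compact ({s. \<forall>f. \<bar>s f\<bar> \<le> form_bound f} \<inter> admissible_forms)" .
  moreover have "admissible_forms \<subseteq> {s. \<forall>f. \<bar>s f\<bar> \<le> form_bound f}" using form_bound by blast
  ultimately show ?thesis by (simp only: Int_absorb1)
qed

section \<open>Approximating functions attached to a linear form\<close>

definition inner_lattice :: "nat \<Rightarrow> (real ^ 'd) set" where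
  "inner_lattice N = {y \<in> lattice N. norm y \<le> real N \<and> cball y (R / 2 ^ N) \<subseteq> U}"

lemma finite_inner_lattice: "finite (inner_lattice N)"
  by (rule finite_subset[OF _ lattice_ball_card(1)[of "real N" N "0 :: real ^ 'd"]]) (auto simp: inner_lattice_def)

lemma inner_lattice_W: "y \<in> inner_lattice N \<Longrightarrow> wl 0 N y \<in> W"
  using wl_supp_cball[of 0 N y] by (intro wl_W) (auto simp: inner_lattice_def)

text \<open>The projection of the form \<open>s\<close> on \<open>V N\<close>, with the scaling
  functions that fit into \<open>U\<close>; \<open>norm y \<le> N\<close> in
  \<open>inner_lattice\<close> keeps the sum finite. One sequence thus serves all compact subsets of
  \<open>U\<close>, although the wavelet bounds start at a scale depending on the set.\<close>

definition approx :: "((real ^ 'd \<Rightarrow> real) \<Rightarrow> real) \<Rightarrow> nat \<Rightarrow> real ^ 'd \<Rightarrow> real" where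
  "approx s N z = (\<Sum>y\<in>inner_lattice N. (2 ^ (CARD('d) * N) * s (wl 0 N y)) * wl 0 N y z)"

text \<open>Divides $2^{-N}$ by the largest total coefficient that an admissible form can produce in
  \<open>approx\<close>. Mollifying every scaling function up to this error changes
  \<open>approx\<close> by at most $2^{-N}$ in $C^r$, uniformly over the forms; the 1 avoids
  division by zero.\<close>

definition eps :: "nat \<Rightarrow> real" where
  "eps N = 1 / (2 ^ N * (1 + (\<Sum>y\<in>inner_lattice N. \<bar>2 ^ (CARD('d) * N) * form_bound (wl 0 N y)\<bar>)))"

lemma eps_pos: "eps N > 0"
  unfolding eps_def by (intro divide_pos_pos mult_pos_pos add_pos_nonneg sum_nonneg) auto

text \<open>A mollified scaling function. Sequences in \<open>Besov_cauchy\<close> consist of smooth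
  functions, whereas the scaling functions are only of class $C^r$.\<close>

definition wt :: "nat \<Rightarrow> real ^ 'd \<Rightarrow> real ^ 'd \<Rightarrow> real" where
  "wt N y = (SOME h. h \<in> Cinf_c UNIV \<and> Cb r (eps N) 1 (\<lambda>x. h x - wl 0 N y x))"

lemma wt: "wt N y \<in> Cinf_c UNIV \<and> Cb r (eps N) 1 (\<lambda>x. wt N y x - wl 0 N y x)"
  unfolding wt_def
proof (rule someI_ex[where P = "\<lambda>h. h \<in> Cinf_c UNIV \<and> Cb r (eps N) 1 (\<lambda>x. h x - wl 0 N y x)"])
  have "wl 0 N y \<in> Crc r UNIV" by (rule wl_Crc) auto
  then obtain h where "h \<in> Cinf_c UNIV" "Cb r (eps N) 1 (\<lambda>x. h x - wl 0 N y x)"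
    using mollify[OF _ eps_pos] by metis
  then show "\<exists>h. h \<in> Cinf_c UNIV \<and> Cb r (eps N) 1 (\<lambda>x. h x - wl 0 N y x)" by blast
qed

definition smooth_approx :: "((real ^ 'd \<Rightarrow> real) \<Rightarrow> real) \<Rightarrow> nat \<Rightarrow> real ^ 'd \<Rightarrow> real" where
  "smooth_approx s N z = (\<Sum>y\<in>inner_lattice N. (2 ^ (CARD('d) * N) * s (wl 0 N y)) * wt N y z)"

lemma Cinf_c_sum: "(\<And>i. i \<in> I \<Longrightarrow> f i \<in> Cinf_c A) \<Longrightarrow> (\<lambda>x. \<Sum>i\<in>I. c i * f i x) \<in> Cinf_c A"
proof (induction I rule: infinite_finite_induct)
  case (insert i I)
  then have "(\<lambda>x. c i * f i x + 1 * (\<Sum>i\<in>I. c i * f i x)) \<in> Crc m A" for m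
    by (intro Crc_lincomb Cinf_c_Crc) auto
  then show ?case using insert by (auto simp: Cinf_c_def)
qed (simp_all add: zero_Cinf_c)

lemma smooth_approx_Cinf_c: "smooth_approx s N \<in> Cinf_c UNIV"
  unfolding smooth_approx_def[abs_def] by (intro Cinf_c_sum) (simp add: wt)

lemma smooth_approx_cont: "continuous_on A (smooth_approx s N)"
  by (rule cc_continuous_on[OF Cinf_c_cc[OF smooth_approx_Cinf_c]])

lemma approx_cc: "cc (approx s N)"
  unfolding approx_def[abs_def] by (intro cc_sum cc_cmult wl_cc) auto

lemma approx_cont: "continuous_on A (approx s N)"
  by (rule cc_continuous_on[OF approx_cc])

lemma smooth_approx_error: assumes "s \<in> admissible_forms" shows "Cb r (1 / 2 ^ N) 1 (\<lambda>z. smooth_approx s N z - approx s N z)"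
proof -
  let ?c = "\<lambda>y. 2 ^ (CARD('d) * N) * s (wl 0 N y)" and ?T = "\<Sum>y\<in>inner_lattice N. \<bar>2 ^ (CARD('d) * N) * form_bound (wl 0 N y)\<bar>"
  have "Cb r (\<Sum>y\<in>inner_lattice N. \<bar>?c y\<bar> * eps N) 1 (\<lambda>z. \<Sum>y\<in>inner_lattice N. ?c y * (wt N y z - wl 0 N y z))"
    by (intro Cb_sum Cb_cmult) (use wt in auto)
  moreover have "(\<Sum>y\<in>inner_lattice N. \<bar>?c y\<bar> * eps N) \<le> 1 / 2 ^ N"
  proof -
    have "(\<Sum>y\<in>inner_lattice N. \<bar>?c y\<bar> * eps N) = (\<Sum>y\<in>inner_lattice N. \<bar>?c y\<bar>) * eps N" by (rule sum_distrib_right[symmetric])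
    also have "\<dots> \<le> (1 + ?T) * eps N"
    proof (rule mult_right_mono)
      have "(\<Sum>y\<in>inner_lattice N. \<bar>?c y\<bar>) \<le> ?T"
      proof (rule sum_mono)
        fix y
        have "\<bar>s (wl 0 N y)\<bar> \<le> \<bar>form_bound (wl 0 N y)\<bar>" using form_bound[OF assms, of "wl 0 N y"] by linarith
        then show "\<bar>?c y\<bar> \<le> \<bar>2 ^ (CARD('d) * N) * form_bound (wl 0 N y)\<bar>" by (simp add: abs_mult)
      qed
      then show "(\<Sum>y\<in>inner_lattice N. \<bar>?c y\<bar>) \<le> 1 + ?T" by simp
    qed (use eps_pos in \<open>auto intro: less_imp_le\<close>)
    also have "\<dots> = 1 / 2 ^ N"
    proof -
      have "?T \<ge> 0" by (rule sum_nonneg) simp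
      then have "1 + ?T \<noteq> 0" by linarith
      then show ?thesis by (simp add: eps_def)
    qed
    finally show ?thesis .
  qed
  ultimately have "Cb r (1 / 2 ^ N) 1 (\<lambda>z. \<Sum>y\<in>inner_lattice N. ?c y * (wt N y z - wl 0 N y z))"
    by (rule Cb_mono[OF _ order_refl]) simp
  then show ?thesis by (simp add: smooth_approx_def approx_def sum_subtractf right_diff_distrib)
qed

lemma near_in_inner_lattice:
  assumes L: "compact L" "L \<subseteq> U"
  obtains j N0 where "\<forall>x\<in>L. cball x (R / 2 ^ k j) \<subseteq> K j" "k j \<le> N0" "\<forall>n\<ge>N0. lattice n \<inter> K j \<subseteq> inner_lattice n"
proof -
  obtain j where j: "\<forall>x\<in>L. cball x (R / 2 ^ k j) \<subseteq> K j" using neighbourhood_in_K[OF L] by blast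
  obtain B where B: "\<forall>x\<in>K j. norm x \<le> B" using compact_imp_bounded[OF K_compact] unfolding bounded_iff by blast
  define N0 where "N0 = max (k j) (nat \<lceil>B\<rceil>)"
  have "lattice n \<inter> K j \<subseteq> inner_lattice n" if n: "n \<ge> N0" for n
  proof
    fix x assume x: "x \<in> lattice n \<inter> K j"
    have "B \<le> real n" using n by (simp add: N0_def)
    then have "norm x \<le> real n" using B x by force
    moreover have "cball x (R / 2 ^ n) \<subseteq> U" by (rule K_cball[of _ j]) (use x n in \<open>auto simp: N0_def\<close>)
    ultimately show "x \<in> inner_lattice n" using x by (simp add: inner_lattice_def)
  qed
  then show thesis using j by (intro that[of j N0]) (auto simp: N0_def)
qed

lemma near_K:
  assumes "\<forall>x\<in>L. cball x (R / 2 ^ k j) \<subseteq> K j" "n \<ge> k j" "z \<in> L"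
  shows "lattice n \<inter> cball z (R / 2 ^ n) \<subseteq> lattice n \<inter> K j"
proof -
  have "R / 2 ^ n \<le> R / 2 ^ k j" using R_pos assms(2) by (intro divide_left_mono power_increasing) auto
  then have "cball z (R / 2 ^ n) \<subseteq> cball z (R / 2 ^ k j)" by (rule subset_cball)
  then show ?thesis using assms(1,3) by blast
qed

lemma Ker_wavelet_span:
  assumes "\<forall>x\<in>L. cball x (R / 2 ^ k j) \<subseteq> K j" "n \<ge> k j" "z \<in> L" "good I"
  shows "Ker I n z \<in> wspan W"
    and "s \<in> admissible_forms \<Longrightarrow> s (Ker I n z) = (\<Sum>i\<in>I. \<Sum>x\<in>lattice n \<inter> cball z (R / 2 ^ n). (2 ^ (CARD('d) * n) * wl i n x z) * s (wl i n x))"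
proof -
  have W: "wl i n x \<in> wspan W" if "i \<in> I" "x \<in> lattice n \<inter> cball z (R / 2 ^ n)" for i x
    using near_K[OF assms(1-3)] that good_sub[OF assms(4)] assms(2) by (intro wspan_base wl_K_W[of _ _ _ j]) auto
  have eq: "Ker I n z = (\<lambda>y. \<Sum>i\<in>I. 1 * (\<Sum>x\<in>lattice n \<inter> cball z (R / 2 ^ n). (2 ^ (CARD('d) * n) * wl i n x z) * wl i n x y))"
    by (simp add: Ker_def)
  show "Ker I n z \<in> wspan W" unfolding eq by (intro wspan_sum W)
  assume s: "s \<in> admissible_forms"
  have "s (Ker I n z) = (\<Sum>i\<in>I. 1 * s (\<lambda>y. \<Sum>x\<in>lattice n \<inter> cball z (R / 2 ^ n). (2 ^ (CARD('d) * n) * wl i n x z) * wl i n x y))"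
    unfolding eq by (rule lin_on_sum[OF admissible_forms_lin[OF s]]) (intro wspan_sum W)
  also have "\<dots> = (\<Sum>i\<in>I. \<Sum>x\<in>lattice n \<inter> cball z (R / 2 ^ n). (2 ^ (CARD('d) * n) * wl i n x z) * s (wl i n x))"
    by (intro sum.cong refl, subst mult_1, rule lin_on_sum[OF admissible_forms_lin[OF s]], rule W)
  finally show "s (Ker I n z) = (\<Sum>i\<in>I. \<Sum>x\<in>lattice n \<inter> cball z (R / 2 ^ n). (2 ^ (CARD('d) * n) * wl i n x z) * s (wl i n x))" .
qed

text \<open>Near a compact set the value of the approximation at \<open>z\<close> is the form
  applied to the reproducing kernel at \<open>z\<close>. Identities between kernels thereby become
  identities between approximations.\<close>

lemma approx_Ker:
  assumes "\<forall>x\<in>L. cball x (R / 2 ^ k j) \<subseteq> K j" "n \<ge> k j" "z \<in> L" "lattice n \<inter> K j \<subseteq> inner_lattice n" "s \<in> admissible_forms"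
  shows "approx s n z = s (Ker {0} n z)"
proof -
  have "s (Ker {0} n z) = (\<Sum>x\<in>lattice n \<inter> cball z (R / 2 ^ n). (2 ^ (CARD('d) * n) * s (wl 0 n x)) * wl 0 n x z)"
    using Ker_wavelet_span(2)[OF assms(1-3), of "{0}" s] assms(5) by (simp add: mult_ac)
  also have "\<dots> = approx s n z" unfolding approx_def
  proof (rule local_sum[OF _ finite_inner_lattice])
    show "x \<in> inner_lattice n" if "x \<in> lattice n" "wl 0 n x z \<noteq> 0" for x
      using wl_supp[of 0 n x z] that near_K[OF assms(1-3)] assms(4) by (auto simp: dist_commute intro: less_imp_le)
  qed (auto simp: inner_lattice_def)
  finally show ?thesis by simp
qed

text \<open>The form applied to \<open>Ker_Suc\<close>. It turns the increment, a difference of sums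
  over scaling functions, into a sum over wavelets of scale \<open>n\<close>, to which the assumed
  coefficient bounds apply.\<close>

lemma approx_Suc:
  assumes "\<forall>x\<in>L. cball x (R / 2 ^ k j) \<subseteq> K j" "n \<ge> k j" "z \<in> L" "\<forall>m\<ge>n. lattice m \<inter> K j \<subseteq> inner_lattice m" "s \<in> admissible_forms"
  shows "approx s (Suc n) z - approx s n z = (\<Sum>i\<in>IW. \<Sum>x\<in>lattice n \<inter> K j. (2 ^ (CARD('d) * n) * s (wl i n x)) * wl i n x z)"
proof -
  have "approx s (Suc n) z = s (Ker {0} (Suc n) z)" using approx_Ker[OF assms(1) _ assms(3) _ assms(5), of "Suc n"] assms(2,4) by simp
  also have "Ker {0} (Suc n) z = (\<lambda>y. 1 * Ker {0} n z y + 1 * Ker IW n z y)" by (simp add: Ker_Suc)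
  also have "s \<dots> = 1 * s (Ker {0} n z) + 1 * s (Ker IW n z)"
    by (rule lin_onD[OF admissible_forms_lin[OF assms(5)]]) (rule Ker_wavelet_span(1)[OF assms(1-3)], simp)+
  also have "s (Ker {0} n z) = approx s n z" using approx_Ker[OF assms(1-3) _ assms(5)] assms(4) by simp
  also have "s (Ker IW n z) = (\<Sum>i\<in>IW. \<Sum>x\<in>lattice n \<inter> cball z (R / 2 ^ n). (2 ^ (CARD('d) * n) * s (wl i n x)) * wl i n x z)"
    using Ker_wavelet_span(2)[OF assms(1-3), of IW s] assms(5) by (simp add: mult_ac)
  also have "\<dots> = (\<Sum>i\<in>IW. \<Sum>x\<in>lattice n \<inter> K j. (2 ^ (CARD('d) * n) * s (wl i n x)) * wl i n x z)"
  proof (rule sum.cong[OF refl])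
    fix i assume "i \<in> IW" then have i: "i \<in> insert 0 IW" by simp
    show "(\<Sum>x\<in>lattice n \<inter> cball z (R / 2 ^ n). (2 ^ (CARD('d) * n) * s (wl i n x)) * wl i n x z) =
        (\<Sum>x\<in>lattice n \<inter> K j. (2 ^ (CARD('d) * n) * s (wl i n x)) * wl i n x z)"
    proof (rule local_sum[OF i finite_lattice_compact[OF K_compact]])
      show "x \<in> lattice n \<inter> K j" if "x \<in> lattice n" "wl i n x z \<noteq> 0" for x
        using wl_supp[OF i, of n x z] that near_K[OF assms(1-3)] by (auto simp: dist_commute intro: less_imp_le)
    qed auto
  qed
  finally show ?thesis by simp
qed

end


context coefficient_bounds
begin

section \<open>Geometric convergence and continuity of the limit\<close>

definition eta :: real where "eta = 2 powr (\<alpha> - \<alpha>')"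

lemma eta: "0 < eta" "eta < 1"
  using \<alpha>_less powr_less_mono[of "\<alpha> - \<alpha>'" 0 2] by (auto simp: eta_def)

lemma eta_power: "2 powr (- (\<alpha>' * real n)) * 2 powr (\<alpha> * real n) = eta ^ n"
proof -
  have "2 powr (- (\<alpha>' * real n)) * 2 powr (\<alpha> * real n) = 2 powr ((\<alpha> - \<alpha>') * real n)"
    unfolding powr_add[symmetric] by (simp add: algebra_simps)
  also have "\<dots> = eta ^ n" by (simp add: eta_def powr_powr flip: powr_realpow)
  finally show ?thesis .
qed

lemma eta_lim: "(\<lambda>n. C * eta ^ n) \<longlonglongrightarrow> 0"
  using tendsto_mult_left[OF LIMSEQ_realpow_zero, of eta C] eta by simp

lemma approx_step:
  assumes \<theta>: "\<theta> \<in> Cinf_c U"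
  obtains C N0 where "C \<ge> 0" "\<forall>s\<in>admissible_forms. \<forall>n\<ge>N0. dB \<theta> (approx s (Suc n)) (approx s n) \<le> ennreal (C * eta ^ n)"
proof -
  obtain j N0 where j: "\<forall>x\<in>supp \<theta>. cball x (R / 2 ^ k j) \<subseteq> K j" "k j \<le> N0" "\<forall>n\<ge>N0. lattice n \<inter> K j \<subseteq> inner_lattice n"
    using near_in_inner_lattice[OF Cinf_c_supp(2,1)[OF \<theta>]] by metis
  obtain C where C: "C \<ge> 0" "\<forall>n i J c \<Lambda>. i \<in> IW \<longrightarrow> finite J \<longrightarrow> J \<subseteq> lattice n \<longrightarrow>
    coef_ok p (1 / 2 ^ (CARD('d) * n)) J c \<Lambda> \<longrightarrow> \<Lambda> \<ge> 0 \<longrightarrow>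
    BN (\<lambda>z. \<theta> z * (\<Sum>x\<in>J. c x * wl i n x z)) \<le> ennreal (C * \<Lambda> * 2 powr (\<alpha> * real n))"
    by (rule BN_block[OF \<theta>])
  have "dB \<theta> (approx s (Suc n)) (approx s n) \<le> ennreal (real (card IW) * C * lam j * eta ^ n)" if s: "s \<in> admissible_forms" and n: "n \<ge> N0" for s n
  proof -
    let ?g = "\<lambda>i z. \<theta> z * (\<Sum>x\<in>lattice n \<inter> K j. (2 ^ (CARD('d) * n) * s (wl i n x)) * wl i n x z)"
    have nk: "n \<ge> k j" using n j(2) by simp
    have "\<theta> z * (approx s (Suc n) z - approx s n z) = (\<Sum>i\<in>IW. ?g i z)" for z
    proof (cases "z \<in> supp \<theta>")
      case True
      have "\<forall>m\<ge>n. lattice m \<inter> K j \<subseteq> inner_lattice m" using j(3) n by auto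
      from approx_Suc[OF j(1) nk True this s] show ?thesis by (simp add: sum_distrib_left)
    next
      case False then show ?thesis by (simp add: notin_supp_eq_0)
    qed
    then have "dB \<theta> (approx s (Suc n)) (approx s n) = BN (\<lambda>z. \<Sum>i\<in>IW. ?g i z)" by (simp add: dB_def)
    also have "\<dots> \<le> (\<Sum>i\<in>IW. BN (?g i))"
      by (intro BN_sum cc_mult Cinf_c_cc[OF \<theta>] cc_sum cc_cmult wl_cc) auto
    also have "\<dots> \<le> (\<Sum>i\<in>IW. ennreal (C * (lam j * 2 powr (- (\<alpha>' * real n))) * 2 powr (\<alpha> * real n)))"
    proof (rule sum_mono)
      fix i assume i: "i \<in> IW"
      show "BN (?g i) \<le> ennreal (C * (lam j * 2 powr (- (\<alpha>' * real n))) * 2 powr (\<alpha> * real n))"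
        using C(2)[rule_format, OF i finite_lattice_compact[OF K_compact] Int_lower1 admissible_forms_coef[OF s nk i]] lam by simp
    qed
    also have "\<dots> = ennreal (real (card IW) * C * lam j * eta ^ n)"
      using C(1) lam[of j] eta by (simp add: mult.assoc eta_power ennreal_of_nat_eq_real_of_nat ennreal_mult)
    finally show ?thesis .
  qed
  then show thesis using C(1) lam[of j] by (intro that[of "real (card IW) * C * lam j" N0]) auto
qed

lemma approx_tail:
  assumes \<theta>: "\<theta> \<in> Cinf_c U"
  obtains C N0 where "C \<ge> 0" "\<forall>s\<in>admissible_forms. \<forall>m\<ge>N0. \<forall>n\<ge>m. dB \<theta> (approx s n) (approx s m) \<le> ennreal (C * eta ^ m)"
proof -
  obtain C N0 where C: "C \<ge> 0" "\<forall>s\<in>admissible_forms. \<forall>n\<ge>N0. dB \<theta> (approx s (Suc n)) (approx s n) \<le> ennreal (C * eta ^ n)"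
    by (rule approx_step[OF \<theta>])
  have "dB \<theta> (approx s n) (approx s m) \<le> ennreal (C / (1 - eta) * eta ^ m)" if s: "s \<in> admissible_forms" and m: "m \<ge> N0" and n: "n \<ge> m" for s m n
  proof -
    have "dB \<theta> (approx s n) (approx s m) \<le> ennreal (C * (\<Sum>l\<in>{m..<n}. eta ^ l))" using n
    proof (induction n rule: dec_induct)
      case base then show ?case by (simp add: dB_same)
    next
      case (step n)
      have "dB \<theta> (approx s (Suc n)) (approx s m) \<le> dB \<theta> (approx s (Suc n)) (approx s n) + dB \<theta> (approx s n) (approx s m)"
        by (intro dB_triangle \<theta> approx_cont)
      also have "\<dots> \<le> ennreal (C * eta ^ n) + ennreal (C * (\<Sum>l\<in>{m..<n}. eta ^ l))"
        using C(2) s m step by (intro add_mono) auto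
      also have "\<dots> = ennreal (C * (\<Sum>l\<in>{m..<Suc n}. eta ^ l))"
        using C(1) eta step by (subst ennreal_plus[symmetric]) (auto intro!: mult_nonneg_nonneg sum_nonneg simp: algebra_simps)
      finally show ?case .
    qed
    also have "\<dots> \<le> ennreal (C / (1 - eta) * eta ^ m)"
    proof (rule ennreal_leI)
      have "(\<Sum>l\<in>{m..<n}. eta ^ l) = (\<Sum>l\<in>{0..<n - m}. eta ^ (l + m))"
        using n sum.shift_bounds_nat_ivl[of "\<lambda>l. eta ^ l" 0 m "n - m"] by simp
      also have "\<dots> = eta ^ m * (\<Sum>l\<in>{0..<n - m}. eta ^ l)" by (simp add: sum_distrib_left power_add mult.commute)
      also have "\<dots> \<le> eta ^ m * (1 / (1 - eta))"
      proof (rule mult_left_mono)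
        have "(\<Sum>l\<in>{0..<n - m}. eta ^ l) \<le> (\<Sum>l. eta ^ l)" using eta by (intro sum_le_suminf summable_geometric) auto
        then show "(\<Sum>l\<in>{0..<n - m}. eta ^ l) \<le> 1 / (1 - eta)" using eta by (simp add: suminf_geometric)
      qed (use eta in simp)
      finally have "C * (\<Sum>l\<in>{m..<n}. eta ^ l) \<le> C * (eta ^ m * (1 / (1 - eta)))" using C(1) by (rule mult_left_mono)
      then show "C * (\<Sum>l\<in>{m..<n}. eta ^ l) \<le> C / (1 - eta) * eta ^ m" by (simp add: mult_ac)
    qed
    finally show ?thesis .
  qed
  then show thesis using C(1) eta by (intro that[of "C / (1 - eta)" N0]) auto
qed

lemma Cinf_c_radius:
  assumes "\<theta> \<in> Cinf_c U" obtains \<rho> where "\<rho> \<ge> 0" "\<forall>z. \<rho> < norm z \<longrightarrow> \<theta> z = 0"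
proof -
  obtain \<rho> where "0 < \<rho>" "\<forall>x. \<rho> < norm x \<longrightarrow> \<theta> x = 0" using Cinf_c_cc[OF assms] by (rule ccE)
  then show thesis by (intro that[of \<rho>]) auto
qed

lemma BN_cut_Cr:
  assumes \<theta>: "\<theta> \<in> Cinf_c U" and L: "L \<ge> 0"
  obtains C where "C \<ge> 0" "\<forall>A u. Cb r A L u \<longrightarrow> BN (\<lambda>z. \<theta> z * u z) \<le> ennreal (C * A)"
proof -
  obtain A\<theta> where A: "Cb r A\<theta> 1 \<theta>" using Cinf_c_Cb[OF \<theta>] by blast
  obtain \<rho> where \<rho>: "\<rho> \<ge> 0" "\<forall>z. \<rho> < norm z \<longrightarrow> \<theta> z = 0" by (rule Cinf_c_radius[OF \<theta>])
  have L1: "1 + L \<ge> 0" using L by simp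
  obtain C where C: "C \<ge> 0" "\<forall>A u. Cb r A (1 + L) u \<longrightarrow> (\<forall>z. \<rho> < norm z \<longrightarrow> u z = 0) \<longrightarrow> BN u \<le> ennreal (C * A)"
    by (rule BN_Cr[OF \<rho>(1) L1])
  have "BN (\<lambda>z. \<theta> z * u z) \<le> ennreal (C * A\<theta> * A')" if u: "Cb r A' L u" for A' u
    using C(2)[rule_format, OF Cb_mult[OF A u]] \<rho>(2) by (simp add: mult.assoc)
  then show thesis using C(1) Cb_nonneg[OF A] by (intro that[of "C * A\<theta>"]) auto
qed

lemma smooth_approx_dB:
  assumes \<theta>: "\<theta> \<in> Cinf_c U"
  obtains C where "C \<ge> 0" "\<forall>s\<in>admissible_forms. \<forall>n. dB \<theta> (smooth_approx s n) (approx s n) \<le> ennreal (C * (1 / 2) ^ n)"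
proof -
  obtain C where C: "C \<ge> 0" "\<forall>A u. Cb r A 1 u \<longrightarrow> BN (\<lambda>z. \<theta> z * u z) \<le> ennreal (C * A)"
    by (rule BN_cut_Cr[OF \<theta>, of 1]) auto
  have "dB \<theta> (smooth_approx s n) (approx s n) \<le> ennreal (C * (1 / 2) ^ n)" if "s \<in> admissible_forms" for s n
    using C(2)[rule_format, OF smooth_approx_error[OF that, of n]] by (simp add: dB_def power_one_over)
  then show thesis using C(1) that by blast
qed

text \<open>The tail of the wavelet series and the mollification errors on both sides get a third of
  \<open>e\<close> each. The index \<open>N\<close> is common to all admissible forms, which is what
  makes the limit depend continuously on the form.\<close>

lemma smooth_approx_uniform_Cauchy:
  assumes \<theta>: "\<theta> \<in> Cinf_c U" and e: "(e::real) > 0"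
  obtains N where "\<forall>s\<in>admissible_forms. \<forall>m\<ge>N. \<forall>n\<ge>N. dB \<theta> (smooth_approx s n) (smooth_approx s m) \<le> ennreal e"
proof -
  obtain C N0 where C: "C \<ge> 0" "\<forall>s\<in>admissible_forms. \<forall>m\<ge>N0. \<forall>n\<ge>m. dB \<theta> (approx s n) (approx s m) \<le> ennreal (C * eta ^ m)"
    by (rule approx_tail[OF \<theta>])
  obtain C' where C': "C' \<ge> 0" "\<forall>s\<in>admissible_forms. \<forall>n. dB \<theta> (smooth_approx s n) (approx s n) \<le> ennreal (C' * (1 / 2) ^ n)"
    by (rule smooth_approx_dB[OF \<theta>])
  have l2: "(\<lambda>n. C' * (1 / 2 :: real) ^ n) \<longlonglongrightarrow> 0"
    using tendsto_mult_left[OF LIMSEQ_realpow_zero, of "1/2" C'] by simp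
  have "\<forall>\<^sub>F n in sequentially. C * eta ^ n < e / 3" using order_tendstoD(2)[OF eta_lim, of "e / 3" C] e by simp
  then obtain N1 where N1: "\<forall>n\<ge>N1. C * eta ^ n < e / 3" by (auto simp: eventually_sequentially)
  have "\<forall>\<^sub>F n in sequentially. C' * (1 / 2) ^ n < e / 3" using order_tendstoD(2)[OF l2, of "e / 3"] e by simp
  then obtain N2 where N2: "\<forall>n\<ge>N2. C' * (1 / 2) ^ n < e / 3" by (auto simp: eventually_sequentially)
  define N where "N = max N0 (max N1 N2)"
  have main: "dB \<theta> (smooth_approx s n) (smooth_approx s m) \<le> ennreal e" if s: "s \<in> admissible_forms" and m: "m \<ge> N" and n: "n \<ge> m" for s m n
  proof -
    have a: "dB \<theta> (smooth_approx s n) (approx s n) \<le> ennreal (e / 3)"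
    proof -
      have "dB \<theta> (smooth_approx s n) (approx s n) \<le> ennreal (C' * (1 / 2) ^ n)" using C'(2) s by blast
      also have "\<dots> \<le> ennreal (e / 3)" using N2 m n by (intro ennreal_leI less_imp_le) (auto simp: N_def)
      finally show ?thesis .
    qed
    have b: "dB \<theta> (approx s m) (smooth_approx s m) \<le> ennreal (e / 3)"
    proof -
      have "dB \<theta> (approx s m) (smooth_approx s m) = dB \<theta> (smooth_approx s m) (approx s m)" by (intro dB_commute \<theta> approx_cont smooth_approx_cont)
      also have "\<dots> \<le> ennreal (C' * (1 / 2) ^ m)" using C'(2) s by blast
      also have "\<dots> \<le> ennreal (e / 3)" using N2 m by (intro ennreal_leI less_imp_le) (auto simp: N_def)
      finally show ?thesis .
    qed
    have c: "dB \<theta> (approx s n) (approx s m) \<le> ennreal (e / 3)"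
    proof -
      have "dB \<theta> (approx s n) (approx s m) \<le> ennreal (C * eta ^ m)" using C(2) s m n by (simp add: N_def)
      also have "\<dots> \<le> ennreal (e / 3)" using N1 m by (intro ennreal_leI less_imp_le) (auto simp: N_def)
      finally show ?thesis .
    qed
    have "dB \<theta> (smooth_approx s n) (smooth_approx s m) \<le> dB \<theta> (smooth_approx s n) (approx s n) + dB \<theta> (approx s n) (smooth_approx s m)" by (intro dB_triangle \<theta> approx_cont smooth_approx_cont)
    also have "\<dots> \<le> dB \<theta> (smooth_approx s n) (approx s n) + (dB \<theta> (approx s n) (approx s m) + dB \<theta> (approx s m) (smooth_approx s m))"
      by (intro add_left_mono dB_triangle \<theta> approx_cont smooth_approx_cont)
    also have "\<dots> \<le> ennreal (e / 3) + (ennreal (e / 3) + ennreal (e / 3))" by (intro add_mono a b c)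
    also have "\<dots> = ennreal (e / 3 + (e / 3 + e / 3))" using e by (simp del: ennreal_plus add: ennreal_plus[symmetric])
    finally show ?thesis by simp
  qed
  have "dB \<theta> (smooth_approx s n) (smooth_approx s m) \<le> ennreal e" if s: "s \<in> admissible_forms" and mn: "m \<ge> N" "n \<ge> N" for s m n
  proof (cases "m \<le> n")
    case True then show ?thesis by (rule main[OF s mn(1)])
  next
    case False
    then have "dB \<theta> (smooth_approx s m) (smooth_approx s n) \<le> ennreal e" by (intro main s mn) simp
    then show ?thesis using dB_commute[OF \<theta> smooth_approx_cont smooth_approx_cont, of s n s m] by simp
  qed
  then show thesis by (intro that[of N]) blast
qed

lemma smooth_approx_cau: assumes s: "s \<in> admissible_forms" shows "smooth_approx s \<in> cau"
  unfolding cau_iff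
proof (intro conjI allI ballI impI)
  show "smooth_approx s j \<in> Cinf U" for j by (rule Cinf_c_Cinf[OF smooth_approx_Cinf_c])
  fix \<theta> and e :: ennreal assume \<theta>: "\<theta> \<in> Cinf_c U" and e: "e > 0"
  obtain c where c: "0 < c" "c < e" using dense[OF e] by blast
  then obtain c' where c': "c = ennreal c'" "c' > 0" by (cases c) auto
  obtain N where "\<forall>s\<in>admissible_forms. \<forall>m\<ge>N. \<forall>n\<ge>N. dB \<theta> (smooth_approx s n) (smooth_approx s m) \<le> ennreal c'"
    by (rule smooth_approx_uniform_Cauchy[OF \<theta> c'(2)])
  then have "\<forall>i\<ge>N. \<forall>j\<ge>N. dB \<theta> (smooth_approx s i) (smooth_approx s j) < e" using s c c' by (meson le_less_trans)
  then show "\<exists>N. \<forall>i\<ge>N. \<forall>j\<ge>N. dB \<theta> (smooth_approx s i) (smooth_approx s j) < e" ..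
qed

definition limit_element :: "((real ^ 'd \<Rightarrow> real) \<Rightarrow> real) \<Rightarrow> (nat \<Rightarrow> real ^ 'd \<Rightarrow> real) set" where
  "limit_element s = eqv `` {smooth_approx s}"

lemma limit_element_in: "s \<in> admissible_forms \<Longrightarrow> limit_element s \<in> bsp"
  unfolding limit_element_def by (rule class_in[OF smooth_approx_cau])

text \<open>For fixed \<open>N\<close> the approximation involves finitely many values of the form,
  so a basic neighbourhood for pointwise convergence suffices.\<close>

lemma head_continuous:
  assumes \<theta>: "\<theta> \<in> Cinf_c U" and s0: "s0 \<in> admissible_forms" and e: "(e::real) > 0"
  obtains T where "open T" "s0 \<in> T" "\<forall>s\<in>T. dB \<theta> (smooth_approx s0 N) (smooth_approx s N) \<le> ennreal e"
proof -
  have "\<exists>b. b \<ge> 0 \<and> BN (\<lambda>z. \<theta> z * wt N y z) \<le> ennreal b" for y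
  proof -
    obtain C where C: "C \<ge> 0" "\<forall>A u. Cb r A 1 u \<longrightarrow> BN (\<lambda>z. \<theta> z * u z) \<le> ennreal (C * A)"
      by (rule BN_cut_Cr[OF \<theta>, of 1]) auto
    obtain A where A: "Cb r A 1 (wt N y)" using Cinf_c_Cb wt by blast
    show ?thesis using C A Cb_nonneg[OF A] by (intro exI[of _ "C * A"]) auto
  qed
  then obtain b where b: "\<forall>y. b y \<ge> 0 \<and> BN (\<lambda>z. \<theta> z * wt N y z) \<le> ennreal (b y)" by metis
  define M where "M = (\<Sum>y\<in>inner_lattice N. 2 ^ (CARD('d) * N) * b y)"
  have M: "M \<ge> 0" unfolding M_def using b by (intro sum_nonneg) auto
  define \<delta> where "\<delta> = e / (M + 1)"
  have \<delta>: "\<delta> > 0" using e M by (simp add: \<delta>_def)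
  define T where "T = (\<Inter>y\<in>inner_lattice N. {s. \<bar>s (wl 0 N y) - s0 (wl 0 N y)\<bar> < \<delta>})"
  have "open T" unfolding T_def
  proof (intro open_INT finite_inner_lattice ballI)
    fix y
    have "continuous_on UNIV (\<lambda>s :: (real ^ 'd \<Rightarrow> real) \<Rightarrow> real. s (wl 0 N y))" by (rule continuous_on_product_coordinates)
    then show "open {s. \<bar>s (wl 0 N y) - s0 (wl 0 N y)\<bar> < \<delta>}"
      by (intro open_Collect_less continuous_on_rabs continuous_on_diff continuous_on_const)
  qed
  moreover have "s0 \<in> T" using \<delta> by (simp add: T_def)
  moreover have "dB \<theta> (smooth_approx s0 N) (smooth_approx s N) \<le> ennreal e" if s: "s \<in> T" for s
  proof -
    let ?c = "\<lambda>y. 2 ^ (CARD('d) * N) * (s0 (wl 0 N y) - s (wl 0 N y))"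
    have cw: "cc (\<lambda>z. \<theta> z * wt N y z)" for y
      using wt[of N y] by (intro cc_mult Cinf_c_cc[OF \<theta>] Cinf_c_cc) auto
    have "dB \<theta> (smooth_approx s0 N) (smooth_approx s N) = BN (\<lambda>z. \<Sum>y\<in>inner_lattice N. ?c y * (\<theta> z * wt N y z))"
      unfolding dB_def smooth_approx_def by (simp add: sum_subtractf[symmetric] sum_distrib_left algebra_simps)
    also have "\<dots> \<le> (\<Sum>y\<in>inner_lattice N. BN (\<lambda>z. ?c y * (\<theta> z * wt N y z)))"
      by (intro BN_sum finite_inner_lattice cc_cmult cw)
    also have "\<dots> \<le> (\<Sum>y\<in>inner_lattice N. ennreal (2 ^ (CARD('d) * N) * \<delta> * b y))"
    proof (rule sum_mono)
      fix y assume y: "y \<in> inner_lattice N"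
      have "\<bar>s (wl 0 N y) - s0 (wl 0 N y)\<bar> < \<delta>" using s y by (simp add: T_def)
      then have c: "\<bar>?c y\<bar> \<le> 2 ^ (CARD('d) * N) * \<delta>" by (simp add: abs_mult abs_minus_commute)
      have "BN (\<lambda>z. ?c y * (\<theta> z * wt N y z)) \<le> ennreal \<bar>?c y\<bar> * BN (\<lambda>z. \<theta> z * wt N y z)" by (rule BN_cmult[OF cw])
      also have "\<dots> \<le> ennreal (2 ^ (CARD('d) * N) * \<delta>) * ennreal (b y)" using b c by (intro mult_mono ennreal_leI) auto
      also have "\<dots> = ennreal (2 ^ (CARD('d) * N) * \<delta> * b y)" using \<delta> b by (simp add: ennreal_mult)
      finally show "BN (\<lambda>z. ?c y * (\<theta> z * wt N y z)) \<le> ennreal (2 ^ (CARD('d) * N) * \<delta> * b y)" .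
    qed
    also have "\<dots> = ennreal (\<Sum>y\<in>inner_lattice N. 2 ^ (CARD('d) * N) * \<delta> * b y)" using \<delta> b by (intro sum_ennreal) auto
    also have "(\<Sum>y\<in>inner_lattice N. 2 ^ (CARD('d) * N) * \<delta> * b y) = \<delta> * M" by (simp add: M_def sum_distrib_left mult_ac)
    also have "\<delta> * M \<le> e" using M e by (simp add: \<delta>_def field_simps)
    finally show ?thesis by (simp add: ennreal_leI)
  qed
  ultimately show thesis by (intro that[of T]) auto
qed

theorem limit_element_continuous:
  "continuous_map (top_of_set admissible_forms) (Besov_loc_topology V U \<alpha> p q) limit_element"
  unfolding Besov_loc_topology_def continuous_on_generated_topo_iff
proof (intro conjI allI impI)
  fix A assume "A \<in> {{G \<in> bsp. bdist \<theta> F G < \<epsilon>} | F \<theta> \<epsilon>. F \<in> bsp \<and> \<theta> \<in> Cinf_c U \<and> \<epsilon> > 0}"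
  then obtain F \<theta> \<epsilon> where A: "A = {G \<in> bsp. bdist \<theta> F G < \<epsilon>}" and F: "F \<in> bsp" and \<theta>: "\<theta> \<in> Cinf_c U" by auto
  show "openin (top_of_set admissible_forms) (limit_element -` A \<inter> topspace (top_of_set admissible_forms))"
  proof (subst openin_subopen, intro ballI)
    fix s0 assume "s0 \<in> limit_element -` A \<inter> topspace (top_of_set admissible_forms)"
    then have s0: "s0 \<in> admissible_forms" and lt: "bdist \<theta> F (limit_element s0) < \<epsilon>" by (auto simp: A)
    \<comment> \<open>An intermediate value, because estimates that survive a limit are not
      strict.\<close>
    obtain c where c: "bdist \<theta> F (limit_element s0) < c" "c < \<epsilon>" using dense[OF lt] by blast
    obtain d where d: "bdist \<theta> F (limit_element s0) = ennreal d" "d \<ge> 0"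
      using c(1) by (cases "bdist \<theta> F (limit_element s0)") (auto simp: top_unique)
    obtain c' where c': "c = ennreal c'" using c(2) by (cases c) auto
    define e where "e = c' - d"
    have e: "e > 0" using c(1) d c' by (simp add: e_def ennreal_less_iff)
    have e4: "e / 3 > 0" using e by simp
    obtain N where N: "\<forall>s\<in>admissible_forms. \<forall>m\<ge>N. \<forall>n\<ge>N. dB \<theta> (smooth_approx s n) (smooth_approx s m) \<le> ennreal (e / 3)"
      by (rule smooth_approx_uniform_Cauchy[OF \<theta> e4])
    obtain T where T: "open T" "s0 \<in> T" "\<forall>s\<in>T. dB \<theta> (smooth_approx s0 N) (smooth_approx s N) \<le> ennreal (e / 3)"
      by (rule head_continuous[OF \<theta> s0 e4])
    have "s \<in> limit_element -` A" if s: "s \<in> admissible_forms" "s \<in> T" for s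
    proof -
      have "dB \<theta> (smooth_approx s0 n) (smooth_approx s n) \<le> ennreal e" if n: "n \<ge> N" for n
      proof -
        have "dB \<theta> (smooth_approx s0 n) (smooth_approx s n) \<le> dB \<theta> (smooth_approx s0 n) (smooth_approx s0 N) + dB \<theta> (smooth_approx s0 N) (smooth_approx s n)"
          by (intro dB_triangle \<theta> smooth_approx_cont)
        also have "\<dots> \<le> dB \<theta> (smooth_approx s0 n) (smooth_approx s0 N) + (dB \<theta> (smooth_approx s0 N) (smooth_approx s N) + dB \<theta> (smooth_approx s N) (smooth_approx s n))"
          by (intro add_left_mono dB_triangle \<theta> smooth_approx_cont)
        also have "\<dots> \<le> ennreal (e / 3) + (ennreal (e / 3) + ennreal (e / 3))"
          using N T s s0 n by (intro add_mono) auto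
        also have "\<dots> = ennreal (e / 3 + (e / 3 + e / 3))" using e by (simp del: ennreal_plus add: ennreal_plus[symmetric])
        finally show ?thesis by simp
      qed
      then have "bdist \<theta> (limit_element s0) (limit_element s) \<le> ennreal e"
        unfolding limit_element_def by (intro dist_class_le[OF smooth_approx_cau[OF s0] smooth_approx_cau[OF s(1)] \<theta>]) blast
      then have "bdist \<theta> F (limit_element s0) + bdist \<theta> (limit_element s0) (limit_element s) \<le> ennreal d + ennreal e"
        unfolding d by (rule add_left_mono)
      also have "\<dots> = c" using d e by (simp add: c' e_def flip: ennreal_plus)
      finally have "bdist \<theta> F (limit_element s) \<le> c"
        using dist_triangle[OF F limit_element_in[OF s0] limit_element_in[OF s(1)] \<theta>] by simp
      then show ?thesis using c(2) limit_element_in[OF s(1)] by (simp add: A)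
    qed
    then show "\<exists>T. openin (top_of_set admissible_forms) T \<and> s0 \<in> T \<and> T \<subseteq> limit_element -` A \<inter> topspace (top_of_set admissible_forms)"
      using T s0 by (intro exI[of _ "admissible_forms \<inter> T"]) (auto intro: openin_open_Int)
  qed
next
  show "limit_element ` topspace (top_of_set admissible_forms) \<subseteq> \<Union> {{G \<in> bsp. bdist \<theta> F G < \<epsilon>} | F \<theta> \<epsilon>. F \<in> bsp \<and> \<theta> \<in> Cinf_c U \<and> \<epsilon> > 0}"
  proof
    fix G assume "G \<in> limit_element ` topspace (top_of_set admissible_forms)"
    then have G: "G \<in> bsp" using limit_element_in by auto
    \<comment> \<open>The cutoff 0 induces the zero seminorm, whose balls are the whole space; this
      shows that the generating sets cover it.\<close>
    then have "G \<in> {H \<in> bsp. bdist (\<lambda>x. 0) G H < 1}" using dist_same[OF G zero_Cinf_c] by simp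
    moreover have "{H \<in> bsp. bdist (\<lambda>x. 0) G H < 1} \<in> {{G \<in> bsp. bdist \<theta> F G < \<epsilon>} | F \<theta> \<epsilon>. F \<in> bsp \<and> \<theta> \<in> Cinf_c U \<and> \<epsilon> > 0}"
      using G zero_Cinf_c[of U] by (intro CollectI exI[of _ G] exI[of _ "\<lambda>x. 0"] exI[of _ 1]) auto
    ultimately show "G \<in> \<Union> {{G \<in> bsp. bdist \<theta> F G < \<epsilon>} | F \<theta> \<epsilon>. F \<in> bsp \<and> \<theta> \<in> Cinf_c U \<and> \<epsilon> > 0}" by blast
  qed
qed

theorem limit_element_compact: "compactin (Besov_loc_topology V U \<alpha> p q) (limit_element ` admissible_forms)"
  by (rule image_compactin[OF _ limit_element_continuous]) (simp add: admissible_forms_compact)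

end


section \<open>Identification of the limits\<close>

lemma tendsto_0_dominated:
  fixes x :: "nat \<Rightarrow> real" and D :: "nat \<Rightarrow> ennreal"
  assumes D: "D \<longlonglongrightarrow> 0" and M: "M \<ge> 0" "\<And>j b. b \<ge> 0 \<Longrightarrow> D j \<le> ennreal b \<Longrightarrow> \<bar>x j\<bar> \<le> M * b"
  shows "x \<longlonglongrightarrow> 0"
proof (rule LIMSEQ_I)
  fix e :: real assume e: "0 < e"
  define b where "b = e / (M + 1)"
  have b: "b > 0" "M * b < e" using e M(1) by (auto simp: b_def field_simps)
  then obtain N where "\<forall>n\<ge>N. D n \<le> ennreal b" using D unfolding ennreal_tendsto_0_iff by blast
  then have "\<forall>n\<ge>N. norm (x n - 0) < e" using M(2)[of b] b by force
  then show "\<exists>N. \<forall>n\<ge>N. norm (x n - 0) < e" ..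
qed

lemma smooth_cutoff_Cinf_c:
  fixes L :: "(real ^ 'd) set"
  assumes "compact L" "L \<subseteq> U" "open U"
  shows "\<exists>\<theta>\<in>Cinf_c U. \<forall>x\<in>L. \<theta> x = 1"
  using smooth_cutoff[OF assms] by metis

context wavelets
begin

lemma PP_near:
  assumes "good I" "PP I n u z \<noteq> 0" shows "\<exists>y\<in>supp u. dist y z \<le> 2 * R / 2 ^ n"
proof (rule ccontr)
  assume h: "\<not> ?thesis"
  have "PP I n u z = 0" unfolding PP_def
  proof (intro sum.neutral ballI)
    fix i x assume i: "i \<in> I" and x: "x \<in> lattice n \<inter> cball z (R / 2 ^ n)"
    have "L2_inner u (wl i n x) = 0"
    proof (rule inner_eq_0[OF good_sub[OF assms(1) i]])
      fix y assume y: "u y \<noteq> 0" "dist x y < R / 2 ^ n"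
      have "dist y z \<le> dist x y + dist z x" using dist_triangle[of y z x] by (simp add: dist_commute)
      also have "\<dots> \<le> R / 2 ^ n + R / 2 ^ n" using x y(2) by (intro add_mono) auto
      finally have "dist y z \<le> 2 * R / 2 ^ n" by simp
      moreover have "y \<in> supp u" using y(1) notin_supp_eq_0 by blast
      ultimately show False using h by blast
    qed
    then show "2 ^ (CARD('d) * n) * L2_inner u (wl i n x) * wl i n x z = 0" by simp
  qed
  then show False using assms(2) by simp
qed

end

context besov_on
begin

text \<open>A cutoff equal to 1 on \<open>L\<close> can be inserted into both pairings without
  changing them. It turns functions that are controlled only inside \<open>U\<close> into functions
  on the whole space, to which \<open>duality\<close> applies.\<close>

lemma pairing_bound:
  assumes L: "compact L" "L \<subseteq> U"
  obtains \<theta> C where "\<theta> \<in> Cinf_c U" "C \<ge> 0"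
    "\<forall>f g \<zeta> B b. continuous_on U f \<longrightarrow> continuous_on U g \<longrightarrow> Cb r B 1 \<zeta> \<longrightarrow> supp \<zeta> \<subseteq> L \<longrightarrow>
       dB \<theta> f g \<le> ennreal b \<longrightarrow> b \<ge> 0 \<longrightarrow> \<bar>L2_inner f \<zeta> - L2_inner g \<zeta>\<bar> \<le> C * B * b"
proof -
  obtain \<theta> where \<theta>: "\<theta> \<in> Cinf_c U" "\<forall>x\<in>L. \<theta> x = 1" using smooth_cutoff_Cinf_c[OF L open_U] by blast
  obtain \<rho> where \<rho>: "\<forall>x\<in>L. norm x \<le> \<rho>" using compact_imp_bounded[OF L(1)] unfolding bounded_iff by blast
  define \<rho>' where "\<rho>' = max \<rho> 0"
  have \<rho>': "\<rho>' \<ge> 0" "\<forall>x\<in>L. norm x \<le> \<rho>'" using \<rho> by (auto simp: \<rho>'_def)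
  obtain C where C: "C \<ge> 0" "\<forall>g \<zeta> B b. cc g \<longrightarrow> Cb r B 1 \<zeta> \<longrightarrow> (\<forall>z. \<rho>' < norm z \<longrightarrow> \<zeta> z = 0) \<longrightarrow>
    BN g \<le> ennreal b \<longrightarrow> b \<ge> 0 \<longrightarrow> \<bar>L2_inner g \<zeta>\<bar> \<le> C * B * b" by (rule duality[OF \<rho>'(1)])
  have "\<bar>L2_inner f \<zeta> - L2_inner g \<zeta>\<bar> \<le> C * B * b"
    if f: "continuous_on U f" and g: "continuous_on U g" and \<zeta>: "Cb r B 1 \<zeta>" and s: "supp \<zeta> \<subseteq> L"
      and d: "dB \<theta> f g \<le> ennreal b" and b: "b \<ge> 0" for f g \<zeta> B b
  proof -
    have 0: "\<zeta> x = 0" if "x \<notin> L" for x using s that notin_supp_eq_0[of x \<zeta>] by blast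
    have cu: "L2_inner h \<zeta> = L2_inner (\<lambda>x. \<theta> x * h x) \<zeta>" for h
    proof -
      have "h x * \<zeta> x = \<theta> x * h x * \<zeta> x" for x using 0[of x] \<theta>(2) by (cases "x \<in> L") auto
      then show ?thesis unfolding L2_inner_def by (intro Bochner_Integration.integral_cong refl)
    qed
    have "compact (supp \<zeta>)" by (intro compact_supp_neighbourhood[OF _ _ s] compact_imp_closed compact_imp_bounded L)
    then have c\<zeta>: "cc \<zeta>" by (rule ccI_compact_supp[OF Ck_continuous_on[OF Cb_Ck[OF \<zeta>]]])
    have cf: "cc (\<lambda>x. \<theta> x * f x)" and cg: "cc (\<lambda>x. \<theta> x * g x)" by (intro cut_cc \<theta> f g)+
    have "L2_inner f \<zeta> - L2_inner g \<zeta> = L2_inner (\<lambda>x. \<theta> x * f x - \<theta> x * g x) \<zeta>"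
      unfolding cu[of f] cu[of g] by (rule L2_inner_diff[symmetric]) (intro cc_L2 cf cg c\<zeta>)+
    moreover have "BN (\<lambda>x. \<theta> x * f x - \<theta> x * g x) \<le> ennreal b" using d by (simp add: dB_def right_diff_distrib)
    moreover have "\<forall>z. \<rho>' < norm z \<longrightarrow> \<zeta> z = 0" using 0 \<rho>'(2) by (meson not_le)
    ultimately show ?thesis using C(2)[rule_format, OF cc_diff[OF cf cg] \<zeta> _ _ b] by simp
  qed
  then show thesis using \<theta>(1) C(1) that by blast
qed

end

context coefficient_bounds
begin

lemma approx_wavelet_span: "approx s N \<in> wavelet_span"
  unfolding approx_def[abs_def] wavelet_span_def by (intro wspan_sum wspan_base inner_lattice_W)

lemma approx_bounded:
  assumes \<theta>: "\<theta> \<in> Cinf_c U" and s: "s \<in> admissible_forms"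
  obtains b N0 where "b \<ge> 0" "\<forall>n\<ge>N0. dB \<theta> (approx s n) (\<lambda>x. 0) \<le> ennreal b"
proof -
  obtain C N0 where C: "C \<ge> 0" "\<forall>s\<in>admissible_forms. \<forall>m\<ge>N0. \<forall>n\<ge>m. dB \<theta> (approx s n) (approx s m) \<le> ennreal (C * eta ^ m)"
    by (rule approx_tail[OF \<theta>])
  obtain C' where C': "C' \<ge> 0" "\<forall>A u. Cb r A 1 u \<longrightarrow> BN (\<lambda>z. \<theta> z * u z) \<le> ennreal (C' * A)"
    by (rule BN_cut_Cr[OF \<theta>, of 1]) auto
  have "approx s N0 \<in> Crc r U" using approx_wavelet_span wavelet_span_Crc by blast
  then obtain A where A: "Cb r A 1 (approx s N0)" using compact_supp_Cb[of r "approx s N0"] by (auto simp: Crc_def)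
  have A0: "A \<ge> 0" by (rule Cb_nonneg(1)[OF A])
  have "dB \<theta> (approx s n) (\<lambda>x. 0) \<le> ennreal (C * eta ^ N0 + C' * A)" if n: "n \<ge> N0" for n
  proof -
    have "dB \<theta> (approx s n) (\<lambda>x. 0) \<le> dB \<theta> (approx s n) (approx s N0) + dB \<theta> (approx s N0) (\<lambda>x. 0)"
      by (intro dB_triangle \<theta> approx_cont continuous_on_const)
    also have "\<dots> \<le> ennreal (C * eta ^ N0) + ennreal (C' * A)"
      using C(2)[rule_format, OF s order_refl n] C'(2)[rule_format, OF A] by (intro add_mono) (auto simp: dB_def)
    also have "\<dots> = ennreal (C * eta ^ N0 + C' * A)" using C(1) C'(1) A0 eta by simp
    finally show ?thesis .
  qed
  then show thesis using C(1) C'(1) A0 eta by (intro that[of "C * eta ^ N0 + C' * A" N0]) auto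
qed

lemma rep_limit_element_approx:
  assumes s: "s \<in> admissible_forms" and \<theta>: "\<theta> \<in> Cinf_c U"
  shows "(\<lambda>j. dB \<theta> (rep (limit_element s) j) (approx s j)) \<longlonglongrightarrow> 0"
proof -
  have e: "(smooth_approx s, rep (limit_element s)) \<in> eqv" unfolding limit_element_def by (rule rep_eqv[OF smooth_approx_cau[OF s]])
  then have 1: "(\<lambda>j. dB \<theta> (smooth_approx s j) (rep (limit_element s) j)) \<longlonglongrightarrow> 0" and c: "rep (limit_element s) \<in> cau" using \<theta> by (auto simp: eqv_iff)
  obtain C where C: "C \<ge> 0" "\<forall>s\<in>admissible_forms. \<forall>n. dB \<theta> (smooth_approx s n) (approx s n) \<le> ennreal (C * (1 / 2) ^ n)"
    by (rule smooth_approx_dB[OF \<theta>])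
  have "(\<lambda>n. C * (1 / 2 :: real) ^ n) \<longlonglongrightarrow> 0"
    using tendsto_mult_left[OF LIMSEQ_realpow_zero, of "1/2" C] by simp
  then have "(\<lambda>n. ennreal (C * (1 / 2) ^ n)) \<longlonglongrightarrow> 0" using tendsto_ennrealI by fastforce
  from tendsto_add[OF 1 this] have lim: "(\<lambda>j. dB \<theta> (smooth_approx s j) (rep (limit_element s) j) + ennreal (C * (1 / 2) ^ j)) \<longlonglongrightarrow> 0" by simp
  have "dB \<theta> (rep (limit_element s) j) (approx s j) \<le> dB \<theta> (smooth_approx s j) (rep (limit_element s) j) + ennreal (C * (1 / 2) ^ j)" for j
  proof -
    have "dB \<theta> (rep (limit_element s) j) (approx s j) \<le> dB \<theta> (rep (limit_element s) j) (smooth_approx s j) + dB \<theta> (smooth_approx s j) (approx s j)"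
      by (intro dB_triangle \<theta> cau_cont[OF c] smooth_approx_cont approx_cont)
    also have "dB \<theta> (rep (limit_element s) j) (smooth_approx s j) = dB \<theta> (smooth_approx s j) (rep (limit_element s) j)"
      by (intro dB_commute \<theta> cau_cont[OF c] smooth_approx_cont)
    finally show ?thesis using C(2) s by (meson add_left_mono order_trans)
  qed
  then show ?thesis by (intro tendsto_sandwich[OF _ _ tendsto_const lim]) auto
qed

lemma pairing_limit_element:
  assumes s: "s \<in> admissible_forms" and \<eta>: "\<eta> \<in> Crc r U" and lim: "(\<lambda>N. L2_inner (approx s N) \<eta>) \<longlonglongrightarrow> c"
  shows "pairing (limit_element s) \<eta> = c"
proof -
  have S: "compact (supp \<eta>)" "supp \<eta> \<subseteq> U" "Ck r \<eta>" using \<eta> by (auto simp: Crc_def)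
  obtain B where B: "Cb r B 1 \<eta>" using compact_supp_Cb[OF S(3,1)] by blast
  obtain \<theta> C where \<theta>: "\<theta> \<in> Cinf_c U" and C: "C \<ge> 0"
    "\<forall>f g \<zeta> B b. continuous_on U f \<longrightarrow> continuous_on U g \<longrightarrow> Cb r B 1 \<zeta> \<longrightarrow> supp \<zeta> \<subseteq> supp \<eta> \<longrightarrow>
       dB \<theta> f g \<le> ennreal b \<longrightarrow> b \<ge> 0 \<longrightarrow> \<bar>L2_inner f \<zeta> - L2_inner g \<zeta>\<bar> \<le> C * B * b"
    by (rule pairing_bound[OF S(1,2)])
  have "(\<lambda>j. L2_inner (rep (limit_element s) j) \<eta> - L2_inner (approx s j) \<eta>) \<longlonglongrightarrow> 0"
  proof (rule tendsto_0_dominated[OF rep_limit_element_approx[OF s \<theta>]])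
    show "0 \<le> C * B" using C(1) Cb_nonneg(1)[OF B] by simp
    show "\<bar>L2_inner (rep (limit_element s) j) \<eta> - L2_inner (approx s j) \<eta>\<bar> \<le> C * B * b"
      if "b \<ge> 0" "dB \<theta> (rep (limit_element s) j) (approx s j) \<le> ennreal b" for j b
      using C(2)[rule_format, OF cau_cont[OF rep_cau[OF limit_element_in[OF s]]] approx_cont B order_refl that(2,1)] .
  qed
  from tendsto_add[OF this lim] have "(\<lambda>j. L2_inner (rep (limit_element s) j) \<eta>) \<longlonglongrightarrow> c" by simp
  then show ?thesis unfolding pairing_def L2_inner_def by (rule limI)
qed

text \<open>The projection is moved to the test function: pairing the approximation with
  \<open>\<eta>\<close> amounts to applying the form to the projection of \<open>\<eta>\<close>,
  which lies in the span. The index \<open>N0\<close> depends only on the set that contains the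
  support.\<close>

lemma approx_inner:
  assumes s: "s \<in> admissible_forms" and L: "compact L" "L \<subseteq> U"
  obtains N0 where "\<forall>N\<ge>N0. \<forall>\<eta>. cc \<eta> \<longrightarrow> supp \<eta> \<subseteq> L \<longrightarrow> PP {0} N \<eta> \<in> wavelet_span \<and> L2_inner (approx s N) \<eta> = s (PP {0} N \<eta>)"
proof -
  obtain j N0 where j: "\<forall>x\<in>L. cball x (R / 2 ^ k j) \<subseteq> K j" "k j \<le> N0" "\<forall>n\<ge>N0. lattice n \<inter> K j \<subseteq> inner_lattice n"
    using near_in_inner_lattice[OF L] by metis
  have "PP {0} N \<eta> \<in> wavelet_span \<and> L2_inner (approx s N) \<eta> = s (PP {0} N \<eta>)"
    if N: "N \<ge> N0" and c: "cc \<eta>" and \<eta>: "supp \<eta> \<subseteq> L" for N \<eta>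
  proof -
    let ?c = "\<lambda>x. 2 ^ (CARD('d) * N) * L2_inner \<eta> (wl 0 N x)"
    have "\<forall>i\<in>insert 0 IW. \<forall>x\<in>lattice N. L2_inner \<eta> (wl i N x) \<noteq> 0 \<longrightarrow> x \<in> inner_lattice N"
      using coeff_in_K[OF \<eta> j(1), of N] j(2,3) N by fastforce
    then have eq: "PP {0} N \<eta> = (\<lambda>z. \<Sum>x\<in>inner_lattice N. ?c x * wl 0 N x z)"
      using PP_eq[of "{0}" "inner_lattice N" N \<eta>] finite_inner_lattice by (auto simp: inner_lattice_def)
    have W: "wl 0 N x \<in> wspan W" if "x \<in> inner_lattice N" for x by (intro wspan_base inner_lattice_W that)
    have "s (PP {0} N \<eta>) = (\<Sum>x\<in>inner_lattice N. ?c x * s (wl 0 N x))"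
      unfolding eq by (rule lin_on_sum[OF admissible_forms_lin[OF s] W])
    also have "\<dots> = (\<Sum>x\<in>inner_lattice N. (2 ^ (CARD('d) * N) * s (wl 0 N x)) * L2_inner (wl 0 N x) \<eta>)"
      by (simp add: L2_inner_commute[of \<eta>] mult_ac)
    also have "\<dots> = L2_inner (approx s N) \<eta>"
      unfolding approx_def[abs_def] by (rule L2_inner_sum[symmetric]) (auto intro: wl_L2 cc_L2[OF c])
    moreover have "PP {0} N \<eta> \<in> wavelet_span" unfolding eq wavelet_span_def by (intro wspan_sum W)
    ultimately show ?thesis by simp
  qed
  then show thesis by (intro that[of N0]) blast
qed

lemma compact_neighbourhood:
  assumes "compact L" "L \<subseteq> U"
  obtains \<delta> where "\<delta> > 0" "compact (\<Union>x\<in>L. cball x \<delta>)" "(\<Union>x\<in>L. cball x \<delta>) \<subseteq> U"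
  using compact_subset_open_imp_cball_epsilon_subset[OF assms(1) open_U assms(2)]
    compact_minkowski_sum_cball[OF assms(1)] by metis

text \<open>By \<open>approx_inner\<close> the pairings are values of \<open>l\<close> at
  projections of \<open>\<eta>\<close>. These converge to \<open>\<eta>\<close> in $C^r$ with
  supports in a fixed compact set, and \<open>l\<close> is continuous. The rate of
  \<open>PP_Cr_error\<close> uses \<open>r + 1\<close> derivatives, so smooth \<open>\<eta>\<close>
  come first.\<close>

lemma pairing_smooth:
  assumes s: "s \<in> admissible_forms" and l: "linear_form_on r U l" "\<forall>f\<in>wavelet_span. s f = l f" and cont: "continuous_form_on r U l"
    and \<eta>: "\<eta> \<in> Cinf_c U"
  shows "(\<lambda>N. L2_inner (approx s N) \<eta>) \<longlonglongrightarrow> l \<eta>"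
proof -
  note S = Cinf_c_supp(2,1)[OF \<eta>] and c = Cinf_c_cc[OF \<eta>]
  obtain \<delta> where \<delta>: "\<delta> > 0" "compact (\<Union>x\<in>supp \<eta>. cball x \<delta>)" "(\<Union>x\<in>supp \<eta>. cball x \<delta>) \<subseteq> U"
    by (rule compact_neighbourhood[OF S])
  define L where "L = (\<Union>x\<in>supp \<eta>. cball x \<delta>)"
  obtain C where C: "\<forall>\<zeta>\<in>Crc r U. \<forall>B. supp \<zeta> \<subseteq> L \<and>
      (\<forall>vs x. length vs \<le> r \<and> set vs \<subseteq> Basis \<longrightarrow> \<bar>ddir vs \<zeta> x\<bar> \<le> B) \<longrightarrow> \<bar>l \<zeta>\<bar> \<le> C * B"
    using cont \<delta>(2,3) unfolding continuous_form_on_def L_def by blast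
  obtain N0 where N0: "\<forall>N\<ge>N0. \<forall>\<zeta>. cc \<zeta> \<longrightarrow> supp \<zeta> \<subseteq> supp \<eta> \<longrightarrow> PP {0} N \<zeta> \<in> wavelet_span \<and> L2_inner (approx s N) \<zeta> = s (PP {0} N \<zeta>)"
    by (rule approx_inner[OF s S])
  obtain A where A: "Cb (r + 1) A 1 \<eta>" using Cinf_c_Cb[OF \<eta>] by blast
  have "(\<lambda>n. 2 * R / 2 ^ n) \<longlonglongrightarrow> 0" by (rule LIMSEQ_divide_realpow_zero) simp
  then have "\<forall>\<^sub>F n in sequentially. 2 * R / 2 ^ n < \<delta>" using order_tendstoD(2)[OF _ \<delta>(1)] by blast
  then obtain N1 where N1: "\<forall>n\<ge>N1. 2 * R / 2 ^ n < \<delta>" by (auto simp: eventually_sequentially)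
  let ?E = "\<lambda>N::nat. C * (2 * KP * Kd * A / 2 ^ N)"
  have "norm (L2_inner (approx s N) \<eta> - l \<eta>) \<le> ?E N" if N: "N \<ge> max N0 N1" for N
  proof -
    let ?P = "PP {0} N \<eta>"
    have P: "?P \<in> wavelet_span" "L2_inner (approx s N) \<eta> = s ?P" using N0 N c by auto
    have \<eta>r: "\<eta> \<in> Crc r U" by (rule Cinf_c_Crc[OF \<eta>])
    have d: "(\<lambda>z. 1 * ?P z + (- 1) * \<eta> z) \<in> Crc r U" using P(1) wavelet_span_Crc by (intro Crc_lincomb \<eta>r) auto
    have "l (\<lambda>z. 1 * ?P z + (- 1) * \<eta> z) = 1 * l ?P + (- 1) * l \<eta>"
      using l(1) \<eta>r P(1) wavelet_span_Crc unfolding linear_form_on_def by blast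
    then have "l (\<lambda>z. ?P z - \<eta> z) = L2_inner (approx s N) \<eta> - l \<eta>" using P l(2) by simp
    moreover have "\<bar>l (\<lambda>z. ?P z - \<eta> z)\<bar> \<le> C * (2 * KP * Kd * A / 2 ^ N)"
    proof (rule C[rule_format], goal_cases)
      case 1 then show ?case using d by simp
    next
      case 2
      have "supp (\<lambda>z. ?P z - \<eta> z) \<subseteq> L"
      proof (rule supp_subset)
        show "closed L" unfolding L_def by (rule compact_imp_closed[OF \<delta>(2)])
        fix z assume z: "z \<notin> L"
        have "z \<notin> supp \<eta>" using z \<delta>(1) unfolding L_def by force
        moreover have "?P z = 0"
        proof (rule ccontr)
          assume "?P z \<noteq> 0"
          then obtain y where "y \<in> supp \<eta>" "dist y z \<le> 2 * R / 2 ^ N" using PP_near[of "{0}" N \<eta> z] by auto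
          moreover have "2 * R / 2 ^ N < \<delta>" using N1 N by simp
          ultimately show False using z unfolding L_def by force
        qed
        ultimately show "?P z - \<eta> z = 0" by (simp add: notin_supp_eq_0)
      qed
      moreover have "\<bar>ddir vs (\<lambda>z. ?P z - \<eta> z) x\<bar> \<le> 2 * KP * Kd * A / 2 ^ N" if "length vs \<le> r" "set vs \<subseteq> Basis" for vs x
        using CbD[OF PP_Cr_error[OF A c] that, of N x] by simp
      ultimately show ?case by blast
    qed
    ultimately show ?thesis by simp
  qed
  then have "\<forall>\<^sub>F N in sequentially. norm (L2_inner (approx s N) \<eta> - l \<eta>) \<le> ?E N"
    unfolding eventually_sequentially by blast
  moreover have "?E \<longlonglongrightarrow> 0"
    using tendsto_mult_left[OF LIMSEQ_divide_realpow_zero, of 2 C "2 * KP * Kd * A"] by simp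
  ultimately have "(\<lambda>N. L2_inner (approx s N) \<eta> - l \<eta>) \<longlonglongrightarrow> 0" by (rule Lim_null_comparison)
  then show ?thesis by (simp add: LIM_zero_iff)
qed

text \<open>Mollification reduces to smooth test functions. The replacement is harmless in
  \<open>l\<close> by continuity, and in the pairings by duality, since the approximations stay
  bounded in the Besov seminorm as \<open>N\<close> grows.\<close>

lemma pairing_continuous:
  assumes s: "s \<in> admissible_forms" and l: "linear_form_on r U l" "\<forall>f\<in>wavelet_span. s f = l f" and cont: "continuous_form_on r U l"
    and \<eta>: "\<eta> \<in> Crc r U"
  shows "(\<lambda>N. L2_inner (approx s N) \<eta>) \<longlonglongrightarrow> l \<eta>"
proof -
  have S: "compact (supp \<eta>)" "supp \<eta> \<subseteq> U" and \<eta>': "\<eta> \<in> Crc r UNIV" using \<eta> by (auto simp: Crc_def)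
  obtain \<delta> where \<delta>: "\<delta> > 0" "compact (\<Union>x\<in>supp \<eta>. cball x \<delta>)" "(\<Union>x\<in>supp \<eta>. cball x \<delta>) \<subseteq> U"
    by (rule compact_neighbourhood[OF S])
  define L where "L = (\<Union>x\<in>supp \<eta>. cball x \<delta>)"
  have \<eta>L: "supp \<eta> \<subseteq> L" using \<delta>(1) unfolding L_def by force
  have L: "compact L" "L \<subseteq> U" using \<delta> by (auto simp: L_def)
  obtain C where C: "\<forall>\<zeta>\<in>Crc r U. \<forall>B. supp \<zeta> \<subseteq> L \<and>
      (\<forall>vs x. length vs \<le> r \<and> set vs \<subseteq> Basis \<longrightarrow> \<bar>ddir vs \<zeta> x\<bar> \<le> B) \<longrightarrow> \<bar>l \<zeta>\<bar> \<le> C * B"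
    using cont L unfolding continuous_form_on_def by blast
  obtain \<theta> C' where \<theta>: "\<theta> \<in> Cinf_c U" and C': "C' \<ge> 0"
    "\<forall>f g \<zeta> B b. continuous_on U f \<longrightarrow> continuous_on U g \<longrightarrow> Cb r B 1 \<zeta> \<longrightarrow> supp \<zeta> \<subseteq> L \<longrightarrow>
       dB \<theta> f g \<le> ennreal b \<longrightarrow> b \<ge> 0 \<longrightarrow> \<bar>L2_inner f \<zeta> - L2_inner g \<zeta>\<bar> \<le> C' * B * b"
    by (rule pairing_bound[OF L])
  obtain b N0 where b: "b \<ge> 0" "\<forall>n\<ge>N0. dB \<theta> (approx s n) (\<lambda>x. 0) \<le> ennreal b" by (rule approx_bounded[OF \<theta> s])
  show ?thesis
  proof (rule LIMSEQ_I)
    fix e :: real assume e: "0 < e"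
    define T where "T = 1 + \<bar>C\<bar> + C' * b"
    have T: "T > 0" using C'(1) b(1) unfolding T_def by (intro add_pos_nonneg) auto
    \<comment> \<open>The first entry keeps the support of the mollification in \<open>L\<close>.
      The second bounds the total of three errors, \<open>t\<close> from convergence for
      \<open>h\<close> and \<open>C' * t * b\<close> and \<open>\<bar>C\<bar> * t\<close> from
      exchanging \<open>\<eta>\<close> for \<open>h\<close>, which is \<open>t * T\<close>.\<close>
    define t where "t = min \<delta> (e / 2 / T)"
    have t: "t > 0" "t \<le> \<delta>" "t * T \<le> e / 2" using \<delta>(1) e T by (auto simp: t_def min_def field_simps)
    obtain h where h: "h \<in> Cinf_c UNIV" "supp h \<subseteq> (\<Union>x\<in>supp \<eta>. cball x t)" "Cb r t 1 (\<lambda>x. h x - \<eta> x)"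
      by (rule mollify[OF \<eta>' t(1)])
    have hL: "supp h \<subseteq> L" using h(2) t(2) unfolding L_def by force
    have hU: "h \<in> Cinf_c U" using h(1) hL L(2) by (auto simp: Cinf_c_def Crc_def)
    have dL: "supp (\<lambda>x. h x - \<eta> x) \<subseteq> L"
    proof (rule supp_subset[OF compact_imp_closed[OF L(1)]])
      fix x assume "x \<notin> L"
      then have "h x = 0" "\<eta> x = 0" using hL \<eta>L by (auto intro: notin_supp_eq_0)
      then show "h x - \<eta> x = 0" by simp
    qed
    have hr: "h \<in> Crc r U" by (rule Cinf_c_Crc[OF hU])
    have 1: "\<bar>l h - l \<eta>\<bar> \<le> \<bar>C\<bar> * t"
    proof -
      have "l (\<lambda>x. 1 * h x + (- 1) * \<eta> x) = 1 * l h + (- 1) * l \<eta>"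
        using l(1) hr \<eta> unfolding linear_form_on_def by blast
      then have "l h - l \<eta> = l (\<lambda>x. h x - \<eta> x)" by simp
      also have "\<bar>\<dots>\<bar> \<le> C * t"
      proof (rule C[rule_format], goal_cases)
        case 1 then show ?case using Crc_lincomb[OF hr \<eta>, of 1 "- 1"] by simp
      next
        case 2
        have "\<bar>ddir vs (\<lambda>x. h x - \<eta> x) x\<bar> \<le> t" if "length vs \<le> r" "set vs \<subseteq> Basis" for vs x
          using CbD[OF h(3) that, of x] by simp
        then show ?case using dL by blast
      qed
      also have "C * t \<le> \<bar>C\<bar> * t" using t(1) by (intro mult_right_mono) auto
      finally show ?thesis .
    qed
    have 2: "\<bar>L2_inner (approx s N) h - L2_inner (approx s N) \<eta>\<bar> \<le> C' * t * b" if N: "N \<ge> N0" for N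
    proof -
      have "\<bar>L2_inner (approx s N) (\<lambda>x. h x - \<eta> x) - L2_inner (\<lambda>x. 0) (\<lambda>x. h x - \<eta> x)\<bar> \<le> C' * t * b"
        using C'(2)[rule_format, OF approx_cont continuous_on_const h(3) dL _ b(1)] b(2) N by blast
      moreover have "L2_inner (\<lambda>x. h x - \<eta> x) (approx s N) = L2_inner h (approx s N) - L2_inner \<eta> (approx s N)"
        by (intro L2_inner_diff cc_L2 approx_cc Cinf_c_cc[OF h(1)] Crc_cc[OF \<eta>])
      moreover have "L2_inner (\<lambda>x. 0) (\<lambda>x. h x - \<eta> x) = 0" by (simp add: L2_inner_def)
      ultimately show ?thesis by (simp add: L2_inner_commute[of "approx s N"])
    qed
    obtain N1 where N1: "\<forall>N\<ge>N1. norm (L2_inner (approx s N) h - l h) < t"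
      using LIMSEQ_D[OF pairing_smooth[OF s l cont hU] t(1)] by blast
    have "norm (L2_inner (approx s N) \<eta> - l \<eta>) < e" if N: "N \<ge> max N0 N1" for N
    proof -
      have "norm (L2_inner (approx s N) h - l h) < t" using N1 N by simp
      moreover have "\<bar>L2_inner (approx s N) h - L2_inner (approx s N) \<eta>\<bar> \<le> C' * t * b" using 2 N by simp
      ultimately have "norm (L2_inner (approx s N) \<eta> - l \<eta>) \<le> t + C' * t * b + \<bar>C\<bar> * t" using 1 by simp
      also have "\<dots> = t * T" by (simp add: T_def algebra_simps)
      finally show ?thesis using t(3) e by linarith
    qed
    then show "\<exists>N0. \<forall>N\<ge>N0. norm (L2_inner (approx s N) \<eta> - l \<eta>) < e" by blast
  qed
qed

text \<open>A wavelet is reproduced by all sufficiently fine projections, so its pairings with the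
  approximations are eventually constant and algebraic linearity is enough. For other test functions
  the continuity of \<open>l\<close> is used through \<open>pairing_continuous\<close>.\<close>

theorem is_Besov_element_limit_element:
  assumes s: "s \<in> admissible_forms" and l: "linear_form_on r U l" "\<forall>f\<in>wavelet_span. s f = l f"
  shows "is_Besov_element r U \<phi> \<psi> l (limit_element s)"
  unfolding is_Besov_element_def
proof (intro conjI ballI impI)
  fix \<eta> assume "\<eta> \<in> wavelets_in U \<phi> \<psi>"
  then have \<eta>: "\<eta> \<in> W" by (simp add: W_def)
  have \<eta>r: "\<eta> \<in> Crc r U" using W_Crc \<eta> by blast
  have S: "compact (supp \<eta>)" "supp \<eta> \<subseteq> U" using \<eta>r by (auto simp: Crc_def)
  obtain N0 where N0: "\<forall>N\<ge>N0. \<forall>\<zeta>. cc \<zeta> \<longrightarrow> supp \<zeta> \<subseteq> supp \<eta> \<longrightarrow> PP {0} N \<zeta> \<in> wavelet_span \<and> L2_inner (approx s N) \<zeta> = s (PP {0} N \<zeta>)"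
    by (rule approx_inner[OF s S])
  obtain m where m: "\<forall>N\<ge>m. PP {0} N \<eta> = \<eta>" using W_PP[OF \<eta>] by blast
  have "L2_inner (approx s N) \<eta> = s \<eta>" if N: "N \<ge> max N0 m" for N
    using N0[rule_format, OF _ Crc_cc[OF \<eta>r] order_refl, of N] m N by simp
  then have "\<forall>\<^sub>F N in sequentially. L2_inner (approx s N) \<eta> = s \<eta>" unfolding eventually_sequentially by blast
  then have "(\<lambda>N. L2_inner (approx s N) \<eta>) \<longlonglongrightarrow> s \<eta>" by (rule tendsto_eventually)
  from pairing_limit_element[OF s \<eta>r this] show "l \<eta> = pairing (limit_element s) \<eta>" using l(2) W_wavelet_span[OF \<eta>] by simp
next
  fix \<eta> assume "continuous_form_on r U l" "\<eta> \<in> Crc r U"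
  then show "l \<eta> = pairing (limit_element s) \<eta>" using pairing_limit_element[OF s _ pairing_continuous[OF s l]] by simp
qed

end


section \<open>Random coefficients\<close>

lemma lattice_compact_card:
  assumes "compact K" shows "\<exists>c\<ge>0. \<forall>n. real (card (lattice n \<inter> K :: (real ^ 'd) set)) \<le> c * 2 ^ (CARD('d) * n)"
proof -
  obtain B0 where B0: "\<forall>x\<in>K. norm x \<le> B0" using compact_imp_bounded[OF assms] unfolding bounded_iff by blast
  define B where "B = max B0 0"
  have B: "B \<ge> 0" "K \<subseteq> cball 0 B" using B0 by (auto simp: B_def)
  have "real (card (lattice n \<inter> K)) \<le> (2 * B + 1) ^ CARD('d) * 2 ^ (CARD('d) * n)" for n
  proof -
    have "card (lattice n \<inter> K) \<le> card (lattice n \<inter> cball (0 :: real ^ 'd) B)"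
    proof (rule card_mono)
      show "finite (lattice n \<inter> cball (0 :: real ^ 'd) B)" by (rule lattice_ball_card(1)[OF B(1)])
    qed (use B(2) in blast)
    then have "real (card (lattice n \<inter> K)) \<le> (2 * (2 ^ n * B) + 1) ^ CARD('d)"
      using lattice_ball_card(2)[OF B(1), of n "0 :: real ^ 'd"] by linarith
    also have "\<dots> \<le> (2 ^ n * (2 * B + 1)) ^ CARD('d)" using B(1) by (intro power_mono) (auto simp: algebra_simps)
    also have "\<dots> = (2 * B + 1) ^ CARD('d) * 2 ^ (CARD('d) * n)" by (simp add: power_mult_distrib power_mult mult.commute)
    finally show ?thesis .
  qed
  then show ?thesis using B(1) by (intro exI[of _ "(2 * B + 1) ^ CARD('d)"]) auto
qed

lemma measurable_scaled_powr:
  fixes g :: "'w \<Rightarrow> real"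
  assumes [measurable]: "g \<in> borel_measurable M" shows "(\<lambda>\<omega>. w * \<bar>t * g \<omega>\<bar> powr p) \<in> borel_measurable M"
  by measurable

lemma scaled_moment:
  fixes g :: "'w \<Rightarrow> real"
  assumes "1 \<le> p" "t > 0" "a \<ge> 0" "w \<ge> 0" and g: "g \<in> borel_measurable M"
    and L: "ennreal t * Lnorm M (ennreal p) (\<lambda>\<omega>. ennreal \<bar>g \<omega>\<bar>) \<le> ennreal a"
  shows "(\<integral>\<^sup>+ \<omega>. ennreal (w * \<bar>t * g \<omega>\<bar> powr p) \<partial>M) \<le> ennreal (w * a powr p)"
proof -
  have "Lnorm M (ennreal p) (\<lambda>\<omega>. ennreal \<bar>g \<omega>\<bar>) \<le> ennreal (a / t)"
  proof (cases "Lnorm M (ennreal p) (\<lambda>\<omega>. ennreal \<bar>g \<omega>\<bar>)")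
    case (real l)
    then have "t * l \<le> a" using L assms(2,3) by (simp add: ennreal_mult[symmetric])
    then show ?thesis using real assms(2) by (simp add: field_simps ennreal_leI)
  next
    case top then show ?thesis using L assms(2) by (simp add: ennreal_mult_top top_unique)
  qed
  then have I: "(\<integral>\<^sup>+ \<omega>. ennreal (\<bar>g \<omega>\<bar> powr p) \<partial>M) \<le> ennreal ((a / t) powr p)"
    using Lnorm_le_iff[OF assms(1), of "a / t" M "\<lambda>\<omega>. ennreal \<bar>g \<omega>\<bar>"] assms(2,3) by (simp add: enn_powr_ennreal)
  have "(\<integral>\<^sup>+ \<omega>. ennreal (w * \<bar>t * g \<omega>\<bar> powr p) \<partial>M) = (\<integral>\<^sup>+ \<omega>. ennreal (w * t powr p) * ennreal (\<bar>g \<omega>\<bar> powr p) \<partial>M)"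
    using assms(2,4) by (simp add: abs_mult powr_mult ennreal_mult mult.assoc)
  also have "\<dots> = ennreal (w * t powr p) * (\<integral>\<^sup>+ \<omega>. ennreal (\<bar>g \<omega>\<bar> powr p) \<partial>M)"
    by (rule nn_integral_cmult) (use g in measurable)
  also have "\<dots> \<le> ennreal (w * t powr p) * ennreal ((a / t) powr p)" by (intro mult_left_mono I) auto
  also have "\<dots> = ennreal (w * a powr p)"
  proof -
    have "t powr p * (a / t) powr p = a powr p" using assms(2,3) by (simp add: powr_divide)
    then show ?thesis using assms(4) by (simp add: ennreal_mult[symmetric] mult.assoc)
  qed
  finally show ?thesis .
qed

lemma nn_integral_sum_le:
  fixes g :: "'a \<Rightarrow> 'w \<Rightarrow> real"
  assumes g: "\<And>x. x \<in> J \<Longrightarrow> g x \<in> borel_measurable M" "\<And>x \<omega>. x \<in> J \<Longrightarrow> 0 \<le> g x \<omega>"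
    and b: "\<And>x. x \<in> J \<Longrightarrow> (\<integral>\<^sup>+ \<omega>. ennreal (g x \<omega>) \<partial>M) \<le> ennreal b" "b \<ge> 0"
  shows "(\<integral>\<^sup>+ \<omega>. ennreal (\<Sum>x\<in>J. g x \<omega>) \<partial>M) \<le> ennreal (real (card J) * b)"
proof -
  have "(\<integral>\<^sup>+ \<omega>. ennreal (\<Sum>x\<in>J. g x \<omega>) \<partial>M) = (\<integral>\<^sup>+ \<omega>. (\<Sum>x\<in>J. ennreal (g x \<omega>)) \<partial>M)"
    by (simp add: sum_ennreal g(2))
  also have "\<dots> = (\<Sum>x\<in>J. \<integral>\<^sup>+ \<omega>. ennreal (g x \<omega>) \<partial>M)"
    by (rule nn_integral_sum) (use g(1) in measurable)
  also have "\<dots> \<le> (\<Sum>x\<in>J. ennreal b)" by (intro sum_mono b(1))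
  also have "\<dots> = ennreal (real (card J) * b)"
    using b(2) by (simp add: ennreal_of_nat_eq_real_of_nat ennreal_mult)
  finally show ?thesis .
qed

lemma suminf_geometric_ennreal_le:
  assumes "E \<ge> 0" "0 < \<rho>" "\<rho> < 1"
  shows "(\<Sum>n. ennreal (E * \<rho> ^ n)) = ennreal (E / (1 - \<rho>))"
proof -
  have "(\<lambda>n. E * \<rho> ^ n) sums (E * (1 / (1 - \<rho>)))" using assms by (intro sums_mult geometric_sums) auto
  then show ?thesis using assms by (intro suminf_ennreal_eq) auto
qed

lemma (in prob_space) prob_countable_INT_ge:
  assumes A: "\<And>j::nat. A j \<in> sets M" "\<And>j. measure M (space M - A j) \<le> \<epsilon> / 2 ^ Suc j"
  shows "(\<Inter>j. A j) \<in> sets M \<and> measure M (\<Inter>j. A j) \<ge> 1 - \<epsilon>"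
proof -
  have s: "(\<Inter>j. A j) \<in> sets M" by (rule sets.countable_INT') (use A(1) in auto)
  have "(\<lambda>j. \<epsilon> * (1 / 2) ^ Suc j) = (\<lambda>j. \<epsilon> / 2 ^ Suc j)" by (simp add: power_one_over)
  then have geo: "(\<lambda>j. \<epsilon> / 2 ^ Suc j) sums \<epsilon>"
    using sums_mult[OF power_half_series, of \<epsilon>] by (simp only: mult_1_right)
  have sm: "summable (\<lambda>j. measure M (space M - A j))"
  proof (rule summable_comparison_test'[OF sums_summable[OF geo], of 0])
    show "norm (measure M (space M - A j)) \<le> \<epsilon> / 2 ^ Suc j" for j
      using A(2)[of j] measure_nonneg[of M "space M - A j"] by (simp only: real_norm_def abs_of_nonneg)
  qed
  have "1 - measure M (\<Inter>j. A j) = measure M (space M - (\<Inter>j. A j))" using prob_compl[OF s] by simp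
  also have "space M - (\<Inter>j. A j) = (\<Union>j. space M - A j)" by auto
  also have "measure M \<dots> \<le> (\<Sum>j. measure M (space M - A j))"
    using A(1) by (intro finite_measure_subadditive_countably sm) auto
  also have "\<dots> \<le> (\<Sum>j. \<epsilon> / 2 ^ Suc j)" by (intro suminf_le sm sums_summable[OF geo] A(2))
  also have "\<dots> = \<epsilon>" using geo by (simp add: sums_iff)
  finally show ?thesis using s by simp
qed

context wavelets
begin

definition coef_event :: "real \<Rightarrow> real \<Rightarrow> (real ^ 'd) set \<Rightarrow> nat \<Rightarrow> real \<Rightarrow> ((real ^ 'd \<Rightarrow> real) \<Rightarrow> real) \<Rightarrow> bool" where
  "coef_event p \<beta>' K k lam l \<longleftrightarrow> (\<forall>x\<in>lattice k \<inter> K. \<bar>l (wl 0 k x)\<bar> \<le> lam) \<and>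
     (\<forall>n\<ge>k. \<forall>i\<in>IW. coef_ok (ennreal p) (1 / 2 ^ (CARD('d) * n)) (lattice n \<inter> K)
        (\<lambda>x. 2 ^ (CARD('d) * n) * l (wl i n x)) (lam * 2 powr (- (\<beta>' * real n))))"

text \<open>All scales are handled by a single application of Markov's inequality. The variable
  \<open>Y\<close> sums the \<open>p\<close>-th powers of all coefficients, weighted by the bounds
  wanted. In its expectation the number of lattice points, of order
  \<open>2 ^ (CARD('d) * n)\<close>, cancels against the cell volume, and the loss from
  \<open>\<beta>\<close> to \<open>\<beta>'\<close> leaves a geometric series whose sum is
  independent of \<open>m\<close>.\<close>

lemma tail_event:
  fixes M :: "nat \<Rightarrow> 'w measure" and f :: "nat \<Rightarrow> 'w \<Rightarrow> (real ^ 'd \<Rightarrow> real) \<Rightarrow> real"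
  assumes p: "1 \<le> p" and \<beta>': "\<beta>' < \<beta>" and K: "compact K" "\<And>x n. x \<in> K \<Longrightarrow> n \<ge> k \<Longrightarrow> cball x (R / 2 ^ n) \<subseteq> U"
    and M: "\<And>m. random_linear_form r U (M m) (f m)" "\<And>m. prob_space (M m)"
    and h0: "\<And>m x. x \<in> lattice k \<inter> K \<Longrightarrow> Lnorm (M m) (ennreal p) (\<lambda>\<omega>. ennreal \<bar>f m \<omega> (wl 0 k x)\<bar>) \<le> ennreal C"
    and h1: "\<And>m i n x. i \<in> IW \<Longrightarrow> n \<ge> k \<Longrightarrow> x \<in> lattice n \<inter> K \<Longrightarrow>
      2 ^ (CARD('d) * n) * Lnorm (M m) (ennreal p) (\<lambda>\<omega>. ennreal \<bar>f m \<omega> (wl i n x)\<bar>) \<le> ennreal (C * 2 powr (- real n * \<beta>))"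
    and C: "C \<ge> 0" and \<eta>: "\<eta> > 0"
  shows "\<exists>lam\<ge>0. \<forall>m. \<exists>A\<in>sets (M m). measure (M m) (space (M m) - A) \<le> \<eta> \<and> (\<forall>\<omega>\<in>A. coef_event p \<beta>' K k lam (f m \<omega>))"
proof -
  define \<rho> where "\<rho> = 2 powr (- ((\<beta> - \<beta>') * p))"
  have \<rho>: "0 < \<rho>" "\<rho> < 1" using p \<beta>' powr_less_mono[of "- ((\<beta> - \<beta>') * p)" 0 2] by (auto simp: \<rho>_def)
  obtain c where c: "c \<ge> 0" "\<forall>n. real (card (lattice n \<inter> K)) \<le> c * 2 ^ (CARD('d) * n)"
    using lattice_compact_card[OF K(1)] by blast
  define E where "E = real (card IW) * c * C powr p"
  define D where "D = real (card (lattice k \<inter> K)) * C powr p + E / (1 - \<rho>)"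
  have E: "E \<ge> 0" using c(1) by (simp add: E_def)
  have D: "D \<ge> 0" using E \<rho> by (simp add: D_def)
  \<comment> \<open>The level for Markov's inequality: expectation at most \<open>D\<close> makes
    the exceptional probability at most \<open>D / lp\<close>, hence at most \<open>\<eta>\<close>.
    The added 1 keeps the level positive when \<open>D\<close> is 0.\<close>
  define lp where "lp = (D + 1) / \<eta>"
  define lam where "lam = lp powr (1 / p)"
  have lp: "lp > 0" using D \<eta> by (simp add: lp_def)
  have lam: "lam \<ge> 0" "lam powr p = lp" using lp p by (auto simp: lam_def powr_powr)
  have meas: "(\<lambda>\<omega>. f m \<omega> (wl i n x)) \<in> borel_measurable (M m)" if "i \<in> insert 0 IW" "n \<ge> k" "x \<in> lattice n \<inter> K" for m i n x
  proof -
    have "wl i n x \<in> Crc r U" using that K(2)[of x n] by (intro wl_Crc) auto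
    then show ?thesis using M(1)[of m] by (simp add: random_linear_form_def)
  qed
  define T0 where "T0 = (\<lambda>m \<omega>. \<Sum>x\<in>lattice k \<inter> K. 1 * \<bar>1 * f m \<omega> (wl 0 k x)\<bar> powr p)"
  define T where "T = (\<lambda>m n \<omega>. \<Sum>i\<in>IW. \<Sum>x\<in>lattice n \<inter> K.
    (2 powr (\<beta>' * real n * p) / 2 ^ (CARD('d) * n)) * \<bar>2 ^ (CARD('d) * n) * f m \<omega> (wl i n x)\<bar> powr p)"
  \<comment> \<open>The shift by \<open>k\<close> starts the sum at the scale from which the
    wavelets centred in \<open>K\<close> are known to be supported in \<open>U\<close>, where the
    form is measurable and bounded in mean.\<close>
  define Y where "Y = (\<lambda>m \<omega>. ennreal (T0 m \<omega>) + (\<Sum>n. ennreal (T m (n + k) \<omega>)))"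
  have T0m: "T0 m \<in> borel_measurable (M m)" for m
    unfolding T0_def by (intro borel_measurable_sum measurable_scaled_powr meas) auto
  have Tm: "T m n \<in> borel_measurable (M m)" if "n \<ge> k" for m n
    unfolding T_def by (intro borel_measurable_sum measurable_scaled_powr meas that) auto
  have Ym: "Y m \<in> borel_measurable (M m)" for m
    unfolding Y_def using T0m[of m] Tm[of _ m] by (intro borel_measurable_add borel_measurable_suminf measurable_compose[OF _ measurable_ennreal]) auto
  have T0i: "(\<integral>\<^sup>+ \<omega>. ennreal (T0 m \<omega>) \<partial>M m) \<le> ennreal (real (card (lattice k \<inter> K)) * C powr p)" for m
    unfolding T0_def
  proof (rule nn_integral_sum_le)
    fix x assume x: "x \<in> lattice k \<inter> K"
    show "(\<lambda>\<omega>. 1 * \<bar>1 * f m \<omega> (wl 0 k x)\<bar> powr p) \<in> borel_measurable (M m)"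
      by (intro measurable_scaled_powr meas x) auto
    show "(\<integral>\<^sup>+ \<omega>. ennreal (1 * \<bar>1 * f m \<omega> (wl 0 k x)\<bar> powr p) \<partial>M m) \<le> ennreal (C powr p)"
      using scaled_moment[OF p _ C, of 1 1 "\<lambda>\<omega>. f m \<omega> (wl 0 k x)" "M m"] h0[OF x, of m] meas[OF _ order_refl x, of 0 m] by simp
  qed auto
  have Ti: "(\<integral>\<^sup>+ \<omega>. ennreal (T m n \<omega>) \<partial>M m) \<le> ennreal (E * \<rho> ^ n)" if n: "n \<ge> k" for m n
  proof -
    define w where "w = 2 powr (\<beta>' * real n * p) / 2 ^ (CARD('d) * n)"
    define a where "a = C * 2 powr (- real n * \<beta>)"
    have w: "w \<ge> 0" and a: "a \<ge> 0" using C by (auto simp: w_def a_def)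
    have m: "(\<lambda>\<omega>. w * \<bar>2 ^ (CARD('d) * n) * f m \<omega> (wl i n x)\<bar> powr p) \<in> borel_measurable (M m)" if "i \<in> IW" "x \<in> lattice n \<inter> K" for i x
      by (intro measurable_scaled_powr meas n that insertI2)
    have "(\<integral>\<^sup>+ \<omega>. ennreal (T m n \<omega>) \<partial>M m) \<le> ennreal (real (card IW) * (real (card (lattice n \<inter> K)) * (w * a powr p)))"
      unfolding T_def w_def[symmetric]
    proof (intro nn_integral_sum_le sum_nonneg mult_nonneg_nonneg borel_measurable_sum m)
      fix i x assume i: "i \<in> IW" and x: "x \<in> lattice n \<inter> K"
      show "(\<integral>\<^sup>+ \<omega>. ennreal (w * \<bar>2 ^ (CARD('d) * n) * f m \<omega> (wl i n x)\<bar> powr p) \<partial>M m) \<le> ennreal (w * a powr p)"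
      proof (rule scaled_moment[OF p _ a w meas[OF insertI2[OF i] n x]])
        have "ennreal (2 ^ (CARD('d) * n)) = 2 ^ (CARD('d) * n)" by (simp add: ennreal_power[symmetric])
        then show "ennreal (2 ^ (CARD('d) * n)) * Lnorm (M m) (ennreal p) (\<lambda>\<omega>. ennreal \<bar>f m \<omega> (wl i n x)\<bar>) \<le> ennreal a"
          using h1[OF i n x, of m] by (simp only: a_def)
      qed simp
    qed (use w in auto)
    also have "\<dots> \<le> ennreal (E * \<rho> ^ n)"
    proof (rule ennreal_leI)
      have "2 powr (\<beta>' * real n * p) * (2 powr (- real n * \<beta>)) powr p = 2 powr (- ((\<beta> - \<beta>') * p) * real n)"
        unfolding powr_powr powr_add[symmetric] by (simp add: algebra_simps)
      also have "\<dots> = \<rho> ^ n" by (simp add: \<rho>_def powr_powr flip: powr_realpow)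
      finally have "w * a powr p = C powr p * \<rho> ^ n / 2 ^ (CARD('d) * n)"
        by (simp add: w_def a_def powr_mult field_simps)
      then have "real (card (lattice n \<inter> K)) * (w * a powr p) \<le> (c * 2 ^ (CARD('d) * n)) * (C powr p * \<rho> ^ n / 2 ^ (CARD('d) * n))"
        using c(2) \<rho> by (simp only:) (intro mult_right_mono divide_nonneg_pos mult_nonneg_nonneg, auto)
      also have "\<dots> = c * C powr p * \<rho> ^ n" by simp
      finally have "real (card IW) * (real (card (lattice n \<inter> K)) * (w * a powr p)) \<le> real (card IW) * (c * C powr p * \<rho> ^ n)"
        by (rule mult_left_mono) simp
      then show "real (card IW) * (real (card (lattice n \<inter> K)) * (w * a powr p)) \<le> E * \<rho> ^ n"
        by (simp add: E_def mult_ac)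
    qed
    finally show ?thesis .
  qed
  have Yi: "(\<integral>\<^sup>+ \<omega>. Y m \<omega> \<partial>M m) \<le> ennreal D" for m
  proof -
    have "(\<integral>\<^sup>+ \<omega>. Y m \<omega> \<partial>M m) = (\<integral>\<^sup>+ \<omega>. ennreal (T0 m \<omega>) \<partial>M m) + (\<integral>\<^sup>+ \<omega>. (\<Sum>n. ennreal (T m (n + k) \<omega>)) \<partial>M m)"
      unfolding Y_def using T0m[of m] Tm[of _ m]
      by (intro nn_integral_add borel_measurable_suminf measurable_compose[OF _ measurable_ennreal]) auto
    also have "(\<integral>\<^sup>+ \<omega>. (\<Sum>n. ennreal (T m (n + k) \<omega>)) \<partial>M m) = (\<Sum>n. \<integral>\<^sup>+ \<omega>. ennreal (T m (n + k) \<omega>) \<partial>M m)"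
      using Tm[of _ m] by (intro nn_integral_suminf measurable_compose[OF _ measurable_ennreal]) auto
    also have "(\<integral>\<^sup>+ \<omega>. ennreal (T0 m \<omega>) \<partial>M m) + \<dots> \<le> ennreal (real (card (lattice k \<inter> K)) * C powr p) + (\<Sum>n. ennreal (E * \<rho> ^ n))"
    proof (intro add_mono T0i suminf_le)
      fix n
      have "(\<integral>\<^sup>+ \<omega>. ennreal (T m (n + k) \<omega>) \<partial>M m) \<le> ennreal (E * \<rho> ^ (n + k))" by (rule Ti) simp
      also have "\<dots> \<le> ennreal (E * \<rho> ^ n)" using \<rho> E by (intro ennreal_leI mult_left_mono power_decreasing) auto
      finally show "(\<integral>\<^sup>+ \<omega>. ennreal (T m (n + k) \<omega>) \<partial>M m) \<le> ennreal (E * \<rho> ^ n)" .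
    qed auto
    also have "(\<Sum>n. ennreal (E * \<rho> ^ n)) = ennreal (E / (1 - \<rho>))" by (rule suminf_geometric_ennreal_le[OF E \<rho>])
    also have "ennreal (real (card (lattice k \<inter> K)) * C powr p) + \<dots> = ennreal D"
      using E \<rho> by (simp add: D_def)
    finally show ?thesis .
  qed
  have "\<exists>A\<in>sets (M m). measure (M m) (space (M m) - A) \<le> \<eta> \<and> (\<forall>\<omega>\<in>A. coef_event p \<beta>' K k lam (f m \<omega>))" for m
  proof -
    interpret prob_space "M m" by (rule M(2))
    define A where "A = {\<omega> \<in> space (M m). \<not> 1 \<le> ennreal (1 / lp) * Y m \<omega>}"
    have As: "A \<in> sets (M m)" unfolding A_def using Ym[of m] by measurable
    have "emeasure (M m) {\<omega> \<in> space (M m). 1 \<le> ennreal (1 / lp) * Y m \<omega>} \<le> ennreal (1 / lp) * (\<integral>\<^sup>+ \<omega>. Y m \<omega> * indicator (space (M m)) \<omega> \<partial>M m)"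
      using nn_integral_Markov_inequality[of "Y m" "space (M m)" "M m" "ennreal (1 / lp)"] Ym[of m] by simp
    also have "(\<integral>\<^sup>+ \<omega>. Y m \<omega> * indicator (space (M m)) \<omega> \<partial>M m) = (\<integral>\<^sup>+ \<omega>. Y m \<omega> \<partial>M m)" by (rule nn_integral_cong) simp
    also have "ennreal (1 / lp) * \<dots> \<le> ennreal (1 / lp) * ennreal D" by (intro mult_left_mono Yi) simp
    also have "\<dots> = ennreal (D / lp)" using lp D by (simp add: ennreal_mult[symmetric])
    also have "\<dots> \<le> ennreal \<eta>" using lp D \<eta> by (intro ennreal_leI) (simp add: lp_def field_simps)
    also have "{\<omega> \<in> space (M m). 1 \<le> ennreal (1 / lp) * Y m \<omega>} = space (M m) - A" by (auto simp: A_def)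
    finally have 1: "measure (M m) (space (M m) - A) \<le> \<eta>" using \<eta> by (simp add: emeasure_eq_measure)
    have "coef_event p \<beta>' K k lam (f m \<omega>)" if \<omega>: "\<omega> \<in> A" for \<omega>
    proof -
      have le: "v \<le> lp" if v: "ennreal v \<le> Y m \<omega>" "v \<ge> 0" for v
      proof -
        have "ennreal (1 / lp) * ennreal v \<le> ennreal (1 / lp) * Y m \<omega>" by (intro mult_left_mono v) simp
        also have "\<dots> < 1" using \<omega> unfolding A_def mem_Collect_eq not_le by (rule conjunct2)
        finally have "ennreal (1 / lp * v) < ennreal 1" using lp v(2) by (simp add: ennreal_mult[symmetric])
        then have "1 / lp * v < 1" using lp v(2) by (subst (asm) ennreal_less_iff) auto
        then show ?thesis using lp by (simp add: field_simps)
      qed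
      have T0n: "T0 m \<omega> \<ge> 0" unfolding T0_def by (intro sum_nonneg) simp
      have Tn: "T m n \<omega> \<ge> 0" for n unfolding T_def by (intro sum_nonneg) simp
      have fin: "finite (lattice n \<inter> K)" for n by (rule finite_lattice_compact[OF K(1)])
      have "T0 m \<omega> \<le> lp" by (rule le[OF _ T0n]) (simp add: Y_def)
      have a: "\<bar>f m \<omega> (wl 0 k x)\<bar> \<le> lam" if x: "x \<in> lattice k \<inter> K" for x
      proof -
        have "\<bar>f m \<omega> (wl 0 k x)\<bar> powr p \<le> T0 m \<omega>"
          unfolding T0_def using member_le_sum[OF x _ fin, of "\<lambda>x. 1 * \<bar>1 * f m \<omega> (wl 0 k x)\<bar> powr p"] by simp
        also have "\<dots> \<le> lp" by fact
        finally have "(\<bar>f m \<omega> (wl 0 k x)\<bar> powr p) powr (1 / p) \<le> lam" unfolding lam_def using p by (intro powr_mono2) auto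
        then show ?thesis using p by (simp add: powr_powr)
      qed
      have b: "coef_ok (ennreal p) (1 / 2 ^ (CARD('d) * n)) (lattice n \<inter> K) (\<lambda>x. 2 ^ (CARD('d) * n) * f m \<omega> (wl i n x)) (lam * 2 powr (- (\<beta>' * real n)))"
        if n: "n \<ge> k" and i: "i \<in> IW" for n i
      proof -
        let ?S = "\<lambda>i. \<Sum>x\<in>lattice n \<inter> K. (1 / 2 ^ (CARD('d) * n)) * \<bar>2 ^ (CARD('d) * n) * f m \<omega> (wl i n x)\<bar> powr p"
        let ?g = "2 powr (\<beta>' * real n * p)"
        have "T m n \<omega> \<le> lp"
        proof (rule le[OF _ Tn])
          have "ennreal (T m n \<omega>) = (\<Sum>l\<in>{n - k}. ennreal (T m (l + k) \<omega>))" using n by simp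
          also have "\<dots> \<le> (\<Sum>l. ennreal (T m (l + k) \<omega>))" by (rule sum_le_suminf) auto
          finally show "ennreal (T m n \<omega>) \<le> Y m \<omega>" by (simp add: Y_def add_increasing)
        qed
        moreover have "?g * ?S i \<le> T m n \<omega>"
        proof -
          have "?g * ?S i \<le> (\<Sum>i\<in>IW. ?g * ?S i)"
            by (rule member_le_sum[OF i]) (auto intro!: mult_nonneg_nonneg sum_nonneg)
          also have "\<dots> = T m n \<omega>" by (simp add: T_def sum_distrib_left)
          finally show ?thesis .
        qed
        ultimately have "?g * ?S i \<le> lp" by linarith
        then have "?S i \<le> lp / ?g" by (simp add: field_simps)
        also have "\<dots> = lam powr p * (2 powr (- (\<beta>' * real n))) powr p"
          unfolding lam(2) powr_powr by (simp add: powr_minus divide_inverse)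
        also have "\<dots> = (lam * 2 powr (- (\<beta>' * real n))) powr p" by (simp add: powr_mult)
        finally show ?thesis using p by (simp add: coef_ok_def)
      qed
      show ?thesis unfolding coef_event_def using a b by blast
    qed
    then show ?thesis using As 1 by blast
  qed
  then show ?thesis using lam(1) by blast
qed

end


section \<open>From bounds on coefficients to tightness\<close>

lemma coef_ok_cong:
  assumes "\<And>x. x \<in> J \<Longrightarrow> c x = d x" shows "coef_ok p wt J c \<Lambda> \<longleftrightarrow> coef_ok p wt J d \<Lambda>"
proof -
  have "(\<Sum>x\<in>J. wt * \<bar>c x\<bar> powr enn2real p) = (\<Sum>x\<in>J. wt * \<bar>d x\<bar> powr enn2real p)"
    by (rule sum.cong) (simp_all add: assms)
  moreover have "(\<forall>x\<in>J. \<bar>c x\<bar> \<le> \<Lambda>) \<longleftrightarrow> (\<forall>x\<in>J. \<bar>d x\<bar> \<le> \<Lambda>)" by (simp add: assms)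
  ultimately show ?thesis by (simp add: coef_ok_def)
qed

text \<open>One term of the weighted sum is at most the whole sum. Removing its weight costs
  \<open>2 ^ (d * n)\<close> under the power \<open>p\<close>, that is, \<open>d / p\<close> in the
  exponent of regularity.\<close>

lemma coef_ok_top:
  assumes p: "1 \<le> p" and ok: "coef_ok (ennreal p) (1 / 2 ^ (d * n)) J c (lam * 2 powr (- (\<beta> * real n)))"
    and "finite J" "lam \<ge> 0"
  shows "coef_ok \<top> wt J c (lam * 2 powr (- ((\<beta> - real d / p) * real n)))"
proof -
  have "\<bar>c x\<bar> \<le> lam * 2 powr (- ((\<beta> - real d / p) * real n))" if x: "x \<in> J" for x
  proof -
    have "1 / 2 ^ (d * n) * \<bar>c x\<bar> powr p \<le> (\<Sum>x\<in>J. 1 / 2 ^ (d * n) * \<bar>c x\<bar> powr p)"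
      using member_le_sum[OF x _ assms(3), of "\<lambda>x. 1 / 2 ^ (d * n) * \<bar>c x\<bar> powr p"] by simp
    also have "\<dots> \<le> (lam * 2 powr (- (\<beta> * real n))) powr p" using ok p by (simp add: coef_ok_def)
    finally have "\<bar>c x\<bar> powr p \<le> 2 ^ (d * n) * (lam * 2 powr (- (\<beta> * real n))) powr p" by (simp add: field_simps)
    also have "(2::real) ^ (d * n) = (2 powr (real d / p * real n)) powr p"
      using p by (simp add: powr_powr flip: powr_realpow)
    also have "\<dots> * (lam * 2 powr (- (\<beta> * real n))) powr p = (2 powr (real d / p * real n) * (lam * 2 powr (- (\<beta> * real n)))) powr p"
      by (rule powr_mult[symmetric])
    also have "2 powr (real d / p * real n) * (lam * 2 powr (- (\<beta> * real n))) = lam * 2 powr (- ((\<beta> - real d / p) * real n))"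
    proof -
      have "2 powr (real d / p * real n) * 2 powr (- (\<beta> * real n)) = 2 powr (- ((\<beta> - real d / p) * real n))"
        unfolding powr_add[symmetric] by (simp add: algebra_simps)
      then show ?thesis by (simp add: mult.left_commute)
    qed
    finally have "(\<bar>c x\<bar> powr p) powr (1 / p) \<le> ((lam * 2 powr (- ((\<beta> - real d / p) * real n))) powr p) powr (1 / p)"
      by (rule powr_mono2[rotated 2]) (use p in auto)
    then show ?thesis using p assms(4) by (simp add: powr_powr)
  qed
  then show ?thesis by (simp add: coef_ok_def)
qed

context besov_on
begin

text \<open>The constants depend on the set of the exhaustion, so the \<open>j\<close>-th set gets
  the share \<open>\<epsilon> / 2 ^ Suc j\<close> of the exceptional probability. On the
  intersection of the events all bounds hold together and the restriction of the form to the span is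
  admissible; the compact set depends on the levels \<open>lam\<close> but not on
  \<open>m\<close>.\<close>

lemma tight_if_coefficient_bounds:
  fixes M :: "nat \<Rightarrow> 'w measure" and K :: "nat \<Rightarrow> (real ^ 'd) set"
  assumes \<alpha>': "\<alpha> < \<alpha>'" and ex: "\<And>L. compact L \<Longrightarrow> L \<subseteq> U \<Longrightarrow> \<exists>n. L \<subseteq> K n" and ad: "\<And>n. adapted U R (K n) (k n)"
    and M: "\<And>m. random_linear_form r U (M m) (f m)" "\<And>m. prob_space (M m)"
    and ev: "\<And>j \<eta>. (\<eta>::real) > 0 \<Longrightarrow> \<exists>lam\<ge>0. \<forall>m. \<exists>A\<in>sets (M m). measure (M m) (space (M m) - A) \<le> \<eta> \<and>
      (\<forall>\<omega>\<in>A. (\<forall>x\<in>lattice (k j) \<inter> K j. \<bar>f m \<omega> (wl 0 (k j) x)\<bar> \<le> lam) \<and>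
        (\<forall>n\<ge>k j. \<forall>i\<in>IW. coef_ok p (1 / 2 ^ (CARD('d) * n)) (lattice n \<inter> K j)
          (\<lambda>x. 2 ^ (CARD('d) * n) * f m \<omega> (wl i n x)) (lam * 2 powr (- (\<alpha>' * real n)))))"
  shows "tight_in_Besov_loc V U \<alpha> p q r \<phi> \<psi> M f"
  unfolding tight_in_Besov_loc_def
proof (intro allI impI)
  fix \<epsilon> :: real assume \<epsilon>: "\<epsilon> > 0"
  define G where "G = (\<lambda>j lam l. (\<forall>x\<in>lattice (k j) \<inter> K j. \<bar>l (wl 0 (k j) x)\<bar> \<le> lam) \<and>
        (\<forall>n\<ge>k j. \<forall>i\<in>IW. coef_ok p (1 / 2 ^ (CARD('d) * n)) (lattice n \<inter> K j)
          (\<lambda>x. 2 ^ (CARD('d) * n) * l (wl i n x)) (lam * 2 powr (- (\<alpha>' * real n)))))"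
  have "\<exists>lam\<ge>0. \<forall>m. \<exists>A\<in>sets (M m). measure (M m) (space (M m) - A) \<le> \<epsilon> / 2 ^ Suc j \<and> (\<forall>\<omega>\<in>A. G j lam (f m \<omega>))" for j
    unfolding G_def by (rule ev) (use \<epsilon> in simp)
  then have "\<forall>j. \<exists>lam. lam \<ge> 0 \<and> (\<forall>m. \<exists>A\<in>sets (M m). measure (M m) (space (M m) - A) \<le> \<epsilon> / 2 ^ Suc j \<and> (\<forall>\<omega>\<in>A. G j lam (f m \<omega>)))" ..
  from choice[OF this] obtain lam where lamG: "\<forall>j. lam j \<ge> 0 \<and>
    (\<forall>m. \<exists>A\<in>sets (M m). measure (M m) (space (M m) - A) \<le> \<epsilon> / 2 ^ Suc j \<and> (\<forall>\<omega>\<in>A. G j (lam j) (f m \<omega>)))" ..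
  interpret coefficient_bounds r R \<phi> \<psi> V p q \<alpha> U K k \<alpha>' lam
    by unfold_locales (use \<alpha>' lamG ex ad in auto)
  show "\<exists>\<K>. compactin (Besov_loc_topology V U \<alpha> p q) \<K> \<and>
        (\<forall>m. \<exists>A\<in>sets (M m). measure (M m) A \<ge> 1 - \<epsilon> \<and> (\<forall>\<omega>\<in>A. \<exists>F\<in>\<K>. is_Besov_element r U \<phi> \<psi> (f m \<omega>) F))"
  proof (intro exI[of _ "limit_element ` admissible_forms"] conjI limit_element_compact allI)
    fix m
    interpret prob_space "M m" by (rule M(2))
    have "\<forall>j. \<exists>A. A \<in> sets (M m) \<and> measure (M m) (space (M m) - A) \<le> \<epsilon> / 2 ^ Suc j \<and> (\<forall>\<omega>\<in>A. G j (lam j) (f m \<omega>))"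
      using lamG by blast
    from choice[OF this] obtain A where A: "\<forall>j. A j \<in> sets (M m) \<and> measure (M m) (space (M m) - A j) \<le> \<epsilon> / 2 ^ Suc j \<and> (\<forall>\<omega>\<in>A j. G j (lam j) (f m \<omega>))" ..
    have AA: "(\<Inter>j. A j) \<in> sets (M m) \<and> measure (M m) (\<Inter>j. A j) \<ge> 1 - \<epsilon>"
      by (rule prob_countable_INT_ge) (use A in blast)+
    have "\<exists>F\<in>limit_element ` admissible_forms. is_Besov_element r U \<phi> \<psi> (f m \<omega>) F" if \<omega>: "\<omega> \<in> (\<Inter>j. A j)" for \<omega>
    proof -
      have "\<omega> \<in> space (M m)" using AA \<omega> sets.sets_into_space by blast
      then have lin: "linear_form_on r U (f m \<omega>)" using M(1)[of m] by (simp add: random_linear_form_def)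
      \<comment> \<open>The restriction of the sample form to the span, with the value 0 elsewhere
        that \<open>admissible_forms\<close> prescribes.\<close>
      define s where "s = (\<lambda>g. if g \<in> wavelet_span then f m \<omega> g else 0)"
      have sw: "s (wl i n x) = f m \<omega> (wl i n x)" if "i \<in> insert 0 IW" "x \<in> lattice n \<inter> K j" "n \<ge> k j" for i n x j
        using W_wavelet_span[OF wl_K_W[of i x n j]] that by (simp add: s_def)
      have "lin_on wavelet_span s" unfolding lin_on_def
      proof (intro ballI allI)
        fix g h a b assume g: "g \<in> wavelet_span" and h: "h \<in> wavelet_span"
        have "(\<lambda>x. a * g x + b * h x) \<in> wavelet_span" using g h unfolding wavelet_span_def by (rule wspan_lincomb)
        moreover have "f m \<omega> (\<lambda>x. a * g x + b * h x) = a * f m \<omega> g + b * f m \<omega> h"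
          using lin g h wavelet_span_Crc unfolding linear_form_on_def by blast
        ultimately show "s (\<lambda>x. a * g x + b * h x) = a * s g + b * s h" using g h by (simp add: s_def)
      qed
      moreover have "\<bar>s (wl 0 (k j) x)\<bar> \<le> lam j" if x: "x \<in> lattice (k j) \<inter> K j" for j x
        using A \<omega> x sw[OF _ x, of 0] unfolding G_def by auto
      moreover have "coef_ok p (1 / 2 ^ (CARD('d) * n)) (lattice n \<inter> K j)
         (\<lambda>x. 2 ^ (CARD('d) * n) * s (wl i n x)) (lam j * 2 powr (- (\<alpha>' * real n)))" if n: "n \<ge> k j" and i: "i \<in> IW" for j n i
      proof -
        have "G j (lam j) (f m \<omega>)" using A \<omega> by blast
        then have "coef_ok p (1 / 2 ^ (CARD('d) * n)) (lattice n \<inter> K j)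
         (\<lambda>x. 2 ^ (CARD('d) * n) * f m \<omega> (wl i n x)) (lam j * 2 powr (- (\<alpha>' * real n)))" using n i unfolding G_def by blast
        moreover have "s (wl i n x) = f m \<omega> (wl i n x)" if "x \<in> lattice n \<inter> K j" for x using sw[OF _ that n, of i] i by simp
        ultimately show ?thesis
          using coef_ok_cong[of "lattice n \<inter> K j" "\<lambda>x. 2 ^ (CARD('d) * n) * s (wl i n x)" "\<lambda>x. 2 ^ (CARD('d) * n) * f m \<omega> (wl i n x)"]
          by metis
      qed
      ultimately have "s \<in> admissible_forms" unfolding admissible_forms_def by (auto simp: s_def)
      moreover have "is_Besov_element r U \<phi> \<psi> (f m \<omega>) (limit_element s)"
        by (rule is_Besov_element_limit_element[OF \<open>s \<in> admissible_forms\<close> lin]) (simp add: s_def)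
      ultimately show ?thesis by blast
    qed
    then show "\<exists>A\<in>sets (M m). measure (M m) A \<ge> 1 - \<epsilon> \<and> (\<forall>\<omega>\<in>A. \<exists>F\<in>limit_element ` admissible_forms. is_Besov_element r U \<phi> \<psi> (f m \<omega>) F)"
      using AA by (intro bexI[of _ "\<Inter>j. A j"]) auto
  qed
qed

end

theorem theorem2p30:
  fixes U :: "(real ^ 'd) set"
    and r :: nat
    and R :: real
    and \<phi> :: "real ^ 'd \<Rightarrow> real"
    and \<psi> :: "nat \<Rightarrow> real ^ 'd \<Rightarrow> real"
    and V :: "int \<Rightarrow> (real ^ 'd \<Rightarrow> real) set"
    and p \<alpha> \<beta> :: real
    and q :: ennreal
    and M :: "nat \<Rightarrow> 'w measure"
    and f :: "nat \<Rightarrow> 'w \<Rightarrow> (real ^ 'd \<Rightarrow> real) \<Rightarrow> real"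
    and \<K> :: "((real ^ 'd) set \<times> nat) set"
  assumes "open U"
    and "r \<ge> 1"
    and "R > 0"
    and "wavelet_family r R \<phi> \<psi> V"
    and "1 \<le> p"
    and "1 \<le> q"
    and "\<bar>\<alpha>\<bar> < real r"
    and "\<bar>\<beta>\<bar> < real r"
    and "\<alpha> < \<beta>"
    and "\<And>m. prob_space (M m)"
    and "\<And>m. random_linear_form r U (M m) (f m)"
    and "spanning_sequence U R \<K>"
    and "\<And>K k. (K, k) \<in> \<K> \<Longrightarrow>
      \<exists>C::real. \<forall>m.
        (SUP x \<in> lattice k \<inter> K.
           Lnorm (M m) (ennreal p) (\<lambda>\<omega>. ennreal \<bar>f m \<omega> (dilate k x \<phi>)\<bar>)) \<le> ennreal C \<and>
        (\<forall>i\<in>{1..<2 ^ CARD('d)}. \<forall>n\<ge>k.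
           (SUP x \<in> lattice n \<inter> K.
              2 ^ (CARD('d) * n) *
              Lnorm (M m) (ennreal p) (\<lambda>\<omega>. ennreal \<bar>f m \<omega> (dilate n x (\<psi> i))\<bar>))
           \<le> ennreal (C * 2 powr (- real n * \<beta>)))"
  shows "tight_in_Besov_loc V U \<alpha> (ennreal p) q r \<phi> \<psi> M f \<and>
    (\<alpha> < \<beta> - real CARD('d) / p \<longrightarrow> tight_in_Besov_loc V U \<alpha> \<top> \<top> r \<phi> \<psi> M f)"
proof -
  interpret wavelets r R \<phi> \<psi> V by unfold_locales (use assms(2-4) in auto)
  obtain K k where Kk: "\<K> = range (\<lambda>n::nat. (K n, k n)) \<and> incseq K \<and> (\<Union>n. K n) = U \<and>
      (\<forall>L. compact L \<and> L \<subseteq> U \<longrightarrow> (\<exists>n. L \<subseteq> K n)) \<and> (\<forall>n. adapted U R (K n) (k n))"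
    using assms(12) unfolding spanning_sequence_def by (elim exE)
  have \<K>: "\<K> = range (\<lambda>n::nat. (K n, k n))"
    and ex: "\<And>L. compact L \<Longrightarrow> L \<subseteq> U \<Longrightarrow> \<exists>n. L \<subseteq> K n" and ad: "\<And>n. adapted U R (K n) (k n)"
    using Kk by simp_all
  have "\<exists>lam\<ge>0. \<forall>m. \<exists>A\<in>sets (M m). measure (M m) (space (M m) - A) \<le> \<eta> \<and> (\<forall>\<omega>\<in>A. coef_event p \<beta>' (K j) (k j) lam (f m \<omega>))"
    if \<eta>: "\<eta> > 0" and \<beta>': "\<beta>' < \<beta>" for \<eta> \<beta>' j
  proof -
    have "(K j, k j) \<in> \<K>" by (simp add: \<K>)
    from assms(13)[OF this] obtain C where C: "\<forall>m.
        (SUP x \<in> lattice (k j) \<inter> K j.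
           Lnorm (M m) (ennreal p) (\<lambda>\<omega>. ennreal \<bar>f m \<omega> (dilate (k j) x \<phi>)\<bar>)) \<le> ennreal C \<and>
        (\<forall>i\<in>{1..<2 ^ CARD('d)}. \<forall>n\<ge>k j.
           (SUP x \<in> lattice n \<inter> K j.
              2 ^ (CARD('d) * n) *
              Lnorm (M m) (ennreal p) (\<lambda>\<omega>. ennreal \<bar>f m \<omega> (dilate n x (\<psi> i))\<bar>))
           \<le> ennreal (C * 2 powr (- real n * \<beta>)))" by blast
    \<comment> \<open>A negative \<open>C\<close> is read as 0 by \<open>ennreal\<close>, whereas
      \<open>tail_event\<close> takes a nonnegative real bound; hence
      \<open>max C 0\<close>.\<close>
    show ?thesis
    proof (rule tail_event[OF assms(5) \<beta>' _ _ assms(11,10) _ _ _ \<eta>, where C = "max C 0"])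
      show "compact (K j)" using ad[of j] by (simp add: adapted_def)
      show "cball x (R / 2 ^ n) \<subseteq> U" if "x \<in> K j" "n \<ge> k j" for x n by (rule adapted_cball[OF ad that R_pos])
    next
      fix m x assume "x \<in> lattice (k j) \<inter> K j"
      then have "Lnorm (M m) (ennreal p) (\<lambda>\<omega>. ennreal \<bar>f m \<omega> (dilate (k j) x \<phi>)\<bar>) \<le> ennreal C"
        using C by (auto simp: SUP_le_iff)
      then show "Lnorm (M m) (ennreal p) (\<lambda>\<omega>. ennreal \<bar>f m \<omega> (wl 0 (k j) x)\<bar>) \<le> ennreal (max C 0)"
        by (simp add: wl_def w_def)
    next
      fix m i n x assume i: "i \<in> IW" and n: "n \<ge> k j" and x: "x \<in> lattice n \<inter> K j"
      have "2 ^ (CARD('d) * n) * Lnorm (M m) (ennreal p) (\<lambda>\<omega>. ennreal \<bar>f m \<omega> (dilate n x (\<psi> i))\<bar>) \<le> ennreal (C * 2 powr (- real n * \<beta>))"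
        using C i n x unfolding IW_def SUP_le_iff by blast
      also have "\<dots> \<le> ennreal (max C 0 * 2 powr (- real n * \<beta>))" by (intro ennreal_leI mult_right_mono) auto
      finally show "2 ^ (CARD('d) * n) * Lnorm (M m) (ennreal p) (\<lambda>\<omega>. ennreal \<bar>f m \<omega> (wl i n x)\<bar>) \<le> ennreal (max C 0 * 2 powr (- real n * \<beta>))"
        using i by (simp add: wl_def w_def IW_def)
    qed simp
  qed
  note ev = this
  have 1: "tight_in_Besov_loc V U \<alpha> (ennreal p) q r \<phi> \<psi> M f"
  proof -
    interpret besov_on r R \<phi> \<psi> V "ennreal p" q \<alpha> U
      by unfold_locales (use assms in auto)
    \<comment> \<open>The midpoint lies strictly above \<open>\<alpha>\<close>, which gives
      convergence of the series, and strictly below \<open>\<beta>\<close>, which gives summability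
      of the expectations.\<close>
    show ?thesis
    proof (rule tight_if_coefficient_bounds[OF _ ex ad assms(11,10), of "(\<alpha> + \<beta>) / 2"])
      show "\<alpha> < (\<alpha> + \<beta>) / 2" using assms(9) by simp
      have "(\<alpha> + \<beta>) / 2 < \<beta>" using assms(9) by simp
      then show "\<exists>lam\<ge>0. \<forall>m. \<exists>A\<in>sets (M m). measure (M m) (space (M m) - A) \<le> \<eta> \<and>
        (\<forall>\<omega>\<in>A. (\<forall>x\<in>lattice (k j) \<inter> K j. \<bar>f m \<omega> (wl 0 (k j) x)\<bar> \<le> lam) \<and>
          (\<forall>n\<ge>k j. \<forall>i\<in>IW. coef_ok (ennreal p) (1 / 2 ^ (CARD('d) * n)) (lattice n \<inter> K j)
            (\<lambda>x. 2 ^ (CARD('d) * n) * f m \<omega> (wl i n x)) (lam * 2 powr (- ((\<alpha> + \<beta>) / 2 * real n)))))"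
        if "\<eta> > 0" for j \<eta> using ev[OF that, of "(\<alpha> + \<beta>) / 2" j] unfolding coef_event_def by blast
    qed
  qed
  have 2: "tight_in_Besov_loc V U \<alpha> \<top> \<top> r \<phi> \<psi> M f" if h: "\<alpha> < \<beta> - real CARD('d) / p"
  proof -
    interpret besov_on r R \<phi> \<psi> V \<top> \<top> \<alpha> U
      by unfold_locales (use assms in auto)
    \<comment> \<open>The midpoint of \<open>\<alpha> + real CARD('d) / p\<close> and
      \<open>\<beta>\<close>: it stays below \<open>\<beta>\<close>, and after the loss in
      \<open>coef_ok_top\<close> the regularity still exceeds \<open>\<alpha>\<close>.\<close>
    define \<beta>' where "\<beta>' = (\<alpha> + real CARD('d) / p + \<beta>) / 2"
    have \<beta>': "\<beta>' < \<beta>" "\<alpha> < \<beta>' - real CARD('d) / p" using h by (auto simp: \<beta>'_def field_simps)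
    show ?thesis
    proof (rule tight_if_coefficient_bounds[OF \<beta>'(2) ex ad assms(11,10)])
      fix j and \<eta> :: real assume "\<eta> > 0"
      from ev[OF this \<beta>'(1), of j] obtain lam where lam: "lam \<ge> 0"
        "\<forall>m. \<exists>A\<in>sets (M m). measure (M m) (space (M m) - A) \<le> \<eta> \<and> (\<forall>\<omega>\<in>A. coef_event p \<beta>' (K j) (k j) lam (f m \<omega>))" by blast
      have fin: "finite (lattice n \<inter> K j)" for n using ad[of j] by (intro finite_lattice_compact) (simp add: adapted_def)
      have imp: "(\<forall>x\<in>lattice (k j) \<inter> K j. \<bar>l (wl 0 (k j) x)\<bar> \<le> lam) \<and>
          (\<forall>n\<ge>k j. \<forall>i\<in>IW. coef_ok \<top> (1 / 2 ^ (CARD('d) * n)) (lattice n \<inter> K j)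
            (\<lambda>x. 2 ^ (CARD('d) * n) * l (wl i n x)) (lam * 2 powr (- ((\<beta>' - real CARD('d) / p) * real n))))"
        if "coef_event p \<beta>' (K j) (k j) lam l" for l
        using that coef_ok_top[OF assms(5) _ fin lam(1)] unfolding coef_event_def by blast
      show "\<exists>lam\<ge>0. \<forall>m. \<exists>A\<in>sets (M m). measure (M m) (space (M m) - A) \<le> \<eta> \<and>
        (\<forall>\<omega>\<in>A. (\<forall>x\<in>lattice (k j) \<inter> K j. \<bar>f m \<omega> (wl 0 (k j) x)\<bar> \<le> lam) \<and>
          (\<forall>n\<ge>k j. \<forall>i\<in>IW. coef_ok \<top> (1 / 2 ^ (CARD('d) * n)) (lattice n \<inter> K j)
            (\<lambda>x. 2 ^ (CARD('d) * n) * f m \<omega> (wl i n x)) (lam * 2 powr (- ((\<beta>' - real CARD('d) / p) * real n)))))"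
      proof (intro exI[of _ lam] conjI lam(1) allI)
        fix m
        from lam(2) obtain A where "A \<in> sets (M m)" "measure (M m) (space (M m) - A) \<le> \<eta>" "\<forall>\<omega>\<in>A. coef_event p \<beta>' (K j) (k j) lam (f m \<omega>)"
          by blast
        then show "\<exists>A\<in>sets (M m). measure (M m) (space (M m) - A) \<le> \<eta> \<and>
        (\<forall>\<omega>\<in>A. (\<forall>x\<in>lattice (k j) \<inter> K j. \<bar>f m \<omega> (wl 0 (k j) x)\<bar> \<le> lam) \<and>
          (\<forall>n\<ge>k j. \<forall>i\<in>IW. coef_ok \<top> (1 / 2 ^ (CARD('d) * n)) (lattice n \<inter> K j)
            (\<lambda>x. 2 ^ (CARD('d) * n) * f m \<omega> (wl i n x)) (lam * 2 powr (- ((\<beta>' - real CARD('d) / p) * real n)))))"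
          using imp by (intro bexI[of _ A] conjI ballI) auto
      qed
    qed
  qed
  from 1 2 show ?thesis by blast
qed

end
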